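(* Let $H$ be a separable real Hilbert space, and let $A$ be a nonnegative self-adjoint (possibly unbounded) linear operator on $H$ with dense domain. Let $m:[0,+\infty)\to(0,+\infty)$ be a locally Lipschitz continuous function such that $\mu:=\inf_{\sigma\geq 0}m(\sigma)>0$. Let $\varphi:[0,+\infty)\to[0,+\infty)$ be a continuous and strictly increasing function such that $$\int_{1}^{+\infty}\frac{\varphi(\sigma)}{\sigma^{2}}\,d\sigma=+\infty.$$ Assume that, for some $r_{0}>0$, $$(u_{0},u_{1})\in\mathcal{G}_{\varphi,r_{0},3/4}(A)\times\mathcal{G}_{\varphi,r_{0},1/4}(A).$$ Then the Cauchy problem $$u''(t)+m\left(|A^{1/2}u(t)|^{2}\right)Au(t)=0\quad\forall t\geq 0,\qquad u(0)=u_{0},\quad u'(0)=u_{1},$$ admits a unique global solution $$u\in C^{1}\left([0,+\infty);\mathcal{G}_{\varphi,r_{0},1/4}(A)\right)\cap C^{0}\left([0,+\infty);\mathcal{G}_{\varphi,r_{0},3/4}(A)\right).$$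
   Context: $|x|$ and $\langle x,y\rangle$ denote the norm and scalar product of $H$. Powers $A^{\alpha}$ ($\alpha\geq 0$), with domain $D(A^{\alpha})$, are defined by the spectral theorem. Generalized Gevrey spaces: for $\varphi:[0,+\infty)\to[0,+\infty)$, $r>0$, $\alpha\geq 0$, $\mathcal{G}_{\varphi,r,\alpha}(A)\subseteq H$ is the domain of the operator $A^{\alpha}\exp\left((r/2)\varphi(A^{1/2})\right)$, meaning the operator $f(A^{1/2})$ given by the functional calculus with $f(\lambda)=\lambda^{2\alpha}e^{(r/2)\varphi(\lambda)}$. Setting $\|u\|_{\varphi,r,\alpha}:=|f(A^{1/2})u|$, it is a Hilbert space with norm $(|u|^{2}+\|u\|_{\varphi,r,\alpha}^{2})^{1/2}$. When $H$ has a complete orthonormal system $\{e_{k}\}$ with $Ae_{k}=\lambda_{k}^{2}e_{k}$, $\lambda_{k}\geq 0$, and $u_{k}=\langle u,e_{k}\rangle$, this reads $$\|u\|_{\varphi,r,\alpha}^{2}=\sum_{k=0}^{\infty}\lambda_{k}^{4\alpha}u_{k}^{2}\exp(r\varphi(\lambda_{k})),\qquad \mathcal{G}_{\varphi,r,\alpha}(A)=\{u\in H:\|u\|_{\varphi,r,\alpha}<+\infty\}.$$ Notion of solution: for functions $u\in C^{1}([0,+\infty);D(A^{1/4}))\cap C^{0}([0,+\infty);D(A^{3/4}))$ (spaces $D(A^\beta)$ with the graph norm), the equation is understood weakly (component-wise): for every $v\in D(A)$ the function $t\mapsto\langle u(t),v\rangle$ is of class $C^{2}$ and $\frac{d^{2}}{dt^{2}}\langle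 u(t),v\rangle+m(|A^{1/2}u(t)|^{2})\langle u(t),Av\rangle=0$ for all $t\geq 0$. *)

theory Defs
  imports "HOL-Analysis.Analysis"
begin

section \<open>Unbounded operators\<close>

text \<open>An unbounded operator is given by its domain \<open>D\<close> and a total function \<open>A\<close> whose values
  outside \<open>D\<close> are irrelevant.\<close>

definition linear_op :: "'a::real_inner set \<Rightarrow> ('a \<Rightarrow> 'a) \<Rightarrow> bool" where
  "linear_op D A \<longleftrightarrow> subspace D \<and> (\<forall>u\<in>D. \<forall>v\<in>D. A (u + v) = A u + A v) \<and>
     (\<forall>c. \<forall>u\<in>D. A (c *\<^sub>R u) = c *\<^sub>R A u)"

definition adj_dom :: "'a::real_inner set \<Rightarrow> ('a \<Rightarrow> 'a) \<Rightarrow> 'a set" where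
  "adj_dom D A = {v. \<exists>w. \<forall>u\<in>D. inner (A u) v = inner u w}"

text \<open>The vector \<open>w\<close> is unique if \<open>D\<close> is dense.\<close>

definition adj_op :: "'a::real_inner set \<Rightarrow> ('a \<Rightarrow> 'a) \<Rightarrow> 'a \<Rightarrow> 'a" where
  "adj_op D A v = (THE w. \<forall>u\<in>D. inner (A u) v = inner u w)"

definition self_adjoint_op :: "'a::real_inner set \<Rightarrow> ('a \<Rightarrow> 'a) \<Rightarrow> bool" where
  "self_adjoint_op D A \<longleftrightarrow> linear_op D A \<and> closure D = UNIV \<and>
     adj_dom D A = D \<and> (\<forall>v\<in>D. adj_op D A v = A v)"

definition nonneg_op :: "'a::real_inner set \<Rightarrow> ('a \<Rightarrow> 'a) \<Rightarrow> bool" where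
  "nonneg_op D A \<longleftrightarrow> (\<forall>u\<in>D. 0 \<le> inner (A u) u)"


section \<open>Spectral theorem and functional calculus\<close>

text \<open>A resolution of the identity is a right-continuous increasing family of orthogonal
  projections \<open>E x\<close>. Idempotence of \<open>E x\<close> is the case \<open>x = y\<close> of the second condition.\<close>

definition resolution_of_identity :: "(real \<Rightarrow> 'a::real_inner \<Rightarrow> 'a) \<Rightarrow> bool" where
  "resolution_of_identity E \<longleftrightarrow>
     (\<forall>x. bounded_linear (E x) \<and> (\<forall>u v. inner (E x u) v = inner u (E x v))) \<and>
     (\<forall>x y u. E x (E y u) = E (min x y) u) \<and>
     (\<forall>x u. ((\<lambda>y. E y u) \<longlongrightarrow> E x u) (at_right x)) \<and>
     (\<forall>u. ((\<lambda>y. E y u) \<longlongrightarrow> 0) at_bot) \<and>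
     (\<forall>u. ((\<lambda>y. E y u) \<longlongrightarrow> u) at_top)"

text \<open>The measure \<open>d\<langle>E(\<lambda>)u,u\<rangle>\<close>.\<close>

definition spec_measure :: "(real \<Rightarrow> 'a::real_inner \<Rightarrow> 'a) \<Rightarrow> 'a \<Rightarrow> real measure" where
  "spec_measure E u = interval_measure (\<lambda>x. inner (E x u) u)"

text \<open>Domain and value of the operator \<open>\<integral> f(\<lambda>) dE(\<lambda>)\<close>. Its matrix elements
  \<open>\<integral> f(\<lambda>) d\<langle>E(\<lambda>)u,v\<rangle>\<close>, for \<open>u\<close>, \<open>v\<close> in the domain, are written by polarization
  of \<open>d\<langle>E(\<lambda>)u,u\<rangle>\<close>; they determine the value because the domain is dense.\<close>

definition spec_dom :: "(real \<Rightarrow> 'a::real_inner \<Rightarrow> 'a) \<Rightarrow> (real \<Rightarrow> real) \<Rightarrow> 'a set" where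
  "spec_dom E f = {u. (\<integral>\<^sup>+x. ennreal ((f x)\<^sup>2) \<partial>spec_measure E u) < \<infinity>}"

definition spec_op :: "(real \<Rightarrow> 'a::real_inner \<Rightarrow> 'a) \<Rightarrow> (real \<Rightarrow> real) \<Rightarrow> 'a \<Rightarrow> 'a" where
  "spec_op E f u = (THE w. \<forall>v\<in>spec_dom E f. inner w v =
     ((\<integral>x. f x \<partial>spec_measure E (u + v)) - (\<integral>x. f x \<partial>spec_measure E (u - v))) / 4)"

text \<open>\<open>A = \<integral> \<lambda> dE(\<lambda>)\<close>, including equality of the domains.\<close>

definition is_spectral_resolution ::
    "'a::real_inner set \<Rightarrow> ('a \<Rightarrow> 'a) \<Rightarrow> (real \<Rightarrow> 'a \<Rightarrow> 'a) \<Rightarrow> bool" where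
  "is_spectral_resolution D A E \<longleftrightarrow> resolution_of_identity E \<and>
     D = spec_dom E (\<lambda>x. x) \<and> (\<forall>u\<in>D. A u = spec_op E (\<lambda>x. x) u)"

text \<open>For self-adjoint operators on a Hilbert space there is exactly one such \<open>E\<close>
  (spectral theorem).\<close>

definition spectral_resolution ::
    "'a::real_inner set \<Rightarrow> ('a \<Rightarrow> 'a) \<Rightarrow> real \<Rightarrow> 'a \<Rightarrow> 'a" where
  "spectral_resolution D A = (SOME E. is_spectral_resolution D A E)"

text \<open>For nonnegative \<open>A\<close> and \<open>f\<close> on \<open>[0,\<infinity>)\<close>, the operator \<open>f(A\<^sup>1\<^sup>/\<^sup>2)\<close> is
  \<open>\<integral> f(\<surd>\<lambda>) dE(\<lambda>)\<close>. The negative half-line carries no spectral mass; the value \<open>0\<close>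
  there only makes the integrand independent of \<open>f\<close> outside \<open>[0,\<infinity>)\<close>.\<close>

definition sqrt_fun :: "(real \<Rightarrow> real) \<Rightarrow> real \<Rightarrow> real" where
  "sqrt_fun f x = (if x < 0 then 0 else f (sqrt x))"

definition fsqrt_dom :: "'a::real_inner set \<Rightarrow> ('a \<Rightarrow> 'a) \<Rightarrow> (real \<Rightarrow> real) \<Rightarrow> 'a set" where
  "fsqrt_dom D A f = spec_dom (spectral_resolution D A) (sqrt_fun f)"

definition fsqrt_op :: "'a::real_inner set \<Rightarrow> ('a \<Rightarrow> 'a) \<Rightarrow> (real \<Rightarrow> real) \<Rightarrow> 'a \<Rightarrow> 'a" where
  "fsqrt_op D A f = spec_op (spectral_resolution D A) (sqrt_fun f)"

text \<open>\<open>x\<^sup>a\<close> for \<open>x, a \<ge> 0\<close> with \<open>0\<^sup>0 = 1\<close>, whereas \<open>0 powr 0 = 0\<close>.\<close>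

definition rpow :: "real \<Rightarrow> real \<Rightarrow> real" where
  "rpow x a = (if a = 0 then 1 else x powr a)"

text \<open>\<open>A\<^sup>\<beta> = (A\<^sup>1\<^sup>/\<^sup>2)\<^sup>2\<^sup>\<beta>\<close>\<close>

definition pow_fun :: "real \<Rightarrow> real \<Rightarrow> real" where
  "pow_fun \<beta> l = rpow l (2 * \<beta>)"

definition gevrey_fun :: "(real \<Rightarrow> real) \<Rightarrow> real \<Rightarrow> real \<Rightarrow> real \<Rightarrow> real" where
  "gevrey_fun \<phi> r \<alpha> l = rpow l (2 * \<alpha>) * exp ((r / 2) * \<phi> l)"

definition gevrey_space ::
    "'a::real_inner set \<Rightarrow> ('a \<Rightarrow> 'a) \<Rightarrow> (real \<Rightarrow> real) \<Rightarrow> real \<Rightarrow> real \<Rightarrow> 'a set" where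
  "gevrey_space D A \<phi> r \<alpha> = fsqrt_dom D A (gevrey_fun \<phi> r \<alpha>)"


section \<open>Functions of time with values in the domain of an operator\<close>

definition graph_norm :: "('a::real_inner \<Rightarrow> 'a) \<Rightarrow> 'a \<Rightarrow> real" where
  "graph_norm T u = sqrt ((norm u)\<^sup>2 + (norm (T u))\<^sup>2)"

text \<open>\<open>C\<^sup>0([0,\<infinity>); X)\<close> and \<open>C\<^sup>1([0,\<infinity>); X)\<close>, where \<open>X\<close> is the domain of \<open>T\<close> with the graph
  norm; difference quotients at \<open>t = 0\<close> are one-sided.\<close>

definition C0_in :: "'a::real_inner set \<Rightarrow> ('a \<Rightarrow> 'a) \<Rightarrow> (real \<Rightarrow> 'a) \<Rightarrow> bool" where
  "C0_in X T u \<longleftrightarrow> (\<forall>t\<ge>0. u t \<in> X) \<and>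
     (\<forall>t\<ge>0. ((\<lambda>s. graph_norm T (u s - u t)) \<longlongrightarrow> 0) (at t within {0..}))"

definition C1_in :: "'a::real_inner set \<Rightarrow> ('a \<Rightarrow> 'a) \<Rightarrow> (real \<Rightarrow> 'a) \<Rightarrow> bool" where
  "C1_in X T u \<longleftrightarrow> (\<forall>t\<ge>0. u t \<in> X) \<and> (\<exists>u'. C0_in X T u' \<and>
     (\<forall>t\<ge>0. ((\<lambda>s. graph_norm T ((1 / (s - t)) *\<^sub>R (u s - u t) - u' t)) \<longlongrightarrow> 0)
       (at t within {0..})))"

text \<open>The domain of \<open>f(A\<^sup>1\<^sup>/\<^sup>2)\<close> with its graph norm.\<close>

definition C0_fsqrt ::
    "'a::real_inner set \<Rightarrow> ('a \<Rightarrow> 'a) \<Rightarrow> (real \<Rightarrow> real) \<Rightarrow> (real \<Rightarrow> 'a) \<Rightarrow> bool" where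
  "C0_fsqrt D A f u \<longleftrightarrow> C0_in (fsqrt_dom D A f) (fsqrt_op D A f) u"

definition C1_fsqrt ::
    "'a::real_inner set \<Rightarrow> ('a \<Rightarrow> 'a) \<Rightarrow> (real \<Rightarrow> real) \<Rightarrow> (real \<Rightarrow> 'a) \<Rightarrow> bool" where
  "C1_fsqrt D A f u \<longleftrightarrow> C1_in (fsqrt_dom D A f) (fsqrt_op D A f) u"


section \<open>The Kirchhoff equation\<close>

text \<open>\<open>g'\<close> and \<open>g''\<close> are the derivatives of \<open>t \<mapsto> \<langle>u(t),v\<rangle>\<close>.\<close>

definition kirchhoff_weak ::
    "'a::real_inner set \<Rightarrow> ('a \<Rightarrow> 'a) \<Rightarrow> (real \<Rightarrow> real) \<Rightarrow> (real \<Rightarrow> 'a) \<Rightarrow> bool" where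
  "kirchhoff_weak D A m u \<longleftrightarrow> (\<forall>v\<in>D. \<exists>g' g''.
     (\<forall>t\<ge>0. ((\<lambda>s. inner (u s) v) has_real_derivative g' t) (at t within {0..})) \<and>
     (\<forall>t\<ge>0. (g' has_real_derivative g'' t) (at t within {0..})) \<and>
     continuous_on {0..} g'' \<and>
     (\<forall>t\<ge>0. g'' t + m ((norm (fsqrt_op D A (pow_fun (1/2)) (u t)))\<^sup>2) * inner (u t) (A v) = 0))"

definition kirchhoff_solution ::
    "'a::real_inner set \<Rightarrow> ('a \<Rightarrow> 'a) \<Rightarrow> (real \<Rightarrow> real) \<Rightarrow> 'a \<Rightarrow> 'a \<Rightarrow> (real \<Rightarrow> 'a) \<Rightarrow> bool" where
  "kirchhoff_solution D A m u0 u1 u \<longleftrightarrow>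
     C1_fsqrt D A (pow_fun (1/4)) u \<and> C0_fsqrt D A (pow_fun (3/4)) u \<and>
     kirchhoff_weak D A m u \<and>
     u 0 = u0 \<and> (u has_vector_derivative u1) (at 0 within {0..})"

definition gevrey_regular ::
    "'a::real_inner set \<Rightarrow> ('a \<Rightarrow> 'a) \<Rightarrow> (real \<Rightarrow> real) \<Rightarrow> real \<Rightarrow> (real \<Rightarrow> 'a) \<Rightarrow> bool" where
  "gevrey_regular D A \<phi> r u \<longleftrightarrow>
     C1_fsqrt D A (gevrey_fun \<phi> r (1/4)) u \<and> C0_fsqrt D A (gevrey_fun \<phi> r (3/4)) u"

definition locally_lipschitz_on :: "real set \<Rightarrow> (real \<Rightarrow> real) \<Rightarrow> bool" where
  "locally_lipschitz_on S f \<longleftrightarrow> (\<forall>x\<in>S. \<exists>d>0. \<exists>L. L-lipschitz_on (cball x d \<inter> S) f)"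

end

(*
Along a solution put c(t) = m(|A^(1/2) u|^2). The weighted energy |u'|^2 + c |A^(1/2) u|^2, with
weight g(A), can grow only through the increments of c, and these are bounded by |<A u, u'>|
since m is locally Lipschitz and nothing more; all energy estimates are therefore one-sided Dini
estimates. Splitting the spectrum at a level Lambda with phi(Lambda) = Y/r, where Y(t) is the
integral of |<A u, u'>| up to a constant factor, the Gevrey energy controls the high frequencies
and gives Y' <= C (1 + phi^(-1)(Y/r)); the divergence of the integral of phi(s)/s^2 says exactly
that such a Y does not blow up in finite time. This bound is uniform over the spectral
truncations of the equation, which are globally solvable ordinary differential equations. The
difference of two truncations is estimated in the energy with weight (1+A)^(-1/2), where the
nonlinearity is again Lipschitz; together with uniform smallness of the energy tails this gives
convergence in every norm controlled by the Gevrey energy. The same weighted energy applied to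
the difference of two solutions gives uniqueness.

The powers of A come from the spectral resolution E(x), the projection onto the kernel of
|S| + S for S = 1/(1+x) - (1+A)^(-1).
*)
theory Submission
  imports Defs "HOL-Probability.Distribution_Functions"
begin

section \<open>Riesz representation and orthogonal projections\<close>

text \<open>No eigenvectors or compactness are available, and \<open>spectral_resolution\<close> is
  an arbitrary choice among the spectral families of \<open>A\<close>. One family is constructed to
  show that the choice succeeds; afterwards only \<open>is_spectral_resolution\<close> is used. The
  growth factor of the energy with weight g is the exponential of the integral of
  \<open>flux\<close>, up to a constant, whatever g is. Hence one bound on \<open>flux\<close>
  propagates the Gevrey energy with the original \<open>r0\<close>, and, with g restricted to high
  frequencies, the smallness of the tails of the data. \<open>flux\<close> is quadratic in A^(1/4)
  u' and A^(3/4) u, exactly the regularity in the notion of solution. The same regularity dictates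
  the weight (1+A)^(-1/2) for a difference w = u - p. In the plain energy the forcing term would
  require A p in norm. With the damping, <A w, u + p> pairs A^(1/2) (1+A)^(-1/4) w, which the damped
  energy sees, with A^(1/2) (1+A)^(1/4) (u + p), which is bounded by A^(1/2) and A^(3/4); the
  forcing term needs only A^(3/4) p.\<close>

lemma riesz_on_subspace:
  fixes f :: "'a::{real_inner,complete_space} \<Rightarrow> real"
  assumes S: "subspace S" "closed S"
    and add: "\<And>u v. u \<in> S \<Longrightarrow> v \<in> S \<Longrightarrow> f (u + v) = f u + f v"
    and scale: "\<And>c u. u \<in> S \<Longrightarrow> f (c *\<^sub>R u) = c * f u"
    and bound: "\<And>u. u \<in> S \<Longrightarrow> \<bar>f u\<bar> \<le> K * norm u"
  shows "\<exists>w\<in>S. \<forall>v\<in>S. f v = inner w v"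
proof -
  \<comment> \<open>Direct method: \<open>f\<close> is represented by the minimizer of this
    functional, and the parallelogram law makes minimizing sequences Cauchy.\<close>
  define J where "J v = (norm v)\<^sup>2 - 2 * f v" for v
  have low: "J v \<ge> - K\<^sup>2" if "v \<in> S" for v
  proof -
    have "(norm v - K)\<^sup>2 \<ge> 0" by simp
    then have "(norm v)\<^sup>2 - 2 * (K * norm v) \<ge> - K\<^sup>2" by (simp add: power2_eq_square algebra_simps)
    then show ?thesis using bound[OF that] by (simp add: J_def abs_le_iff)
  qed
  have S0: "0 \<in> S" using S(1) by (rule subspace_0)
  define d where "d = Inf (J ` S)"
  have bdd: "bdd_below (J ` S)" using low by (auto intro!: bdd_belowI2)
  have dle: "d \<le> J v" if "v \<in> S" for v
    unfolding d_def using bdd that by (auto intro: cInf_lower)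
  have "\<exists>v\<in>S. J v < d + 1 / real (Suc n)" for n
  proof -
    have "Inf (J ` S) < d + 1 / real (Suc n)" by (simp add: d_def)
    then show ?thesis using cInf_lessD[of "J ` S"] S0 by blast
  qed
  then obtain v where vS: "\<And>n. v n \<in> S" and Jv: "\<And>n. J (v n) < d + 1 / real (Suc n)" by metis
  have par: "(norm (x - y))\<^sup>2 \<le> 2 * J x + 2 * J y - 4 * d" if "x \<in> S" "y \<in> S" for x y
  proof -
    let ?z = "(1/2) *\<^sub>R (x + y)"
    have "?z \<in> S" using S(1) that by (intro subspace_scale subspace_add)
    then have "4 * d \<le> 4 * J ?z" using dle by simp
    also have "\<dots> = (norm (x + y))\<^sup>2 - 4 * (f x + f y)"
    proof -
      have f: "f ?z = (f x + f y) / 2"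
        using scale[OF subspace_add[OF S(1) that], of "1/2"] add[OF that] by simp
      show ?thesis unfolding J_def f by (simp add: power_mult_distrib power2_eq_square add_divide_distrib)
    qed
    finally have "4 * d \<le> (norm (x + y))\<^sup>2 - 4 * (f x + f y)" .
    moreover have "(norm (x + y))\<^sup>2 + (norm (x - y))\<^sup>2 = 2 * (norm x)\<^sup>2 + 2 * (norm y)\<^sup>2"
      by (simp add: power2_norm_eq_inner inner_add_left inner_add_right inner_diff_left inner_diff_right inner_commute)
    ultimately show ?thesis by (simp add: J_def)
  qed
  have "Cauchy v"
  proof (rule CauchyI)
    fix e :: real assume e: "0 < e"
    obtain N where N: "4 / real (Suc N) < e\<^sup>2"
    proof -
      obtain N where "inverse (real (Suc N)) < e\<^sup>2 / 4" using reals_Archimedean[of "e\<^sup>2/4"] e by auto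
      then show ?thesis using that[of N] by (simp add: field_simps)
    qed
    show "\<exists>M. \<forall>m\<ge>M. \<forall>n\<ge>M. norm (v m - v n) < e"
    proof (intro exI[of _ N] allI impI)
      fix m n assume mn: "N \<le> m" "N \<le> n"
      have "1 / real (Suc m) \<le> 1 / real (Suc N)" "1 / real (Suc n) \<le> 1 / real (Suc N)"
        using mn by (auto simp: frac_le)
      then have "(norm (v m - v n))\<^sup>2 \<le> 4 / real (Suc N)"
        using par[OF vS vS, of m n] Jv[of m] Jv[of n] by linarith
      also have "\<dots> < e\<^sup>2" by (rule N)
      finally show "norm (v m - v n) < e" using e by (simp add: power_less_imp_less_base)
    qed
  qed
  then obtain w where w: "v \<longlonglongrightarrow> w" using Cauchy_convergent convergent_def by blast
  have wS: "w \<in> S" using closed_sequentially[OF S(2) _ w] vS by auto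
  have fdiff: "f (x - y) = f x - f y" if "x \<in> S" "y \<in> S" for x y
    using add[OF that(1) subspace_scale[OF S(1) that(2), of "-1"]] scale[OF that(2), of "-1"] by simp
  have Jw: "J w \<le> d"
  proof (rule LIMSEQ_le_const2)
    have "(\<lambda>n. f (v n) - f w) \<longlonglongrightarrow> 0"
    proof (rule Lim_null_comparison[where g="\<lambda>n. K * norm (v n - w)"])
      show "\<forall>\<^sub>F n in sequentially. norm (f (v n) - f w) \<le> K * norm (v n - w)"
        using bound[OF subspace_diff[OF S(1) vS wS]] fdiff[OF vS wS] by simp
      show "(\<lambda>n. K * norm (v n - w)) \<longlonglongrightarrow> 0"
        using tendsto_mult_right_zero[OF tendsto_norm_zero[OF LIM_zero[OF w]]] by simp
    qed
    then have "(\<lambda>n. f (v n)) \<longlonglongrightarrow> f w" by (rule LIM_zero_cancel)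
    then have "(\<lambda>n. J (v n)) \<longlonglongrightarrow> J w" unfolding J_def by (intro tendsto_intros w)
    then have "(\<lambda>n. J (v n) - 1 / real (Suc n)) \<longlonglongrightarrow> J w - 0"
      by (intro tendsto_diff lim_1_over_n[THEN LIMSEQ_Suc]) 
    then show "(\<lambda>n. J (v n) - 1 / real (Suc n)) \<longlonglongrightarrow> J w" by simp
    show "\<exists>N. \<forall>n\<ge>N. J (v n) - 1 / real (Suc n) \<le> d" using Jv by (metis add.commute diff_le_eq less_imp_le)
  qed
  have "f x = inner w x" if x: "x \<in> S" for x
  proof -
    define c where "c = inner w x - f x"
    have ineq: "0 \<le> 2 * t * c + t\<^sup>2 * (norm x)\<^sup>2" for t
    proof -
      have "J w \<le> J (w + t *\<^sub>R x)" using Jw dle[OF subspace_add[OF S(1) wS subspace_scale[OF S(1) x, of t]]] by linarith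
      also have "\<dots> = (norm w)\<^sup>2 + 2 * t * inner w x + t\<^sup>2 * (norm x)\<^sup>2 - 2 * (f w + t * f x)"
        unfolding J_def power2_norm_eq_inner
        by (simp add: add[OF wS subspace_scale[OF S(1) x]] scale[OF x] inner_add_left inner_add_right inner_commute[of x w] power2_eq_square algebra_simps)
      finally show ?thesis by (simp add: J_def c_def algebra_simps)
    qed
    have "c = 0"
    proof (rule ccontr)
      assume c: "c \<noteq> 0"
      \<comment> \<open>The best step in direction \<open>x\<close> is -c/|x|^2; the added 1 avoids
        a separate case \<open>x = 0\<close> and still gives a negative value.\<close>
      define q where "q = (norm x)\<^sup>2 + 1"
      have q: "q > 0" unfolding q_def by (simp add: add_nonneg_pos)
      have "0 \<le> 2 * (- c / q) * c + (- c / q)\<^sup>2 * (norm x)\<^sup>2" by (rule ineq)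
      also have "\<dots> \<le> 2 * (- c / q) * c + (- c / q)\<^sup>2 * q"
        by (intro add_left_mono mult_left_mono) (auto simp: q_def)
      also have "\<dots> = - c\<^sup>2 / q" using q by (simp add: power2_eq_square field_simps)
      finally show False using c q by (simp add: divide_simps)
    qed
    then show ?thesis by (simp add: c_def)
  qed
  then show ?thesis using wS by blast
qed

text \<open>The projection is the Riesz vector of the functional y \<mapsto> <x, y> restricted to
  \<open>S\<close>.\<close>

lemma orthogonal_projection_exists:
  fixes S :: "'a::{real_inner,complete_space} set"
  assumes "subspace S" "closed S"
  shows "\<exists>p\<in>S. \<forall>y\<in>S. inner (x - p) y = 0"
proof -
  have "\<exists>w\<in>S. \<forall>v\<in>S. inner x v = inner w v"
    by (rule riesz_on_subspace[OF assms, where K="norm x"])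
       (auto simp: inner_add_right Cauchy_Schwarz_ineq2)
  then show ?thesis by (auto simp: inner_diff_left)
qed

lemma inner_eqI: "(\<And>v. inner x v = inner y v) \<Longrightarrow> x = (y::'a::real_inner)"
  by (metis inner_diff_left inner_eq_zero_iff right_minus_eq)

text \<open>Every operator of the functional calculus is produced from its matrix elements in this
  way, so that identities between operators become identities between forms.\<close>

lemma bounded_form_operator:
  fixes b :: "'a::{real_inner,complete_space} \<Rightarrow> 'a \<Rightarrow> real"
  assumes "\<And>u u' v. b (u + u') v = b u v + b u' v" "\<And>c u v. b (c *\<^sub>R u) v = c * b u v"
    and "\<And>u v v'. b u (v + v') = b u v + b u v'" "\<And>c u v. b u (c *\<^sub>R v) = c * b u v"
    and bound: "\<And>u v. \<bar>b u v\<bar> \<le> K * norm u * norm v"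
  shows "\<exists>T. bounded_linear T \<and> (\<forall>u v. inner (T u) v = b u v) \<and> (\<forall>u. norm (T u) \<le> K * norm u)"
proof -
  have "\<exists>w. \<forall>v. b u v = inner w v" for u
    using riesz_on_subspace[of UNIV "b u" "K * norm u"] assms by (auto simp: mult.assoc)
  then obtain T where T: "\<And>u v. b u v = inner (T u) v" by metis
  have nT: "norm (T u) \<le> K * norm u" for u
  proof (cases "T u = 0")
    case True
    have "0 \<le> \<bar>b u u\<bar>" by simp
    also have "\<dots> \<le> K * norm u * norm u" by (rule bound)
    finally show ?thesis using True by (cases "u = 0") (auto simp: zero_le_mult_iff)
  next
    case False
    have "norm (T u) * norm (T u) \<le> K * norm u * norm (T u)"
      using bound[of u "T u"] T[of u "T u"] by (simp add: power2_norm_eq_inner[symmetric] power2_eq_square)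
    then show ?thesis using False by simp
  qed
  have "bounded_linear T"
  proof (rule bounded_linear_intro)
    show "T (x + y) = T x + T y" for x y
      by (rule inner_eqI) (simp add: T[symmetric] inner_add_left assms)
    show "T (c *\<^sub>R x) = c *\<^sub>R T x" for c x
      by (rule inner_eqI) (simp add: T[symmetric] assms)
    show "norm (T x) \<le> norm x * K" for x using nT[of x] by (simp add: mult.commute)
  qed
  then show ?thesis using T nT by metis
qed

section \<open>Bounded Borel functional calculus of a resolution of the identity\<close>

definition bounded_borel :: "(real \<Rightarrow> real) \<Rightarrow> bool" where
  "bounded_borel f \<longleftrightarrow> f \<in> borel_measurable borel \<and> (\<exists>K. \<forall>x. \<bar>f x\<bar> \<le> K)"

lemma bounded_borel_measurable: "bounded_borel f \<Longrightarrow> f \<in> borel_measurable borel"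
  by (simp add: bounded_borel_def)

lemma bounded_borelE:
  assumes "bounded_borel f" obtains K where "0 \<le> K" "\<And>x. \<bar>f x\<bar> \<le> K"
  using assms unfolding bounded_borel_def by (meson abs_ge_zero order_trans)

lemma bounded_borelI: "f \<in> borel_measurable borel \<Longrightarrow> (\<And>x. \<bar>f x\<bar> \<le> K) \<Longrightarrow> bounded_borel f"
  by (auto simp: bounded_borel_def)

lemma bounded_borel_const [simp]: "bounded_borel (\<lambda>_. c)"
  by (auto intro: bounded_borelI)

lemma bounded_borel_indicator [simp]: "A \<in> sets borel \<Longrightarrow> bounded_borel (indicator A)"
  by (rule bounded_borelI[where K=1]) (auto simp: indicator_def)

lemma bounded_borel_add [simp]:
  assumes "bounded_borel f" "bounded_borel g" shows "bounded_borel (\<lambda>x. f x + g x)"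
proof -
  obtain K L where "\<And>x. \<bar>f x\<bar> \<le> K" "\<And>x. \<bar>g x\<bar> \<le> L" using assms by (metis bounded_borelE)
  then have "\<bar>f x + g x\<bar> \<le> K + L" for x using abs_triangle_ineq[of "f x" "g x"] by (smt (verit))
  then show ?thesis using assms
    by (intro bounded_borelI[OF borel_measurable_add]) (auto simp: bounded_borel_measurable)
qed

lemma bounded_borel_mult [simp]:
  assumes "bounded_borel f" "bounded_borel g" shows "bounded_borel (\<lambda>x. f x * g x)"
proof -
  obtain K L where "0 \<le> K" "\<And>x. \<bar>f x\<bar> \<le> K" "\<And>x. \<bar>g x\<bar> \<le> L" using assms by (metis bounded_borelE)
  then have "\<bar>f x * g x\<bar> \<le> K * L" for x by (simp add: abs_mult mult_mono)
  then show ?thesis using assms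
    by (intro bounded_borelI[OF borel_measurable_times]) (auto simp: bounded_borel_measurable)
qed

lemma bounded_borel_cmult: "bounded_borel f \<Longrightarrow> bounded_borel (\<lambda>x. c * f x)"
  using bounded_borel_mult[of "\<lambda>_. c" f] by simp

lemma bounded_borel_diff [simp]: "bounded_borel f \<Longrightarrow> bounded_borel g \<Longrightarrow> bounded_borel (\<lambda>x. f x - g x)"
  using bounded_borel_add[OF _ bounded_borel_cmult, of f g "-1"] by simp

lemma bounded_borel_power2 [simp]: "bounded_borel f \<Longrightarrow> bounded_borel (\<lambda>x. (f x)\<^sup>2)"
  by (simp add: power2_eq_square)

lemma bounded_borel_smaller:
  assumes "bounded_borel g" "f \<in> borel_measurable borel" "\<And>x. \<bar>f x\<bar> \<le> \<bar>g x\<bar>"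
  shows "bounded_borel f"
proof -
  obtain K where "\<And>x. \<bar>g x\<bar> \<le> K" using assms(1) by (metis bounded_borelE)
  then show ?thesis using assms(2,3) by (intro bounded_borelI[where K=K]) (auto intro: order_trans)
qed

lemma bounded_borel_integrable:
  assumes "finite_measure M" and [measurable_cong]: "sets M = sets borel" and f: "bounded_borel f"
  shows "integrable M f"
proof -
  obtain K where "\<And>x. \<bar>f x\<bar> \<le> K" using f by (metis bounded_borelE)
  then show ?thesis using bounded_borel_measurable[OF f]
    by (intro finite_measure.integrable_const_bound[OF assms(1), where B=K]) auto
qed

text \<open>Abstracts finite signed measures, so that identities between polarized spectral measures can
  be checked on half-lines.\<close>

definition signed_functional :: "((real \<Rightarrow> real) \<Rightarrow> real) \<Rightarrow> bool" where
  "signed_functional \<Phi> \<longleftrightarrow>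
    (\<forall>f g. bounded_borel f \<longrightarrow> bounded_borel g \<longrightarrow> \<Phi> (\<lambda>x. f x + g x) = \<Phi> f + \<Phi> g) \<and>
    (\<forall>c f. bounded_borel f \<longrightarrow> \<Phi> (\<lambda>x. c * f x) = c * \<Phi> f) \<and>
    (\<forall>F f K. (\<forall>n. F n \<in> borel_measurable borel) \<longrightarrow> (\<forall>n x. \<bar>F n x\<bar> \<le> K) \<longrightarrow>
       (\<forall>x. (\<lambda>n. F n x) \<longlonglongrightarrow> f x) \<longrightarrow> (\<lambda>n::nat. \<Phi> (F n)) \<longlonglongrightarrow> \<Phi> f)"

lemma signed_functional_limit:
  "signed_functional \<Phi> \<Longrightarrow> (\<And>n. F n \<in> borel_measurable borel) \<Longrightarrow> (\<And>n x. \<bar>F n x\<bar> \<le> K) \<Longrightarrow>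
   (\<And>x. (\<lambda>n. F n x) \<longlonglongrightarrow> f x) \<Longrightarrow> (\<lambda>n::nat. \<Phi> (F n)) \<longlonglongrightarrow> \<Phi> f"
  unfolding signed_functional_def by blast

lemma signed_functional_plus:
  "signed_functional \<Phi> \<Longrightarrow> bounded_borel f \<Longrightarrow> bounded_borel g \<Longrightarrow> \<Phi> (\<lambda>x. f x + g x) = \<Phi> f + \<Phi> g"
  unfolding signed_functional_def by blast

lemma signed_functional_scale:
  "signed_functional \<Phi> \<Longrightarrow> bounded_borel f \<Longrightarrow> \<Phi> (\<lambda>x. c * f x) = c * \<Phi> f"
  unfolding signed_functional_def by blast

lemma signed_functional_integral:
  assumes M: "finite_measure M" and [measurable_cong]: "sets M = sets borel"
  shows "signed_functional (\<lambda>f. \<integral>x. f x \<partial>M)"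
  unfolding signed_functional_def
proof (intro conjI allI impI)
  fix f g assume "bounded_borel f" "bounded_borel g"
  then show "(\<integral>x. f x + g x \<partial>M) = (\<integral>x. f x \<partial>M) + (\<integral>x. g x \<partial>M)"
    using assms by (intro Bochner_Integration.integral_add bounded_borel_integrable)
next
  fix F :: "nat \<Rightarrow> real \<Rightarrow> real" and f K
  assume F: "\<forall>n. F n \<in> borel_measurable borel" and K: "\<forall>n x. \<bar>F n x\<bar> \<le> K"
    and lim: "\<forall>x. (\<lambda>n. F n x) \<longlonglongrightarrow> f x"
  have f: "f \<in> borel_measurable borel" using F lim by (metis borel_measurable_LIMSEQ_metric)
  show "(\<lambda>n. \<integral>x. F n x \<partial>M) \<longlonglongrightarrow> (\<integral>x. f x \<partial>M)"
  proof (rule integral_dominated_convergence[where w="\<lambda>_. K"])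
    show "integrable M (\<lambda>_. K)" using M assms by (intro bounded_borel_integrable) auto
  qed (use F K lim f in \<open>auto simp: measurable_cong_sets[OF assms(2) refl]\<close>)
qed simp

lemma signed_functional_add:
  assumes "signed_functional \<Phi>" "signed_functional \<Psi>"
  shows "signed_functional (\<lambda>f. \<Phi> f + \<Psi> f)"
  unfolding signed_functional_def
proof (intro conjI allI impI)
  fix F :: "nat \<Rightarrow> real \<Rightarrow> real" and f K
  assume "\<forall>n. F n \<in> borel_measurable borel" "\<forall>n x. \<bar>F n x\<bar> \<le> K" "\<forall>x. (\<lambda>n. F n x) \<longlonglongrightarrow> f x"
  then show "(\<lambda>n. \<Phi> (F n) + \<Psi> (F n)) \<longlonglongrightarrow> \<Phi> f + \<Psi> f"
    by (intro tendsto_add assms[THEN signed_functional_limit, where K=K]) auto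
qed (simp_all add: assms[THEN signed_functional_plus] assms[THEN signed_functional_scale] distrib_left)

lemma signed_functional_cmult:
  assumes "signed_functional \<Phi>" shows "signed_functional (\<lambda>f. c * \<Phi> f)"
  unfolding signed_functional_def
proof (intro conjI allI impI)
  fix F :: "nat \<Rightarrow> real \<Rightarrow> real" and f K
  assume "\<forall>n. F n \<in> borel_measurable borel" "\<forall>n x. \<bar>F n x\<bar> \<le> K" "\<forall>x. (\<lambda>n. F n x) \<longlonglongrightarrow> f x"
  then show "(\<lambda>n. c * \<Phi> (F n)) \<longlonglongrightarrow> c * \<Phi> f"
    by (intro tendsto_mult_left assms[THEN signed_functional_limit, where K=K]) auto
qed (simp_all add: assms[THEN signed_functional_plus] assms[THEN signed_functional_scale] distrib_left)

lemma signed_functional_diff: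
  "signed_functional \<Phi> \<Longrightarrow> signed_functional \<Psi> \<Longrightarrow> signed_functional (\<lambda>f. \<Phi> f - \<Psi> f)"
  using signed_functional_add[of \<Phi> "\<lambda>f. (-1) * \<Psi> f"] signed_functional_cmult[of \<Psi> "-1"] by simp

lemma signed_functional_divide:
  "signed_functional \<Phi> \<Longrightarrow> signed_functional (\<lambda>f. \<Phi> f / c)"
  using signed_functional_cmult[of \<Phi> "1/c"] by simp

lemma signed_functional_mult:
  assumes \<Phi>: "signed_functional \<Phi>" and g: "bounded_borel g"
  shows "signed_functional (\<lambda>f. \<Phi> (\<lambda>x. f x * g x))"
  unfolding signed_functional_def
proof (intro conjI allI impI)
  fix f h assume f: "bounded_borel f" "bounded_borel h"
  show "\<Phi> (\<lambda>x. (f x + h x) * g x) = \<Phi> (\<lambda>x. f x * g x) + \<Phi> (\<lambda>x. h x * g x)"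
    using \<Phi> f g by (auto simp: signed_functional_def distrib_right)
next
  fix c f assume "bounded_borel f"
  then show "\<Phi> (\<lambda>x. c * f x * g x) = c * \<Phi> (\<lambda>x. f x * g x)"
    using \<Phi> g by (auto simp: signed_functional_def mult.assoc)
next
  fix F :: "nat \<Rightarrow> real \<Rightarrow> real" and f K
  assume F: "\<forall>n. F n \<in> borel_measurable borel" and K: "\<forall>n x. \<bar>F n x\<bar> \<le> K"
    and lim: "\<forall>x. (\<lambda>n. F n x) \<longlonglongrightarrow> f x"
  obtain L where L: "0 \<le> L" "\<And>x. \<bar>g x\<bar> \<le> L" using g by (metis bounded_borelE)
  have "0 \<le> K" using K by (meson abs_ge_zero order_trans)
  show "(\<lambda>n. \<Phi> (\<lambda>x. F n x * g x)) \<longlonglongrightarrow> \<Phi> (\<lambda>x. f x * g x)"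
    using F K lim L \<open>0 \<le> K\<close> bounded_borel_measurable[OF g]
    by (intro signed_functional_limit[OF \<Phi>, where K="K * L"])
       (auto simp: abs_mult intro!: mult_mono tendsto_mult borel_measurable_times)
qed

text \<open>A finite signed measure is determined by its distribution function: half-lines are an
  intersection-stable generator of the Borel sets, Dynkin's argument reaches all Borel sets, and
  monotone approximation reaches all bounded Borel functions. The value at the constant 1 is needed
  for complements.\<close>

lemma signed_functional_eq_zero:
  assumes \<Phi>: "signed_functional \<Phi>" and half: "\<And>x. \<Phi> (indicator {..x}) = 0"
    and one: "\<Phi> (\<lambda>_. 1) = 0" and f: "bounded_borel f"
  shows "\<Phi> f = 0"
proof -
  have addf: "\<Phi> (\<lambda>x. f x + g x) = \<Phi> f + \<Phi> g" if "bounded_borel f" "bounded_borel g" for f g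
    using \<Phi> that by (auto simp: signed_functional_def)
  have scale: "\<Phi> (\<lambda>x. c * f x) = c * \<Phi> f" if "bounded_borel f" for f c
    using \<Phi> that by (auto simp: signed_functional_def)
  have zero: "\<Phi> (\<lambda>_. 0) = 0" using scale[of "\<lambda>_. 1" 0] by simp
  have set0: "\<Phi> (indicator A) = 0" if "A \<in> sets borel" for A
  proof -
    have eq: "sets borel = sigma_sets UNIV (range (\<lambda>a::real. {..a}))"
      by (subst borel_eq_atMost) (simp add: sets_measure_of)
    have "Int_stable (range (\<lambda>a::real. {..a}))" by (auto simp: Int_stable_def)
    moreover have "range (\<lambda>a::real. {..a}) \<subseteq> Pow UNIV" by simp
    ultimately show ?thesis using that unfolding eq
    proof (induction rule: sigma_sets_induct_disjoint)
      case (basic A)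
      then show ?case using half by auto
    next
      case empty
      then show ?case using zero by (simp add: indicator_def)
    next
      case (compl A)
      then have "A \<in> sets borel" by (simp add: eq)
      then have "\<Phi> (indicator A) + \<Phi> (indicator (UNIV - A)) = \<Phi> (\<lambda>x. indicator A x + indicator (UNIV - A) x)"
        by (subst addf) auto
      also have "(\<lambda>x. indicator A x + indicator (UNIV - A) x :: real) = (\<lambda>_. 1)"
        by (auto simp: indicator_def)
      finally show ?case using compl one by simp
    next
      case (union A)
      then have A: "A i \<in> sets borel" for i by (auto simp: eq)
      have fin: "\<Phi> (indicator (\<Union>i<n. A i)) = 0" for n
      proof (induction n)
        case 0
        then show ?case using zero by (simp add: indicator_def)
      next
        case (Suc n)
        have "indicator (\<Union>i<Suc n. A i) = (\<lambda>x. indicator (\<Union>i<n. A i) x + indicator (A n) x :: real)"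
        proof
          fix x
          have "A i \<inter> A n = {}" if "i < n" for i
            using union(1) that unfolding disjoint_family_on_def by (metis UNIV_I less_irrefl)
          then have "x \<notin> (\<Union>i<n. A i) \<or> x \<notin> A n" by blast
          then show "indicator (\<Union>i<Suc n. A i) x = (indicator (\<Union>i<n. A i) x + indicator (A n) x :: real)"
            by (auto simp: indicator_def less_Suc_eq)
        qed
        then show ?case using Suc A union(3) by (simp add: addf)
      qed
      have "(\<lambda>n. \<Phi> (indicator (\<Union>i<n. A i))) \<longlonglongrightarrow> \<Phi> (indicator (\<Union>i. A i))"
        using A by (intro signed_functional_limit[OF \<Phi>, where K=1] LIMSEQ_indicator_UN) (auto simp: indicator_def)
      then show ?case using fin LIMSEQ_unique tendsto_const by (simp add: LIMSEQ_const_iff)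
    qed
  qed
  \<comment> \<open>Boundedness sits inside the induction formula because it must be recovered for
    each summand and each approximant; these are nonnegative and lie below the bounded function that
    they build.\<close>
  have nonneg: "bounded_borel f \<longrightarrow> \<Phi> f = 0" if "f \<in> borel_measurable borel" "\<And>x. 0 \<le> f x" for f
    using that
  proof (induction rule: borel_measurable_induct_real)
    case (set A)
    then show ?case using set0 by simp
  next
    case (mult u c)
    show ?case
    proof
      assume b: "bounded_borel (\<lambda>x. c * u x)"
      show "\<Phi> (\<lambda>x. c * u x) = 0"
      proof (cases "c = 0")
        case False
        then have "bounded_borel u" using bounded_borel_cmult[OF b, of "1/c"] by simp
        then show ?thesis using mult scale by simp
      qed (use zero in simp)
    qed
  next
    case (add u v)
    show ?case
    proof
      assume b: "bounded_borel (\<lambda>x. v x + u x)"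
      have "bounded_borel u" "bounded_borel v"
        using add(1-5) by (auto intro!: bounded_borel_smaller[OF b])
      then show "\<Phi> (\<lambda>x. v x + u x) = 0" using add addf by simp
    qed
  next
    case (seq U)
    show ?case
    proof
      assume b: "bounded_borel f"
      then obtain K where K: "\<And>x. \<bar>f x\<bar> \<le> K" by (metis bounded_borelE)
      have "U i x \<le> f x" for i x
        by (rule incseq_le[of "\<lambda>i. U i x"]) (use seq in \<open>auto simp: incseq_def le_fun_def\<close>)
      then have UK: "\<bar>U i x\<bar> \<le> K" for i x
        using seq(2)[where x=x and i=i] K[of x] by (smt (verit))
      then have "bounded_borel (U i)" for i using seq(1) by (auto intro: bounded_borelI)
      then have z: "\<Phi> (U i) = 0" for i using seq by blast
      have "(\<lambda>i. \<Phi> (U i)) \<longlonglongrightarrow> \<Phi> f"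
        using seq UK by (intro signed_functional_limit[OF \<Phi>, where K=K]) auto
      then show "\<Phi> f = 0" by (simp add: z LIMSEQ_const_iff)
    qed
  qed
  have fm: "f \<in> borel_measurable borel" using f by (rule bounded_borel_measurable)
  have p: "bounded_borel (\<lambda>x. max 0 (f x))" "bounded_borel (\<lambda>x. max 0 (- f x))"
    using fm by (auto intro!: bounded_borel_smaller[OF f])
  have "\<Phi> f = \<Phi> (\<lambda>x. max 0 (f x) + (-1) * max 0 (- f x))" by (rule arg_cong[of _ _ \<Phi>]) auto
  also have "\<dots> = \<Phi> (\<lambda>x. max 0 (f x)) + (-1) * \<Phi> (\<lambda>x. max 0 (- f x))"
    using addf[OF p(1) bounded_borel_cmult[OF p(2), of "-1"]] scale[OF p(2), of "-1"] by simp
  also have "\<dots> = 0" using nonneg p fm by auto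
  finally show ?thesis .
qed

lemma signed_functional_eqI:
  assumes "signed_functional \<Phi>" "signed_functional \<Psi>"
    and "\<And>x. \<Phi> (indicator {..x}) = \<Psi> (indicator {..x})" "\<Phi> (\<lambda>_. 1) = \<Psi> (\<lambda>_. 1)" "bounded_borel f"
  shows "\<Phi> f = \<Psi> f"
  using signed_functional_eq_zero[OF signed_functional_diff[OF assms(1,2)]] assms(3-) by simp

section \<open>The functional calculus of a fixed resolution of the identity\<close>

locale resolution =
  fixes E :: "real \<Rightarrow> 'a::{real_inner,complete_space} \<Rightarrow> 'a"
  assumes resolution: "resolution_of_identity E"
begin

lemma E_bl: "bounded_linear (E x)" and E_sym: "inner (E x u) v = inner u (E x v)"
  and E_E: "E x (E y u) = E (min x y) u"
  and E_right: "((\<lambda>y. E y u) \<longlongrightarrow> E x u) (at_right x)"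
  and E_bot: "((\<lambda>y. E y u) \<longlongrightarrow> 0) at_bot"
  and E_top: "((\<lambda>y. E y u) \<longlongrightarrow> u) at_top"
  using resolution by (auto simp: resolution_of_identity_def)

lemma E_linear: "E x (u + v) = E x u + E x v" "E x (u - v) = E x u - E x v"
  "E x (c *\<^sub>R u) = c *\<^sub>R E x u" "E x 0 = 0" "E x (- u) = - E x u"
  by (rule linear_add[OF bounded_linear.linear[OF E_bl]] linear_diff[OF bounded_linear.linear[OF E_bl]]
      linear_scale[OF bounded_linear.linear[OF E_bl]] linear_0[OF bounded_linear.linear[OF E_bl]]
      linear_neg[OF bounded_linear.linear[OF E_bl]])+

lemma E_swap: "inner (E x v) u = inner (E x u) v"
  by (metis E_sym inner_commute)

lemma E_norm: "inner (E x u) u = (norm (E x u))\<^sup>2"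
  by (metis E_E E_sym min.idem power2_norm_eq_inner)

lemma E_mono: assumes "x \<le> y" shows "inner (E x u) u \<le> inner (E y u) u"
proof -
  have 1: "inner (E x u) (E x u) = inner (E x u) u" for x by (metis E_E E_sym min.idem)
  have 2: "inner (E y u) (E x u) = inner (E x u) u" using assms by (metis E_E E_sym inner_commute min.absorb1)
  have "0 \<le> (norm (E y u - E x u))\<^sup>2" by simp
  also have "\<dots> = inner (E y u) u - inner (E x u) u"
    unfolding power2_norm_eq_inner using 1 2 by (simp add: inner_diff_left inner_diff_right inner_commute[of "E x u" "E y u"])
  finally show ?thesis by simp
qed

abbreviation \<mu> :: "'a \<Rightarrow> real measure" where "\<mu> u \<equiv> spec_measure E u"

lemma cdf_facts: "continuous (at_right a) (\<lambda>x. inner (E x u) u)"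
   "((\<lambda>x. inner (E x u) u) \<longlongrightarrow> 0) at_bot" "((\<lambda>x. inner (E x u) u) \<longlongrightarrow> (norm u)\<^sup>2) at_top"
proof -
  show "continuous (at_right a) (\<lambda>x. inner (E x u) u)"
    unfolding continuous_within by (intro tendsto_inner E_right tendsto_const)
  show "((\<lambda>x. inner (E x u) u) \<longlongrightarrow> 0) at_bot"
    using tendsto_inner[OF E_bot tendsto_const, of u u] by simp
  show "((\<lambda>x. inner (E x u) u) \<longlongrightarrow> (norm u)\<^sup>2) at_top"
    unfolding power2_norm_eq_inner by (intro tendsto_inner E_top tendsto_const)
qed

lemma sets_mu [simp, measurable_cong]: "sets (\<mu> u) = sets borel"
  by (simp add: spec_measure_def)

lemma space_mu [simp]: "space (\<mu> u) = UNIV"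
  by (simp add: spec_measure_def)

lemma emeasure_mu: "emeasure (\<mu> u) UNIV = ennreal ((norm u)\<^sup>2)"
  unfolding spec_measure_def by (rule interval_measure_UNIV) (auto intro: E_mono cdf_facts)

lemma finite_mu [simp]: "finite_measure (\<mu> u)"
  by (rule finite_measureI) (simp add: emeasure_mu)

lemma measure_mu: "measure (\<mu> u) UNIV = (norm u)\<^sup>2"
  by (simp add: measure_def emeasure_mu)

lemma measure_mu_atMost: "measure (\<mu> u) {..x} = inner (E x u) u"
  unfolding spec_measure_def by (rule measure_interval_measure_Iic) (auto intro: E_mono cdf_facts)

lemma integrable_mu [simp]: "bounded_borel f \<Longrightarrow> integrable (\<mu> u) f"
  by (rule bounded_borel_integrable) auto

lemma sf_mu: "signed_functional (\<lambda>f. \<integral>x. f x \<partial>\<mu> u)"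
  by (rule signed_functional_integral) auto

lemma integral_mu_1: "(\<integral>x. 1 \<partial>\<mu> u) = (norm u)\<^sup>2"
  by (simp add: measure_mu)

lemma integral_mu_E: "(\<integral>x. indicator {..y} x \<partial>\<mu> u) = inner (E y u) u"
  by (simp add: measure_mu_atMost)

definition spec_form :: "(real \<Rightarrow> real) \<Rightarrow> 'a \<Rightarrow> 'a \<Rightarrow> real" where
  "spec_form f u v = ((\<integral>x. f x \<partial>\<mu> (u + v)) - (\<integral>x. f x \<partial>\<mu> (u - v))) / 4"

lemma sf_form: "signed_functional (\<lambda>f. spec_form f u v)"
  unfolding spec_form_def by (intro signed_functional_divide signed_functional_diff sf_mu)

lemma form_1: "spec_form (\<lambda>_. 1) u v = inner u v"
  unfolding spec_form_def integral_mu_1 power2_norm_eq_inner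
  by (simp add: inner_add_left inner_add_right inner_diff_left inner_diff_right inner_commute)

lemma form_E: "spec_form (indicator {..y}) u v = inner (E y u) v"
  using E_swap[of y v u] unfolding spec_form_def integral_mu_E
  by (simp add: E_linear inner_add_left inner_add_right inner_diff_left inner_diff_right)

text \<open>The polarized formula does not show bilinearity. For fixed vectors both sides are signed
  functionals of \<open>f\<close>, so half-lines suffice, and there the claim is linearity of the
  projections \<open>E y\<close>.\<close>

lemma form_add_left: "bounded_borel f \<Longrightarrow> spec_form f (u + u') v = spec_form f u v + spec_form f u' v"
  by (rule signed_functional_eqI[OF sf_form signed_functional_add[OF sf_form sf_form]])
     (auto simp: form_1 form_E E_linear inner_add_left)

lemma form_scale_left: "bounded_borel f \<Longrightarrow> spec_form f (c *\<^sub>R u) v = c * spec_form f u v"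
  by (rule signed_functional_eqI[OF sf_form signed_functional_cmult[OF sf_form]])
     (auto simp: form_1 form_E E_linear)

lemma form_commute: "bounded_borel f \<Longrightarrow> spec_form f u v = spec_form f v u"
  by (rule signed_functional_eqI[OF sf_form sf_form])
     (auto simp: form_1 form_E inner_commute[of u v] E_swap[of _ v u])

lemma form_self: "bounded_borel f \<Longrightarrow> spec_form f u u = (\<integral>x. f x \<partial>\<mu> u)"
  by (rule signed_functional_eqI[OF sf_form sf_mu])
     (auto simp: form_1 form_E integral_mu_E measure_mu power2_norm_eq_inner measure_mu_atMost)

lemma integral_mu_bound:
  assumes f: "bounded_borel f" and K: "\<And>x. \<bar>f x\<bar> \<le> K"
  shows "\<bar>\<integral>x. f x \<partial>\<mu> u\<bar> \<le> K * (norm u)\<^sup>2"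
proof -
  have "\<bar>\<integral>x. f x \<partial>\<mu> u\<bar> \<le> (\<integral>x. \<bar>f x\<bar> \<partial>\<mu> u)" by (rule integral_abs_bound)
  also have "\<dots> \<le> (\<integral>x. K \<partial>\<mu> u)"
    using f K by (intro integral_mono integrable_abs integrable_mu) auto
  finally show ?thesis by (simp add: measure_mu mult.commute)
qed

lemma form_bound:
  assumes f: "bounded_borel f" and K: "\<And>x. \<bar>f x\<bar> \<le> K"
  shows "\<bar>spec_form f u v\<bar> \<le> K * norm u * norm v"
proof -
  \<comment> \<open>Polarization bounds the form only by |u|^2 + |v|^2; applying this to normalized
    vectors gives the product bound.\<close>
  have weak: "\<bar>spec_form f u v\<bar> \<le> K / 2 * ((norm u)\<^sup>2 + (norm v)\<^sup>2)" for u v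
  proof -
    have "(norm (u + v))\<^sup>2 + (norm (u - v))\<^sup>2 = 2 * ((norm u)\<^sup>2 + (norm v)\<^sup>2)"
      by (simp add: power2_norm_eq_inner inner_add_left inner_add_right inner_diff_left inner_diff_right inner_commute)
    then have "K * (norm (u + v))\<^sup>2 + K * (norm (u - v))\<^sup>2 = K * (2 * ((norm u)\<^sup>2 + (norm v)\<^sup>2))"
      by (metis distrib_left)
    then show ?thesis unfolding spec_form_def
      using integral_mu_bound[OF f K, of "u + v"] integral_mu_bound[OF f K, of "u - v"] by (simp add: field_simps)
  qed
  have scale_right: "spec_form f x (c *\<^sub>R y) = c * spec_form f x y" for x y c
    using form_scale_left[OF f] form_commute[OF f] by metis
  show ?thesis
  proof (cases "u = 0 \<or> v = 0")
    case True
    then show ?thesis using form_scale_left[OF f, of 0 0 v] scale_right[of u 0 0] by auto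
  next
    case False
    define a b where "a = norm u" and "b = norm v"
    have ab: "a > 0" "b > 0" using False by (auto simp: a_def b_def)
    have "spec_form f u v = a * b * spec_form f (u /\<^sub>R a) (v /\<^sub>R b)"
      using ab by (simp add: form_scale_left[OF f] scale_right field_simps)
    moreover have "\<bar>spec_form f (u /\<^sub>R a) (v /\<^sub>R b)\<bar> \<le> K"
      using weak[of "u /\<^sub>R a" "v /\<^sub>R b"] ab by (simp add: a_def b_def)
    ultimately have "\<bar>spec_form f u v\<bar> \<le> a * b * K" using ab by (simp add: abs_mult)
    then show ?thesis by (simp add: a_def b_def mult_ac)
  qed
qed

definition fcalc :: "(real \<Rightarrow> real) \<Rightarrow> 'a \<Rightarrow> 'a" where
  "fcalc f = (SOME T. bounded_linear T \<and> (\<forall>u v. inner (T u) v = spec_form f u v))"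

lemma fcalc_facts:
  assumes f: "bounded_borel f"
  shows fcalc_bl: "bounded_linear (fcalc f)" and fcalc_form: "inner (fcalc f u) v = spec_form f u v"
proof -
  obtain K where K: "0 \<le> K" "\<And>x. \<bar>f x\<bar> \<le> K" using f by (metis bounded_borelE)
  have "\<exists>T. bounded_linear T \<and> (\<forall>u v. inner (T u) v = spec_form f u v) \<and> (\<forall>u. norm (T u) \<le> K * norm u)"
  proof (rule bounded_form_operator)
    show "spec_form f u (v + v') = spec_form f u v + spec_form f u v'" for u v v'
      using form_add_left[OF f] form_commute[OF f] by metis
    show "spec_form f u (c *\<^sub>R v) = c * spec_form f u v" for u v c
      using form_scale_left[OF f] form_commute[OF f] by metis
  qed (use form_add_left[OF f] form_scale_left[OF f] form_bound[OF f K(2)] in auto)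
  then have "\<exists>T. bounded_linear T \<and> (\<forall>u v. inner (T u) v = spec_form f u v)" by blast
  then have "bounded_linear (fcalc f) \<and> (\<forall>u v. inner (fcalc f u) v = spec_form f u v)"
    unfolding fcalc_def by (rule someI_ex)
  then show "bounded_linear (fcalc f)" "inner (fcalc f u) v = spec_form f u v" by auto
qed

lemma fcalc_linear:
  assumes "bounded_borel f"
  shows "fcalc f (u + v) = fcalc f u + fcalc f v" "fcalc f (u - v) = fcalc f u - fcalc f v"
    "fcalc f (c *\<^sub>R u) = c *\<^sub>R fcalc f u" "fcalc f 0 = 0" "fcalc f (- u) = - fcalc f u"
  by (rule linear_add[OF bounded_linear.linear[OF fcalc_bl[OF assms]]] linear_diff[OF bounded_linear.linear[OF fcalc_bl[OF assms]]]
      linear_scale[OF bounded_linear.linear[OF fcalc_bl[OF assms]]] linear_0[OF bounded_linear.linear[OF fcalc_bl[OF assms]]]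
      linear_neg[OF bounded_linear.linear[OF fcalc_bl[OF assms]]])+

lemma fcalc_sym: "bounded_borel f \<Longrightarrow> inner (fcalc f u) v = inner u (fcalc f v)"
  by (metis fcalc_form form_commute inner_commute)

lemma fcalc_quad: "bounded_borel f \<Longrightarrow> inner (fcalc f u) u = (\<integral>x. f x \<partial>\<mu> u)"
  by (simp add: fcalc_form form_self)

lemma fcalc_one: "fcalc (\<lambda>_. 1) u = u"
  by (rule inner_eqI) (simp add: fcalc_form form_1)

lemma fcalc_E: "fcalc (indicator {..y}) u = E y u"
  by (rule inner_eqI) (simp add: fcalc_form form_E)

lemma fcalc_add: "bounded_borel f \<Longrightarrow> bounded_borel g \<Longrightarrow> fcalc (\<lambda>x. f x + g x) u = fcalc f u + fcalc g u"
  by (rule inner_eqI)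
     (simp add: fcalc_form inner_add_left signed_functional_plus[OF sf_form])

lemma fcalc_cmult: "bounded_borel f \<Longrightarrow> fcalc (\<lambda>x. c * f x) u = c *\<^sub>R fcalc f u"
  by (rule inner_eqI)
     (simp add: fcalc_form bounded_borel_cmult signed_functional_scale[OF sf_form])

lemma fcalc_diff: "bounded_borel f \<Longrightarrow> bounded_borel g \<Longrightarrow> fcalc (\<lambda>x. f x - g x) u = fcalc f u - fcalc g u"
  using fcalc_add[of f "\<lambda>x. - 1 * g x" u] fcalc_cmult[of g "-1" u] bounded_borel_cmult[of g "-1"] by simp

text \<open>This is multiplicativity of the calculus in weak form. On pairs of half-lines it is the
  product rule for the projections; \<open>step\<close> extends it to arbitrary \<open>f\<close>
  with a half-line as second function, and the second comparison then extends it in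
  \<open>g\<close>.\<close>

lemma fcalc_inner:
  assumes f: "bounded_borel f" and g: "bounded_borel g"
  shows "inner (fcalc f u) (fcalc g v) = spec_form (\<lambda>x. f x * g x) u v"
proof -
  have step: "spec_form f u (E y v) = spec_form (\<lambda>x. f x * indicator {..y} x) u v"
    if "bounded_borel f" for f u v y
  proof (rule signed_functional_eqI[OF sf_form signed_functional_mult[OF sf_form] _ _ that])
    fix x
    have "(\<lambda>z. indicator {..x} z * indicator {..y} z :: real) = indicator {..min x y}" by (auto simp: indicator_def)
    then show "spec_form (indicator {..x}) u (E y v) = spec_form (\<lambda>z. indicator {..x} z * indicator {..y} z) u v"
      by (simp add: form_E E_sym E_E)
  qed (auto simp: form_1 form_E E_sym)
  have "inner (fcalc f u) (fcalc g v) = spec_form g (fcalc f u) v"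
    by (simp add: fcalc_form[OF g, symmetric] fcalc_sym[OF g])
  also have "\<dots> = spec_form (\<lambda>x. g x * f x) u v"
  proof (rule signed_functional_eqI[OF sf_form signed_functional_mult[OF sf_form f] _ _ g])
    show "spec_form (indicator {..x}) (fcalc f u) v = spec_form (\<lambda>y. indicator {..x} y * f y) u v" for x
      using step[OF f, of u x v] by (simp add: form_E E_sym fcalc_form[OF f] mult.commute)
    show "spec_form (\<lambda>_. 1) (fcalc f u) v = spec_form (\<lambda>y. 1 * f y) u v"
      by (simp add: form_1 fcalc_form[OF f])
  qed
  finally show ?thesis by (simp add: mult.commute)
qed

lemma fcalc_mult:
  assumes f: "bounded_borel f" and g: "bounded_borel g"
  shows "fcalc f (fcalc g u) = fcalc (\<lambda>x. f x * g x) u"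
proof (rule inner_eqI)
  fix v
  have "inner (fcalc f (fcalc g u)) v = inner (fcalc g u) (fcalc f v)" by (rule fcalc_sym[OF f])
  also have "\<dots> = spec_form (\<lambda>x. f x * g x) u v" using fcalc_inner[OF g f] by (simp add: mult.commute)
  finally show "inner (fcalc f (fcalc g u)) v = inner (fcalc (\<lambda>x. f x * g x) u) v"
    using bounded_borel_mult[OF f g] by (simp add: fcalc_form)
qed

lemma fcalc_norm2: "bounded_borel f \<Longrightarrow> (norm (fcalc f u))\<^sup>2 = (\<integral>x. (f x)\<^sup>2 \<partial>\<mu> u)"
  unfolding power2_norm_eq_inner
  by (simp add: fcalc_inner form_self bounded_borel_mult power2_eq_square)

lemma fcalc_norm_le: "bounded_borel f \<Longrightarrow> (\<And>x. \<bar>f x\<bar> \<le> K) \<Longrightarrow> norm (fcalc f u) \<le> K * norm u"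
proof -
  assume f: "bounded_borel f" and K: "\<And>x. \<bar>f x\<bar> \<le> K"
  have K0: "0 \<le> K" using K by (meson abs_ge_zero order_trans)
  have "(norm (fcalc f u))\<^sup>2 \<le> \<bar>\<integral>x. (f x)\<^sup>2 \<partial>\<mu> u\<bar>" using fcalc_norm2[OF f] by simp
  also have "\<dots> \<le> K\<^sup>2 * (norm u)\<^sup>2"
  proof (rule integral_mu_bound[OF bounded_borel_power2[OF f]])
    show "\<bar>(f x)\<^sup>2\<bar> \<le> K\<^sup>2" for x using power_mono[of "\<bar>f x\<bar>" K 2] K by simp
  qed
  finally have "(norm (fcalc f u))\<^sup>2 \<le> (K * norm u)\<^sup>2" by (simp add: power_mult_distrib)
  then show ?thesis by (rule power2_le_imp_le) (use K0 in simp)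
qed

text \<open>The squared norm of the difference is the integral of \<open>(F n x - f x)^2\<close>, so
  bounded pointwise convergence of symbols gives strong convergence of operators.\<close>

lemma fcalc_limit:
  assumes F: "\<And>n::nat. F n \<in> borel_measurable borel" and K: "\<And>n x. \<bar>F n x\<bar> \<le> K"
    and lim: "\<And>x. (\<lambda>n. F n x) \<longlonglongrightarrow> f x"
  shows "(\<lambda>n. fcalc (F n) u) \<longlonglongrightarrow> fcalc f u"
proof -
  have f: "bounded_borel f"
  proof (rule bounded_borelI[where K=K])
    show "f \<in> borel_measurable borel" using F lim by (rule borel_measurable_LIMSEQ_metric)
    show "\<bar>f x\<bar> \<le> K" for x using LIMSEQ_le_const2[OF tendsto_rabs[OF lim[of x]]] K by blast
  qed
  have b: "bounded_borel (F n)" for n using F K by (rule bounded_borelI)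
  have d: "bounded_borel (\<lambda>x. F n x - f x)" for n using b f by (rule bounded_borel_diff)
  have fK: "\<bar>f x\<bar> \<le> K" for x using LIMSEQ_le_const2[OF tendsto_rabs[OF lim[of x]]] K by blast
  have "(\<lambda>n. \<integral>x. (F n x - f x)\<^sup>2 \<partial>\<mu> u) \<longlonglongrightarrow> (\<integral>x. 0 \<partial>\<mu> u)"
  proof (rule signed_functional_limit[OF sf_mu, where K="(2*K)\<^sup>2"])
    show "(\<lambda>x. (F n x - f x)\<^sup>2) \<in> borel_measurable borel" for n using d by (auto simp: bounded_borel_measurable)
    show "\<bar>(F n x - f x)\<^sup>2\<bar> \<le> (2*K)\<^sup>2" for n :: nat and x
    proof -
      have "\<bar>F n x - f x\<bar> \<le> \<bar>2*K\<bar>" using K[of n x] fK[of x] by linarith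
      then show ?thesis by (simp only: abs_power2 abs_le_square_iff)
    qed
    show "(\<lambda>n. (F n x - f x)\<^sup>2) \<longlonglongrightarrow> (0::real)" for x :: real
      using tendsto_power[OF LIM_zero[OF lim[of x]], of 2] by simp
  qed
  then have "(\<lambda>n. (norm (fcalc (F n) u - fcalc f u))\<^sup>2) \<longlonglongrightarrow> 0"
    by (simp add: fcalc_diff[OF b f, symmetric] fcalc_norm2[OF d])
  then have "(\<lambda>n. sqrt ((norm (fcalc (F n) u - fcalc f u))\<^sup>2)) \<longlonglongrightarrow> sqrt 0" by (rule tendsto_real_sqrt)
  then show ?thesis by (simp add: tendsto_norm_zero_iff LIM_zero_iff)
qed

end

section \<open>Unbounded functions of a resolution of the identity\<close>

text \<open>Powers and Gevrey exponentials are unbounded, but on each spectral window [-n, n] they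
  give bounded operators. All later work happens on windows and then lets n grow.\<close>

definition locally_bounded_borel :: "(real \<Rightarrow> real) \<Rightarrow> bool" where
  "locally_bounded_borel f \<longleftrightarrow> f \<in> borel_measurable borel \<and>
     (\<forall>n. bounded_borel (\<lambda>x. f x * indicator {- real n..real n} x))"

lemma locally_bounded_borelD:
  assumes "locally_bounded_borel f"
  shows "f \<in> borel_measurable borel" "bounded_borel (\<lambda>x. f x * indicator {- real n..real n} x)"
  using assms by (auto simp: locally_bounded_borel_def)

lemma bounded_imp_locally_bounded: "bounded_borel f \<Longrightarrow> locally_bounded_borel f"
  by (simp add: locally_bounded_borel_def bounded_borel_measurable)

lemma locally_bounded_mult:
  assumes "locally_bounded_borel f" "locally_bounded_borel g"
  shows "locally_bounded_borel (\<lambda>x. f x * g x)"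
proof -
  have "(\<lambda>x. f x * g x * indicator {- real n..real n} x) =
    (\<lambda>x. (f x * indicator {- real n..real n} x) * (g x * indicator {- real n..real n} x))" for n
    by (auto simp: indicator_def)
  moreover have "bounded_borel (\<lambda>x. (f x * indicator {- real n..real n} x) * (g x * indicator {- real n..real n} x))" for n
    by (intro bounded_borel_mult locally_bounded_borelD assms)
  ultimately show ?thesis using assms by (auto simp: locally_bounded_borel_def simp del: bounded_borel_mult)
qed

lemma locally_bounded_add:
  assumes "locally_bounded_borel f" "locally_bounded_borel g"
  shows "locally_bounded_borel (\<lambda>x. f x + g x)"
proof -
  have "bounded_borel (\<lambda>x. f x * indicator {- real n..real n} x + g x * indicator {- real n..real n} x)" for n
    by (intro bounded_borel_add locally_bounded_borelD assms)
  then show ?thesis using assms unfolding locally_bounded_borel_def distrib_right by auto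
qed

lemma locally_bounded_id: "locally_bounded_borel (\<lambda>x. x)"
proof -
  have "bounded_borel (\<lambda>x. x * indicator {- real n..real n} x)" for n
    by (rule bounded_borelI[where K="real n"]) (auto simp: indicator_def)
  then show ?thesis by (simp add: locally_bounded_borel_def)
qed

lemma indicator_power2: "(indicator A x :: real)\<^sup>2 = indicator A x"
  by (simp add: indicator_def)

lemma indicator_interval_tendsto: "(\<lambda>n. indicator {- real n..real n} x :: real) \<longlonglongrightarrow> 1"
proof (rule tendsto_eventually)
  obtain N :: nat where "\<bar>x\<bar> \<le> real N" using real_arch_simple by blast
  then show "\<forall>\<^sub>F n in sequentially. indicator {- real n..real n} x = (1::real)"
    unfolding eventually_sequentially by (intro exI[of _ N]) (auto simp: indicator_def)
qed

section \<open>Spectral windows and unbounded symbols\<close>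

context resolution begin

definition cut :: "nat \<Rightarrow> 'a \<Rightarrow> 'a" where
  "cut n = fcalc (indicator {- real n..real n})"

definition trunc :: "(real \<Rightarrow> real) \<Rightarrow> nat \<Rightarrow> 'a \<Rightarrow> 'a" where
  "trunc f n = fcalc (\<lambda>x. f x * indicator {- real n..real n} x)"

lemma cut_tendsto: "(\<lambda>n. cut n u) \<longlonglongrightarrow> u"
proof -
  have "(\<lambda>n. cut n u) \<longlonglongrightarrow> fcalc (\<lambda>_. 1) u"
    unfolding cut_def by (rule fcalc_limit[where K=1]) (auto simp: indicator_interval_tendsto indicator_le_1)
  then show ?thesis by (simp add: fcalc_one)
qed

lemma norm_cut_le: "norm (cut n u) \<le> norm u"
  using fcalc_norm_le[of "indicator {- real n..real n}" 1 u] by (simp add: cut_def indicator_def)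

lemma trunc_linear:
  assumes "locally_bounded_borel f"
  shows "trunc f n (u + v) = trunc f n u + trunc f n v" "trunc f n (u - v) = trunc f n u - trunc f n v"
    "trunc f n (c *\<^sub>R u) = c *\<^sub>R trunc f n u" "trunc f n 0 = 0"
  using fcalc_linear[OF locally_bounded_borelD(2)[OF assms]] by (auto simp: trunc_def)

lemma trunc_bl: "locally_bounded_borel f \<Longrightarrow> bounded_linear (trunc f n)"
  unfolding trunc_def by (rule fcalc_bl) (rule locally_bounded_borelD(2))

lemma cut_bl: "bounded_linear (cut n)"
  unfolding cut_def by (rule fcalc_bl) simp

lemma trunc_trunc:
  assumes "locally_bounded_borel f" "locally_bounded_borel g" "m \<le> n"
  shows "trunc f n (trunc g m u) = trunc (\<lambda>x. f x * g x) m u" "trunc f m (trunc g n u) = trunc (\<lambda>x. f x * g x) m u"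
proof -
  have 1: "(\<lambda>x. (f x * indicator {- real n..real n} x) * (g x * indicator {- real m..real m} x)) =
     (\<lambda>x. f x * g x * indicator {- real m..real m} x)"
    and 2: "(\<lambda>x. (f x * indicator {- real m..real m} x) * (g x * indicator {- real n..real n} x)) =
     (\<lambda>x. f x * g x * indicator {- real m..real m} x)"
    using assms(3) by (auto simp: indicator_def)
  show "trunc f n (trunc g m u) = trunc (\<lambda>x. f x * g x) m u"
    unfolding trunc_def by (simp only: fcalc_mult[OF locally_bounded_borelD(2)[OF assms(1)] locally_bounded_borelD(2)[OF assms(2)]] 1)
  show "trunc f m (trunc g n u) = trunc (\<lambda>x. f x * g x) m u"
    unfolding trunc_def by (simp only: fcalc_mult[OF locally_bounded_borelD(2)[OF assms(1)] locally_bounded_borelD(2)[OF assms(2)]] 2)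
qed

lemma cut_eq_trunc: "cut n = trunc (\<lambda>_. 1) n"
  by (simp add: cut_def trunc_def)

lemma locally_bounded_one [simp]: "locally_bounded_borel (\<lambda>_. c)"
  by (simp add: bounded_imp_locally_bounded)

lemma cut_trunc:
  assumes "locally_bounded_borel f" "m \<le> n"
  shows "cut n (trunc f m u) = trunc f m u" "cut m (trunc f n u) = trunc f m u"
    "trunc f n (cut m u) = trunc f m u" "trunc f m (cut n u) = trunc f m u"
  using trunc_trunc[OF locally_bounded_one[of 1] assms, of u] trunc_trunc[OF assms(1) locally_bounded_one[of 1] assms(2), of u]
  unfolding cut_eq_trunc by (simp_all only: mult_1_left mult_1_right)

lemma norm_trunc2: "locally_bounded_borel f \<Longrightarrow>
    (norm (trunc f n u))\<^sup>2 = (\<integral>x. (f x)\<^sup>2 * indicator {- real n..real n} x \<partial>\<mu> u)"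
  unfolding trunc_def
  by (simp only: fcalc_norm2 locally_bounded_borelD power_mult_distrib indicator_power2)

text \<open>The increment lives on the part of the spectrum between the two windows, which is
  orthogonal to the smaller window. Norms therefore grow with n, and a bound on them already makes
  the truncations Cauchy.\<close>

lemma trunc_orthogonal:
  assumes "locally_bounded_borel f" "m \<le> n"
  shows "(norm (trunc f n u - trunc f m u))\<^sup>2 = (norm (trunc f n u))\<^sup>2 - (norm (trunc f m u))\<^sup>2"
proof -
  have "inner (trunc f n u) (trunc f m u) = inner (trunc f n u) (cut m (trunc f m u))"
    using cut_trunc[OF assms(1) order_refl] by simp
  also have "\<dots> = inner (cut m (trunc f n u)) (trunc f m u)" by (simp add: cut_def fcalc_sym)
  also have "\<dots> = (norm (trunc f m u))\<^sup>2" using cut_trunc[OF assms] by (simp add: power2_norm_eq_inner)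
  finally show ?thesis by (simp add: power2_norm_eq_inner inner_diff_left inner_diff_right inner_commute)
qed

lemma norm_trunc_mono:
  assumes "locally_bounded_borel f" "m \<le> n" shows "norm (trunc f m u) \<le> norm (trunc f n u)"
proof (rule power2_le_imp_le)
  show "(norm (trunc f m u))\<^sup>2 \<le> (norm (trunc f n u))\<^sup>2"
    using trunc_orthogonal[OF assms, of u] zero_le_power2[of "norm (trunc f n u - trunc f m u)"] by linarith
qed simp

lemma nn_integral_trunc:
  assumes f: "locally_bounded_borel f"
  shows "(\<integral>\<^sup>+x. ennreal ((f x)\<^sup>2) \<partial>\<mu> u) = (SUP n. ennreal ((norm (trunc f n u))\<^sup>2))"
proof -
  have fm [measurable]: "f \<in> borel_measurable borel" using f by (rule locally_bounded_borelD)
  have "(\<integral>\<^sup>+x. ennreal ((f x)\<^sup>2) \<partial>\<mu> u) =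
     (\<integral>\<^sup>+x. (SUP n. ennreal ((f x)\<^sup>2 * indicator {- real n..real n} x)) \<partial>\<mu> u)"
  proof (rule nn_integral_cong)
    fix x
    have "(\<lambda>n. ennreal ((f x)\<^sup>2 * indicator {- real n..real n} x)) \<longlonglongrightarrow> ennreal ((f x)\<^sup>2 * 1)"
      by (intro tendsto_ennrealI tendsto_intros indicator_interval_tendsto)
    moreover have "incseq (\<lambda>n. ennreal ((f x)\<^sup>2 * indicator {- real n..real n} x))"
      by (auto simp: incseq_def indicator_def)
    then have "(\<lambda>n. ennreal ((f x)\<^sup>2 * indicator {- real n..real n} x)) \<longlonglongrightarrow>
      (SUP n. ennreal ((f x)\<^sup>2 * indicator {- real n..real n} x))" by (rule LIMSEQ_SUP)
    ultimately show "ennreal ((f x)\<^sup>2) = (SUP n. ennreal ((f x)\<^sup>2 * indicator {- real n..real n} x))"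
      by (simp only: mult_1_right LIMSEQ_unique)
  qed
  also have "\<dots> = (SUP n. \<integral>\<^sup>+x. ennreal ((f x)\<^sup>2 * indicator {- real n..real n} x) \<partial>\<mu> u)"
    by (rule nn_integral_monotone_convergence_SUP) (auto simp: incseq_def le_fun_def indicator_def)
  also have "\<dots> = (SUP n. ennreal ((norm (trunc f n u))\<^sup>2))"
  proof (rule SUP_cong[OF refl])
    fix n
    have "bounded_borel (\<lambda>x. (f x * indicator {- real n..real n} x)\<^sup>2)"
      by (intro bounded_borel_power2 locally_bounded_borelD f)
    then have "bounded_borel (\<lambda>x. (f x)\<^sup>2 * indicator {- real n..real n} x)"
      by (simp only: power_mult_distrib indicator_power2)
    then show "(\<integral>\<^sup>+x. ennreal ((f x)\<^sup>2 * indicator {- real n..real n} x) \<partial>\<mu> u) = ennreal ((norm (trunc f n u))\<^sup>2)"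
      using f by (simp add: norm_trunc2 nn_integral_eq_integral)
  qed
  finally show ?thesis .
qed

text \<open>Monotone convergence over the windows replaces finiteness of the spectral integral by a
  uniform bound on truncations; this is the test for membership used from here on.\<close>

lemma spec_dom_iff:
  assumes f: "locally_bounded_borel f"
  shows "u \<in> spec_dom E f \<longleftrightarrow> (\<exists>K. \<forall>n. norm (trunc f n u) \<le> K)"
proof
  assume "u \<in> spec_dom E f"
  then have fin: "(SUP n. ennreal ((norm (trunc f n u))\<^sup>2)) < \<infinity>" using nn_integral_trunc[OF f] by (simp add: spec_dom_def)
  define S where "S = enn2real (SUP n. ennreal ((norm (trunc f n u))\<^sup>2))"
  have "(norm (trunc f n u))\<^sup>2 \<le> S" for n
  proof -
    have "ennreal ((norm (trunc f n u))\<^sup>2) \<le> (SUP n. ennreal ((norm (trunc f n u))\<^sup>2))" by (rule SUP_upper) simp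
    also have "\<dots> = ennreal S" using fin unfolding S_def by (simp add: less_top)
    finally show ?thesis by (simp add: S_def)
  qed
  then have "norm (trunc f n u) \<le> sqrt S" for n by (simp add: real_le_rsqrt)
  then show "\<exists>K. \<forall>n. norm (trunc f n u) \<le> K" by blast
next
  assume "\<exists>K. \<forall>n. norm (trunc f n u) \<le> K"
  then obtain K where K: "\<And>n. norm (trunc f n u) \<le> K" by blast
  have "(SUP n. ennreal ((norm (trunc f n u))\<^sup>2)) \<le> ennreal (K\<^sup>2)"
    using K by (intro SUP_least ennreal_leI power_mono) auto
  also have "\<dots> < \<infinity>" by simp
  finally show "u \<in> spec_dom E f" using nn_integral_trunc[OF f] by (simp add: spec_dom_def)
qed

lemma trunc_convergent:
  assumes f: "locally_bounded_borel f" and u: "u \<in> spec_dom E f"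
  shows "convergent (\<lambda>n. trunc f n u)"
proof -
  obtain K where K: "\<And>n. norm (trunc f n u) \<le> K" using u spec_dom_iff[OF f] by blast
  have "Bseq (\<lambda>n. (norm (trunc f n u))\<^sup>2)"
    using K by (intro BseqI'[where K="K\<^sup>2"]) (auto intro: power_mono)
  moreover have "incseq (\<lambda>n. (norm (trunc f n u))\<^sup>2)"
    by (auto simp: incseq_def intro!: power_mono norm_trunc_mono[OF f])
  ultimately have "convergent (\<lambda>n. (norm (trunc f n u))\<^sup>2)" by (simp add: Bseq_mono_convergent incseq_def)
  then have C: "Cauchy (\<lambda>n. (norm (trunc f n u))\<^sup>2)" by (rule convergent_Cauchy)
  have "Cauchy (\<lambda>n. trunc f n u)"
  proof (rule CauchyI)
    fix e :: real assume e: "0 < e"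
    obtain M where M: "\<And>m n. m \<ge> M \<Longrightarrow> n \<ge> M \<Longrightarrow> \<bar>(norm (trunc f m u))\<^sup>2 - (norm (trunc f n u))\<^sup>2\<bar> < e\<^sup>2"
      using CauchyD[OF C, of "e\<^sup>2"] e by (auto simp: real_norm_def)
    have *: "norm (trunc f m u - trunc f n u) < e" if "m \<ge> n" "n \<ge> M" for m n
    proof (rule power_less_imp_less_base)
      show "(norm (trunc f m u - trunc f n u))\<^sup>2 < e\<^sup>2"
        using M[of m n] that trunc_orthogonal[OF f, of n m u] by linarith
    qed (use e in simp)
    show "\<exists>M. \<forall>m\<ge>M. \<forall>n\<ge>M. norm (trunc f m u - trunc f n u) < e"
      using * by (intro exI[of _ M] allI impI) (metis norm_minus_commute nle_le)
  qed
  then show ?thesis by (rule Cauchy_convergent)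
qed

lemma spec_dom_subspace:
  assumes f: "locally_bounded_borel f"
  shows "subspace (spec_dom E f)"
proof (rule subspaceI)
  show "0 \<in> spec_dom E f" by (auto simp: spec_dom_iff[OF f] trunc_linear[OF f] intro!: exI[of _ 0])
  fix u v :: 'a and c :: real
  assume u: "u \<in> spec_dom E f"
  then obtain K where K: "\<And>n. norm (trunc f n u) \<le> K" using spec_dom_iff[OF f] by blast
  show "c *\<^sub>R u \<in> spec_dom E f"
    using K by (auto simp: spec_dom_iff[OF f] trunc_linear[OF f] intro!: exI[of _ "\<bar>c\<bar> * K"] mult_left_mono)
  assume v: "v \<in> spec_dom E f"
  then obtain L where L: "\<And>n. norm (trunc f n v) \<le> L" using spec_dom_iff[OF f] by blast
  show "u + v \<in> spec_dom E f"
    unfolding spec_dom_iff[OF f] trunc_linear[OF f]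
    by (rule exI[of _ "K + L"]) (metis K L add_mono norm_triangle_le)
qed

lemma cut_in_spec_dom:
  assumes f: "locally_bounded_borel f" shows "cut n u \<in> spec_dom E f"
proof -
  have "norm (trunc f m (cut n u)) \<le> norm (trunc f n u)" for m
  proof (cases "m \<le> n")
    case True
    then show ?thesis using cut_trunc(4)[OF f True] norm_trunc_mono[OF f True] by simp
  next
    case False
    then show ?thesis using cut_trunc(3)[OF f, of n m u] by simp
  qed
  then show ?thesis using spec_dom_iff[OF f] by blast
qed

lemma spec_dom_integrable:
  assumes f: "locally_bounded_borel f" and u: "u \<in> spec_dom E f"
  shows "integrable (\<mu> u) (\<lambda>x. (f x)\<^sup>2)" "integrable (\<mu> u) f"
proof -
  have fm [measurable]: "f \<in> borel_measurable borel" using f by (rule locally_bounded_borelD)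
  show 1: "integrable (\<mu> u) (\<lambda>x. (f x)\<^sup>2)"
    using u by (intro integrableI_nonneg) (auto simp: spec_dom_def)
  have "\<bar>t\<bar> \<le> 1 + t\<^sup>2" for t :: real
  proof -
    have "0 \<le> (\<bar>t\<bar> - 1)\<^sup>2 + \<bar>t\<bar>" by simp
    also have "\<dots> = 1 + t\<^sup>2 - \<bar>t\<bar>" by (simp add: power2_eq_square algebra_simps)
    finally show ?thesis by simp
  qed
  then show "integrable (\<mu> u) f"
    by (intro Bochner_Integration.integrable_bound[OF Bochner_Integration.integrable_add[OF integrable_mu[of "\<lambda>_. 1"] 1]]) auto
qed

text \<open>The weak description of \<open>spec_op\<close> determines at most one vector because the
  vectors \<open>cut n v\<close> belong to the domain and approximate every \<open>v\<close>; the
  limit of the truncations satisfies it by dominated convergence.\<close>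

lemma spec_op_tendsto:
  assumes f: "locally_bounded_borel f" and u: "u \<in> spec_dom E f"
  shows "(\<lambda>n. trunc f n u) \<longlonglongrightarrow> spec_op E f u"
proof -
  obtain w where w: "(\<lambda>n. trunc f n u) \<longlonglongrightarrow> w" using trunc_convergent[OF f u] convergent_def by blast
  have fm [measurable]: "f \<in> borel_measurable borel" using f by (rule locally_bounded_borelD)
  have int: "(\<lambda>n. \<integral>x. f x * indicator {- real n..real n} x \<partial>\<mu> z) \<longlonglongrightarrow> (\<integral>x. f x \<partial>\<mu> z)"
    if z: "z \<in> spec_dom E f" for z
  proof (rule integral_dominated_convergence[where w="\<lambda>x. \<bar>f x\<bar>"])
    show "integrable (\<mu> z) (\<lambda>x. \<bar>f x\<bar>)" using spec_dom_integrable[OF f z] by simp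
    show "AE x in \<mu> z. (\<lambda>n. f x * indicator {- real n..real n} x) \<longlonglongrightarrow> f x"
      using tendsto_mult_left[OF indicator_interval_tendsto] by (intro AE_I2) fastforce
  qed (auto simp: indicator_def)
  have weak: "inner w v = ((\<integral>x. f x \<partial>\<mu> (u + v)) - (\<integral>x. f x \<partial>\<mu> (u - v))) / 4"
    if v: "v \<in> spec_dom E f" for v
  proof (rule LIMSEQ_unique)
    show "(\<lambda>n. inner (trunc f n u) v) \<longlonglongrightarrow> inner w v" by (intro tendsto_inner w tendsto_const)
    have "(\<lambda>n. spec_form (\<lambda>x. f x * indicator {- real n..real n} x) u v) \<longlonglongrightarrow>
      ((\<integral>x. f x \<partial>\<mu> (u + v)) - (\<integral>x. f x \<partial>\<mu> (u - v))) / 4"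
      unfolding spec_form_def using subspace_add[OF spec_dom_subspace[OF f] u v] subspace_diff[OF spec_dom_subspace[OF f] u v]
      by (intro tendsto_intros int) auto
    then show "(\<lambda>n. inner (trunc f n u) v) \<longlonglongrightarrow> ((\<integral>x. f x \<partial>\<mu> (u + v)) - (\<integral>x. f x \<partial>\<mu> (u - v))) / 4"
      by (simp add: trunc_def fcalc_form locally_bounded_borelD[OF f])
  qed
  have "spec_op E f u = w" unfolding spec_op_def
  proof (rule the_equality)
    show "\<forall>v\<in>spec_dom E f. inner w v = ((\<integral>x. f x \<partial>\<mu> (u + v)) - (\<integral>x. f x \<partial>\<mu> (u - v))) / 4"
      using weak by blast
    fix w' assume w': "\<forall>v\<in>spec_dom E f. inner w' v = ((\<integral>x. f x \<partial>\<mu> (u + v)) - (\<integral>x. f x \<partial>\<mu> (u - v))) / 4"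
    show "w' = w"
    proof (rule inner_eqI)
      fix v
      have "inner w' (cut n v) = inner w (cut n v)" for n
        using weak w' cut_in_spec_dom[OF f] by metis
      then show "inner w' v = inner w v"
        using LIMSEQ_unique[OF tendsto_inner[OF tendsto_const[of w'] cut_tendsto[of v]]]
          tendsto_inner[OF tendsto_const[of w] cut_tendsto[of v]] by simp
    qed
  qed
  then show ?thesis using w by simp
qed

lemma cut_spec_op:
  assumes f: "locally_bounded_borel f" and u: "u \<in> spec_dom E f"
  shows "cut n (spec_op E f u) = trunc f n u"
proof (rule LIMSEQ_unique)
  show "(\<lambda>m. cut n (trunc f m u)) \<longlonglongrightarrow> cut n (spec_op E f u)"
    using spec_op_tendsto[OF f u] bounded_linear.tendsto[OF cut_bl] by blast
  show "(\<lambda>m. cut n (trunc f m u)) \<longlonglongrightarrow> trunc f n u"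
    using cut_trunc(2)[OF f] by (intro tendsto_eventually) (auto simp: eventually_sequentially)
qed

text \<open>Both the domain and the value can be read off window by window, without any
  integral.\<close>

lemma spec_opI:
  assumes f: "locally_bounded_borel f" and eq: "\<And>n. cut n w = trunc f n u"
  shows "u \<in> spec_dom E f" "spec_op E f u = w"
proof -
  have "norm (trunc f n u) \<le> norm w" for n using norm_cut_le[of n w] by (simp add: eq)
  then show u: "u \<in> spec_dom E f" using spec_dom_iff[OF f] by blast
  show "spec_op E f u = w"
    using spec_op_tendsto[OF f u] cut_tendsto[of w] unfolding eq by (rule LIMSEQ_unique)
qed

lemma cut_inject: "(\<And>n. cut n u = cut n v) \<Longrightarrow> u = v"
  using cut_tendsto[of u] cut_tendsto[of v] LIMSEQ_unique by simp

lemma spec_op_linear: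
  assumes f: "locally_bounded_borel f" and u: "u \<in> spec_dom E f" and v: "v \<in> spec_dom E f"
  shows "spec_op E f (u + v) = spec_op E f u + spec_op E f v"
    "spec_op E f (u - v) = spec_op E f u - spec_op E f v"
    "spec_op E f (c *\<^sub>R u) = c *\<^sub>R spec_op E f u"
proof -
  have cutl: "cut n (x + y) = cut n x + cut n y" "cut n (x - y) = cut n x - cut n y" "cut n (c *\<^sub>R x) = c *\<^sub>R cut n x" for n x y
    by (simp_all add: cut_def fcalc_linear)
  show "spec_op E f (u + v) = spec_op E f u + spec_op E f v"
    "spec_op E f (u - v) = spec_op E f u - spec_op E f v"
    "spec_op E f (c *\<^sub>R u) = c *\<^sub>R spec_op E f u"
    by (rule spec_opI(2)[OF f]; simp add: cutl trunc_linear[OF f] cut_spec_op[OF f] u v)+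
qed

end

section \<open>Square roots and spectral projections of bounded operators\<close>

definition symmetric_op :: "('a::real_inner \<Rightarrow> 'a) \<Rightarrow> bool" where
  "symmetric_op T \<longleftrightarrow> (\<forall>u v. inner (T u) v = inner u (T v))"

lemma symmetric_opD: "symmetric_op T \<Longrightarrow> inner (T u) v = inner u (T v)"
  by (simp add: symmetric_op_def)

lemma bounded_linear_simps:
  assumes "bounded_linear T"
  shows "T (u + v) = T u + T v" "T (u - v) = T u - T v" "T (c *\<^sub>R u) = c *\<^sub>R T u" "T 0 = 0"
  using assms by (simp_all add: linear_simps bounded_linear.linear linear_add linear_diff linear_scale linear_0)

text \<open>This is the equality case of Cauchy-Schwarz for the semidefinite form <Z u, v>: moving
  from \<open>b\<close> in the direction -Z b would make the form negative unless
  \<open>Z b = 0\<close>.\<close>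

lemma positive_form_zero:
  assumes Z: "bounded_linear Z" "symmetric_op Z" and pos: "\<And>u. 0 \<le> inner (Z u) u" and b: "inner (Z b) b = 0"
  shows "Z b = 0"
proof (rule ccontr)
  assume "Z b \<noteq> 0"
  define c where "c = inner (Z b) (Z b)"
  define d where "d = inner (Z (Z b)) (Z b)"
  have c: "c > 0" and d: "d \<ge> 0" using \<open>Z b \<noteq> 0\<close> pos by (auto simp: c_def d_def)
  have ineq: "0 \<le> - 2 * t * c + t\<^sup>2 * d" for t
  proof -
    have "0 \<le> inner (Z (b - t *\<^sub>R Z b)) (b - t *\<^sub>R Z b)" by (rule pos)
    also have "\<dots> = - 2 * t * c + t\<^sup>2 * d"
      using b symmetric_opD[OF Z(2), of "Z b" b]
      by (simp add: bounded_linear_simps[OF Z(1)] inner_diff_left inner_diff_right c_def d_def power2_eq_square algebra_simps)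
    finally show ?thesis .
  qed
  define q where "q = d + 1"
  have q: "q > 0" using d by (simp add: q_def)
  have "0 \<le> - 2 * (c / q) * c + (c / q)\<^sup>2 * d" by (rule ineq)
  also have "\<dots> \<le> - 2 * (c / q) * c + (c / q)\<^sup>2 * q" by (intro add_left_mono mult_left_mono) (auto simp: q_def)
  also have "\<dots> = - c\<^sup>2 / q" using q by (simp add: power2_eq_square field_simps)
  finally show False using c q by (simp add: divide_simps)
qed

context
  fixes X :: "'a::{real_inner,complete_space} \<Rightarrow> 'a"
begin

text \<open>A fixed point Y = (X + Y^2)/2 satisfies (1 - Y)^2 = 1 - X. The iterates are polynomials
  in \<open>X\<close> with nonnegative coefficients, so norms can be compared with a scalar
  recursion.\<close>

fun sqrt_iter :: "nat \<Rightarrow> 'a \<Rightarrow> 'a" where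
  "sqrt_iter 0 u = 0"
| "sqrt_iter (Suc n) u = (1/2) *\<^sub>R (X u + sqrt_iter n (sqrt_iter n u))"

end

text \<open>The same recursion for the scalar \<open>X = 1\<close>; it majorizes the operator iteration.\<close>

fun sqrt_bound :: "nat \<Rightarrow> real" where
  "sqrt_bound 0 = 0"
| "sqrt_bound (Suc n) = (1 + (sqrt_bound n)\<^sup>2) / 2"

lemma sqrt_bound_range: "0 \<le> sqrt_bound n \<and> sqrt_bound n \<le> 1"
  by (induction n) (auto simp: power_le_one)

lemma sqrt_bound_mono: "sqrt_bound n \<le> sqrt_bound (Suc n)"
proof -
  have "0 \<le> (1 - sqrt_bound n)\<^sup>2" by simp
  then show ?thesis by (simp add: power2_eq_square algebra_simps)
qed

text \<open>The increments of the iteration are bounded by the increments of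
  \<open>sqrt_bound\<close>, which is monotone and at most 1, so convergence holds even though the
  map is no strict contraction. Whatever commutes with \<open>X\<close> commutes with every iterate,
  hence with the limit.\<close>

lemma operator_sqrt:
  fixes X :: "'a::{real_inner,complete_space} \<Rightarrow> 'a"
  assumes X: "bounded_linear X" "symmetric_op X" and nX: "\<And>u. norm (X u) \<le> norm u"
  obtains Z where "bounded_linear Z" "symmetric_op Z" "\<And>u. 0 \<le> inner (Z u) u" "\<And>u. Z (Z u) = u - X u"
    "\<forall>C. bounded_linear C \<longrightarrow> (\<forall>u. C (X u) = X (C u)) \<longrightarrow> (\<forall>u. C (Z u) = Z (C u))"
proof -
  let ?Y = "sqrt_iter X"
  have bl: "bounded_linear (?Y n)" for n
  proof (induction n)
    case 0
    then show ?case by (simp add: bounded_linear_zero)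
  next
    case (Suc n)
    have "bounded_linear (\<lambda>u. (1/2) *\<^sub>R (X u + ?Y n (?Y n u)))"
      by (intro bounded_linear_const_scaleR bounded_linear_add X bounded_linear_compose[OF Suc Suc])
    then show ?case by simp
  qed
  note lin = bounded_linear_simps[OF bl]
  have comm: "C (?Y n u) = ?Y n (C u)" if "bounded_linear C" "\<And>u. C (X u) = X (C u)" for C n u
    by (induction n arbitrary: u) (auto simp: that(2) bounded_linear_simps[OF that(1)])
  have XY: "?Y m (X u) = X (?Y m u)" for m u using comm[OF X(1)] by simp
  have YY: "?Y m (?Y n u) = ?Y n (?Y m u)" for m n u by (rule comm[OF bl XY])
  have nY: "norm (?Y n u) \<le> sqrt_bound n * norm u" for n u
  proof (induction n arbitrary: u)
    case (Suc n)
    have "norm (?Y n (?Y n u)) \<le> sqrt_bound n * (sqrt_bound n * norm u)"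
      by (rule order_trans[OF Suc mult_left_mono[OF Suc]]) (simp add: sqrt_bound_range)
    then have "norm (X u + ?Y n (?Y n u)) \<le> norm u + sqrt_bound n * (sqrt_bound n * norm u)"
      using nX[of u] norm_triangle_ineq[of "X u" "?Y n (?Y n u)"] by linarith
    then show ?case unfolding sqrt_iter.simps sqrt_bound.simps norm_scaleR
      by (simp add: power2_eq_square algebra_simps)
  qed simp
  have step: "norm (?Y (Suc n) u - ?Y n u) \<le> (sqrt_bound (Suc n) - sqrt_bound n) * norm u" for n u
  proof (induction n arbitrary: u)
    case 0
    then show ?case using nX by simp
  next
    case (Suc n)
    let ?a = "?Y (Suc n)" and ?b = "?Y n" and ?s = "sqrt_bound (Suc n)" and ?t = "sqrt_bound n"
    \<comment> \<open>The identity a^2 - b^2 = a(a - b) + b(a - b) holds here because different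
      iterates commute.\<close>
    have *: "?a (?a u) - ?b (?b u) = ?a (?a u - ?b u) + ?b (?a u - ?b u)"
      using YY[of "Suc n" n u] by (simp only: lin) simp
    have "norm (?a (?a u - ?b u) + ?b (?a u - ?b u)) \<le> ?s * norm (?a u - ?b u) + ?t * norm (?a u - ?b u)"
      by (rule order_trans[OF norm_triangle_ineq add_mono[OF nY nY]])
    also have "\<dots> = (?s + ?t) * norm (?a u - ?b u)" by (simp only: distrib_right)
    also have "\<dots> \<le> (?s + ?t) * ((?s - ?t) * norm u)"
      by (rule mult_left_mono[OF Suc]) (use sqrt_bound_range in \<open>simp only: add_nonneg_nonneg\<close>)
    also have "\<dots> = (?s\<^sup>2 - ?t\<^sup>2) * norm u" by (simp only: power2_eq_square algebra_simps)
    finally have le: "norm (?a (?a u) - ?b (?b u)) \<le> (?s\<^sup>2 - ?t\<^sup>2) * norm u" by (simp only: *)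
    have e1: "?Y (Suc (Suc n)) u - ?a u = (1/2) *\<^sub>R (?a (?a u) - ?b (?b u))"
      unfolding sqrt_iter.simps(2)[of X "Suc n"] sqrt_iter.simps(2)[of X n u] by (simp add: scaleR_diff_right scaleR_add_right)
    have e2: "sqrt_bound (Suc (Suc n)) - ?s = (?s\<^sup>2 - ?t\<^sup>2) / 2"
      unfolding sqrt_bound.simps(2)[of "Suc n"] sqrt_bound.simps(2)[of n] by (simp add: field_simps)
    show ?case unfolding e1 e2 norm_scaleR using le by (simp del: sqrt_iter.simps sqrt_bound.simps)
  qed
  have tele: "norm (?Y (n + k) u - ?Y n u) \<le> (sqrt_bound (n + k) - sqrt_bound n) * norm u" for n k u
  proof (induction k)
    case (Suc k)
    have "norm (?Y (n + Suc k) u - ?Y n u) \<le> norm (?Y (Suc (n + k)) u - ?Y (n + k) u) + norm (?Y (n + k) u - ?Y n u)"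
      using norm_triangle_ineq[of "?Y (Suc (n + k)) u - ?Y (n + k) u" "?Y (n + k) u - ?Y n u"] by (simp del: sqrt_iter.simps)
    also have "\<dots> \<le> (sqrt_bound (Suc (n + k)) - sqrt_bound (n + k)) * norm u + (sqrt_bound (n + k) - sqrt_bound n) * norm u"
      by (intro add_mono step Suc)
    finally show ?case by (simp only: left_diff_distrib add_Suc_right)
  qed simp
  have "incseq sqrt_bound" using sqrt_bound_mono by (rule incseq_SucI)
  then have "convergent sqrt_bound" using sqrt_bound_range
    by (intro Bseq_mono_convergent) (auto intro!: BseqI'[where K=1] simp: incseq_def)
  then have Cq: "Cauchy sqrt_bound" by (rule convergent_Cauchy)
  have "Cauchy (\<lambda>n. ?Y n u)" for u
  proof (rule CauchyI)
    fix e :: real assume e: "0 < e"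
    have e': "0 < e / (norm u + 1)" using e by (simp add: add_nonneg_pos)
    obtain M where M: "\<And>m n. m \<ge> M \<Longrightarrow> n \<ge> M \<Longrightarrow> \<bar>sqrt_bound m - sqrt_bound n\<bar> < e / (norm u + 1)"
      using CauchyD[OF Cq e'] by (auto simp: real_norm_def)
    have *: "norm (?Y (n + k) u - ?Y n u) < e" if "n \<ge> M" for n k
    proof -
      have "norm (?Y (n + k) u - ?Y n u) \<le> (sqrt_bound (n + k) - sqrt_bound n) * norm u" by (rule tele)
      also have "\<dots> \<le> e / (norm u + 1) * norm u"
        using M[of "n + k" n] that by (intro mult_right_mono) auto
      also have "\<dots> < e" using e by (simp add: divide_less_eq add_nonneg_pos)
      finally show ?thesis .
    qed
    have "norm (?Y m u - ?Y n u) < e" if "m \<ge> n" "n \<ge> M" for m n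
      using *[of n "m - n"] that by simp
    then show "\<exists>M. \<forall>m\<ge>M. \<forall>n\<ge>M. norm (?Y m u - ?Y n u) < e"
      by (intro exI[of _ M] allI impI) (metis norm_minus_commute nle_le)
  qed
  then have "\<forall>u. \<exists>y. (\<lambda>n. ?Y n u) \<longlonglongrightarrow> y" using Cauchy_convergent convergent_def by blast
  then obtain Y where Y: "\<And>u. (\<lambda>n. ?Y n u) \<longlonglongrightarrow> Y u" by metis
  have nY1: "norm (Y u) \<le> norm u" for u
  proof (rule LIMSEQ_le_const2[OF tendsto_norm[OF Y]])
    have "norm (?Y n u) \<le> norm u" for n
      using order_trans[OF nY mult_right_mono[of "sqrt_bound n" 1]] sqrt_bound_range by fastforce
    then show "\<exists>N. \<forall>n\<ge>N. norm (?Y n u) \<le> norm u" by blast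
  qed
  have Ybl: "bounded_linear Y"
  proof (rule bounded_linear_intro)
    show "Y (x + y) = Y x + Y y" for x y
      using LIMSEQ_unique[OF Y[of "x + y"]] tendsto_add[OF Y[of x] Y[of y]] by (simp add: lin)
    show "Y (r *\<^sub>R x) = r *\<^sub>R Y x" for r x
      using LIMSEQ_unique[OF Y[of "r *\<^sub>R x"]] tendsto_scaleR[OF tendsto_const Y[of x], of r] by (simp add: lin)
    show "norm (Y x) \<le> norm x * 1" for x using nY1 by simp
  qed
  have symn: "inner (?Y n u) v = inner u (?Y n v)" for n u v
    by (induction n arbitrary: u v) (auto simp: inner_add_left inner_add_right symmetric_opD[OF X(2)])
  have Ysym: "symmetric_op Y" unfolding symmetric_op_def
  proof (intro allI)
    fix u v
    show "inner (Y u) v = inner u (Y v)"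
      using LIMSEQ_unique[OF tendsto_inner[OF Y[of u] tendsto_const[of v]]]
        tendsto_inner[OF tendsto_const[of u] Y[of v]] by (simp add: symn)
  qed
  have YYlim: "(\<lambda>n. ?Y n (?Y n u)) \<longlonglongrightarrow> Y (Y u)" for u
  proof -
    have "(\<lambda>n. ?Y n (?Y n u - Y u)) \<longlonglongrightarrow> 0"
    proof (rule Lim_null_comparison)
      show "\<forall>\<^sub>F n in sequentially. norm (?Y n (?Y n u - Y u)) \<le> norm (?Y n u - Y u)"
        using order_trans[OF nY mult_right_mono[of _ 1]] sqrt_bound_range by (intro always_eventually allI) fastforce
      show "(\<lambda>n. norm (?Y n u - Y u)) \<longlonglongrightarrow> 0" using Y[of u] by (simp add: tendsto_norm_zero LIM_zero)
    qed
    then have "(\<lambda>n. ?Y n (?Y n u - Y u) + ?Y n (Y u)) \<longlonglongrightarrow> 0 + Y (Y u)" by (intro tendsto_add Y)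
    then show ?thesis by (simp add: lin)
  qed
  have fixp: "Y u = (1/2) *\<^sub>R (X u + Y (Y u))" for u
  proof (rule LIMSEQ_unique)
    show "(\<lambda>n. ?Y (Suc n) u) \<longlonglongrightarrow> Y u" using Y by (rule LIMSEQ_Suc)
    show "(\<lambda>n. ?Y (Suc n) u) \<longlonglongrightarrow> (1/2) *\<^sub>R (X u + Y (Y u))"
      unfolding sqrt_iter.simps by (intro tendsto_intros YYlim)
  qed
  show ?thesis
  proof (rule that[of "\<lambda>u. u - Y u"])
    show "bounded_linear (\<lambda>u. u - Y u)" by (intro bounded_linear_sub bounded_linear_ident Ybl)
    show "symmetric_op (\<lambda>u. u - Y u)"
      using Ysym by (auto simp: symmetric_op_def inner_diff_left inner_diff_right)
    show "0 \<le> inner (u - Y u) u" for u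
      using norm_cauchy_schwarz[of "Y u" u] mult_right_mono[OF nY1[of u], of "norm u"]
      by (simp add: inner_diff_left norm_eq_sqrt_inner)
    have "2 *\<^sub>R Y u = X u + Y (Y u)" for u using arg_cong[OF fixp[of u], of "(*\<^sub>R) 2"] by simp
    then show "(u - Y u) - Y (u - Y u) = u - X u" for u
      by (simp add: bounded_linear_simps[OF Ybl] scaleR_2 algebra_simps)
    have "C (u - Y u) = C u - Y (C u)" if C: "bounded_linear C" "\<And>u. C (X u) = X (C u)" for C :: "'a \<Rightarrow> 'a" and u
    proof -
    have "C (Y u) = Y (C u)" for u
      using LIMSEQ_unique[OF bounded_linear.tendsto[OF C(1) Y[of u]]] Y[of "C u"] by (simp add: comm[OF C])
      then show ?thesis by (simp add: bounded_linear_simps[OF C(1)])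
    qed
    then show "\<forall>C. bounded_linear C \<longrightarrow> (\<forall>u. C (X u) = X (C u)) \<longrightarrow> (\<forall>u. C (u - Y u) = C u - Y (C u))" by blast
  qed
qed

lemma projection_operator:
  fixes K :: "'a::{real_inner,complete_space} set"
  assumes K: "subspace K" "closed K"
  obtains P where "bounded_linear P" "symmetric_op P" "\<And>u. P u \<in> K" "\<And>u. u \<in> K \<Longrightarrow> P u = u"
proof -
  obtain P where P: "\<And>x. P x \<in> K" "\<And>x y. y \<in> K \<Longrightarrow> inner (x - P x) y = 0"
    using orthogonal_projection_exists[OF K] by metis
  have uniq: "P x = p" if "p \<in> K" "\<And>y. y \<in> K \<Longrightarrow> inner (x - p) y = 0" for x p
  proof -
    have k: "P x - p \<in> K" using K P that by (intro subspace_diff)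
    have "inner (P x - p) (P x - p) = inner (x - p) (P x - p) - inner (x - P x) (P x - p)"
      by (simp add: inner_diff_left)
    also have "\<dots> = 0" using that(2)[OF k] P(2)[OF k] by simp
    finally show ?thesis by simp
  qed
  have sym: "inner (P u) v = inner (P u) (P v)" for u v
    using P(2)[OF P(1), of v u] by (metis inner_commute inner_diff_left eq_iff_diff_eq_0)
  show ?thesis
  proof (rule that[of P])
    show "bounded_linear P"
    proof (rule bounded_linear_intro)
      show "P (x + y) = P x + P y" for x y
      proof (rule uniq)
        fix z assume "z \<in> K"
        then have "inner (x - P x) z + inner (y - P y) z = 0" using P by simp
        then show "inner (x + y - (P x + P y)) z = 0" by (simp add: inner_diff_left inner_add_left)
      qed (use K P in \<open>auto intro: subspace_add\<close>)
      show "P (r *\<^sub>R x) = r *\<^sub>R P x" for r x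
      proof (rule uniq)
        fix z assume "z \<in> K"
        then have "r * inner (x - P x) z = 0" using P by simp
        then show "inner (r *\<^sub>R x - r *\<^sub>R P x) z = 0" by (simp add: inner_diff_left right_diff_distrib)
      qed (use K P in \<open>auto intro: subspace_scale\<close>)
      show "norm (P x) \<le> norm x * 1" for x
      proof (cases "P x = 0")
        case False
        have "norm (P x) * norm (P x) = inner (P x) x" using sym[of x x] by (metis power2_norm_eq_inner power2_eq_square)
        also have "\<dots> \<le> norm (P x) * norm x" by (rule norm_cauchy_schwarz)
        finally show ?thesis using False by simp
      qed simp
    qed
    show "symmetric_op P" using sym unfolding symmetric_op_def by (metis inner_commute)
    show "P u \<in> K" for u by (rule P)
    show "P u = u" if "u \<in> K" for u using that by (intro uniq) auto
  qed
qed

text \<open>The projection onto the kernel of \<open>\<bar>S\<bar> + S\<close>, the spectral subspace of \<open>(-\<infinity>, 0]\<close>.\<close>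

lemma spectral_projection:
  fixes S :: "'a::{real_inner,complete_space} \<Rightarrow> 'a"
  assumes S: "bounded_linear S" "symmetric_op S" and nS: "\<And>u. norm (S u) \<le> norm u"
  obtains P where "bounded_linear P" "symmetric_op P" "\<And>u. P (P u) = P u"
    "\<And>u. inner (S (P u)) (P u) \<le> 0" "\<And>u. P u = 0 \<Longrightarrow> 0 \<le> inner (S u) u"
    "\<And>u. P u = 0 \<Longrightarrow> inner (S u) u \<le> 0 \<Longrightarrow> u = 0"
    "\<forall>C. bounded_linear C \<longrightarrow> symmetric_op C \<longrightarrow> (\<forall>u. C (S u) = S (C u)) \<longrightarrow> (\<forall>u. C (P u) = P (C u))"
proof -
  \<comment> \<open>With this \<open>X\<close> the square root \<open>Z\<close> satisfies Z^2 = S^2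
    and is nonnegative, so \<open>Z\<close> is the absolute value of \<open>S\<close>.\<close>
  define X where "X u = u - S (S u)" for u
  note Slin = bounded_linear_simps[OF S(1)]
  have Xbl: "bounded_linear X" unfolding X_def
    by (intro bounded_linear_sub bounded_linear_ident bounded_linear_compose[OF S(1) S(1)])
  have Xsym: "symmetric_op X" using S(2) by (simp add: symmetric_op_def X_def inner_diff_left inner_diff_right)
  have nX: "norm (X u) \<le> norm u" for u
  proof (rule power2_le_imp_le)
    have "(norm (X u))\<^sup>2 = (norm u)\<^sup>2 - 2 * (norm (S u))\<^sup>2 + (norm (S (S u)))\<^sup>2"
      using symmetric_opD[OF S(2), of "S u" u]
      by (simp add: X_def power2_norm_eq_inner inner_diff_left inner_diff_right inner_commute)
    moreover have "(norm (S (S u)))\<^sup>2 \<le> (norm (S u))\<^sup>2" using nS by (intro power_mono) auto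
    ultimately show "(norm (X u))\<^sup>2 \<le> (norm u)\<^sup>2" by (smt (verit) zero_le_power2)
  qed simp
  obtain Z where Z: "bounded_linear Z" "symmetric_op Z" "\<And>u. 0 \<le> inner (Z u) u" "\<And>u. Z (Z u) = u - X u"
    and Zcomm: "\<forall>C. bounded_linear C \<longrightarrow> (\<forall>u. C (X u) = X (C u)) \<longrightarrow> (\<forall>u. C (Z u) = Z (C u))"
    using operator_sqrt[OF Xbl Xsym nX] by blast
  note Zlin = bounded_linear_simps[OF Z(1)]
  have ZZ: "Z (Z u) = S (S u)" for u using Z(4) by (simp add: X_def)
  have SZ: "S (Z u) = Z (S u)" for u using Zcomm S(1) by (simp add: X_def Slin)
  define K where "K = {u. Z u + S u = 0}"
  have Ksub: "subspace K" by (auto simp: K_def subspace_def Slin Zlin algebra_simps simp flip: scaleR_add_right)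
  have "continuous_on UNIV (\<lambda>u. Z u + S u)"
    by (intro continuous_on_add linear_continuous_on Z S)
  then have Kcl: "closed K" unfolding K_def by (intro closed_Collect_eq) (auto simp: continuous_on_const)
  obtain P where P: "bounded_linear P" "symmetric_op P" "\<And>u. P u \<in> K" "\<And>u. u \<in> K \<Longrightarrow> P u = u"
    using projection_operator[OF Ksub Kcl] by blast
  \<comment> \<open>Since (Z + S)(Z - S) = Z^2 - S^2 = 0, the range of Z - S lies in
    \<open>K\<close>. A vector orthogonal to \<open>K\<close> is therefore killed by Z - S, which
    makes \<open>S\<close> nonnegative there.\<close>
  have ker: "Z b = S b" if "P b = 0" for b
  proof -
    have "Z (Z x - S x) + S (Z x - S x) = 0" for x using SZ ZZ by (simp add: Slin Zlin)
    then have k: "P (Z x - S x) = Z x - S x" for x by (intro P(4)) (simp add: K_def)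
    have "inner (Z b - S b) x = 0" for x
    proof -
      have "inner (Z b - S b) x = inner b (Z x - S x)"
        using symmetric_opD[OF Z(2)] symmetric_opD[OF S(2)] by (simp add: inner_diff_left inner_diff_right)
      also have "\<dots> = inner (P b) (Z x - S x)" using symmetric_opD[OF P(2), of b] k by simp
      finally show ?thesis using that by simp
    qed
    then have "Z b - S b = 0" by (metis inner_eq_zero_iff)
    then show ?thesis by simp
  qed
  show ?thesis
  proof (rule that[of P])
    show "bounded_linear P" "symmetric_op P" by fact+
    show "P (P u) = P u" for u using P by auto
    show "inner (S (P u)) (P u) \<le> 0" for u
    proof -
      have "Z (P u) + S (P u) = 0" using P(3) by (simp add: K_def)
      then have "S (P u) = - Z (P u)" by (simp add: eq_neg_iff_add_eq_0 add.commute)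
      then show ?thesis using Z(3)[of "P u"] by simp
    qed
    show "0 \<le> inner (S u) u" if "P u = 0" for u using ker[OF that] Z(3)[of u] by simp
    show "u = 0" if u: "P u = 0" "inner (S u) u \<le> 0" for u
    proof -
      have "inner (Z u) u = 0" using ker[OF u(1)] Z(3)[of u] u(2) by simp
      then have "Z u = 0" by (rule positive_form_zero[OF Z(1-3)])
      then have "u \<in> K" using ker[OF u(1)] by (simp add: K_def)
      then show ?thesis using P(4) u(1) by metis
    qed
    have "C (P u) = P (C u)" if C: "bounded_linear C" "symmetric_op C" "\<And>u. C (S u) = S (C u)"
      for C :: "'a \<Rightarrow> 'a" and u
    proof -
    note Clin = bounded_linear_simps[OF C(1)]
    have CZ: "C (Z u) = Z (C u)" for u using Zcomm C(1) by (simp add: X_def Clin C(3))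
    have inv: "C v \<in> K" if "v \<in> K" for v
    proof -
      have "C (Z v + S v) = 0" using that Clin by (simp add: K_def)
      then show ?thesis by (simp only: K_def mem_Collect_eq Clin CZ C(3))
    qed
    have CP: "P (C (P u)) = C (P u)" for u using inv P by auto
      show ?thesis
      proof (rule inner_eqI)
      fix v
      have "inner (C (P u)) v = inner (P (C (P u))) v" by (simp add: CP)
      also have "\<dots> = inner u (P (C (P v)))" using symmetric_opD[OF P(2)] symmetric_opD[OF C(2)] by metis
      also have "\<dots> = inner u (C (P v))" by (simp add: CP)
      also have "\<dots> = inner (P (C u)) v" using symmetric_opD[OF P(2)] symmetric_opD[OF C(2)] by metis
      finally show "inner (C (P u)) v = inner (P (C u)) v" .
      qed
    qed
    then show "\<forall>C. bounded_linear C \<longrightarrow> symmetric_op C \<longrightarrow> (\<forall>u. C (S u) = S (C u)) \<longrightarrow> (\<forall>u. C (P u) = P (C u))"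
      by blast
  qed
qed

section \<open>The spectral theorem for nonnegative self-adjoint operators\<close>

text \<open>The last conclusion is the working form of self-adjointness: a pair that is formally
  adjoint to \<open>A\<close> on the whole domain belongs to the graph of \<open>A\<close>. Density
  makes the adjoint value unique, which evaluates the \<open>THE\<close> in
  \<open>adj_op\<close>.\<close>

lemma self_adjoint_facts:
  fixes D :: "'a::{real_inner,complete_space} set"
  assumes sa: "self_adjoint_op D A"
  shows "subspace D" "\<And>u v. u \<in> D \<Longrightarrow> v \<in> D \<Longrightarrow> A (u + v) = A u + A v"
    "\<And>c u. u \<in> D \<Longrightarrow> A (c *\<^sub>R u) = c *\<^sub>R A u" "closure D = UNIV"
    "\<And>u v. u \<in> D \<Longrightarrow> v \<in> D \<Longrightarrow> inner (A u) v = inner u (A v)"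
    "\<And>v w. (\<And>u. u \<in> D \<Longrightarrow> inner (A u) v = inner u w) \<Longrightarrow> v \<in> D \<and> A v = w"
proof -
  show lin: "subspace D" "\<And>u v. u \<in> D \<Longrightarrow> v \<in> D \<Longrightarrow> A (u + v) = A u + A v"
    "\<And>c u. u \<in> D \<Longrightarrow> A (c *\<^sub>R u) = c *\<^sub>R A u" and cl: "closure D = UNIV"
    using sa by (auto simp: self_adjoint_op_def linear_op_def)
  have adj: "adj_dom D A = D" "\<And>v. v \<in> D \<Longrightarrow> adj_op D A v = A v" using sa by (auto simp: self_adjoint_op_def)
  have uniq: "w = w'" if "\<And>u. u \<in> D \<Longrightarrow> inner u w = inner u w'" for w w'
  proof (rule inner_eqI)
    fix x
    obtain s where s: "\<And>n. s n \<in> D" "s \<longlonglongrightarrow> x" using cl closure_sequential[of x D] by auto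
    have "(\<lambda>n. inner w (s n)) \<longlonglongrightarrow> inner w x" "(\<lambda>n. inner w' (s n)) \<longlonglongrightarrow> inner w' x"
      by (intro tendsto_intros s)+
    moreover have "(\<lambda>n. inner w (s n)) = (\<lambda>n. inner w' (s n))"
      by (rule ext) (metis that s(1) inner_commute)
    ultimately show "inner w x = inner w' x" using LIMSEQ_unique by metis
  qed
  have star: "v \<in> D \<and> A v = w" if w: "\<And>u. u \<in> D \<Longrightarrow> inner (A u) v = inner u w" for v w
  proof -
    have v: "v \<in> D" using w adj(1) by (auto simp: adj_dom_def)
    have "adj_op D A v = w" unfolding adj_op_def
    proof (rule the_equality)
      fix w' assume "\<forall>u\<in>D. inner (A u) v = inner u w'"
      then show "w' = w" using w by (intro uniq) metis
    qed (use w in blast)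
    then show ?thesis using v adj(2) by simp
  qed
  then show "\<And>v w. (\<And>u. u \<in> D \<Longrightarrow> inner (A u) v = inner u w) \<Longrightarrow> v \<in> D \<and> A v = w" by blast
  show "inner (A u) v = inner u (A v)" if "u \<in> D" "v \<in> D" for u v
  proof -
    have "v \<in> adj_dom D A" using that adj by simp
    then obtain w where w: "\<forall>u\<in>D. inner (A u) v = inner u w" by (auto simp: adj_dom_def)
    then have "A v = w" using star by blast
    then show ?thesis using w that by blast
  qed
qed

text \<open>\<open>R\<close> inverts 1 + A. Nonnegativity gives |u| \<le> |u + A u|, hence
  injectivity and, as the graph is closed, a closed range. A vector z orthogonal to the range would
  satisfy A z = -z by self-adjointness, and nonnegativity then forces z = 0.\<close>

lemma resolvent_exists:
  fixes D :: "'a::{real_inner,complete_space} set"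
  assumes sa: "self_adjoint_op D A" and nn: "nonneg_op D A"
  obtains R where "bounded_linear R" "symmetric_op R" "\<And>u. R u \<in> D" "\<And>u. R u + A (R u) = u"
    "\<And>u. u \<in> D \<Longrightarrow> R (u + A u) = u" "\<And>u. (norm (R u))\<^sup>2 \<le> inner (R u) u" "\<And>u. norm (R u) \<le> norm u"
proof -
  note F = self_adjoint_facts[OF sa]
  have pos: "0 \<le> inner (A u) u" if "u \<in> D" for u using nn that by (auto simp: nonneg_op_def)
  have Adiff: "A (u - v) = A u - A v" if "u \<in> D" "v \<in> D" for u v
    using F(2)[OF that(1) subspace_scale[OF F(1) that(2), of "-1"]] F(3)[OF that(2), of "-1"] by simp
  have coer: "(norm u)\<^sup>2 \<le> inner u (u + A u)" if "u \<in> D" for u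
    using pos[OF that] by (simp add: inner_add_right power2_norm_eq_inner inner_commute)
  have low: "norm u \<le> norm (u + A u)" if "u \<in> D" for u
  proof (cases "u = 0")
    case False
    have "norm u * norm u \<le> norm u * norm (u + A u)"
      using coer[OF that] norm_cauchy_schwarz[of u "u + A u"] by (simp add: power2_eq_square)
    then show ?thesis using False by simp
  qed simp
  define M where "M = (\<lambda>u. u + A u) ` D"
  have Msub: "subspace M"
  proof (rule subspaceI)
    have "0 \<in> D" "A 0 = 0" using subspace_0[OF F(1)] F(3)[of 0 0] by auto
    then show "0 \<in> M" unfolding M_def by force
    show "x + y \<in> M" if xy: "x \<in> M" "y \<in> M" for x y
    proof -
      obtain u v where "u \<in> D" "v \<in> D" "x = u + A u" "y = v + A v" using xy by (auto simp: M_def)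
      then show ?thesis unfolding M_def using F(2) subspace_add[OF F(1)] by (intro image_eqI[of _ _ "u + v"]) auto
    qed
    show "c *\<^sub>R x \<in> M" if x: "x \<in> M" for c x
    proof -
      obtain u where "u \<in> D" "x = u + A u" using x by (auto simp: M_def)
      then show ?thesis unfolding M_def using F(3) subspace_scale[OF F(1)]
        by (intro image_eqI[of _ _ "c *\<^sub>R u"]) (auto simp: scaleR_add_right)
    qed
  qed
  have Mcl: "closed M"
  proof (unfold closed_sequential_limits, intro allI impI, elim conjE)
    fix x l assume "\<forall>n. x n \<in> M" and lim: "x \<longlonglongrightarrow> l"
    then have "\<forall>n. \<exists>v\<in>D. x n = v + A v" by (auto simp: M_def)
    then obtain u where u: "\<And>n. u n \<in> D" "\<And>n. x n = u n + A (u n)" by metis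
    have "Cauchy u"
    proof (rule CauchyI)
      fix e :: real assume "0 < e"
      then obtain N where N: "\<And>m n. m \<ge> N \<Longrightarrow> n \<ge> N \<Longrightarrow> norm (x m - x n) < e"
        using CauchyD[OF LIMSEQ_imp_Cauchy[OF lim]] by blast
      have "norm (u m - u n) \<le> norm (x m - x n)" for m n
        using low[OF subspace_diff[OF F(1) u(1) u(1)], of m n] by (simp add: u(2) Adiff[OF u(1) u(1)] algebra_simps)
      then show "\<exists>N. \<forall>m\<ge>N. \<forall>n\<ge>N. norm (u m - u n) < e" using N le_less_trans by blast
    qed
    then obtain w where w: "u \<longlonglongrightarrow> w" using Cauchy_convergent convergent_def by blast
    have Au: "(\<lambda>n. A (u n)) \<longlonglongrightarrow> l - w" using tendsto_diff[OF lim w] by (simp add: u(2))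
    have "w \<in> D \<and> A w = l - w"
    proof (rule F(6))
      fix v assume v: "v \<in> D"
      have "(\<lambda>n. inner (A v) (u n)) \<longlonglongrightarrow> inner (A v) w" "(\<lambda>n. inner v (A (u n))) \<longlonglongrightarrow> inner v (l - w)"
        by (intro tendsto_intros w Au)+
      then show "inner (A v) w = inner v (l - w)" using F(5)[OF v u(1)] LIMSEQ_unique by simp
    qed
    then show "l \<in> M" unfolding M_def by (intro image_eqI[of _ _ w]) auto
  qed
  have surj: "\<exists>u\<in>D. u + A u = f" for f
  proof -
    obtain p where p: "p \<in> M" "\<forall>y\<in>M. inner (f - p) y = 0" using orthogonal_projection_exists[OF Msub Mcl] by metis
    have z: "f - p \<in> D \<and> A (f - p) = - (f - p)"
    proof (rule F(6))
      fix u assume "u \<in> D"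
      then have "inner (f - p) (u + A u) = 0" using p(2) by (auto simp: M_def)
      then show "inner (A u) (f - p) = inner u (- (f - p))" 
        unfolding inner_minus_right inner_commute[of u "f - p"] inner_commute[of "A u" "f - p"] inner_add_right by linarith
    qed
    have "0 \<le> inner (A (f - p)) (f - p)" using z by (intro pos) auto
    also have "\<dots> = - inner (f - p) (f - p)" using z by (metis inner_minus_left)
    finally have "f - p = 0" by (metis inner_ge_zero inner_eq_zero_iff neg_0_le_iff_le order_antisym)
    then show ?thesis using p(1) by (auto simp: M_def)
  qed
  then obtain R where R: "\<And>u. R u \<in> D" "\<And>u. R u + A (R u) = u" by metis
  have uniq: "u = v" if "u \<in> D" "v \<in> D" "u + A u = v + A v" for u v
  proof -
    have "norm (u - v) \<le> norm ((u + A u) - (v + A v))"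
      using low[OF subspace_diff[OF F(1) that(1,2)]] by (simp add: Adiff[OF that(1,2)] algebra_simps)
    then show ?thesis using that(3) by simp
  qed
  have nR2: "(norm (R u))\<^sup>2 \<le> inner (R u) u" for u using coer[OF R(1)[of u]] R(2)[of u] by simp
  have nR: "norm (R u) \<le> norm u" for u using low[OF R(1)[of u]] R(2)[of u] by simp
  show ?thesis
  proof (rule that[of R])
    show "bounded_linear R"
    proof (rule bounded_linear_intro)
      show "R (x + y) = R x + R y" for x y
      proof (rule uniq)
        show "R x + R y \<in> D" by (intro subspace_add F R)
        have "R x + R y + A (R x + R y) = (R x + A (R x)) + (R y + A (R y))" by (simp add: F(2) R(1))
        then show "R (x + y) + A (R (x + y)) = R x + R y + A (R x + R y)" by (simp only: R(2))
      qed (rule R)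
      show "R (c *\<^sub>R x) = c *\<^sub>R R x" for c x
      proof (rule uniq)
        show "c *\<^sub>R R x \<in> D" by (intro subspace_scale F R)
        have "c *\<^sub>R R x + A (c *\<^sub>R R x) = c *\<^sub>R (R x + A (R x))" by (simp add: F(3) R(1) scaleR_add_right)
        then show "R (c *\<^sub>R x) + A (R (c *\<^sub>R x)) = c *\<^sub>R R x + A (c *\<^sub>R R x)" by (simp only: R(2))
      qed (rule R)
      show "norm (R x) \<le> norm x * 1" for x using nR by simp
    qed
    show "symmetric_op R" unfolding symmetric_op_def
    proof (intro allI)
      fix u v
      have "inner (R u) v = inner (R u) (R v + A (R v))" by (simp only: R(2))
      also have "\<dots> = inner (R u + A (R u)) (R v)" using F(5)[OF R(1) R(1)] by (simp add: inner_add_left inner_add_right)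
      finally show "inner (R u) v = inner u (R v)" by (simp only: R(2))
    qed
    show "R (u + A u) = u" if "u \<in> D" for u using uniq[OF R(1) that] R(2) by blast
  qed (fact R nR2 nR)+
qed

section \<open>The spectral family constructed from the resolvent\<close>

locale resolvent =
  fixes R :: "'a::{real_inner,complete_space} \<Rightarrow> 'a"
  assumes bl: "bounded_linear R" and sym: "symmetric_op R" and nR2: "(norm (R u))\<^sup>2 \<le> inner (R u) u"
    and nR: "norm (R u) \<le> norm u" and inj: "R u = 0 \<Longrightarrow> u = 0"
begin

text \<open>In terms of \<open>R\<close>, the spectral projection of A on [0, l] is characterized by
  R \<ge> 1/(1+l) on its range and R < 1/(1+l) on its kernel. The strict inequality is the clause
  that forces \<open>u = 0\<close>; it puts the endpoint l into the range and thereby yields right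
  continuity. The last clause makes projections of different levels commute.\<close>

definition is_cut :: "real \<Rightarrow> ('a \<Rightarrow> 'a) \<Rightarrow> bool" where
  "is_cut l P \<longleftrightarrow> bounded_linear P \<and> symmetric_op P \<and> (\<forall>u. P (P u) = P u) \<and>
    (\<forall>u. (norm (P u))\<^sup>2 / (1 + l) \<le> inner (R (P u)) (P u)) \<and>
    (\<forall>u. P u = 0 \<longrightarrow> inner (R u) u \<le> (norm u)\<^sup>2 / (1 + l)) \<and>
    (\<forall>u. P u = 0 \<longrightarrow> (norm u)\<^sup>2 / (1 + l) \<le> inner (R u) u \<longrightarrow> u = 0) \<and>
    (\<forall>C. bounded_linear C \<longrightarrow> symmetric_op C \<longrightarrow> (\<forall>u. C (R u) = R (C u)) \<longrightarrow> (\<forall>u. C (P u) = P (C u)))"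

lemma is_cut_exists: assumes l: "0 \<le> l" shows "\<exists>P. is_cut l P"
proof -
  define a where "a = 1 / (1 + l)"
  have a: "0 < a" "a \<le> 1" using l by (auto simp: a_def)
  define S where "S u = a *\<^sub>R u - R u" for u
  have Sbl: "bounded_linear S" unfolding S_def
    by (intro bounded_linear_sub bounded_linear_scaleR_right bl)
  have Ssym: "symmetric_op S" using sym by (simp add: symmetric_op_def S_def inner_diff_left inner_diff_right)
  have nS: "norm (S u) \<le> norm u" for u
  proof (rule power2_le_imp_le)
    have "(norm (S u))\<^sup>2 = a\<^sup>2 * (norm u)\<^sup>2 - 2 * a * inner (R u) u + (norm (R u))\<^sup>2"
      unfolding S_def power2_norm_eq_inner
      by (simp add: inner_diff_left inner_diff_right inner_commute[of u "R u"] power2_eq_square algebra_simps)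
    also have "\<dots> \<le> a\<^sup>2 * (norm u)\<^sup>2 - 2 * a * (norm (R u))\<^sup>2 + (norm (R u))\<^sup>2"
      using mult_left_mono[OF nR2, of "2 * a" u] a by simp
    also have "\<dots> = a\<^sup>2 * (norm u)\<^sup>2 + (1 - 2 * a) * (norm (R u))\<^sup>2" by (simp add: algebra_simps)
    also have "\<dots> \<le> (norm u)\<^sup>2"
    \<comment> \<open>For small \<open>a\<close> the last term is estimated by |R u| \<le> |u| and
      the coefficients add up to (1 - a)^2; for large \<open>a\<close> that term is
      nonpositive.\<close>
    proof (cases "1 - 2 * a \<ge> 0")
      case True
      have "(1 - 2 * a) * (norm (R u))\<^sup>2 \<le> (1 - 2 * a) * (norm u)\<^sup>2" using nR True by (intro mult_left_mono power_mono) auto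
      moreover have "(a\<^sup>2 + (1 - 2 * a)) * (norm u)\<^sup>2 \<le> 1 * (norm u)\<^sup>2"
        using a True by (intro mult_right_mono) (auto simp: power2_eq_square intro: order_trans[OF mult_left_le_one_le])
      ultimately show ?thesis by (simp add: algebra_simps)
    next
      case False
      have "(1 - 2 * a) * (norm (R u))\<^sup>2 \<le> 0" using False by (intro mult_nonpos_nonneg) auto
      moreover have "a\<^sup>2 * (norm u)\<^sup>2 \<le> 1 * (norm u)\<^sup>2" using a by (intro mult_right_mono power_le_one) auto
      ultimately show ?thesis by simp
    qed
    finally show "(norm (S u))\<^sup>2 \<le> (norm u)\<^sup>2" .
  qed simp
  have inS: "inner (S u) u = (norm u)\<^sup>2 / (1 + l) - inner (R u) u" for u
    by (simp add: S_def inner_diff_left a_def power2_norm_eq_inner)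
  have CS: "C (S u) = S (C u)" if "bounded_linear C" "\<forall>u. C (R u) = R (C u)" for C u
    using that by (simp add: S_def bounded_linear_simps[OF that(1)])
  show ?thesis
  proof (rule spectral_projection[OF Sbl Ssym nS])
    fix P assume P: "bounded_linear P" "symmetric_op P" "\<And>u. P (P u) = P u"
      "\<And>u. inner (S (P u)) (P u) \<le> 0" "\<And>u. P u = 0 \<Longrightarrow> 0 \<le> inner (S u) u"
      "\<And>u. P u = 0 \<Longrightarrow> inner (S u) u \<le> 0 \<Longrightarrow> u = 0"
      "\<forall>C. bounded_linear C \<longrightarrow> symmetric_op C \<longrightarrow> (\<forall>u. C (S u) = S (C u)) \<longrightarrow> (\<forall>u. C (P u) = P (C u))"
    have "is_cut l P" unfolding is_cut_def
    proof (intro conjI allI impI)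
      show "(norm (P u))\<^sup>2 / (1 + l) \<le> inner (R (P u)) (P u)" for u using P(4)[of u] by (simp add: inS)
      show "inner (R u) u \<le> (norm u)\<^sup>2 / (1 + l)" if "P u = 0" for u using P(5)[OF that] by (simp add: inS)
      show "u = 0" if "P u = 0" "(norm u)\<^sup>2 / (1 + l) \<le> inner (R u) u" for u using that P(6)[of u] by (simp add: inS)
      show "C (P u) = P (C u)" if "bounded_linear C" "symmetric_op C" "\<forall>u. C (R u) = R (C u)" for C u
        using that P(7) CS by blast
    qed (use P in auto)
    then show ?thesis by blast
  qed
qed

definition E :: "real \<Rightarrow> 'a \<Rightarrow> 'a" where
  "E x = (if x < 0 then (\<lambda>_. 0) else (SOME P. is_cut x P))"

lemma E_neg: "x < 0 \<Longrightarrow> E x u = 0"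
  by (simp add: E_def)

lemma E_cut: "0 \<le> x \<Longrightarrow> is_cut x (E x)"
  using someI_ex[OF is_cut_exists] by (simp add: E_def)

lemma E_bl: "bounded_linear (E x)" and E_sym: "symmetric_op (E x)" and E_idem: "E x (E x u) = E x u"
  using E_cut[of x] by (cases "x < 0"; auto simp: E_neg is_cut_def E_def bounded_linear_zero symmetric_op_def)+

lemma E_lower: "0 \<le> x \<Longrightarrow> (norm (E x u))\<^sup>2 / (1 + x) \<le> inner (R (E x u)) (E x u)"
  and E_upper: "0 \<le> x \<Longrightarrow> E x u = 0 \<Longrightarrow> inner (R u) u \<le> (norm u)\<^sup>2 / (1 + x)"
  and E_zero: "0 \<le> x \<Longrightarrow> E x u = 0 \<Longrightarrow> (norm u)\<^sup>2 / (1 + x) \<le> inner (R u) u \<Longrightarrow> u = 0"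
  using E_cut[of x] by (auto simp: is_cut_def)

lemma R_E: "R (E x u) = E x (R u)"
  using E_cut[of x] bl sym by (cases "x < 0"; auto simp: E_neg is_cut_def bounded_linear_simps)

lemma E_commute: "E x (E y u) = E y (E x u)"
proof (cases "y < 0")
  case False
  then have "\<forall>C. bounded_linear C \<longrightarrow> symmetric_op C \<longrightarrow> (\<forall>u. C (R u) = R (C u)) \<longrightarrow> (\<forall>u. C (E y u) = E y (C u))"
    using E_cut[of y] by (simp add: is_cut_def)
  then show ?thesis using E_bl[of x] E_sym[of x] R_E by metis
qed (simp add: E_neg bounded_linear_simps[OF E_bl])

text \<open>Let \<open>b\<close> be the part of \<open>E x u\<close> missed by \<open>E y\<close>.
  It is in the range of \<open>E x\<close>, so R \<ge> 1/(1+x) \<ge> 1/(1+y) on it, and in the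
  kernel of \<open>E y\<close>, where this is only possible for 0.\<close>

lemma E_min_le: assumes "x \<le> y" shows "E y (E x u) = E x u"
proof (cases "x < 0")
  case False
  define b where "b = E x u - E y (E x u)"
  have "E y b = 0" by (simp add: b_def bounded_linear_simps[OF E_bl] E_idem)
  moreover have xb: "E x b = b" by (simp add: b_def bounded_linear_simps[OF E_bl] E_idem E_commute[of x y])
  have "(norm b)\<^sup>2 / (1 + y) \<le> inner (R b) b"
  proof -
    have "(norm b)\<^sup>2 / (1 + y) \<le> (norm b)\<^sup>2 / (1 + x)" using False assms by (intro divide_left_mono) auto
    also have "\<dots> \<le> inner (R b) b" using E_lower[of x b] False xb by simp
    finally show ?thesis .
  qed
  ultimately have "b = 0" using E_zero[of y b] False assms by simp
  then show ?thesis by (simp add: b_def)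
qed (simp add: E_neg bounded_linear_simps[OF E_bl])

lemma E_min: "E x (E y u) = E (min x y) u"
  using E_min_le[of x y u] E_min_le[of y x u] E_commute[of x y u] by (cases "x \<le> y") (auto simp: min_def)

lemma E_inner: "inner (E x u) (E y u) = (norm (E (min x y) u))\<^sup>2"
proof -
  have "inner (E x u) (E y u) = inner u (E (min x y) u)" using symmetric_opD[OF E_sym] E_min by metis
  also have "\<dots> = inner u (E (min x y) (E (min x y) u))" by (simp only: E_idem)
  also have "\<dots> = inner (E (min x y) u) (E (min x y) u)" using symmetric_opD[OF E_sym] by metis
  finally show ?thesis by (simp add: power2_norm_eq_inner)
qed

lemma E_dist: "x \<le> y \<Longrightarrow> (norm (E y u - E x u))\<^sup>2 = (norm (E y u))\<^sup>2 - (norm (E x u))\<^sup>2"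
  using E_inner[of x u y] by (simp add: power2_norm_eq_inner inner_diff_left inner_diff_right inner_commute[of "E y u" "E x u"])

lemma E_norm_mono: "x \<le> y \<Longrightarrow> (norm (E x u))\<^sup>2 \<le> (norm (E y u))\<^sup>2"
  using E_dist[of x y u] zero_le_power2[of "norm (E y u - E x u)"] by linarith

lemma norm_E_le: "norm (E x u) \<le> norm u"
proof (cases "E x u = 0")
  case False
  have "norm (E x u) * norm (E x u) = inner (E x u) u"
    using symmetric_opD[OF E_sym, of x "E x u" u] E_idem by (metis power2_norm_eq_inner power2_eq_square)
  also have "\<dots> \<le> norm (E x u) * norm u" by (rule norm_cauchy_schwarz)
  finally show ?thesis using False by simp
qed simp

text \<open>Squared distances along the family are differences of the bounded monotone quantity |E x
  u|^2. Decreasing sequences serve right continuity, increasing ones the limit at infinity.\<close>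

lemma E_monotone_Cauchy:
  assumes mono: "incseq t \<or> decseq t"
  shows "convergent (\<lambda>n::nat. E (t n) u)"
proof -
  define G where "G n = (norm (E (t n) u))\<^sup>2" for n
  have d: "(norm (E (t m) u - E (t n) u))\<^sup>2 = \<bar>G m - G n\<bar>" for m n
    using E_dist[of "t m" "t n" u] E_dist[of "t n" "t m" u] E_norm_mono[of "t m" "t n" u] E_norm_mono[of "t n" "t m" u]
    by (cases "t m \<le> t n") (auto simp: G_def norm_minus_commute)
  have "monoseq G" using mono E_norm_mono by (auto simp: monoseq_def G_def incseq_def decseq_def)
  moreover have "Bseq G" unfolding G_def using norm_E_le by (intro BseqI'[where K="(norm u)\<^sup>2"]) (auto intro: power_mono)
  ultimately have "Cauchy G" by (intro convergent_Cauchy Bseq_monoseq_convergent)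
  have "Cauchy (\<lambda>n. E (t n) u)"
  proof (rule CauchyI)
    fix e :: real assume e: "0 < e"
    obtain M where M: "\<And>m n. m \<ge> M \<Longrightarrow> n \<ge> M \<Longrightarrow> \<bar>G m - G n\<bar> < e\<^sup>2"
      using CauchyD[OF \<open>Cauchy G\<close>, of "e\<^sup>2"] e by (auto simp: real_norm_def)
    then have "norm (E (t m) u - E (t n) u) < e" if "m \<ge> M" "n \<ge> M" for m n
      by (intro power_less_imp_less_base[of _ 2 e]) (use that d e in auto)
    then show "\<exists>M. \<forall>m\<ge>M. \<forall>n\<ge>M. norm (E (t m) u - E (t n) u) < e" by blast
  qed
  then show ?thesis by (rule Cauchy_convergent)
qed

lemma incseq_real: "incseq real"
  by (simp add: incseq_def)

text \<open>The limit exceeds \<open>E x u\<close> by a vector \<open>b\<close> in the kernel of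
  \<open>E x\<close> and in the range of every \<open>E (t n)\<close>. Passing to the limit in the
  lower bounds gives R \<ge> 1/(1+x) on \<open>b\<close>, so the strict clause yields
  \<open>b = 0\<close>.\<close>

lemma E_right_seq:
  assumes x: "0 \<le> x"
  shows "(\<lambda>n. E (x + 1 / real (Suc n)) u) \<longlonglongrightarrow> E x u"
proof -
  define t where "t n = x + 1 / real (Suc n)" for n
  have tx: "x \<le> t n" for n by (simp add: t_def)
  have tlim: "t \<longlonglongrightarrow> x" unfolding t_def using tendsto_add[OF tendsto_const LIMSEQ_inverse_real_of_nat, of x] by (simp add: inverse_eq_divide)
  have dec: "decseq t" by (auto simp: decseq_def t_def frac_le)
  obtain w where w: "(\<lambda>n. E (t n) u) \<longlonglongrightarrow> w"
    using E_monotone_Cauchy[of t u] dec unfolding convergent_def by blast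
  define b where "b = w - E x u"
  have "(\<lambda>n. E x (E (t n) u)) \<longlonglongrightarrow> E x w" by (rule bounded_linear.tendsto[OF E_bl w])
  then have "E x w = E x u" using tx by (simp add: E_min min_absorb1 LIMSEQ_const_iff)
  then have xb: "E x b = 0" by (simp add: b_def bounded_linear_simps[OF E_bl] E_idem)
  have tb: "E (t n) b = b" for n
  proof -
    have "(\<lambda>m. E (t n) (E (t m) u)) \<longlonglongrightarrow> E (t n) w" by (rule bounded_linear.tendsto[OF E_bl w])
    moreover have "\<forall>\<^sub>F m in sequentially. E (t n) (E (t m) u) = E (t m) u"
      using dec by (auto simp: eventually_sequentially E_min decseq_def min_absorb2 intro!: exI[of _ n])
    ultimately have "(\<lambda>m. E (t m) u) \<longlonglongrightarrow> E (t n) w" by (rule Lim_transform_eventually)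
    then have "E (t n) w = w" using w LIMSEQ_unique by blast
    then show ?thesis using tx by (simp add: b_def bounded_linear_simps[OF E_bl] E_min min_absorb2)
  qed
  have "(norm b)\<^sup>2 / (1 + x) \<le> inner (R b) b"
  proof (rule LIMSEQ_le_const2)
    show "(\<lambda>n. (norm b)\<^sup>2 / (1 + t n)) \<longlonglongrightarrow> (norm b)\<^sup>2 / (1 + x)" using x by (intro tendsto_intros tlim) auto
    have "(norm b)\<^sup>2 / (1 + t n) \<le> inner (R b) b" for n
      using E_lower[of "t n" b] tb order_trans[OF x tx] by simp
    then show "\<exists>N. \<forall>n\<ge>N. (norm b)\<^sup>2 / (1 + t n) \<le> inner (R b) b" by blast
  qed
  then have "b = 0" using E_zero[OF x xb] by blast
  then show ?thesis using w by (simp add: b_def t_def)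
qed

lemma E_right: "((\<lambda>y. E y u) \<longlongrightarrow> E x u) (at_right x)"
proof (cases "x < 0")
  case True
  have "\<forall>\<^sub>F y in at_right x. E y u = E x u"
    unfolding eventually_at_right_field using True by (intro exI[of _ 0]) (auto simp: E_neg)
  then show ?thesis by (rule tendsto_eventually)
next
  case False
  show ?thesis
  proof (rule tendstoI)
    fix e :: real assume e: "0 < e"
    obtain n where n: "norm (E (x + 1 / real (Suc n)) u - E x u) < e"
      using LIMSEQ_D[OF E_right_seq[of x u] e] False by (metis not_le order_refl)
    let ?y = "x + 1 / real (Suc n)"
    have "dist (E y u) (E x u) < e" if "x < y" "y < ?y" for y
    proof -
      have "(norm (E y u - E x u))\<^sup>2 \<le> (norm (E ?y u - E x u))\<^sup>2"
        using E_dist[of x y u] E_dist[of x ?y u] E_norm_mono[of y ?y u] that by simp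
      then have "norm (E y u - E x u) \<le> norm (E ?y u - E x u)" by (rule power2_le_imp_le) simp
      then show ?thesis using n by (simp add: dist_norm)
    qed
    then show "\<forall>\<^sub>F y in at_right x. dist (E y u) (E x u) < e"
      unfolding eventually_at_right_field by (intro exI[of _ ?y]) auto
  qed
qed

text \<open>The defect \<open>b\<close> is annihilated by all \<open>E n\<close>, hence <R b, b>
  \<le> |b|^2/(1+n) for every n. Thus R b = 0, and \<open>R\<close> is injective.\<close>

lemma E_top: "((\<lambda>y. E y u) \<longlongrightarrow> u) at_top"
proof -
  obtain w where w: "(\<lambda>n. E (real n) u) \<longlonglongrightarrow> w"
    using E_monotone_Cauchy[of real u] incseq_real unfolding convergent_def by blast
  define b where "b = u - w"
  have b0: "E (real n) b = 0" for n
  proof -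
    have "(\<lambda>m. E (real n) (E (real m) u)) \<longlonglongrightarrow> E (real n) w" by (rule bounded_linear.tendsto[OF E_bl w])
    moreover have "\<forall>\<^sub>F m in sequentially. E (real n) (E (real m) u) = E (real n) u"
      by (auto simp: eventually_sequentially E_min min_absorb1 intro!: exI[of _ n])
    ultimately have "(\<lambda>m. E (real n) u) \<longlonglongrightarrow> E (real n) w" by (rule Lim_transform_eventually)
    then show ?thesis by (simp add: b_def bounded_linear_simps[OF E_bl] LIMSEQ_const_iff)
  qed
  have "inner (R b) b \<le> 0"
  proof (rule LIMSEQ_le_const)
    show "(\<lambda>n. (norm b)\<^sup>2 * inverse (real (Suc n))) \<longlonglongrightarrow> 0"
      using tendsto_mult_right_zero[OF LIMSEQ_inverse_real_of_nat] by simp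
    have "inner (R b) b \<le> (norm b)\<^sup>2 * inverse (real (Suc n))" for n
      using E_upper[OF _ b0, of n] by (simp add: divide_inverse add.commute)
    then show "\<exists>N. \<forall>n\<ge>N. inner (R b) b \<le> (norm b)\<^sup>2 * inverse (real (Suc n))" by blast
  qed
  then have "(norm (R b))\<^sup>2 \<le> 0" using nR2[of b] by linarith
  then have "b = 0" using inj by simp
  then have lim: "(\<lambda>n. E (real n) u) \<longlonglongrightarrow> u" using w by (simp add: b_def)
  show ?thesis
  proof (rule tendstoI)
    fix e :: real assume e: "0 < e"
    obtain n where n: "norm (E (real n) u - u) < e" using LIMSEQ_D[OF lim e] by blast
    have "dist (E y u) u < e" if "real n \<le> y" for y
    proof -
      have *: "(norm (u - E z u))\<^sup>2 = (norm u)\<^sup>2 - (norm (E z u))\<^sup>2" for z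
      proof -
        have "inner (E z u) u = (norm (E z u))\<^sup>2"
          using symmetric_opD[OF E_sym, of z "E z u" u] E_idem by (metis power2_norm_eq_inner)
        then show ?thesis by (simp add: power2_norm_eq_inner inner_diff_left inner_diff_right inner_commute[of u "E z u"])
      qed
      have "(norm (u - E y u))\<^sup>2 \<le> (norm (u - E (real n) u))\<^sup>2" using *[of y] *[of "real n"] E_norm_mono[OF that, of u] by simp
      then have "norm (u - E y u) \<le> norm (u - E (real n) u)" by (rule power2_le_imp_le) simp
      then show ?thesis using n by (simp add: dist_norm norm_minus_commute)
    qed
    then show "\<forall>\<^sub>F y in at_top. dist (E y u) u < e" unfolding eventually_at_top_linorder by (intro exI[of _ "real n"]) simp
  qed
qed

lemma resolution: "resolution_of_identity E"
proof -
  have "((\<lambda>y. E y u) \<longlongrightarrow> 0) at_bot" for u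
    by (rule tendsto_eventually) (auto simp: eventually_at_bot_linorder E_neg intro!: exI[of _ "-1"])
  then show ?thesis unfolding resolution_of_identity_def
    using E_bl symmetric_opD[OF E_sym] E_min E_right E_top by blast
qed

sublocale res: resolution E
  by unfold_locales (rule resolution)

end

text \<open>Over a uniform partition of mesh s the increments telescope to at most s (G y - G 0),
  which vanishes with the mesh. It replaces a limit of Riemann-Stieltjes sums.\<close>

lemma constant_of_quadratic_increments:
  fixes h G :: "real \<Rightarrow> real"
  assumes "\<And>x y. 0 \<le> x \<Longrightarrow> x \<le> y \<Longrightarrow> \<bar>h y - h x\<bar> \<le> (y - x) * (G y - G x)" and y: "0 \<le> y"
  shows "h y = h 0"
proof -
  have part: "\<bar>h y - h 0\<bar> \<le> y * (G y - G 0) * (1 / real (Suc n))" for n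
  proof -
    define s where "s = y / real (Suc n)"
    have s: "0 \<le> s" using y by (simp add: s_def)
    have "\<bar>h (real k * s) - h 0\<bar> \<le> s * (G (real k * s) - G 0)" for k
    proof (induction k)
      case (Suc k)
      have "\<bar>h (real (Suc k) * s) - h (real k * s)\<bar> \<le> (real (Suc k) * s - real k * s) * (G (real (Suc k) * s) - G (real k * s))"
        using s by (intro assms(1)) (auto simp: algebra_simps)
      also have "real (Suc k) * s - real k * s = s" by (simp add: algebra_simps)
      finally show ?case using Suc unfolding right_diff_distrib by linarith
    qed simp
    from this[of "Suc n"] show ?thesis by (simp add: s_def mult_ac)
  qed
  have "\<bar>h y - h 0\<bar> \<le> 0"
  proof (rule LIMSEQ_le_const)
    show "(\<lambda>n. y * (G y - G 0) * (1 / real (Suc n))) \<longlonglongrightarrow> 0"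
      using tendsto_mult_right_zero[OF LIMSEQ_inverse_real_of_nat] by (simp add: inverse_eq_divide)
  qed (use part in blast)
  then show ?thesis by simp
qed

context resolution begin

text \<open>The open negative half-line is exhausted by half-lines ending at -1/(n+1), on which the
  family vanishes; hence the values of a symbol there are immaterial.\<close>

lemma fcalc_negative_part:
  assumes neg: "\<And>x u. x < 0 \<Longrightarrow> E x u = 0" and f: "bounded_borel f" and g: "bounded_borel g"
    and eq: "\<And>x. 0 \<le> x \<Longrightarrow> f x = g x"
  shows "fcalc f u = fcalc g u"
proof -
  define h where "h x = f x - g x" for x
  have h: "bounded_borel h" unfolding h_def using f g by simp
  define t where "t n = - inverse (real (Suc n))" for n
  obtain K where K: "\<And>x. \<bar>h x\<bar> \<le> K" using h by (metis bounded_borelE)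
  have zero: "fcalc (\<lambda>x. h x * indicator {..t n} x) u = 0" for n
  proof -
    have "fcalc (\<lambda>x. h x * indicator {..t n} x) u = fcalc h (fcalc (indicator {..t n}) u)"
      by (subst fcalc_mult[OF h]) auto
    then show ?thesis by (simp add: fcalc_E neg t_def fcalc_linear[OF h])
  qed
  have "(\<lambda>n. fcalc (\<lambda>x. h x * indicator {..t n} x) u) \<longlonglongrightarrow> fcalc h u"
  proof (rule fcalc_limit[where K=K])
    show "(\<lambda>x. h x * indicator {..t n} x) \<in> borel_measurable borel" for n
      using bounded_borel_measurable[OF h] by simp
    show "\<bar>h x * indicator {..t n} x\<bar> \<le> K" for n x
      using K[of x] order_trans[OF abs_ge_zero K] by (auto simp: indicator_def)
    show "(\<lambda>n. h x * indicator {..t n} x) \<longlonglongrightarrow> h x" for x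
    proof (cases "x < 0")
      case True
      have "t \<longlonglongrightarrow> - 0" unfolding t_def by (intro tendsto_minus LIMSEQ_inverse_real_of_nat)
      then have "\<forall>\<^sub>F n in sequentially. x < t n" using True order_tendstoD(1)[of t "-0"] by simp
      then show ?thesis
        by (intro tendsto_eventually, elim eventually_mono) (auto simp: indicator_def)
    qed (simp add: h_def eq)
  qed
  then have "fcalc h u = 0" by (simp add: zero LIMSEQ_const_iff)
  then show ?thesis unfolding h_def by (simp add: fcalc_diff[OF f g])
qed

end

text \<open>The symbol of \<open>R\<close>. Taking the positive part of x keeps it bounded on the
  negative half-line, where the constructed family has no mass.\<close>

definition resolvent_fun :: "real \<Rightarrow> real" where
  "resolvent_fun x = 1 / (1 + max 0 x)"

lemma resolvent_fun_bounded [simp]: "bounded_borel resolvent_fun"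
  unfolding resolvent_fun_def by (rule bounded_borelI[where K=1]) (auto simp: field_simps)

section \<open>Recovering the resolvent from its spectral family\<close>

context resolvent begin

text \<open>Between levels x and y both sides grow by an amount between (G y - G x)/(1+y) and (G y -
  G x)/(1+x). These bounds differ by at most (y - x)(G y - G x), so the difference of the two sides
  has quadratic increments and is constant.\<close>

lemma resolvent_integral_halfline:
  assumes y: "0 \<le> y"
  shows "inner (R (E y u)) (E y u) = (\<integral>x. resolvent_fun x * indicator {..y} x \<partial>spec_measure E u)"
proof -
  define h where "h y = inner (R (E y u)) (E y u) - (\<integral>x. resolvent_fun x * indicator {..y} x \<partial>spec_measure E u)" for y
  define G where "G y = (norm (E y u))\<^sup>2" for y
  have iE: "(\<integral>x. indicator {..y} x \<partial>spec_measure E u) = G y" for y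
    unfolding res.integral_mu_E G_def by (rule res.E_norm)
  have "h y = h 0"
  proof (rule constant_of_quadratic_increments[where G=G])
    fix x y :: real assume x: "0 \<le> x" and xy: "x \<le> y"
    define b where "b = E y u - E x u"
    have Eb: "E y b = b" "E x b = 0" using xy by (simp_all add: b_def bounded_linear_simps[OF E_bl] E_min min_absorb1 min_absorb2 E_idem)
    have nb: "(norm b)\<^sup>2 = G y - G x" unfolding b_def G_def by (rule E_dist[OF xy])
    have cross: "inner (R (E y u)) (E x u) = inner (R (E x u)) (E x u)"
    proof -
      have "inner (R (E y u)) (E x u) = inner (R (E y u)) (E x (E x u))" by (simp add: E_idem)
      also have "\<dots> = inner (E x (R (E y u))) (E x u)" by (simp add: symmetric_opD[OF E_sym])
      also have "E x (R (E y u)) = R (E x u)" using xy by (simp add: R_E[symmetric] E_min min_absorb1)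
      finally show ?thesis .
    qed
    have "inner (R b) b = inner (R (E y u)) (E y u) - inner (R (E x u)) (E x u)"
      using cross symmetric_opD[OF sym, of "E x u" "E y u"]
      by (simp add: b_def bounded_linear_simps[OF bl] inner_diff_left inner_diff_right inner_commute[of "E x u" "R (E y u)"])
    moreover have "(G y - G x) / (1 + y) \<le> inner (R b) b" "inner (R b) b \<le> (G y - G x) / (1 + x)"
      using E_lower[of y b] E_upper[of x b] x xy by (auto simp: Eb nb)
    moreover
    let ?I = "\<lambda>z. \<integral>x. resolvent_fun x * indicator {..z} x \<partial>spec_measure E u"
    have diff: "?I y - ?I x = (\<integral>z. resolvent_fun z * indicator {..y} z - resolvent_fun z * indicator {..x} z \<partial>spec_measure E u)"
      by (rule Bochner_Integration.integral_diff[symmetric]) (auto intro!: res.integrable_mu)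
    have sandwich: "(G y - G x) * c = (\<integral>z. c * (indicator {..y} z - indicator {..x} z) \<partial>spec_measure E u)" for c
      by (simp add: iE[symmetric] Bochner_Integration.integral_diff[symmetric] res.integrable_mu)
    have "(G y - G x) * (1 / (1 + y)) \<le> ?I y - ?I x"
      unfolding diff sandwich using x xy
      by (intro integral_mono res.integrable_mu bounded_borel_cmult bounded_borel_diff bounded_borel_mult
          resolvent_fun_bounded bounded_borel_indicator)
         (auto simp: indicator_def resolvent_fun_def frac_le)
    moreover have "?I y - ?I x \<le> (G y - G x) * (1 / (1 + x))"
      unfolding diff sandwich using x xy
      by (intro integral_mono res.integrable_mu bounded_borel_cmult bounded_borel_diff bounded_borel_mult
          resolvent_fun_bounded bounded_borel_indicator)
         (auto simp: indicator_def resolvent_fun_def frac_le)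
    moreover have "(G y - G x) / (1 + x) - (G y - G x) / (1 + y) \<le> (y - x) * (G y - G x)"
    proof -
      have "1 / (1 + x) - 1 / (1 + y) = (y - x) / ((1 + x) * (1 + y))" using x xy by (simp add: field_simps)
      also have "\<dots> \<le> (y - x) / 1" using x xy mult_mono[of 1 "1 + x" 1 "1 + y"] by (intro divide_left_mono) auto
      finally have "(1 / (1 + x) - 1 / (1 + y)) * (G y - G x) \<le> (y - x) * (G y - G x)"
        using nb zero_le_power2[of "norm b"] by (intro mult_right_mono) auto
      then show ?thesis by (simp add: algebra_simps)
    qed
    ultimately show "\<bar>h y - h x\<bar> \<le> (y - x) * (G y - G x)" unfolding h_def abs_le_iff by simp
  qed (rule y)
  \<comment> \<open>On the range of \<open>E 0\<close> the cut property gives R \<ge> 1 and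
    contractivity gives R \<le> 1; the symbol is 1 on the half-line up to 0.\<close>
  also have "h 0 = 0"
  proof -
    have "(\<lambda>x. resolvent_fun x * indicator {..0} x) = indicator {..0}" by (auto simp: resolvent_fun_def indicator_def)
    then have "(\<integral>x. resolvent_fun x * indicator {..0} x \<partial>spec_measure E u) = G 0" by (simp only: iE)
    moreover have "G 0 \<le> inner (R (E 0 u)) (E 0 u)" using E_lower[of 0 u] by (simp add: G_def)
    moreover have "inner (R (E 0 u)) (E 0 u) \<le> norm (R (E 0 u)) * norm (E 0 u)" by (rule norm_cauchy_schwarz)
    moreover have "norm (R (E 0 u)) * norm (E 0 u) \<le> norm (E 0 u) * norm (E 0 u)" by (intro mult_right_mono nR) auto
    ultimately show ?thesis by (simp add: h_def G_def power2_eq_square)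
  qed
  finally show ?thesis by (simp add: h_def)
qed

text \<open>Letting the half-lines grow equates the quadratic forms of two symmetric operators; a
  symmetric operator with zero form vanishes by \<open>positive_form_zero\<close>.\<close>

lemma R_fcalc: "R u = res.fcalc resolvent_fun u"
proof -
  let ?F = "res.fcalc resolvent_fun"
  have quad: "inner (R u) u = inner (?F u) u" for u
  proof (rule LIMSEQ_unique)
    have lim: "(\<lambda>n. E (real n) u) \<longlonglongrightarrow> u"
      using filterlim_compose[OF E_top filterlim_real_sequentially] by simp
    show "(\<lambda>n. inner (R (E (real n) u)) (E (real n) u)) \<longlonglongrightarrow> inner (R u) u"
      by (intro tendsto_inner bounded_linear.tendsto[OF bl] lim)
    have "(\<lambda>n. \<integral>x. resolvent_fun x * indicator {..real n} x \<partial>spec_measure E u) \<longlonglongrightarrow> (\<integral>x. resolvent_fun x \<partial>spec_measure E u)"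
    proof (rule signed_functional_limit[OF res.sf_mu, where K=1])
      show "(\<lambda>x. resolvent_fun x * indicator {..real n} x) \<in> borel_measurable borel" for n
        by (intro bounded_borel_measurable) simp
      show "\<bar>resolvent_fun x * indicator {..real n} x\<bar> \<le> 1" for n x
        by (auto simp: indicator_def resolvent_fun_def field_simps)
      show "(\<lambda>n. resolvent_fun x * indicator {..real n} x) \<longlonglongrightarrow> resolvent_fun x" for x
      proof (rule tendsto_eventually)
        obtain N :: nat where "x \<le> real N" using real_arch_simple by blast
        then show "\<forall>\<^sub>F n in sequentially. resolvent_fun x * indicator {..real n} x = resolvent_fun x"
          unfolding eventually_sequentially by (intro exI[of _ N]) (auto simp: indicator_def)
      qed
    qed
    then show "(\<lambda>n. inner (R (E (real n) u)) (E (real n) u)) \<longlonglongrightarrow> inner (?F u) u"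
      by (simp add: resolvent_integral_halfline res.fcalc_quad)
  qed
  define T where "T u = R u - ?F u" for u
  have Tbl: "bounded_linear T" unfolding T_def by (intro bounded_linear_sub bl res.fcalc_bl) simp
  have Tsym: "symmetric_op T" unfolding symmetric_op_def T_def
    by (simp add: inner_diff_left inner_diff_right symmetric_opD[OF sym] res.fcalc_sym)
  have "T u = 0" by (rule positive_form_zero[OF Tbl Tsym]) (simp_all add: T_def inner_diff_left quad)
  then show ?thesis by (simp add: T_def)
qed

end

text \<open>For u = R f one has A u = f - R f, and on a window 1 - 1/(1+x) = x/(1+x) identifies this
  with the symbol x applied to u. Conversely, if u is in the spectral domain with value w, then R (u
  + w) = u, so u lies in the range of \<open>R\<close>, hence in \<open>D\<close>.\<close>

theorem spectral_resolution_exists: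
  fixes D :: "'a::{real_inner,complete_space} set"
  assumes sa: "self_adjoint_op D A" and nn: "nonneg_op D A"
  shows "\<exists>E. is_spectral_resolution D A E"
proof -
  obtain R where R: "bounded_linear R" "symmetric_op R" "\<And>u. R u \<in> D" "\<And>u. R u + A (R u) = u"
    "\<And>u. u \<in> D \<Longrightarrow> R (u + A u) = u" "\<And>u. (norm (R u))\<^sup>2 \<le> inner (R u) u" "\<And>u. norm (R u) \<le> norm u"
    using resolvent_exists[OF sa nn] by metis
  note F = self_adjoint_facts[OF sa]
  have A0: "A 0 = 0" using F(3)[of 0 0] subspace_0[OF F(1)] by simp
  interpret resolvent R
  proof (rule resolvent.intro)
    show "u = 0" if "R u = 0" for u using R(4)[of u] that A0 by simp
  qed (use R in auto)
  have eqf: "res.fcalc f u = res.fcalc g u" if "bounded_borel f" "bounded_borel g" "\<And>x. 0 \<le> x \<Longrightarrow> f x = g x" for f g u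
    using res.fcalc_negative_part[OF E_neg that] by blast
  let ?i = "\<lambda>n. indicator {- real n..real n} :: real \<Rightarrow> real"
  have b1: "bounded_borel (\<lambda>x. x * ?i n x)" for n using locally_bounded_borelD(2)[OF locally_bounded_id] .
  have dom1: "u \<in> spec_dom E (\<lambda>x. x) \<and> spec_op E (\<lambda>x. x) u = A u" if u: "u \<in> D" for u
  proof -
    define f where "f = u + A u"
    have Rf: "R f = u" using R(5)[OF u] by (simp add: f_def)
    have Au: "A u = f - R f" unfolding Rf by (simp add: f_def)
    have cut: "res.cut n (A u) = res.trunc (\<lambda>x. x) n u" for n
    proof -
      have "res.cut n (A u) = res.fcalc (?i n) f - res.fcalc (\<lambda>x. ?i n x * resolvent_fun x) f"
        by (simp add: Au res.cut_def res.fcalc_linear R_fcalc res.fcalc_mult)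
      also have "\<dots> = res.fcalc (\<lambda>x. ?i n x - ?i n x * resolvent_fun x) f" by (simp add: res.fcalc_diff)
      also have "\<dots> = res.fcalc (\<lambda>x. (x * ?i n x) * resolvent_fun x) f"
      proof (rule eqf)
        show "bounded_borel (\<lambda>x. x * ?i n x * resolvent_fun x)"
          by (rule bounded_borel_mult[OF b1 resolvent_fun_bounded])
        show "?i n x - ?i n x * resolvent_fun x = x * ?i n x * resolvent_fun x" if "0 \<le> x" for x
          using that by (simp add: resolvent_fun_def field_simps)
      qed simp
      also have "\<dots> = res.trunc (\<lambda>x. x) n (R f)"
        unfolding res.trunc_def R_fcalc[of f] by (rule res.fcalc_mult[symmetric]) (use b1 in auto)
      finally show ?thesis by (simp only: Rf)
    qed
    show ?thesis using res.spec_opI[OF locally_bounded_id cut] by blast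
  qed
  have dom2: "u \<in> D" if u: "u \<in> spec_dom E (\<lambda>x. x)" for u
  proof -
    define w where "w = spec_op E (\<lambda>x. x) u"
    have "R (u + w) = u"
    proof (rule res.cut_inject)
      fix n
      have "res.cut n (R (u + w)) = R (res.cut n (u + w))"
        by (simp add: R_fcalc res.cut_def res.fcalc_mult mult.commute)
      also have "res.cut n (u + w) = res.fcalc (?i n) u + res.fcalc (\<lambda>x. x * ?i n x) u"
        using res.cut_spec_op[OF locally_bounded_id u, of n] by (simp add: w_def res.cut_def res.fcalc_linear res.trunc_def)
      also have "\<dots> = res.fcalc (\<lambda>x. ?i n x + x * ?i n x) u" using b1 by (simp add: res.fcalc_add)
      also have "R \<dots> = res.fcalc (\<lambda>x. resolvent_fun x * (?i n x + x * ?i n x)) u"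
        by (subst R_fcalc, rule res.fcalc_mult) (use b1 in \<open>auto intro!: bounded_borel_add\<close>)
      also have "\<dots> = res.fcalc (?i n) u"
      proof (rule eqf)
        show "bounded_borel (\<lambda>x. resolvent_fun x * (?i n x + x * ?i n x))"
          by (intro bounded_borel_mult[OF resolvent_fun_bounded] bounded_borel_add b1) simp
        show "resolvent_fun x * (?i n x + x * ?i n x) = ?i n x" if "0 \<le> x" for x
        proof -
          have "?i n x + x * ?i n x = (1 + x) * ?i n x" by (simp add: algebra_simps)
          then show ?thesis using that by (simp add: resolvent_fun_def)
        qed
      qed simp
      finally show "res.cut n (R (u + w)) = res.cut n u" by (simp add: res.cut_def)
    qed
    then show ?thesis using R(3) by metis
  qed
  have "is_spectral_resolution D A E"
    unfolding is_spectral_resolution_def using resolution dom1 dom2 by auto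
  then show ?thesis by blast
qed

text \<open>Proved for every spectral family, since the one used later is picked by
  \<open>SOME\<close>. The component c of u in ]-n, x] or its closure satisfies <A c, c> \<le> x
  |c|^2, which contradicts nonnegativity unless c = 0.\<close>

lemma spectral_resolution_negative:
  fixes D :: "'a::{real_inner,complete_space} set"
  assumes E: "is_spectral_resolution D A E" and nn: "nonneg_op D A" and x: "x < 0"
  shows "E x u = 0"
proof -
  interpret resolution E using E by unfold_locales (simp add: is_spectral_resolution_def)
  let ?i = "\<lambda>n. indicator {- real n..x} :: real \<Rightarrow> real"
  have zero: "fcalc (?i n) u = 0" for n
  proof -
    define c where "c = fcalc (?i n) u"
    have b: "bounded_borel (\<lambda>t. t * ?i n t)"
      using x by (intro bounded_borelI[where K="real n"]) (auto simp: indicator_def)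
    have cut: "cut k (fcalc (\<lambda>t. t * ?i n t) u) = trunc (\<lambda>t. t) k c" for k
    proof -
      have "cut k (fcalc (\<lambda>t. t * ?i n t) u) = fcalc (\<lambda>t. indicator {- real k..real k} t * (t * ?i n t)) u"
        unfolding cut_def by (rule fcalc_mult) (use b in auto)
      also have "\<dots> = fcalc (\<lambda>t. (t * indicator {- real k..real k} t) * ?i n t) u" by (simp only: mult_ac)
      also have "\<dots> = trunc (\<lambda>t. t) k c" unfolding trunc_def c_def
        by (rule fcalc_mult[symmetric]) (use locally_bounded_borelD(2)[OF locally_bounded_id] in auto)
      finally show ?thesis .
    qed
    have "c \<in> D" and Ac: "A c = fcalc (\<lambda>t. t * ?i n t) u"
      using spec_opI[OF locally_bounded_id cut] E by (auto simp: is_spectral_resolution_def)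
    then have "0 \<le> inner (A c) c" using nn by (auto simp: nonneg_op_def)
    also have "\<dots> = (\<integral>t. t * ?i n t * ?i n t \<partial>\<mu> u)"
    proof -
      have "inner (A c) c = inner (fcalc (\<lambda>t. t * ?i n t) u) (fcalc (?i n) u)" by (simp only: Ac) (simp only: c_def)
      then show ?thesis using b by (simp add: fcalc_inner form_self)
    qed
    also have "\<dots> \<le> (\<integral>t. x * (?i n t)\<^sup>2 \<partial>\<mu> u)"
    proof (rule integral_mono)
      show "integrable (\<mu> u) (\<lambda>t. t * ?i n t * ?i n t)" using b by (intro integrable_mu bounded_borel_mult[OF b]) simp
      show "integrable (\<mu> u) (\<lambda>t. x * (?i n t)\<^sup>2)" by (intro integrable_mu bounded_borel_cmult bounded_borel_power2) simp
    qed (auto simp: indicator_def)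
    also have "\<dots> = x * (norm c)\<^sup>2" by (simp add: c_def fcalc_norm2)
    finally have "0 \<le> x * (norm c)\<^sup>2" .
    then have "c = 0" using x by (simp add: zero_le_mult_iff)
    then show ?thesis by (simp add: c_def)
  qed
  have "(\<lambda>n. fcalc (?i n) u) \<longlonglongrightarrow> fcalc (indicator {..x}) u"
  proof (rule fcalc_limit[where K=1])
    show "(\<lambda>n. ?i n t) \<longlonglongrightarrow> indicator {..x} t" for t
    proof (rule tendsto_eventually)
      obtain N :: nat where "- t \<le> real N" using real_arch_simple by blast
      then show "\<forall>\<^sub>F n in sequentially. ?i n t = indicator {..x} t"
        unfolding eventually_sequentially by (intro exI[of _ N]) (auto simp: indicator_def)
    qed
  qed (auto simp: indicator_def)
  then show ?thesis by (simp add: zero LIMSEQ_const_iff fcalc_E)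
qed

section \<open>Differential inequalities\<close>

lemma has_real_derivative_atLeast_subset:
  "0 \<le> a \<Longrightarrow> (f has_real_derivative d) (at t within {0..}) \<Longrightarrow> (f has_real_derivative d) (at t within {a..b})"
  by (rule has_field_derivative_subset) auto

lemma continuous_on_of_real_derivative:
  assumes "0 \<le> a" "\<And>t. t \<in> {a..b} \<Longrightarrow> (f has_real_derivative f' t) (at t within {0..})"
  shows "continuous_on {a..b} f"
  by (rule DERIV_continuous_on) (rule has_real_derivative_atLeast_subset[OF assms(1) assms(2)])

lemma derivative_nonpos_le:
  fixes f :: "real \<Rightarrow> real"
  assumes ab: "0 \<le> a" "a \<le> b" and d: "\<And>t. t \<in> {a..b} \<Longrightarrow> (f has_real_derivative f' t) (at t within {0..})"
    and np: "\<And>t. t \<in> {a..b} \<Longrightarrow> f' t \<le> 0"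
  shows "f b \<le> f a"
proof (cases "a = b")
  case False
  then have "a < b" using ab by simp
  moreover have "(f has_derivative (\<lambda>h. f' t * h)) (at t within {a..b})" if "t \<in> {a..b}" for t
    using has_real_derivative_atLeast_subset[OF ab(1) d[OF that]] by (simp add: has_field_derivative_def)
  ultimately have "\<exists>x\<in>{a<..<b}. f b - f a = f' x * (b - a)"
    by (intro mvt_simple[where f'="\<lambda>t h. f' t * h"]) simp_all
  then obtain x where x: "x \<in> {a<..<b}" "f b - f a = f' x * (b - a)" by blast
  then have "f' x * (b - a) \<le> 0" using ab by (intro mult_nonpos_nonneg np) auto
  then show ?thesis using x by simp
qed simp

text \<open>The upper right Dini derivative of \<open>f\<close> at \<open>t\<close> is at most
  \<open>b\<close>.\<close>

definition dini_le :: "(real \<Rightarrow> real) \<Rightarrow> real \<Rightarrow> real \<Rightarrow> bool" where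
  "dini_le f t b \<longleftrightarrow> (\<forall>\<epsilon>>0. \<forall>\<^sub>F s in at_right t. f s \<le> f t + (b + \<epsilon>) * (s - t))"

lemma derivative_at_right_estimate:
  fixes f :: "real \<Rightarrow> real"
  assumes d: "(f has_real_derivative d) (at t within {0..})" and t: "0 \<le> t" and e: "0 < e"
  shows "\<forall>\<^sub>F s in at_right t. \<bar>f s - f t - d * (s - t)\<bar> \<le> e * (s - t)"
proof -
  have "(f has_real_derivative d) (at t within {t<..})" using t by (intro has_field_derivative_subset[OF d]) auto
  then have "((\<lambda>s. (f s - f t) / (s - t)) \<longlongrightarrow> d) (at_right t)" by (simp add: has_field_derivative_iff)
  then have "\<forall>\<^sub>F s in at_right t. dist ((f s - f t) / (s - t)) d < e" using e by (rule tendstoD)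
  moreover have "\<forall>\<^sub>F s in at_right t. t < s" by (simp add: eventually_at_filter)
  ultimately show ?thesis
  proof eventually_elim
    case (elim s)
    have "f s - f t - d * (s - t) = ((f s - f t) / (s - t) - d) * (s - t)" using elim by (simp add: field_simps)
    then have "\<bar>f s - f t - d * (s - t)\<bar> = \<bar>(f s - f t) / (s - t) - d\<bar> * (s - t)" using elim by (simp add: abs_mult)
    also have "\<dots> \<le> e * (s - t)" using elim by (intro mult_right_mono) (auto simp: dist_real_def)
    finally show ?case .
  qed
qed

text \<open>Comparison with differentiable majorants touching at \<open>t\<close>. The slack in
  their slope absorbs errors that enter multiplied by other factors.\<close>

lemma dini_leI:
  assumes t: "0 \<le> t"
    and ex: "\<And>\<epsilon>. 0 < \<epsilon> \<Longrightarrow> \<exists>\<psi> d. (\<psi> has_real_derivative d) (at t within {0..}) \<and> d \<le> b + \<epsilon> \<and> \<psi> t = f t \<and>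
      (\<forall>\<^sub>F s in at_right t. f s \<le> \<psi> s)"
  shows "dini_le f t b"
  unfolding dini_le_def
proof (intro allI impI)
  fix e :: real assume e: "0 < e"
  then obtain \<psi> d where \<psi>: "(\<psi> has_real_derivative d) (at t within {0..})" "d \<le> b + e / 2" "\<psi> t = f t"
    "\<forall>\<^sub>F s in at_right t. f s \<le> \<psi> s" using ex[of "e/2"] by auto
  have "\<forall>\<^sub>F s in at_right t. \<bar>\<psi> s - \<psi> t - d * (s - t)\<bar> \<le> e / 2 * (s - t)"
    using e by (intro derivative_at_right_estimate[OF \<psi>(1) t]) auto
  moreover have "\<forall>\<^sub>F s in at_right t. t < s" by (simp add: eventually_at_filter)
  ultimately show "\<forall>\<^sub>F s in at_right t. f s \<le> f t + (b + e) * (s - t)" using \<psi>(4)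
  proof eventually_elim
    case (elim s)
    have "d * (s - t) \<le> (b + e / 2) * (s - t)" using \<psi>(2) elim by (intro mult_right_mono) auto
    moreover have "\<psi> s - \<psi> t - d * (s - t) \<le> e / 2 * (s - t)" using elim by (simp only: abs_le_iff)
    moreover have "(b + e) * (s - t) = (b + e / 2) * (s - t) + e / 2 * (s - t)" by (simp add: algebra_simps)
    ultimately show ?case using elim \<psi>(3) by linarith
  qed
qed

lemma dini_le_mono: "dini_le f t b \<Longrightarrow> b \<le> c \<Longrightarrow> dini_le f t c"
  unfolding dini_le_def
proof (intro allI impI)
  fix e :: real assume f: "\<forall>\<epsilon>>0. \<forall>\<^sub>F s in at_right t. f s \<le> f t + (b + \<epsilon>) * (s - t)" and bc: "b \<le> c" and e: "0 < e"
  have "\<forall>\<^sub>F s in at_right t. f s \<le> f t + (b + e) * (s - t)" using f e by blast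
  moreover have "\<forall>\<^sub>F s in at_right t. t < s" by (simp add: eventually_at_filter)
  ultimately show "\<forall>\<^sub>F s in at_right t. f s \<le> f t + (c + e) * (s - t)"
  proof eventually_elim
    case (elim s)
    then show ?case using bc mult_right_mono[of "b + e" "c + e" "s - t"] by linarith
  qed
qed

text \<open>After subtracting a line of small slope e, consider the last point where the bound
  holds. The Dini estimate with e/2 extends the bound to its right, so this point can only be the
  end of the interval.\<close>

lemma dini_nonincreasing:
  fixes f :: "real \<Rightarrow> real"
  assumes ab: "a \<le> b" and cont: "continuous_on {a..b} f" and dini: "\<And>t. t \<in> {a..<b} \<Longrightarrow> dini_le f t 0"
  shows "f b \<le> f a"
proof (rule field_le_epsilon)
  fix d :: real assume d: "0 < d"
  define e where "e = d / (b - a + 1)"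
  have e: "0 < e" using d ab by (simp add: e_def)
  define g where "g s = f s - f a - e * (s - a)" for s
  have "g b \<le> 0"
  proof (rule ccontr)
    assume "\<not> g b \<le> 0"
    define S where "S = {s \<in> {a..b}. g s \<le> 0}"
    have "continuous_on {a..b} g" unfolding g_def by (intro continuous_intros cont)
    then have "closed S" unfolding S_def by (rule continuous_on_closed_Collect_le[OF _ continuous_on_const closed_atLeastAtMost])
    moreover have "bounded S" by (rule bounded_subset[of "{a..b}"]) (auto simp: S_def)
    ultimately have "compact S" by (simp add: compact_eq_bounded_closed)
    moreover have "a \<in> S" using ab by (simp add: S_def g_def)
    ultimately obtain c where c: "c \<in> S" "\<And>s. s \<in> S \<Longrightarrow> s \<le> c" using compact_attains_sup[of S] by blast
    have cb: "c < b" using c(1) \<open>\<not> g b \<le> 0\<close> by (cases "c = b") (auto simp: S_def)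
    have "\<forall>\<^sub>F s in at_right c. f s \<le> f c + e / 2 * (s - c)"
    proof -
      have "dini_le f c 0" using c(1) cb by (intro dini) (auto simp: S_def)
      then show ?thesis using e unfolding dini_le_def by (auto dest: spec[of _ "e/2"])
    qed
    moreover have "\<forall>\<^sub>F s in at_right c. s \<in> {c<..<b}" by (rule eventually_at_rightI[of c b]) (use cb in auto)
    ultimately have "\<forall>\<^sub>F s in at_right c. False"
    proof eventually_elim
      case (elim s)
      have "e / 2 * (s - c) > 0" using e elim by simp
      moreover have "e * (s - a) = e * (c - a) + (e / 2 * (s - c) + e / 2 * (s - c))" by (simp add: algebra_simps)
      ultimately have "g s \<le> g c" using elim unfolding g_def by linarith
      then have "s \<in> S" using c(1) elim by (auto simp: S_def)
      then show ?case using c(2)[of s] elim by auto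
    qed
    then show False by simp
  qed
  then have "f b \<le> f a + e * (b - a)" by (simp add: g_def)
  also have "e * (b - a) \<le> d" using d ab by (simp add: e_def divide_simps algebra_simps)
  finally show "f b \<le> f a + d" by simp
qed

lemma dini_integral:
  fixes f :: "real \<Rightarrow> real"
  assumes T: "0 \<le> T" and cont: "continuous_on {0..T} f"
    and B: "\<And>t. t \<in> {0..T} \<Longrightarrow> (B has_real_derivative b t) (at t within {0..})"
    and dini: "\<And>t. t \<in> {0..<T} \<Longrightarrow> dini_le f t (b t)"
  shows "f T - f 0 \<le> B T - B 0"
proof -
  have "f T - B T \<le> f 0 - B 0"
  proof (rule dini_nonincreasing[OF T])
    show "continuous_on {0..T} (\<lambda>t. f t - B t)"
      by (intro continuous_on_diff cont continuous_on_of_real_derivative[OF order_refl B])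
    fix t assume t: "t \<in> {0..<T}"
    show "dini_le (\<lambda>t. f t - B t) t 0"
    proof (rule dini_leI)
      fix e :: real assume e: "0 < e"
      show "\<exists>\<psi> d. (\<psi> has_real_derivative d) (at t within {0..}) \<and> d \<le> 0 + e \<and> \<psi> t = f t - B t \<and>
          (\<forall>\<^sub>F s in at_right t. f s - B s \<le> \<psi> s)"
      proof (intro exI conjI)
        let ?\<psi> = "\<lambda>s. f t + (b t + e) * (s - t) - B s"
        show "(?\<psi> has_real_derivative (b t + e) - b t) (at t within {0..})"
          using B[of t] t by (auto intro!: derivative_eq_intros)
        show "\<forall>\<^sub>F s in at_right t. f s - B s \<le> ?\<psi> s" using dini[OF t] e by (auto simp: dini_le_def elim: eventually_mono)
      qed auto
    qed (use t in auto)
  qed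
  then show ?thesis by simp
qed

lemma dini_gronwall:
  fixes e :: "real \<Rightarrow> real"
  assumes T: "0 \<le> T" and cont: "continuous_on {0..T} e"
    and K: "\<And>t. t \<in> {0..T} \<Longrightarrow> (K has_real_derivative k t) (at t within {0..})"
    and dini: "\<And>t. t \<in> {0..<T} \<Longrightarrow> dini_le e t (k t * e t)"
  shows "e T \<le> e 0 * exp (K T - K 0)"
proof -
  have "e T * exp (- K T) \<le> e 0 * exp (- K 0)"
  proof (rule dini_nonincreasing[OF T])
    show "continuous_on {0..T} (\<lambda>t. e t * exp (- K t))"
      by (intro continuous_intros cont continuous_on_of_real_derivative[OF order_refl K])
    fix t assume t: "t \<in> {0..<T}"
    show "dini_le (\<lambda>t. e t * exp (- K t)) t 0"
    proof (rule dini_leI)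
      fix d :: real assume d: "0 < d"
      \<comment> \<open>The integrating factor multiplies the error by exp(-K t); this choice leaves
        exactly d.\<close>
      define d' where "d' = d * exp (K t)"
      have d': "0 < d'" using d by (simp add: d'_def)
      show "\<exists>\<psi> c. (\<psi> has_real_derivative c) (at t within {0..}) \<and> c \<le> 0 + d \<and> \<psi> t = e t * exp (- K t) \<and>
          (\<forall>\<^sub>F s in at_right t. e s * exp (- K s) \<le> \<psi> s)"
      proof (intro exI conjI)
        let ?\<psi> = "\<lambda>s. (e t + (k t * e t + d') * (s - t)) * exp (- K s)"
        show "(?\<psi> has_real_derivative (k t * e t + d') * exp (- K t) + e t * (exp (- K t) * (- k t))) (at t within {0..})"
          using K[of t] t by (auto intro!: derivative_eq_intros)
        show "(k t * e t + d') * exp (- K t) + e t * (exp (- K t) * (- k t)) \<le> 0 + d"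
          by (simp add: d'_def exp_minus field_simps)
        show "\<forall>\<^sub>F s in at_right t. e s * exp (- K s) \<le> ?\<psi> s"
          using dini[OF t] d' by (auto simp: dini_le_def elim: eventually_mono)
      qed auto
    qed (use t in auto)
  qed
  then have "e T * exp (- K T) * exp (K T) \<le> e 0 * exp (- K 0) * exp (K T)" by (intro mult_right_mono) auto
  then show ?thesis by (simp add: exp_diff exp_minus field_simps)
qed

section \<open>The blow-up criterion\<close>

text \<open>Abel summation turns the weighted increments of \<phi> into the sums of
  \<phi>(2^n)/2^(n+1), up to a nonnegative boundary term and \<phi>(1). If these were bounded, so
  would be the integral: on [2^n, 2^(n+1)[ the integrand is at most \<phi>(2^(n+1))/4^n over a
  length 2^n.\<close>

lemma dyadic_sums_unbounded:
  fixes \<phi> :: "real \<Rightarrow> real"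
  assumes nn: "\<forall>\<sigma>\<ge>0. 0 \<le> \<phi> \<sigma>" and cont: "continuous_on {0..} \<phi>" and mono: "strict_mono_on {0..} \<phi>"
    and int: "(\<integral>\<^sup>+\<sigma>\<in>{1..}. ennreal (\<phi> \<sigma> / \<sigma>\<^sup>2) \<partial>lborel) = \<infinity>"
  shows "\<exists>N. M < (\<Sum>n<N. (\<phi> (2 ^ Suc n) - \<phi> (2 ^ n)) / 2 ^ Suc n)"
proof (rule ccontr)
  assume "\<nexists>N. M < (\<Sum>n<N. (\<phi> (2 ^ Suc n) - \<phi> (2 ^ n)) / 2 ^ Suc n)"
  then have M: "(\<Sum>n<N. (\<phi> (2 ^ Suc n) - \<phi> (2 ^ n)) / 2 ^ Suc n) \<le> M" for N by (meson not_le)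
  have phi0: "0 \<le> \<phi> (2 ^ n)" for n using nn by simp
  have abel: "(\<Sum>n<N. (\<phi> (2 ^ Suc n) - \<phi> (2 ^ n)) / 2 ^ Suc n) = \<phi> (2 ^ N) / 2 ^ N - \<phi> 1 + (\<Sum>n<N. \<phi> (2 ^ n) / 2 ^ Suc n)" for N
  proof (induction N)
    case (Suc N)
    have "(\<phi> (2 ^ Suc N) - \<phi> (2 ^ N)) / 2 ^ Suc N = \<phi> (2 ^ Suc N) / 2 ^ Suc N - \<phi> (2 ^ N) / 2 ^ N + \<phi> (2 ^ N) / 2 ^ Suc N"
      by (simp add: field_simps)
    then show ?case using Suc unfolding sum.lessThan_Suc by linarith
  qed simp
  have sum_le: "(\<Sum>n<N. \<phi> (2 ^ n) / 2 ^ Suc n) \<le> M + \<phi> 1" for N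
    using M[of N] abel[of N] phi0[of N] by (smt (verit) divide_nonneg_pos zero_less_power)
  define f where "f \<sigma> = indicator {1..} \<sigma> * (\<phi> \<sigma> / \<sigma>\<^sup>2)" for \<sigma> :: real
  have fm [measurable]: "f \<in> borel_measurable borel"
  proof -
    have "continuous_on {1..} (\<lambda>\<sigma>. \<phi> \<sigma> / \<sigma>\<^sup>2)"
      by (intro continuous_intros continuous_on_subset[OF cont]) auto
    then show ?thesis
      using borel_measurable_continuous_on_indicator[of "{1..}" "\<lambda>\<sigma>. \<phi> \<sigma> / \<sigma>\<^sup>2"]
      unfolding f_def[abs_def] real_scaleR_def by simp
  qed
  define I where "I N = (\<integral>\<^sup>+\<sigma>. ennreal (f \<sigma> * indicator {..<2 ^ N} \<sigma>) \<partial>lborel)" for N :: nat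
  have f0: "0 \<le> f \<sigma>" for \<sigma> using nn by (auto simp: f_def indicator_def)
  have I: "I N \<le> ennreal (\<Sum>n<N. 4 * (\<phi> (2 ^ Suc n) / 2 ^ Suc (Suc n)))" for N
  proof (induction N)
    case 0
    have "f \<sigma> * indicator {..<2 ^ 0} \<sigma> = 0" for \<sigma> by (auto simp: f_def indicator_def)
    then show ?case unfolding I_def by (simp only:) simp
  next
    case (Suc N)
    define c where "c = \<phi> (2 ^ Suc N) / (2 ^ N)\<^sup>2"
    have c0: "0 \<le> c" using phi0[of "Suc N"] by (simp add: c_def)
    have "I (Suc N) \<le> (\<integral>\<^sup>+\<sigma>. ennreal (f \<sigma> * indicator {..<2 ^ N} \<sigma>) + ennreal c * indicator {2 ^ N..<2 ^ Suc N} \<sigma> \<partial>lborel)"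
      unfolding I_def
    proof (intro nn_integral_mono)
      fix \<sigma> :: real
      have "f \<sigma> \<le> c" if "2 ^ N \<le> \<sigma>" "\<sigma> < 2 ^ Suc N"
      proof -
        have s1: "1 \<le> \<sigma>" using that(1) one_le_power[of "2::real" N] by linarith
        have "\<phi> \<sigma> \<le> \<phi> (2 ^ Suc N)" using strict_mono_onD[OF mono, of \<sigma> "2 ^ Suc N"] that s1 by auto
        moreover have "(2 ^ N)\<^sup>2 \<le> \<sigma>\<^sup>2" using that by (intro power_mono) auto
        ultimately show ?thesis unfolding f_def c_def using phi0[of "Suc N"] s1 by (auto intro!: frac_le)
      qed
      then show "ennreal (f \<sigma> * indicator {..<2 ^ Suc N} \<sigma>) \<le>
          ennreal (f \<sigma> * indicator {..<2 ^ N} \<sigma>) + ennreal c * indicator {2 ^ N..<2 ^ Suc N} \<sigma>"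
        by (auto simp: indicator_def intro: ennreal_leI)
    qed
    also have "\<dots> = I N + ennreal c * emeasure lborel {2 ^ N..<(2::real) ^ Suc N}"
      unfolding I_def by (subst nn_integral_add) (auto simp: nn_integral_cmult_indicator)
    also have "emeasure lborel {2 ^ N..<(2::real) ^ Suc N} = ennreal (2 ^ N)" by (subst emeasure_lborel_Ico) auto
    also have "ennreal c * ennreal (2 ^ N) = ennreal (4 * (\<phi> (2 ^ Suc N) / 2 ^ Suc (Suc N)))"
      using c0 by (simp add: ennreal_mult[symmetric] c_def power2_eq_square)
    also have "I N + \<dots> \<le> ennreal (\<Sum>n<N. 4 * (\<phi> (2 ^ Suc n) / 2 ^ Suc (Suc n))) + ennreal (4 * (\<phi> (2 ^ Suc N) / 2 ^ Suc (Suc N)))"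
      by (rule add_right_mono[OF Suc])
    also have "\<dots> = ennreal (\<Sum>n<Suc N. 4 * (\<phi> (2 ^ Suc n) / 2 ^ Suc (Suc n)))"
      by (subst ennreal_plus[symmetric])
        (auto intro!: sum_nonneg mult_nonneg_nonneg divide_nonneg_nonneg phi0 simp del: power_Suc)
    finally show ?case .
  qed
  have "(\<Sum>n<N. 4 * (\<phi> (2 ^ Suc n) / 2 ^ Suc (Suc n))) \<le> 4 * (M + \<phi> 1)" for N
  proof -
    have "(\<Sum>n<N. \<phi> (2 ^ Suc n) / 2 ^ Suc (Suc n)) \<le> (\<Sum>n<Suc N. \<phi> (2 ^ n) / 2 ^ Suc n)"
      unfolding sum.lessThan_Suc_shift using phi0[of 0] by (simp add: comp_def)
    also have "\<dots> \<le> M + \<phi> 1" by (rule sum_le)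
    finally have le: "(\<Sum>n<N. \<phi> (2 ^ Suc n) / 2 ^ Suc (Suc n)) \<le> M + \<phi> 1" .
    show ?thesis unfolding sum_distrib_left[symmetric] by (rule mult_left_mono[OF le]) simp
  qed
  then have bound: "I N \<le> ennreal (4 * (M + \<phi> 1))" for N using I[of N] order_trans ennreal_leI by blast
  have "(\<integral>\<^sup>+\<sigma>\<in>{1..}. ennreal (\<phi> \<sigma> / \<sigma>\<^sup>2) \<partial>lborel) = (\<integral>\<^sup>+\<sigma>. (SUP N. ennreal (f \<sigma> * indicator {..<2 ^ N} \<sigma>)) \<partial>lborel)"
  proof (rule nn_integral_cong)
    fix \<sigma> :: real
    obtain N :: nat where N: "\<sigma> < 2 ^ N" using real_arch_pow[of 2 \<sigma>] by auto
    have "(SUP N. ennreal (f \<sigma> * indicator {..<2 ^ N} \<sigma>)) = ennreal (f \<sigma>)"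
    proof (rule antisym)
      show "(SUP N. ennreal (f \<sigma> * indicator {..<2 ^ N} \<sigma>)) \<le> ennreal (f \<sigma>)"
        using f0 by (intro SUP_least ennreal_leI) (auto simp: indicator_def)
      show "ennreal (f \<sigma>) \<le> (SUP N. ennreal (f \<sigma> * indicator {..<2 ^ N} \<sigma>))"
        using N by (intro SUP_upper2[of N]) auto
    qed
    moreover have "ennreal (\<phi> \<sigma> / \<sigma>\<^sup>2) * indicator {1..} \<sigma> = ennreal (f \<sigma>)"
      by (auto simp: f_def indicator_def)
    ultimately show "ennreal (\<phi> \<sigma> / \<sigma>\<^sup>2) * indicator {1..} \<sigma> = (SUP N. ennreal (f \<sigma> * indicator {..<2 ^ N} \<sigma>))"
      by (simp only:)
  qed
  also have "\<dots> = (SUP N. I N)" unfolding I_def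
  proof (rule nn_integral_monotone_convergence_SUP)
    show "incseq (\<lambda>N \<sigma>. ennreal (f \<sigma> * indicator {..<2 ^ N} \<sigma>))"
    proof (rule incseq_SucI, rule le_funI, rule ennreal_leI)
      fix N and \<sigma> :: real
      have "\<sigma> < 2 ^ N \<Longrightarrow> \<sigma> < 2 * 2 ^ N" using zero_less_power[of "2::real" N] by linarith
      then show "f \<sigma> * indicator {..<2 ^ N} \<sigma> \<le> f \<sigma> * indicator {..<2 ^ Suc N} \<sigma>"
        using f0 by (auto simp: indicator_def)
    qed
  qed simp
  also have "\<dots> \<le> ennreal (4 * (M + \<phi> 1))" by (intro SUP_least bound)
  finally show False using int by (simp add: top_unique)
qed

text \<open>Osgood's criterion without inverting \<phi>. While \<open>Y\<close> is below level r
  \<phi>(2^(n+1)) its slope is at most C (1 + 2^(n+1)), so climbing from level n to level n+1 takes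
  at least the time \<open>a n\<close>. The sum of these times diverges, and a level unreachable by
  time \<open>T\<close> depends only on \<open>Y0\<close> and \<open>T\<close>, not on
  \<open>Y\<close>; this makes the bound uniform over truncations.\<close>

lemma no_blow_up:
  fixes \<phi> :: "real \<Rightarrow> real"
  assumes phi: "\<forall>\<sigma>\<ge>0. 0 \<le> \<phi> \<sigma>" "continuous_on {0..} \<phi>" "strict_mono_on {0..} \<phi>"
      "(\<integral>\<^sup>+\<sigma>\<in>{1..}. ennreal (\<phi> \<sigma> / \<sigma>\<^sup>2) \<partial>lborel) = \<infinity>"
    and r: "0 < r" and C: "0 < C"
  shows "\<exists>B\<ge>1. \<forall>Y F. Y 0 \<le> Y0 \<longrightarrow> (\<forall>t\<in>{0..T}. (Y has_real_derivative F t) (at t within {0..})) \<longrightarrow>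
    (\<forall>t\<in>{0..T}. 0 \<le> F t) \<longrightarrow> (\<forall>t\<in>{0..T}. \<forall>l\<ge>1. Y t \<le> r * \<phi> l \<longrightarrow> F t \<le> C * (1 + l)) \<longrightarrow>
    (\<forall>t\<in>{0..T}. Y t \<le> r * \<phi> B)"
proof -
  define p where "p n = \<phi> (2 ^ n)" for n :: nat
  define a where "a n = r * (p (Suc n) - p n) / (C * (1 + 2 ^ Suc n))" for n :: nat
  have pS: "p n < p (Suc n)" for n unfolding p_def by (rule strict_mono_onD[OF phi(3)]) auto
  have a0: "0 \<le> a n" for n using pS[of n] r C by (simp add: a_def add_nonneg_nonneg)
  have dy: "\<exists>N. M < (\<Sum>n<N. (p (Suc n) - p n) / 2 ^ Suc n)" for M
    using dyadic_sums_unbounded[OF phi] by (simp add: p_def)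
  \<comment> \<open>The divergence also forces \<phi> to be unbounded, so some dyadic level lies
    above \<open>Y0\<close>.\<close>
  obtain n0 where n0: "Y0 \<le> r * p n0"
  proof -
    obtain N where N: "Y0 / r < (\<Sum>n<N. (p (Suc n) - p n) / 2 ^ Suc n)" using dy by blast
    also have "\<dots> \<le> (\<Sum>n<N. p (Suc n) - p n)"
    proof (rule sum_mono)
      fix n
      show "(p (Suc n) - p n) / 2 ^ Suc n \<le> p (Suc n) - p n"
        using divide_left_mono[of 1 "2 ^ Suc n" "p (Suc n) - p n"] pS[of n] one_le_power[of "2::real" "Suc n"] by simp
    qed
    also have "\<dots> = p N - p 0" by (rule sum_lessThan_telescope)
    also have "\<dots> \<le> p N" using phi(1) by (simp add: p_def)
    finally show ?thesis using r by (intro that[of N]) (simp add: field_simps)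
  qed
  have a_low: "r / (2 * C) * ((p (Suc n) - p n) / 2 ^ Suc n) \<le> a n" for n
  proof -
    have "a n \<ge> r * (p (Suc n) - p n) / (C * (2 * 2 ^ Suc n))" unfolding a_def
    proof (rule divide_left_mono)
      show "C * (1 + 2 ^ Suc n) \<le> C * (2 * 2 ^ Suc n)" using C one_le_power[of "2::real" "Suc n"] by (intro mult_left_mono) auto
      show "0 \<le> r * (p (Suc n) - p n)" using r pS[of n] by simp
      show "0 < C * (2 * 2 ^ Suc n) * (C * (1 + 2 ^ Suc n))" using C by (simp add: add_pos_pos)
    qed
    then show ?thesis by (simp add: field_simps)
  qed
  define S where "S N = (\<Sum>n\<in>{n0..<N}. a n)" for N
  obtain N1 where N1: "n0 \<le> N1" "T < S N1"
  proof -
    define M0 where "M0 = (\<Sum>n<n0. a n)"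
    obtain N where N: "(\<bar>T\<bar> + M0) * (2 * C) / r < (\<Sum>n<N. (p (Suc n) - p n) / 2 ^ Suc n)" using dy by blast
    then have "\<bar>T\<bar> + M0 < r / (2 * C) * (\<Sum>n<N. (p (Suc n) - p n) / 2 ^ Suc n)" using r C by (simp add: field_simps)
    also have "\<dots> \<le> (\<Sum>n<N. a n)" unfolding sum_distrib_left by (rule sum_mono) (rule a_low)
    finally have lt: "\<bar>T\<bar> + M0 < (\<Sum>n<N. a n)" .
    have "n0 \<le> N"
    proof (rule ccontr)
      assume "\<not> n0 \<le> N"
      then have "(\<Sum>n<N. a n) \<le> M0" unfolding M0_def using a0 by (intro sum_mono2) auto
      then show False using lt by simp
    qed
    moreover from this have "(\<Sum>n<N. a n) = M0 + S N"
      unfolding M0_def S_def by (simp add: lessThan_atLeast0 sum.atLeastLessThan_concat)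
    ultimately show ?thesis using lt by (intro that[of N]) auto
  qed
  have main: "\<forall>t\<in>{0..T}. Y t \<le> r * p N1"
    if Y: "Y 0 \<le> Y0" "\<forall>t\<in>{0..T}. (Y has_real_derivative F t) (at t within {0..})" "\<forall>t\<in>{0..T}. 0 \<le> F t"
      "\<forall>t\<in>{0..T}. \<forall>l\<ge>1. Y t \<le> r * \<phi> l \<longrightarrow> F t \<le> C * (1 + l)" for Y F
  proof -
    have Ymono: "Y s \<le> Y t" if st: "0 \<le> s" "s \<le> t" "t \<le> T" for s t
    proof -
      have "- Y t \<le> - Y s"
      proof (rule derivative_nonpos_le[where f="\<lambda>t. - Y t" and f'="\<lambda>t. - F t"])
        show "((\<lambda>t. - Y t) has_real_derivative - F x) (at x within {0..})" if "x \<in> {s..t}" for x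
          using Y(2) that st by (intro DERIV_minus) auto
      qed (use st Y(3) in auto)
      then show ?thesis by simp
    qed
    have Yc: "continuous_on {0..t} Y" if "t \<le> T" for t
      using Y(2) that by (intro continuous_on_of_real_derivative[where f'=F]) auto
    have claim: "\<forall>t\<in>{0..T}. t \<le> S N \<longrightarrow> Y t \<le> r * p N" if "n0 \<le> N" for N
      using that
    proof (induction N rule: dec_induct)
      case base
      have "Y 0 \<le> r * p n0" using Y(1) n0 by simp
      then show ?case by (auto simp: S_def dest: antisym)
    next
      case (step N)
      have SS: "S (Suc N) = S N + a N" using step(1) by (simp add: S_def)
      show ?case
      proof (intro ballI impI, rule ccontr)
        fix t assume t: "t \<in> {0..T}" "t \<le> S (Suc N)" and "\<not> Y t \<le> r * p (Suc N)"
        then have big: "r * p (Suc N) < Y t" by simp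
        have pn: "p n0 \<le> p (Suc N)" using step(1) lift_Suc_mono_le[of p n0 "Suc N"] pS by (simp add: less_imp_le)
        have "Y 0 \<le> r * p (Suc N)" using Y(1) n0 mult_left_mono[OF pn, of r] r by linarith
        then obtain q where q: "0 \<le> q" "q \<le> t" "Y q = r * p (Suc N)"
          using IVT'[of Y 0 "r * p (Suc N)" t] Yc[of t] big t by auto
        have qt: "q < t" using q big by (cases "q = t") auto
        have strict: "r * p N < r * p (Suc N)" using pS r by simp
        show False
        proof (cases "q \<le> S N")
          case True
          then show False using step(3) q t strict by force
        next
          case False
          \<comment> \<open>At time \<open>S N\<close> the solution is still below level N by
            induction. The time left until \<open>q\<close> is less than \<open>a N\<close>, too
            short for reaching level N+1 with the allowed slope.\<close>
          define s where "s = S N"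
          have s0: "0 \<le> s" unfolding s_def S_def using a0 by (intro sum_nonneg) auto
          have Fle: "F x \<le> C * (1 + 2 ^ Suc N)" if "x \<in> {s..q}" for x
          proof -
            have "Y x \<le> r * \<phi> (2 ^ Suc N)" using Ymono[of x q] that s0 q t by (simp add: p_def)
            then show ?thesis using Y(4) that s0 q t one_le_power[of "2::real" "Suc N"] by auto
          qed
          have "Y q - C * (1 + 2 ^ Suc N) * q \<le> Y s - C * (1 + 2 ^ Suc N) * s"
          proof (rule derivative_nonpos_le[where f="\<lambda>x. Y x - C * (1 + 2 ^ Suc N) * x" and f'="\<lambda>x. F x - C * (1 + 2 ^ Suc N)"])
            fix x assume x: "x \<in> {s..q}"
            then have "(Y has_real_derivative F x) (at x within {0..})" using Y(2) s0 q t by auto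
            then show "((\<lambda>x. Y x - C * (1 + 2 ^ Suc N) * x) has_real_derivative F x - C * (1 + 2 ^ Suc N)) (at x within {0..})"
              by (auto intro!: derivative_eq_intros)
          qed (use Fle False s0 in \<open>auto simp: s_def\<close>)
          moreover have "Y s \<le> r * p N" using step(3) False s0 q t by (simp add: s_def)
          moreover have "C * (1 + 2 ^ Suc N) * (q - s) < C * (1 + 2 ^ Suc N) * a N"
            using qt t(2) SS C by (intro mult_strict_left_mono) (auto simp: s_def add_pos_pos)
          moreover have "C * (1 + 2 ^ Suc N) * a N = r * (p (Suc N) - p N)"
          proof -
            have "C * (1 + 2 ^ Suc N) \<noteq> 0" using C by (simp add: add_pos_pos less_imp_neq[symmetric] del: power_Suc)
            then show ?thesis by (simp add: a_def del: power_Suc)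
          qed
          ultimately show False using q(3) by (simp add: algebra_simps del: power_Suc)
        qed
      qed
    qed
    show ?thesis using claim[OF N1(1)] N1(2) by fastforce
  qed
  show ?thesis
  proof (intro exI[of _ "2 ^ N1"] conjI)
    show "(1::real) \<le> 2 ^ N1" by simp
  qed (use main in \<open>unfold p_def, blast\<close>)
qed

section \<open>Ordinary differential equations in a Hilbert space\<close>

lemma has_vector_derivative_inner:
  assumes "(f has_vector_derivative f') (at t within S)" "(g has_vector_derivative g') (at t within S)"
  shows "((\<lambda>s. inner (f s) (g s)) has_real_derivative (inner (f t) g' + inner f' (g t))) (at t within S)"
proof -
  have "((\<lambda>s. inner (f s) (g s)) has_derivative (\<lambda>h. inner (f t) (h *\<^sub>R g') + inner (h *\<^sub>R f') (g t))) (at t within S)"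
    by (rule has_derivative_inner) (use assms in \<open>simp_all add: has_vector_derivative_def\<close>)
  then show ?thesis by (simp add: has_field_derivative_def distrib_left[symmetric] mult_commute_abs)
qed

lemma has_vector_derivative_bounded_linear:
  "bounded_linear T \<Longrightarrow> (f has_vector_derivative f') F \<Longrightarrow> ((\<lambda>s. T (f s)) has_vector_derivative T f') F"
  by (rule bounded_linear.has_vector_derivative)

lemma continuous_on_of_vector_derivative:
  "(\<And>t. 0 \<le> t \<Longrightarrow> (f has_vector_derivative f' t) (at t within {0..})) \<Longrightarrow> continuous_on {0..} f"
  by (meson atLeast_iff continuous_on_eq_continuous_within has_vector_derivative_continuous)

text \<open>The vector increment is tested against itself, which reduces the mean value inequality
  to the monotonicity of a real function.\<close>

lemma norm_increment_le:
  fixes G :: "real \<Rightarrow> 'a::real_inner"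
  assumes ab: "0 \<le> a" "a \<le> b"
    and G: "\<And>t. t \<in> {a..b} \<Longrightarrow> (G has_vector_derivative g t) (at t within {0..})"
    and h: "\<And>t. t \<in> {a..b} \<Longrightarrow> (h has_real_derivative h' t) (at t within {0..})"
    and le: "\<And>t. t \<in> {a..b} \<Longrightarrow> norm (g t) \<le> h' t"
  shows "norm (G b - G a) \<le> h b - h a"
proof -
  define v where "v = G b - G a"
  have "inner (G b) v - norm v * h b \<le> inner (G a) v - norm v * h a"
  proof (rule derivative_nonpos_le[OF ab, where f="\<lambda>t. inner (G t) v - norm v * h t" and f'="\<lambda>t. inner (g t) v - norm v * h' t"])
    fix t assume t: "t \<in> {a..b}"
    show "((\<lambda>t. inner (G t) v - norm v * h t) has_real_derivative inner (g t) v - norm v * h' t) (at t within {0..})"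
      using has_vector_derivative_inner[OF G[OF t] has_vector_derivative_const[of v]] h[OF t]
      by (auto intro!: derivative_eq_intros)
    have "inner (g t) v \<le> norm (g t) * norm v" by (rule norm_cauchy_schwarz)
    also have "\<dots> \<le> h' t * norm v" using le[OF t] by (rule mult_right_mono) simp
    finally show "inner (g t) v - norm v * h' t \<le> 0" by (simp add: mult.commute)
  qed
  then have "norm v * norm v \<le> norm v * (h b - h a)"
    by (simp add: v_def power2_eq_square[symmetric] power2_norm_eq_inner inner_diff_left right_diff_distrib)
  moreover have "h a \<le> h b"
    using derivative_nonpos_le[OF ab, of "\<lambda>t. - h t" "\<lambda>t. - h' t"] h order_trans[OF norm_ge_zero le]
    by (auto intro: DERIV_minus)
  ultimately show ?thesis by (cases "v = 0") (auto simp: v_def)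
qed

text \<open>Weak differentiability alone is not uniform in the test vector. Continuity of
  \<open>g\<close> gives the uniformity: over a short interval the error of the difference quotient
  is tested against itself.\<close>

lemma weak_derivative_imp_derivative:
  fixes G :: "real \<Rightarrow> 'a::real_inner"
  assumes weak: "\<And>v t. 0 \<le> t \<Longrightarrow> ((\<lambda>s. inner (G s) v) has_real_derivative inner (g t) v) (at t within {0..})"
    and cont: "continuous_on {0..} g" and t: "0 \<le> t"
  shows "(G has_vector_derivative g t) (at t within {0..})"
  unfolding has_vector_derivative_def has_derivative_within_alt
proof (intro conjI allI impI)
  show "bounded_linear (\<lambda>x. x *\<^sub>R g t)" by (rule bounded_linear_scaleR_left)
  fix e :: real assume e: "0 < e"
  have "\<exists>d>0. \<forall>s\<in>{0..}. dist s t < d \<longrightarrow> dist (g s) (g t) < e"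
    using cont e t unfolding continuous_on_iff by auto
  then obtain d where d: "0 < d" "\<And>s. 0 \<le> s \<Longrightarrow> \<bar>s - t\<bar> < d \<Longrightarrow> norm (g s - g t) < e"
    by (auto simp: dist_norm)
  have inc: "norm (G b - G a - (b - a) *\<^sub>R g t) \<le> e * (b - a)"
    if ab: "0 \<le> a" "a \<le> b" and near: "\<And>s. s \<in> {a..b} \<Longrightarrow> \<bar>s - t\<bar> < d" for a b
  proof -
    define v where "v = G b - G a - (b - a) *\<^sub>R g t"
    have "inner (G b) v - b * inner (g t) v - norm v * (e * b) \<le> inner (G a) v - a * inner (g t) v - norm v * (e * a)"
    proof (rule derivative_nonpos_le[OF ab, where f="\<lambda>s. inner (G s) v - s * inner (g t) v - norm v * (e * s)"
          and f'="\<lambda>s. inner (g s) v - inner (g t) v - norm v * e"])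
      fix s assume s: "s \<in> {a..b}"
      show "((\<lambda>s. inner (G s) v - s * inner (g t) v - norm v * (e * s)) has_real_derivative
          inner (g s) v - inner (g t) v - norm v * e) (at s within {0..})"
        using weak[of s v] s ab by (auto intro!: derivative_eq_intros)
      have "inner (g s) v - inner (g t) v = inner (g s - g t) v" by (simp add: inner_diff_left)
      also have "\<dots> \<le> norm (g s - g t) * norm v" by (rule norm_cauchy_schwarz)
      also have "\<dots> \<le> e * norm v" using d(2)[of s] near[OF s] s ab by (intro mult_right_mono) auto
      finally show "inner (g s) v - inner (g t) v - norm v * e \<le> 0" by (simp add: mult.commute)
    qed
    then have "norm v * norm v \<le> norm v * (e * (b - a))"
      by (simp add: v_def power2_eq_square[symmetric] power2_norm_eq_inner inner_diff_left inner_diff_right algebra_simps)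
    then show ?thesis using e ab by (cases "v = 0") (auto simp: v_def)
  qed
  show "\<exists>d>0. \<forall>y\<in>{0..}. norm (y - t) < d \<longrightarrow> norm (G y - G t - (y - t) *\<^sub>R g t) \<le> e * norm (y - t)"
  proof (intro exI[of _ d] conjI ballI impI d(1))
    fix y assume y: "y \<in> {0..}" "norm (y - t) < d"
    show "norm (G y - G t - (y - t) *\<^sub>R g t) \<le> e * norm (y - t)"
    proof (cases "t \<le> y")
      case True
      then show ?thesis using inc[OF t True] y by auto
    next
      case False
      have "norm (G t - G y - (t - y) *\<^sub>R g t) \<le> e * (t - y)" using inc[of y t] False y by auto
      moreover have "G y - G t - (y - t) *\<^sub>R g t = - (G t - G y - (t - y) *\<^sub>R g t)" by (simp add: algebra_simps)
      ultimately show ?thesis using False by (metis abs_minus_commute abs_of_nonneg diff_ge_0_iff_ge linear norm_minus_cancel real_norm_def)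
    qed
  qed
qed

text \<open>\<open>{real_inner, complete_space}\<close> is not a subsort of \<open>banach\<close>, so the integral is taken weakly.\<close>

lemma primitive_exists:
  fixes g :: "real \<Rightarrow> 'a::{real_inner,complete_space}"
  assumes cont: "continuous_on {0..} g"
  shows "\<exists>G. G 0 = 0 \<and> (\<forall>t\<ge>0. (G has_vector_derivative g t) (at t within {0..}))"
proof -
  have ci: "continuous_on {0..t} (\<lambda>s. inner (g s) v)" for t v
    by (intro continuous_intros continuous_on_subset[OF cont]) auto
  have "\<exists>w. \<forall>v. integral {0..t} (\<lambda>s. inner (g s) v) = inner w v" for t
  proof -
    have int: "(\<lambda>s. inner (g s) v) integrable_on {0..t}" for v by (rule integrable_continuous_real[OF ci])
    have "compact (g ` {0..t})" by (intro compact_continuous_image continuous_on_subset[OF cont]) auto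
    then obtain M where M: "\<And>s. s \<in> {0..t} \<Longrightarrow> norm (g s) \<le> M" using compact_imp_bounded bounded_iff by (metis image_eqI)
    have "\<exists>w\<in>UNIV. \<forall>v\<in>UNIV. integral {0..t} (\<lambda>s. inner (g s) v) = inner w v"
    proof (rule riesz_on_subspace[where K="\<bar>M\<bar> * \<bar>t\<bar>"])
      fix u v :: 'a and c :: real
      show "integral {0..t} (\<lambda>s. inner (g s) (u + v)) = integral {0..t} (\<lambda>s. inner (g s) u) + integral {0..t} (\<lambda>s. inner (g s) v)"
        unfolding inner_add_right by (rule integral_add[OF int int])
      show "integral {0..t} (\<lambda>s. inner (g s) (c *\<^sub>R u)) = c * integral {0..t} (\<lambda>s. inner (g s) u)" by simp
      show "\<bar>integral {0..t} (\<lambda>s. inner (g s) u)\<bar> \<le> \<bar>M\<bar> * \<bar>t\<bar> * norm u"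
      proof (cases "0 \<le> t")
        case True
        have "norm (integral {0..t} (\<lambda>s. inner (g s) u)) \<le> (\<bar>M\<bar> * norm u) * (t - 0)"
        proof (rule integral_bound[OF True ci])
          fix s assume "s \<in> {0..t}"
          then have "norm (g s) \<le> \<bar>M\<bar>" using M[of s] by linarith
          then show "norm (inner (g s) u) \<le> \<bar>M\<bar> * norm u"
            using order_trans[OF Cauchy_Schwarz_ineq2 mult_right_mono] by simp
        qed
        then show ?thesis using True by (simp add: mult_ac)
      next
        case False
        then have "integral {0..t} (\<lambda>s. inner (g s) u) = 0" by simp
        then show ?thesis by (simp only: abs_zero mult_nonneg_nonneg abs_ge_zero norm_ge_zero)
      qed
    qed auto
    then show ?thesis by auto
  qed
  then obtain G where G: "\<And>t v. integral {0..t} (\<lambda>s. inner (g s) v) = inner (G t) v" by metis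
  have "((\<lambda>s. inner (G s) v) has_real_derivative inner (g t) v) (at t within {0..})" if t: "0 \<le> t" for v t
  proof -
    have "((\<lambda>s. integral {0..s} (\<lambda>s. inner (g s) v)) has_real_derivative inner (g t) v) (at t within {0..t+1})"
      by (rule integral_has_real_derivative[OF ci]) (use t in auto)
    then have "((\<lambda>s. inner (G s) v) has_real_derivative inner (g t) v) (at t within {0..t+1})" by (simp add: G)
    moreover have "at t within {0..t+1} = at t within {0..}"
      using t by (intro at_within_nhd[of t "{..<t+1}"]) auto
    ultimately show ?thesis by simp
  qed
  then have "\<forall>t\<ge>0. (G has_vector_derivative g t) (at t within {0..})"
    using weak_derivative_imp_derivative[OF _ cont] by blast
  moreover have "G 0 = 0" by (rule inner_eqI) (simp flip: G)
  ultimately show ?thesis by blast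
qed

text \<open>Picard iteration on \<open>[0,\<infinity>)\<close> in the weighted norm \<open>sup e\<^sup>-\<^sup>2\<^sup>L\<^sup>t \<bar>x(t)\<bar>\<close>.\<close>

lemma picard_global:
  fixes F :: "'a::{real_inner,complete_space} \<Rightarrow> 'a"
  assumes L: "0 < L" and F: "\<And>x y. norm (F x - F y) \<le> L * norm (x - y)"
  shows "\<exists>x. x 0 = x0 \<and> (\<forall>t\<ge>0. (x has_vector_derivative F (x t)) (at t within {0..}))"
proof -
  \<comment> \<open>Integrating the weight exp(K t) gains 1/K, so the Picard map has Lipschitz
    constant L/K = 1/2.\<close>
  define K where "K = 2 * L"
  have K: "0 < K" using L by (simp add: K_def)
  have Fc: "continuous_on UNIV F"
  proof -
    have "L-lipschitz_on UNIV F" using L F by (auto simp: lipschitz_on_def dist_norm)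
    then show ?thesis by (rule lipschitz_on_continuous_on)
  qed
  define rhs where "rhs y t = F (exp (K * t) *\<^sub>R apply_bcontfun y t)" for y :: "real \<Rightarrow>\<^sub>C 'a" and t
  have rc: "continuous_on {0..} (rhs y)" for y
    unfolding rhs_def by (intro continuous_on_compose2[OF Fc] continuous_intros continuous_on_apply_bcontfun) auto
  obtain P where P0: "\<And>y. P y 0 = 0" and P: "\<And>y t. 0 \<le> t \<Longrightarrow> (P y has_vector_derivative rhs y t) (at t within {0..})"
    using primitive_exists[OF rc] by metis
  have Pc: "continuous_on {0..} (P y)" for y by (rule continuous_on_of_vector_derivative[OF P])
  have expd: "((\<lambda>t. C / K * exp (K * t)) has_real_derivative C * exp (K * t)) (at t within {0..})" for C t
    using K by (auto intro!: derivative_eq_intros)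
  \<comment> \<open>Bounded continuous functions here live on the whole line; \<open>max 0 t\<close>
    continues the iterate by a constant to negative times.\<close>
  define q where "q y t = exp (- K * max 0 t) *\<^sub>R (x0 + P y (max 0 t))" for y t
  have Pb: "norm (P y t) \<le> C / K * exp (K * t)" if "0 \<le> t" "\<And>s. 0 \<le> s \<Longrightarrow> norm (rhs y s) \<le> C * exp (K * s)" "0 \<le> C" for y t C
  proof -
    have "norm (P y t - P y 0) \<le> C / K * exp (K * t) - C / K * exp (K * 0)"
      by (rule norm_increment_le[OF order_refl that(1) P expd]) (use that in auto)
    then show ?thesis using that(3) K by (simp add: P0 field_simps)
  qed
  have qb: "q y \<in> bcontfun" for y
  proof -
    obtain B where B: "\<And>t. norm (apply_bcontfun y t) \<le> B"
      using apply_bcontfun[of y] unfolding bcontfun_def bounded_iff by auto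
    have B0: "0 \<le> B" using order_trans[OF norm_ge_zero B] .
    define C where "C = norm (F 0) + L * B"
    have C0: "0 \<le> C" using B0 L by (simp add: C_def)
    have rb: "norm (rhs y s) \<le> C * exp (K * s)" if "0 \<le> s" for s
    proof -
      have "norm (rhs y s) \<le> norm (F 0) + norm (rhs y s - F 0)" by (metis add.commute diff_add_cancel norm_triangle_ineq)
      also have "norm (rhs y s - F 0) \<le> L * norm (exp (K * s) *\<^sub>R apply_bcontfun y s - 0)" unfolding rhs_def by (rule F)
      also have "\<dots> \<le> L * (exp (K * s) * B)" using B L by (auto intro!: mult_left_mono)
      also have "norm (F 0) + L * (exp (K * s) * B) \<le> norm (F 0) * exp (K * s) + L * (exp (K * s) * B)"
        using that K mult_left_mono[of 1 "exp (K * s)" "norm (F 0)"] by simp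
      finally show ?thesis by (simp add: C_def algebra_simps)
    qed
    show ?thesis
    proof (rule bcontfun_normI)
      show "continuous_on UNIV (q y)" unfolding q_def
        by (intro continuous_intros continuous_on_compose2[OF Pc]) auto
      fix t :: real
      let ?t = "max 0 t"
      have "norm (q y t) \<le> exp (- K * ?t) * (norm x0 + C / K * exp (K * ?t))"
        unfolding q_def norm_scaleR using Pb[OF _ rb C0, of ?t] norm_triangle_ineq[of x0 "P y ?t"] by auto
      also have "\<dots> = exp (- K * ?t) * norm x0 + C / K" by (simp add: algebra_simps exp_minus)
      also have "\<dots> \<le> norm x0 + C / K" using K by (simp add: mult_left_le_one_le)
      finally show "norm (q y t) \<le> norm x0 + C / K" .
    qed
  qed
  define Q where "Q y = Bcontfun (q y)" for y
  have Q: "apply_bcontfun (Q y) = q y" for y unfolding Q_def by (rule Bcontfun_inverse[OF qb])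
  have "\<exists>!y. Q y = y"
  proof (rule banach_fix_type[of "1/2"])
    show "\<forall>y z. dist (Q y) (Q z) \<le> 1/2 * dist y z"
    proof (intro allI dist_bound)
      fix y z :: "real \<Rightarrow>\<^sub>C 'a" and t :: real
      let ?t = "max 0 t" and ?C = "L * dist y z"
      have d: "norm (rhs y s - rhs z s) \<le> ?C * exp (K * s)" for s
      proof -
        have "norm (rhs y s - rhs z s) \<le> L * norm (exp (K * s) *\<^sub>R (apply_bcontfun y s - apply_bcontfun z s))"
          unfolding rhs_def scaleR_diff_right by (rule F)
        also have "\<dots> \<le> L * (exp (K * s) * dist y z)"
          using L dist_bounded[of y s z] by (auto simp: dist_norm intro!: mult_left_mono)
        finally show ?thesis by (simp add: mult_ac)
      qed
      have "norm ((P y ?t - P z ?t) - (P y 0 - P z 0)) \<le> ?C / K * exp (K * ?t) - ?C / K * exp (K * 0)"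
        by (rule norm_increment_le[where G="\<lambda>t. P y t - P z t" and g="\<lambda>t. rhs y t - rhs z t", OF _ _ _ expd d])
          (auto intro!: has_vector_derivative_diff P)
      then have "norm (P y ?t - P z ?t) \<le> ?C / K * exp (K * ?t) - ?C / K" by (simp add: P0)
      also have "\<dots> \<le> ?C / K * exp (K * ?t)" using L K by simp
      finally have "exp (- K * ?t) * norm (P y ?t - P z ?t) \<le> exp (- K * ?t) * (?C / K * exp (K * ?t))"
        by (intro mult_left_mono) auto
      also have "\<dots> = ?C / K" by (simp add: exp_minus)
      also have "\<dots> = 1/2 * dist y z" using L by (simp add: K_def)
      finally show "dist (apply_bcontfun (Q y) t) (apply_bcontfun (Q z) t) \<le> 1/2 * dist y z"
        by (simp add: Q q_def dist_norm flip: scaleR_diff_right)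
    qed
  qed auto
  then obtain y where y: "Q y = y" by blast
  define x where "x t = exp (K * t) *\<^sub>R apply_bcontfun y t" for t
  have xP: "x t = x0 + P y t" if "0 \<le> t" for t
  proof -
    have "apply_bcontfun y t = exp (- K * t) *\<^sub>R (x0 + P y t)" using that fun_cong[OF Q, of y t] by (simp add: y q_def)
    then show ?thesis by (simp add: x_def exp_minus)
  qed
  have "(x has_vector_derivative F (x t)) (at t within {0..})" if t: "0 \<le> t" for t
  proof (rule has_vector_derivative_transform[where f="\<lambda>t. x0 + P y t"])
    have "((\<lambda>t. x0 + P y t) has_vector_derivative 0 + rhs y t) (at t within {0..})"
      by (intro has_vector_derivative_add has_vector_derivative_const P t)
    then show "((\<lambda>t. x0 + P y t) has_vector_derivative F (x t)) (at t within {0..})" by (simp add: rhs_def x_def)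
  qed (use t xP in auto)
  moreover have "x 0 = x0" using xP[of 0] P0 by simp
  ultimately show ?thesis by blast
qed

section \<open>Spectral truncations of the Kirchhoff equation\<close>

text \<open>\<open>lam\<close>, \<open>rt\<close> and \<open>qrt\<close> are the symbols of A,
  A^(1/2) and A^(1/4). The positive part makes them continuous on the whole line.\<close>

definition lam :: "real \<Rightarrow> real" where "lam x = max 0 x"
definition rt :: "real \<Rightarrow> real" where "rt x = sqrt (lam x)"
definition qrt :: "real \<Rightarrow> real" where "qrt x = sqrt (rt x)"

lemma lam_nonneg [simp]: "0 \<le> lam x" and rt_nonneg [simp]: "0 \<le> rt x" and qrt_nonneg [simp]: "0 \<le> qrt x"
  by (auto simp: lam_def rt_def qrt_def)

lemma rt_rt: "rt x * rt x = lam x" and qrt_qrt: "qrt x * qrt x = rt x"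
  by (auto simp: rt_def qrt_def)

lemma locally_bounded_continuous:
  assumes "continuous_on UNIV f" shows "locally_bounded_borel f"
  unfolding locally_bounded_borel_def
proof (intro conjI allI)
  show f: "f \<in> borel_measurable borel" using assms by (rule borel_measurable_continuous_onI)
  fix n :: nat
  have "compact (f ` {- real n..real n})" by (intro compact_continuous_image continuous_on_subset[OF assms]) auto
  then obtain M where M: "\<And>x. x \<in> {- real n..real n} \<Longrightarrow> norm (f x) \<le> M" using compact_imp_bounded bounded_iff by (metis image_eqI)
  show "bounded_borel (\<lambda>x. f x * indicator {- real n..real n} x)"
  proof (rule bounded_borelI[where K="\<bar>M\<bar>"])
    show "(\<lambda>x. f x * indicator {- real n..real n} x) \<in> borel_measurable borel" using f by simp
    show "\<bar>f x * indicator {- real n..real n} x\<bar> \<le> \<bar>M\<bar>" for x using M[of x] by (auto simp: indicator_def)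
  qed
qed

lemma continuous_lam: "continuous_on UNIV lam" and continuous_rt: "continuous_on UNIV rt"
  and continuous_qrt: "continuous_on UNIV qrt"
  unfolding lam_def[abs_def] rt_def[abs_def] qrt_def[abs_def] by (intro continuous_intros)+

lemma lb_lam [simp]: "locally_bounded_borel lam" and lb_rt [simp]: "locally_bounded_borel rt"
  and lb_qrt [simp]: "locally_bounded_borel qrt"
  by (intro locally_bounded_continuous continuous_lam continuous_rt continuous_qrt)+

context resolution begin

lemma trunc_sym: "locally_bounded_borel f \<Longrightarrow> inner (trunc f n u) v = inner u (trunc f n v)"
  unfolding trunc_def by (intro fcalc_sym locally_bounded_borelD)

lemma trunc_inner:
  assumes "locally_bounded_borel f" "locally_bounded_borel g"
  shows "inner (trunc f n u) (trunc g n v) = inner (trunc (\<lambda>x. f x * g x) n u) v"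
proof -
  have "inner (trunc f n u) (trunc g n v) = inner (trunc g n (trunc f n u)) v" by (simp add: trunc_sym[OF assms(2)])
  also have "trunc g n (trunc f n u) = trunc (\<lambda>x. f x * g x) n u"
    using trunc_trunc(1)[OF assms(2,1) order_refl, of n u] by (simp add: mult.commute)
  finally show ?thesis .
qed

lemma trunc_quad: "locally_bounded_borel g \<Longrightarrow>
    inner (trunc g n u) u = (\<integral>x. g x * indicator {- real n..real n} x \<partial>\<mu> u)"
  unfolding trunc_def by (intro fcalc_quad locally_bounded_borelD)

lemma trunc_quad_mono:
  assumes "locally_bounded_borel g" "locally_bounded_borel h" "\<And>x. g x \<le> h x"
  shows "inner (trunc g n u) u \<le> inner (trunc h n u) u"
  unfolding trunc_quad[OF assms(1)] trunc_quad[OF assms(2)]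
  by (intro integral_mono integrable_mu locally_bounded_borelD(2) assms) (auto intro: mult_right_mono assms)

lemma trunc_quad_nonneg:
  assumes "locally_bounded_borel g" "\<And>x. 0 \<le> g x" shows "0 \<le> inner (trunc g n u) u"
  unfolding trunc_quad[OF assms(1)] by (intro Bochner_Integration.integral_nonneg) (simp add: assms)

lemma trunc_add: "locally_bounded_borel f \<Longrightarrow> locally_bounded_borel g \<Longrightarrow>
    trunc (\<lambda>x. f x + g x) n u = trunc f n u + trunc g n u"
  unfolding trunc_def distrib_right by (intro fcalc_add locally_bounded_borelD)

lemma trunc_cmult: "locally_bounded_borel f \<Longrightarrow> trunc (\<lambda>x. c * f x) n u = c *\<^sub>R trunc f n u"
  unfolding trunc_def mult.assoc by (intro fcalc_cmult locally_bounded_borelD)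

lemma norm_trunc_sq: "locally_bounded_borel f \<Longrightarrow> (norm (trunc f n u))\<^sup>2 = inner (trunc (\<lambda>x. f x * f x) n u) u"
  unfolding power2_norm_eq_inner by (rule trunc_inner)

lemma trunc_bound:
  assumes "locally_bounded_borel f" obtains K where "0 < K" "\<And>u. norm (trunc f n u) \<le> K * norm u"
proof -
  obtain K where K: "0 \<le> K" "\<And>x. \<bar>f x * indicator {- real n..real n} x\<bar> \<le> K"
    by (rule bounded_borelE[OF locally_bounded_borelD(2)[OF assms, of n]]) (rule that)
  have "norm (trunc f n u) \<le> K * norm u" for u
    unfolding trunc_def using fcalc_norm_le[OF locally_bounded_borelD(2)[OF assms] K(2)] .
  then have "norm (trunc f n u) \<le> (K + 1) * norm u" for u
    by (rule order_trans) (simp add: mult_right_mono)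
  then show ?thesis using K(1) by (intro that[of "K + 1"]) auto
qed

lemma trunc_quad_derivative:
  assumes g: "locally_bounded_borel g" and w: "(w has_vector_derivative w') (at t within S)"
  shows "((\<lambda>s. inner (trunc g n (w s)) (w s)) has_real_derivative 2 * inner (trunc g n (w t)) w') (at t within S)"
proof -
  have "inner (trunc g n w') (w t) = inner (trunc g n (w t)) w'" by (metis trunc_sym[OF g] inner_commute)
  then show ?thesis
    using has_vector_derivative_inner[OF has_vector_derivative_bounded_linear[OF trunc_bl[OF g, of n] w] w] by simp
qed

text \<open>The terms with \<open>c t\<close> and first derivatives cancel between kinetic and
  potential part. What remains is the work of the forcing \<open>z\<close> and the variation of
  \<open>c\<close>; the latter multiplies a nonnegative quadratic form, so a one-sided bound on
  \<open>c\<close> is enough.\<close>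

lemma energy_dini:
  fixes w w1 z :: "real \<Rightarrow> 'a" and c :: "real \<Rightarrow> real"
  assumes g: "locally_bounded_borel g" "\<And>x. 0 \<le> g x" and t: "0 \<le> t"
    and w: "(w has_vector_derivative w1 t) (at t within {0..})"
    and w1: "(w1 has_vector_derivative (z t - c t *\<^sub>R trunc lam n (w t))) (at t within {0..})"
    and c: "dini_le c t \<kappa>"
  shows "dini_le (\<lambda>t. inner (trunc g n (w1 t)) (w1 t) + c t * inner (trunc (\<lambda>x. g x * lam x) n (w t)) (w t)) t
    (2 * inner (trunc g n (w1 t)) (z t) + \<kappa> * inner (trunc (\<lambda>x. g x * lam x) n (w t)) (w t))"
proof (rule dini_leI[OF t])
  define p where "p s = inner (trunc g n (w1 s)) (w1 s)" for s
  define q where "q s = inner (trunc (\<lambda>x. g x * lam x) n (w s)) (w s)" for s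
  have gl: "locally_bounded_borel (\<lambda>x. g x * lam x)" using g by (simp add: locally_bounded_mult)
  have q0: "0 \<le> q s" for s unfolding q_def by (rule trunc_quad_nonneg[OF gl]) (simp add: g)
  have dq: "(q has_real_derivative 2 * inner (trunc (\<lambda>x. g x * lam x) n (w t)) (w1 t)) (at t within {0..})"
    unfolding q_def by (rule trunc_quad_derivative[OF gl w])
  have dp: "(p has_real_derivative 2 * inner (trunc g n (w1 t)) (z t - c t *\<^sub>R trunc lam n (w t))) (at t within {0..})"
    unfolding p_def by (rule trunc_quad_derivative[OF g(1) w1])
  have cross: "inner (trunc g n (w1 t)) (trunc lam n (w t)) = inner (trunc (\<lambda>x. g x * lam x) n (w t)) (w1 t)"
    using trunc_inner[OF g(1) lb_lam, of n "w1 t" "w t"] trunc_sym[OF gl, of n "w1 t" "w t"]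
    by (simp only: inner_commute[of "w1 t"])
  fix \<epsilon> :: real assume \<epsilon>: "0 < \<epsilon>"
  \<comment> \<open>Chosen so that the slack in the slope of \<open>c\<close>, multiplied by the
    potential term \<open>q t\<close>, stays below the prescribed one; the 1 covers
    \<open>q t = 0\<close>.\<close>
  define \<epsilon>' where "\<epsilon>' = \<epsilon> / (q t + 1)"
  have e1: "0 < \<epsilon>'" using \<epsilon> q0[of t] by (simp add: \<epsilon>'_def)
  have e2: "\<epsilon>' * q t \<le> \<epsilon>" using \<epsilon> q0[of t] by (simp add: \<epsilon>'_def divide_simps)
  show "\<exists>\<psi> d. (\<psi> has_real_derivative d) (at t within {0..}) \<and>
      d \<le> 2 * inner (trunc g n (w1 t)) (z t) + \<kappa> * inner (trunc (\<lambda>x. g x * lam x) n (w t)) (w t) + \<epsilon> \<and>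
      \<psi> t = inner (trunc g n (w1 t)) (w1 t) + c t * inner (trunc (\<lambda>x. g x * lam x) n (w t)) (w t) \<and>
      (\<forall>\<^sub>F s in at_right t. inner (trunc g n (w1 s)) (w1 s) + c s * inner (trunc (\<lambda>x. g x * lam x) n (w s)) (w s) \<le> \<psi> s)"
    unfolding p_def[symmetric] q_def[symmetric]
  proof (intro exI conjI)
    let ?\<psi> = "\<lambda>s. p s + (c t + (\<kappa> + \<epsilon>') * (s - t)) * q s"
    let ?q' = "2 * inner (trunc (\<lambda>x. g x * lam x) n (w t)) (w1 t)"
    let ?p' = "2 * inner (trunc g n (w1 t)) (z t - c t *\<^sub>R trunc lam n (w t))"
    show "(?\<psi> has_real_derivative ?p' + (c t * ?q' + (\<kappa> + \<epsilon>') * q t)) (at t within {0..})"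
      by (rule derivative_eq_intros dp dq refl | simp)+
    show "?p' + (c t * ?q' + (\<kappa> + \<epsilon>') * q t) \<le> 2 * inner (trunc g n (w1 t)) (z t) + \<kappa> * q t + \<epsilon>"
      using e2 by (simp add: inner_diff_right cross algebra_simps)
    show "\<forall>\<^sub>F s in at_right t. p s + c s * q s \<le> ?\<psi> s"
      using c e1 unfolding dini_le_def by (auto elim!: eventually_mono intro!: mult_right_mono q0)
  qed simp
qed

end

lemma second_order_ode:
  fixes G :: "'a::{real_inner,complete_space} \<Rightarrow> 'a"
  assumes L: "0 \<le> L" and G: "\<And>x y. norm (G x - G y) \<le> L * norm (x - y)"
  obtains u v where "u 0 = a" "v 0 = b" "\<And>t. 0 \<le> t \<Longrightarrow> (u has_vector_derivative v t) (at t within {0..})"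
    "\<And>t. 0 \<le> t \<Longrightarrow> (v has_vector_derivative - G (u t)) (at t within {0..})"
proof -
  define F where "F x = (snd x, - G (fst x))" for x :: "'a \<times> 'a"
  have F: "norm (F x - F y) \<le> (1 + L) * norm (x - y)" for x y
  proof -
    have "norm (F x - F y) \<le> norm (snd x - snd y) + norm (G (fst x) - G (fst y))"
      unfolding F_def using norm_Pair_le[of "snd x - snd y" "- G (fst x) + G (fst y)"]
      by (simp add: norm_minus_commute)
    also have "\<dots> \<le> norm (snd (x - y)) + L * norm (fst (x - y))" using G by (intro add_mono) auto
    also have "\<dots> \<le> norm (x - y) + L * norm (x - y)"
    proof -
      have "norm (snd z) \<le> norm z" "norm (fst z) \<le> norm z" for z :: "'a \<times> 'a"
        using norm_snd_le[of "snd z" "fst z"] norm_fst_le[of "fst z" "snd z"] by auto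
      then show ?thesis using L by (intro add_mono mult_left_mono)
    qed
    finally show ?thesis by (simp add: algebra_simps)
  qed
  have "0 < 1 + L" using L by simp
  then obtain x where x: "x 0 = (a, b)" "\<And>t. 0 \<le> t \<Longrightarrow> (x has_vector_derivative F (x t)) (at t within {0..})"
    using picard_global[of "1 + L" F "(a, b)"] F by blast
  show ?thesis
  proof (rule that[of "\<lambda>t. fst (x t)" "\<lambda>t. snd (x t)"])
    show "((\<lambda>t. fst (x t)) has_vector_derivative snd (x t)) (at t within {0..})" if "0 \<le> t" for t
      using has_vector_derivative_bounded_linear[OF bounded_linear_fst x(2)[OF that]] by (simp add: F_def)
    show "((\<lambda>t. snd (x t)) has_vector_derivative - G (fst (x t))) (at t within {0..})" if "0 \<le> t" for t
      using has_vector_derivative_bounded_linear[OF bounded_linear_snd x(2)[OF that]] by (simp add: F_def)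
  qed (use x in auto)
qed

text \<open>The radial retraction onto a ball. It makes the nonlinearity globally Lipschitz, so that
  Picard iteration applies on the whole half-line.\<close>

definition radial :: "real \<Rightarrow> 'a::real_normed_vector \<Rightarrow> 'a" where
  "radial \<rho> z = (if norm z \<le> \<rho> then z else (\<rho> / norm z) *\<^sub>R z)"

lemma norm_radial: "0 < \<rho> \<Longrightarrow> norm (radial \<rho> z) = min (norm z) \<rho>"
  by (auto simp: radial_def min_def)

text \<open>Only the triangle inequality enters, whence the constant 2.\<close>

lemma radial_lipschitz:
  assumes \<rho>: "0 < \<rho>" shows "norm (radial \<rho> x - radial \<rho> y) \<le> 2 * norm (x - y)"
proof -
  have mixed: "norm (x - (\<rho> / norm y) *\<^sub>R y) \<le> 2 * norm (x - y)" if "norm x \<le> \<rho>" "\<rho> < norm y" for x y :: 'a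
  proof -
    have "y - (\<rho> / norm y) *\<^sub>R y = (1 - \<rho> / norm y) *\<^sub>R y" by (simp add: algebra_simps)
    then have "norm (y - (\<rho> / norm y) *\<^sub>R y) = \<bar>1 - \<rho> / norm y\<bar> * norm y" by (metis norm_scaleR)
    moreover have "\<bar>1 - \<rho> / norm y\<bar> * norm y = norm y - \<rho>"
    proof -
      have "0 < norm y" using that \<rho> by linarith
      moreover from this have "\<bar>1 - \<rho> / norm y\<bar> = 1 - \<rho> / norm y" using that \<rho> by (intro abs_of_nonneg) (simp add: field_simps)
      ultimately show ?thesis by (simp only: left_diff_distrib) simp
    qed
    moreover have "norm y - norm x \<le> norm (x - y)" by (metis norm_minus_commute norm_triangle_ineq2)
    moreover have "norm (x - (\<rho> / norm y) *\<^sub>R y) \<le> norm (x - y) + norm (y - (\<rho> / norm y) *\<^sub>R y)"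
      using norm_triangle_ineq[of "x - y" "y - (\<rho> / norm y) *\<^sub>R y"] by simp
    ultimately show ?thesis using that by linarith
  qed
  have outer: "norm ((\<rho> / norm x) *\<^sub>R x - (\<rho> / norm y) *\<^sub>R y) \<le> 2 * norm (x - y)" if "\<rho> < norm x" "\<rho> < norm y"
  proof -
    have "(\<rho> / norm x) *\<^sub>R x - (\<rho> / norm y) *\<^sub>R y = (\<rho> / norm x) *\<^sub>R (x - y) + (\<rho> / norm x - \<rho> / norm y) *\<^sub>R y"
      by (simp add: algebra_simps)
    then have "norm ((\<rho> / norm x) *\<^sub>R x - (\<rho> / norm y) *\<^sub>R y) \<le> \<rho> / norm x * norm (x - y) + \<bar>\<rho> / norm x - \<rho> / norm y\<bar> * norm y"
      using norm_triangle_ineq[of "(\<rho> / norm x) *\<^sub>R (x - y)" "(\<rho> / norm x - \<rho> / norm y) *\<^sub>R y"] \<rho> by simp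
    also have "\<bar>\<rho> / norm x - \<rho> / norm y\<bar> * norm y = \<rho> / norm x * \<bar>norm y - norm x\<bar>"
    proof -
      have pos: "0 < norm x" "0 < norm y" using that \<rho> by linarith+
      have "\<rho> / a - \<rho> / b = \<rho> / a * (b - a) / b" if "0 < a" "0 < b" for a b :: real
        using that by (simp add: field_simps)
      then have "\<rho> / norm x - \<rho> / norm y = \<rho> / norm x * (norm y - norm x) / norm y" using pos by blast
      moreover have "0 \<le> \<rho> / norm x" using \<rho> by simp
      ultimately show ?thesis using pos \<rho> by (simp add: abs_mult)
    qed
    also have "\<rho> / norm x * \<bar>norm y - norm x\<bar> \<le> \<rho> / norm x * norm (x - y)"
      using \<rho> norm_triangle_ineq3[of y x] by (intro mult_left_mono) (auto simp: norm_minus_commute)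
    also have "\<rho> / norm x * norm (x - y) + \<rho> / norm x * norm (x - y) \<le> 1 * norm (x - y) + 1 * norm (x - y)"
    proof -
      have "0 < norm x" using that \<rho> by linarith
      then have "\<rho> / norm x \<le> 1" using that by (simp only: divide_le_eq_1_pos less_imp_le)
      then show ?thesis by (intro add_mono mult_right_mono) auto
    qed
    finally show ?thesis by simp
  qed
  show ?thesis
    using mixed[of x y] mixed[of y x] outer norm_ge_zero[of "x - y"]
    by (auto simp: radial_def norm_minus_commute)
qed

section \<open>The Hamiltonian structure and global truncated solutions\<close>

locale kirchhoff = resolution E for E :: "real \<Rightarrow> 'a::{real_inner,complete_space} \<Rightarrow> 'a" +
  fixes m :: "real \<Rightarrow> real" and m0 :: real
  assumes m0: "0 < m0" and m_ge: "\<And>\<sigma>. 0 \<le> \<sigma> \<Longrightarrow> m0 \<le> m \<sigma>"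
    and m_lip: "\<And>R. \<exists>L>0. \<forall>x\<in>{0..R}. \<forall>y\<in>{0..R}. \<bar>m x - m y\<bar> \<le> L * \<bar>x - y\<bar>"
begin

lemma m_cont: "continuous_on {0..} m"
  unfolding continuous_on_iff
proof (intro ballI allI impI)
  fix x e :: real assume x: "x \<in> {0..}" and e: "0 < e"
  obtain L where L: "0 < L" "\<And>a b. a \<in> {0..x+1} \<Longrightarrow> b \<in> {0..x+1} \<Longrightarrow> \<bar>m a - m b\<bar> \<le> L * \<bar>a - b\<bar>"
    using m_lip[of "x + 1"] by blast
  show "\<exists>d>0. \<forall>y\<in>{0..}. dist y x < d \<longrightarrow> dist (m y) (m x) < e"
  proof (intro exI[of _ "min 1 (e / L)"] conjI ballI impI)
    fix y assume y: "y \<in> {0..}" "dist y x < min 1 (e / L)"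
    then have "\<bar>m y - m x\<bar> \<le> L * \<bar>y - x\<bar>" using x by (intro L) (auto simp: dist_real_def)
    also have "\<dots> < e" using y L(1) by (simp add: dist_real_def field_simps)
    finally show "dist (m y) (m x) < e" by (simp add: dist_real_def)
  qed (use e L in auto)
qed

text \<open>The potential: |u'|^2 + M(|A^(1/2) u|^2) is the conserved Hamiltonian of the
  equation.\<close>

definition M :: "real \<Rightarrow> real" where
  "M = (SOME G. G 0 = 0 \<and> (\<forall>\<sigma>\<ge>0. (G has_vector_derivative m \<sigma>) (at \<sigma> within {0..})))"

lemma M_0: "M 0 = 0" and M_deriv: "0 \<le> \<sigma> \<Longrightarrow> (M has_real_derivative m \<sigma>) (at \<sigma> within {0..})"
  using someI_ex[OF primitive_exists[OF m_cont]]
  unfolding M_def[symmetric] has_real_derivative_iff_has_vector_derivative by auto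

lemma primitive_lower:
  assumes G: "G 0 = 0" "\<And>\<sigma>. \<sigma> \<in> {0..s} \<Longrightarrow> (G has_real_derivative h \<sigma>) (at \<sigma> within {0..})"
    and h: "\<And>\<sigma>. \<sigma> \<in> {0..s} \<Longrightarrow> c \<le> h \<sigma>" and s: "0 \<le> s"
  shows "c * s \<le> G s"
proof -
  have "c * s - G s \<le> c * 0 - G 0"
    by (rule derivative_nonpos_le[OF order_refl s, where f="\<lambda>s. c * s - G s" and f'="\<lambda>\<sigma>. c - h \<sigma>"])
       (auto intro!: derivative_eq_intros G h)
  then show ?thesis using G(1) by simp
qed

lemma M_lower: "0 \<le> s \<Longrightarrow> m0 * s \<le> M s"
  by (rule primitive_lower[OF M_0 M_deriv m_ge]) auto

lemma M_mono: assumes "0 \<le> a" "a \<le> b" shows "M a \<le> M b"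
proof -
  have "- M b \<le> - M a"
  proof (rule derivative_nonpos_le[OF assms, where f="\<lambda>t. - M t" and f'="\<lambda>t. - m t"])
    fix t assume t: "t \<in> {a..b}"
    show "((\<lambda>t. - M t) has_real_derivative - m t) (at t within {0..})" using t assms by (intro DERIV_minus M_deriv) auto
    show "- m t \<le> 0" using m_ge[of t] m0 t assms by auto
  qed
  then show ?thesis by simp
qed

text \<open>The equation is first solved with the nonlinearity cut off radially at \<rho>. The
  modified equation is still Hamiltonian, with a potential \<open>Mt\<close> satisfying Mt(\<rho>^2)
  \<ge> m0 \<rho>^2. Assumption \<open>H\<close> keeps the conserved energy strictly below this
  barrier, so the cut-off is never active along the solution.\<close>

lemma galerkin:
  assumes \<rho>: "0 < \<rho>" and H: "(norm (cut n u1))\<^sup>2 + M ((norm (trunc rt n u0))\<^sup>2) < m0 * \<rho>\<^sup>2"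
  obtains u v where "u 0 = cut n u0" "v 0 = cut n u1"
    "\<And>t. 0 \<le> t \<Longrightarrow> (u has_vector_derivative v t) (at t within {0..})"
    "\<And>t. 0 \<le> t \<Longrightarrow> (v has_vector_derivative - m ((norm (trunc rt n (u t)))\<^sup>2) *\<^sub>R trunc lam n (u t)) (at t within {0..})"
    "\<And>t. 0 \<le> t \<Longrightarrow> (norm (trunc rt n (u t)))\<^sup>2 \<le> \<rho>\<^sup>2" "\<And>t. 0 \<le> t \<Longrightarrow> (norm (v t))\<^sup>2 \<le> m0 * \<rho>\<^sup>2"
    "\<And>t. 0 \<le> t \<Longrightarrow> cut n (u t) = u t" "\<And>t. 0 \<le> t \<Longrightarrow> cut n (v t) = v t"
proof -
  let ?S = "trunc rt n" and ?B = "trunc lam n"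
  have Slin: "bounded_linear ?S" by (rule trunc_bl) simp
  have SS: "?S (?S x) = ?B x" for x using trunc_trunc(1)[OF lb_rt lb_rt order_refl, of n x] by (simp add: rt_rt)
  define N where "N z = m ((norm (radial \<rho> z))\<^sup>2) *\<^sub>R radial \<rho> z" for z :: 'a
  \<comment> \<open>The retracted field is again a scalar function of the squared norm times the
    vector; that is why the modified equation still conserves an energy.\<close>
  define mt where "mt \<sigma> = m ((min (sqrt \<sigma>) \<rho>)\<^sup>2) * (\<rho> / max (sqrt \<sigma>) \<rho>)" for \<sigma>
  have N_mt: "N z = mt ((norm z)\<^sup>2) *\<^sub>R z" for z
    using \<rho> by (cases "norm z \<le> \<rho>") (auto simp: N_def mt_def norm_radial radial_def max_def min_def)
  obtain L where L: "0 < L" "\<And>a b. a \<in> {0..\<rho>\<^sup>2} \<Longrightarrow> b \<in> {0..\<rho>\<^sup>2} \<Longrightarrow> \<bar>m a - m b\<bar> \<le> L * \<bar>a - b\<bar>"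
    using m_lip[of "\<rho>\<^sup>2"] by blast
  define M1 where "M1 = m 0 + L * \<rho>\<^sup>2"
  have mM1: "\<bar>m a\<bar> \<le> M1" if "a \<in> {0..\<rho>\<^sup>2}" for a
  proof -
    have "m a - m 0 \<le> L * \<bar>a - 0\<bar>" using L(2)[of a 0] that by auto
    also have "\<dots> \<le> L * \<rho>\<^sup>2" using that L by (intro mult_left_mono) auto
    finally show ?thesis using m_ge[of a] m0 that by (simp add: M1_def)
  qed
  have rng: "(norm (radial \<rho> z))\<^sup>2 \<in> {0..\<rho>\<^sup>2}" for z :: 'a
    using \<rho> by (auto simp: norm_radial intro!: power_mono)
  \<comment> \<open>Product rule: the bound of \<open>m\<close> times the Lipschitz constant 2 of
    the retraction, plus the Lipschitz constant of m(|z|^2) on the ball times the radius.\<close>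
  define LN where "LN = M1 * 2 + L * (2 * \<rho> * 2) * \<rho>"
  have M1: "0 \<le> M1" using mM1[of 0] by (auto intro: order_trans[OF abs_ge_zero])
  have LN0: "0 \<le> LN" using M1 L \<rho> by (simp add: LN_def)
  have NL: "norm (N x - N y) \<le> LN * norm (x - y)" for x y
  proof -
    let ?x = "radial \<rho> x" and ?y = "radial \<rho> y"
    have "N x - N y = m ((norm ?x)\<^sup>2) *\<^sub>R (?x - ?y) + (m ((norm ?x)\<^sup>2) - m ((norm ?y)\<^sup>2)) *\<^sub>R ?y"
      by (simp add: N_def algebra_simps)
    then have "norm (N x - N y) \<le> \<bar>m ((norm ?x)\<^sup>2)\<bar> * norm (?x - ?y) + \<bar>m ((norm ?x)\<^sup>2) - m ((norm ?y)\<^sup>2)\<bar> * norm ?y"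
      by (metis norm_scaleR norm_triangle_ineq)
    also have "\<dots> \<le> M1 * (2 * norm (x - y)) + (L * (2 * \<rho> * (2 * norm (x - y)))) * \<rho>"
    proof (intro add_mono mult_mono)
      show "\<bar>m ((norm ?x)\<^sup>2)\<bar> \<le> M1" by (rule mM1[OF rng])
      show xy: "norm (?x - ?y) \<le> 2 * norm (x - y)" by (rule radial_lipschitz[OF \<rho>])
      show "norm ?y \<le> \<rho>" using \<rho> by (simp add: norm_radial)
      have "(norm ?x)\<^sup>2 - (norm ?y)\<^sup>2 = (norm ?x + norm ?y) * (norm ?x - norm ?y)" by (simp add: power2_eq_square algebra_simps)
      then have "\<bar>(norm ?x)\<^sup>2 - (norm ?y)\<^sup>2\<bar> = (norm ?x + norm ?y) * \<bar>norm ?x - norm ?y\<bar>" by (simp add: abs_mult)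
      also have "\<dots> \<le> (2 * \<rho>) * (2 * norm (x - y))"
        using \<rho> order_trans[OF norm_triangle_ineq3 xy] by (intro mult_mono) (auto simp: norm_radial)
      finally have "L * \<bar>(norm ?x)\<^sup>2 - (norm ?y)\<^sup>2\<bar> \<le> L * (2 * \<rho> * (2 * norm (x - y)))" using L by (intro mult_left_mono) auto
      then show "\<bar>m ((norm ?x)\<^sup>2) - m ((norm ?y)\<^sup>2)\<bar> \<le> L * (2 * \<rho> * (2 * norm (x - y)))"
        using L(2)[OF rng rng, of x y] by linarith
    qed (use L \<rho> M1 in auto)
    finally show ?thesis by (simp add: LN_def algebra_simps)
  qed
  obtain k where k: "0 < k" "\<And>x. norm (?S x) \<le> k * norm x" using trunc_bound[OF lb_rt, of n] by blast
  have GL: "norm (?S (N (?S x)) - ?S (N (?S y))) \<le> (k * LN * k) * norm (x - y)" for x y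
  proof -
    have "norm (?S (N (?S x)) - ?S (N (?S y))) \<le> k * norm (N (?S x) - N (?S y))"
      using k(2)[of "N (?S x) - N (?S y)"] by (simp add: trunc_linear)
    also have "\<dots> \<le> k * (LN * norm (?S x - ?S y))" using k(1) NL by (intro mult_left_mono) auto
    also have "\<dots> \<le> k * (LN * (k * norm (x - y)))"
      using k(1) LN0 k(2)[of "x - y"] by (intro mult_left_mono) (auto simp: trunc_linear)
    finally show ?thesis by (simp add: mult_ac)
  qed
  have "0 \<le> k * LN * k" using k LN0 by simp
  then obtain u v where uv: "u 0 = cut n u0" "v 0 = cut n u1"
    "\<And>t. 0 \<le> t \<Longrightarrow> (u has_vector_derivative v t) (at t within {0..})"
    "\<And>t. 0 \<le> t \<Longrightarrow> (v has_vector_derivative - ?S (N (?S (u t)))) (at t within {0..})"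
    using second_order_ode[OF _ GL, of "cut n u0" "cut n u1"] by metis
  have force: "?S (N (?S x)) = mt ((norm (?S x))\<^sup>2) *\<^sub>R ?B x" for x
    by (simp add: N_mt trunc_linear SS)
  have mt_cont: "continuous_on {0..} mt" unfolding mt_def
    by (intro continuous_intros continuous_on_compose2[OF m_cont]) (use \<rho> in \<open>auto simp: max_def\<close>)
  obtain Mt where Mt: "Mt 0 = 0" "\<And>\<sigma>. 0 \<le> \<sigma> \<Longrightarrow> (Mt has_real_derivative mt \<sigma>) (at \<sigma> within {0..})"
    using primitive_exists[OF mt_cont] unfolding has_real_derivative_iff_has_vector_derivative by blast
  have mt_pos: "0 \<le> mt \<sigma>" if "0 \<le> \<sigma>" for \<sigma>
    unfolding mt_def using that \<rho> m0 m_ge[of "(min (sqrt \<sigma>) \<rho>)\<^sup>2"] by (intro mult_nonneg_nonneg) auto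
  have mt_in: "mt \<sigma> = m \<sigma>" if "0 \<le> \<sigma>" "\<sigma> \<le> \<rho>\<^sup>2" for \<sigma>
  proof -
    have "sqrt \<sigma> \<le> \<rho>" using that \<rho> by (simp add: real_le_lsqrt)
    then show ?thesis using that \<rho> by (simp add: mt_def min_absorb1 max_absorb2)
  qed
  define s where "s t = (norm (?S (u t)))\<^sup>2" for t
  have s0: "0 \<le> s t" for t by (simp add: s_def)
  have ds: "(s has_real_derivative 2 * inner (?B (u t)) (v t)) (at t within {0..})" if t: "0 \<le> t" for t
    using trunc_quad_derivative[OF lb_lam uv(3)[OF t]] unfolding s_def norm_trunc_sq[OF lb_rt] rt_rt by simp
  define h where "h t = (norm (v t))\<^sup>2 + Mt (s t)" for t
  have dh: "(h has_real_derivative 0) (at t within {0..})" if t: "0 \<le> t" for t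
  proof -
    have dM: "((Mt \<circ> s) has_real_derivative mt (s t) * (2 * inner (?B (u t)) (v t))) (at t within {0..})"
      by (rule DERIV_image_chain[OF has_field_derivative_subset[OF Mt(2)] ds[OF t]]) (use s0 in auto)
    have dv: "((\<lambda>t. (norm (v t))\<^sup>2) has_real_derivative 2 * inner (v t) (- (mt (s t) *\<^sub>R ?B (u t)))) (at t within {0..})"
      unfolding power2_norm_eq_inner using has_vector_derivative_inner[OF uv(4)[OF t] uv(4)[OF t]]
      by (simp add: force s_def inner_commute mult_ac)
    have "((\<lambda>t. (norm (v t))\<^sup>2 + (Mt \<circ> s) t) has_real_derivative
        2 * inner (v t) (- (mt (s t) *\<^sub>R ?B (u t))) + mt (s t) * (2 * inner (?B (u t)) (v t))) (at t within {0..})"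
      by (rule DERIV_add[OF dv dM])
    then show ?thesis by (simp add: h_def[abs_def] comp_def inner_commute)
  qed
  have h_le: "h t \<le> h 0" if "0 \<le> t" for t
    by (rule derivative_nonpos_le[OF order_refl that, where f'="\<lambda>_. 0"]) (auto intro: dh)
  have s00: "s 0 \<le> (norm (trunc rt n u0))\<^sup>2" using cut_trunc[OF lb_rt order_refl] by (simp add: s_def uv)
  have s0\<rho>: "s 0 \<le> \<rho>\<^sup>2"
  proof -
    have "m0 * s 0 \<le> M (s 0)" by (rule M_lower[OF s0])
    also have "\<dots> \<le> M ((norm (trunc rt n u0))\<^sup>2)" by (rule M_mono[OF s0 s00])
    also have "\<dots> \<le> m0 * \<rho>\<^sup>2" using H zero_le_power2[of "norm (cut n u1)"] by linarith
    finally show ?thesis using m0 by simp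
  qed
  have h0: "h 0 < m0 * \<rho>\<^sup>2"
  proof -
    have "Mt (s 0) - M (s 0) \<le> Mt 0 - M 0"
    proof (rule derivative_nonpos_le[OF order_refl s0, where f="\<lambda>\<sigma>. Mt \<sigma> - M \<sigma>" and f'="\<lambda>\<sigma>. mt \<sigma> - m \<sigma>"])
      fix t assume t: "t \<in> {0..s 0}"
      show "((\<lambda>\<sigma>. Mt \<sigma> - M \<sigma>) has_real_derivative mt t - m t) (at t within {0..})"
        using t by (intro DERIV_diff Mt M_deriv) auto
      show "mt t - m t \<le> 0" using mt_in[of t] t s0\<rho> by auto
    qed
    then have "h 0 \<le> (norm (cut n u1))\<^sup>2 + M (s 0)" by (simp add: h_def uv Mt M_0)
    also have "M (s 0) \<le> M ((norm (trunc rt n u0))\<^sup>2)" by (rule M_mono[OF s0 s00])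
    finally show ?thesis using H by simp
  qed
  have Mt_mono: "Mt a \<le> Mt b" if ab: "0 \<le> a" "a \<le> b" for a b
  proof -
    have "- Mt b \<le> - Mt a"
    proof (rule derivative_nonpos_le[OF ab, where f="\<lambda>t. - Mt t" and f'="\<lambda>t. - mt t"])
      fix t assume t: "t \<in> {a..b}"
      show "((\<lambda>t. - Mt t) has_real_derivative - mt t) (at t within {0..})" using t ab by (intro DERIV_minus Mt) auto
      show "- mt t \<le> 0" using mt_pos[of t] t ab by auto
    qed
    then show ?thesis by simp
  qed
  have s_le: "s t \<le> \<rho>\<^sup>2" if t: "0 \<le> t" for t
  proof (rule ccontr)
    assume "\<not> s t \<le> \<rho>\<^sup>2"
    have "m0 * \<rho>\<^sup>2 \<le> Mt (\<rho>\<^sup>2)"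
    proof (rule primitive_lower[where G=Mt and h=mt, OF Mt(1)])
      show "(Mt has_real_derivative mt \<sigma>) (at \<sigma> within {0..})" if "\<sigma> \<in> {0..\<rho>\<^sup>2}" for \<sigma>
        using that by (intro Mt) auto
      show "m0 \<le> mt \<sigma>" if "\<sigma> \<in> {0..\<rho>\<^sup>2}" for \<sigma> using that mt_in m_ge by auto
    qed simp
    also have "\<dots> \<le> Mt (s t)" using \<open>\<not> s t \<le> \<rho>\<^sup>2\<close> by (intro Mt_mono) auto
    also have "\<dots> \<le> h t" by (simp add: h_def)
    also have "\<dots> \<le> h 0" by (rule h_le[OF t])
    finally show False using h0 by simp
  qed
  have v_le: "(norm (v t))\<^sup>2 \<le> m0 * \<rho>\<^sup>2" if t: "0 \<le> t" for t
    using h_le[OF t] h0 Mt_mono[OF order_refl s0, of t] Mt(1) by (simp add: h_def)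
  have const: "f t = f 0" if d: "\<And>t. 0 \<le> t \<Longrightarrow> (f has_vector_derivative 0) (at t within {0..})" and t: "0 \<le> t"
    for f :: "real \<Rightarrow> 'a" and t
    using norm_increment_le[OF order_refl t d, of "\<lambda>_. 0" "\<lambda>_. 0"] by auto
  \<comment> \<open>Initial velocity and force both lie in the range of the window, so the part of
    the velocity outside it has zero derivative and starts at 0; integrating once more gives the
    same for the position.\<close>
  have cv: "cut n (v t) = v t" if t: "0 \<le> t" for t
  proof -
    have "v t - cut n (v t) = v 0 - cut n (v 0)"
    proof (rule const[OF _ t])
      fix t :: real assume t: "0 \<le> t"
      have "((\<lambda>t. v t - cut n (v t)) has_vector_derivative (- ?S (N (?S (u t))) - cut n (- ?S (N (?S (u t)))))) (at t within {0..})"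
        by (intro has_vector_derivative_diff has_vector_derivative_bounded_linear[OF cut_bl] uv t)
      moreover have "cut n (- ?S x) = - ?S x" for x
        using cut_trunc(1)[OF lb_rt order_refl, of n x] by (simp add: cut_def fcalc_linear)
      ultimately show "((\<lambda>t. v t - cut n (v t)) has_vector_derivative 0) (at t within {0..})" by simp
    qed
    then show ?thesis using cut_trunc(1)[OF locally_bounded_one[of 1] order_refl, of n u1] by (simp add: uv cut_eq_trunc)
  qed
  have cu: "cut n (u t) = u t" if t: "0 \<le> t" for t
  proof -
    have "u t - cut n (u t) = u 0 - cut n (u 0)"
    proof (rule const[OF _ t])
      fix t :: real assume t: "0 \<le> t"
      have "((\<lambda>t. u t - cut n (u t)) has_vector_derivative (v t - cut n (v t))) (at t within {0..})"
        by (intro has_vector_derivative_diff has_vector_derivative_bounded_linear[OF cut_bl] uv t)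
      then show "((\<lambda>t. u t - cut n (u t)) has_vector_derivative 0) (at t within {0..})" by (simp add: cv t)
    qed
    then show ?thesis using cut_trunc(1)[OF locally_bounded_one[of 1] order_refl, of n u0] by (simp add: uv cut_eq_trunc)
  qed
  show ?thesis
  proof (rule that[OF uv(1-3)])
    fix t :: real assume t: "0 \<le> t"
    show "(v has_vector_derivative - m ((norm (?S (u t)))\<^sup>2) *\<^sub>R ?B (u t)) (at t within {0..})"
      using uv(4)[OF t] mt_in[OF s0 s_le[OF t]] by (simp add: force s_def)
    show "(norm (?S (u t)))\<^sup>2 \<le> \<rho>\<^sup>2" using s_le[OF t] by (simp add: s_def)
  qed (use v_le cu cv in auto)
qed

end

section \<open>A priori estimates\<close>

text \<open>\<open>wq\<close> is the symbol of A^(1/4) exp((r/2) \<phi>(A^(1/2))), and multiplying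
  by \<open>rt\<close> raises the index to 3/4; the data conditions are therefore the two Gevrey
  conditions.\<close>

locale quasi_analytic = kirchhoff E m m0
  for E :: "real \<Rightarrow> 'a::{real_inner,complete_space} \<Rightarrow> 'a" and m m0 +
  fixes \<phi> :: "real \<Rightarrow> real" and r :: real and wq :: "real \<Rightarrow> real" and u0 u1 :: 'a
  assumes phi: "\<forall>\<sigma>\<ge>0. 0 \<le> \<phi> \<sigma>" "continuous_on {0..} \<phi>" "strict_mono_on {0..} \<phi>"
      "(\<integral>\<^sup>+\<sigma>\<in>{1..}. ennreal (\<phi> \<sigma> / \<sigma>\<^sup>2) \<partial>lborel) = \<infinity>"
    and r: "0 < r" and wq_def: "\<And>x. wq x = qrt x * exp (r / 2 * \<phi> (rt x))"
    and data: "u0 \<in> spec_dom E (\<lambda>x. rt x * wq x)" "u1 \<in> spec_dom E wq"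
begin

lemma lb_wq [simp]: "locally_bounded_borel wq"
proof (rule locally_bounded_continuous)
  have "continuous_on UNIV (\<lambda>x. \<phi> (rt x))"
    by (rule continuous_on_compose2[OF phi(2) continuous_rt]) auto
  then show "continuous_on UNIV wq" unfolding wq_def[abs_def] by (intro continuous_intros continuous_qrt)
qed

lemma wq_sq: "wq x * wq x = rt x * exp (r * \<phi> (rt x))"
proof -
  have "wq x * wq x = (qrt x * qrt x) * (exp (r / 2 * \<phi> (rt x)) * exp (r / 2 * \<phi> (rt x)))" by (simp add: wq_def)
  also have "\<dots> = rt x * exp (r * \<phi> (rt x))" by (simp only: qrt_qrt exp_add[symmetric]) simp
  finally show ?thesis .
qed

text \<open>The 1 controls low frequencies, where \<open>wq\<close> degenerates, so that this weight
  dominates both the plain norm and the Gevrey norm.\<close>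

definition wt :: "real \<Rightarrow> real" where "wt x = 1 + wq x * wq x"

lemma lb_wq2 [simp]: "locally_bounded_borel (\<lambda>x. wq x * wq x)" by (simp add: locally_bounded_mult)
lemma lb_wt [simp]: "locally_bounded_borel wt"
  unfolding wt_def[abs_def] by (intro locally_bounded_add lb_wq2) simp
lemma wt_ge: "1 \<le> wt x" by (simp add: wt_def)
lemma lb_lam_mult [simp]: "locally_bounded_borel g \<Longrightarrow> locally_bounded_borel (\<lambda>x. g x * lam x)"
  by (rule locally_bounded_mult) simp_all

definition qf :: "nat \<Rightarrow> (real \<Rightarrow> real) \<Rightarrow> 'a \<Rightarrow> real" where
  "qf n g u = inner (trunc g n u) u"

lemma qf_nonneg: "locally_bounded_borel g \<Longrightarrow> (\<And>x. 0 \<le> g x) \<Longrightarrow> 0 \<le> qf n g u"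
  unfolding qf_def by (rule trunc_quad_nonneg)

lemma qf_mono: "locally_bounded_borel g \<Longrightarrow> locally_bounded_borel h \<Longrightarrow> (\<And>x. g x \<le> h x) \<Longrightarrow> qf n g u \<le> qf n h u"
  unfolding qf_def by (rule trunc_quad_mono)

lemma qf_add: "locally_bounded_borel g \<Longrightarrow> locally_bounded_borel h \<Longrightarrow> qf n (\<lambda>x. g x + h x) u = qf n g u + qf n h u"
  unfolding qf_def by (simp add: trunc_add inner_add_left)

lemma qf_cmult: "locally_bounded_borel g \<Longrightarrow> qf n (\<lambda>x. c * g x) u = c * qf n g u"
  unfolding qf_def by (simp add: trunc_cmult)

lemma qf_sq: "locally_bounded_borel f \<Longrightarrow> qf n (\<lambda>x. f x * f x) u = (norm (trunc f n u))\<^sup>2"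
  unfolding qf_def by (rule norm_trunc_sq[symmetric])

lemma qf_cut:
  assumes g: "locally_bounded_borel g" shows "qf n g (cut n u) = qf n g u"
proof -
  have "inner (trunc g n u) (cut n u) = inner (cut n (trunc g n u)) u" by (simp add: cut_def fcalc_sym)
  then show ?thesis by (simp add: qf_def cut_trunc[OF g order_refl])
qed

lemma qf_one: "qf n (\<lambda>x. 1) u \<le> (norm u)\<^sup>2"
proof -
  have "qf n (\<lambda>x. 1) u = (norm (cut n u))\<^sup>2" using qf_sq[OF locally_bounded_one[of 1], of n u] by (simp add: cut_eq_trunc)
  then show ?thesis using norm_cut_le[of n u] by (simp add: power_mono)
qed

lemma wt_lam: "wt x * lam x \<le> 1 + 2 * ((rt x * wq x) * (rt x * wq x))"
proof -
  have e: "(rt x * wq x) * (rt x * wq x) = lam x * (wq x * wq x)" by (simp add: rt_rt[symmetric] mult_ac)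
  have "lam x \<le> 1 + lam x * (wq x * wq x)"
  proof (cases "lam x \<le> 1")
    case False
    then have "1 \<le> rt x" by (simp add: rt_def)
    moreover have "1 \<le> exp (r * \<phi> (rt x))" using r phi(1) by simp
    ultimately have "1 \<le> wq x * wq x" unfolding wq_sq using mult_mono[of 1 "rt x" 1] by simp
    from mult_left_mono[OF this lam_nonneg[of x]] show ?thesis by linarith
  qed (simp add: add_increasing2)
  then show ?thesis unfolding e wt_def distrib_right mult_1_left mult.commute[of "wq x * wq x" "lam x"] by linarith
qed

lemma data_bounds: "\<exists>C>0. \<forall>n. qf n wt u1 \<le> C \<and> qf n (\<lambda>x. wt x * lam x) u0 \<le> C"
proof -
  have lbu: "locally_bounded_borel (\<lambda>x. rt x * wq x)" by (simp add: locally_bounded_mult)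
  obtain K0 K1 where K: "\<And>n. norm (trunc (\<lambda>x. rt x * wq x) n u0) \<le> K0" "\<And>n. norm (trunc wq n u1) \<le> K1"
    using data spec_dom_iff[OF lbu] spec_dom_iff[OF lb_wq] by metis
  have 1: "qf n wt u1 \<le> (norm u1)\<^sup>2 + K1\<^sup>2" for n
  proof -
    have "qf n wt u1 = qf n (\<lambda>x. 1) u1 + (norm (trunc wq n u1))\<^sup>2"
      unfolding wt_def[abs_def] by (subst qf_add) (simp_all add: qf_sq)
    then show ?thesis using qf_one[of n u1] power_mono[OF K(2)[of n], of 2] by simp
  qed
  have 2: "qf n (\<lambda>x. wt x * lam x) u0 \<le> (norm u0)\<^sup>2 + 2 * K0\<^sup>2" for n
  proof -
    have lb2: "locally_bounded_borel (\<lambda>x. (rt x * wq x) * (rt x * wq x))" by (rule locally_bounded_mult[OF lbu lbu])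
    have lb3: "locally_bounded_borel (\<lambda>x. 2 * ((rt x * wq x) * (rt x * wq x)))" by (rule locally_bounded_mult[OF _ lb2]) simp
    have "qf n (\<lambda>x. wt x * lam x) u0 \<le> qf n (\<lambda>x. 1 + 2 * ((rt x * wq x) * (rt x * wq x))) u0"
      by (rule qf_mono) (simp_all add: lb3 locally_bounded_add wt_lam)
    also have "\<dots> = qf n (\<lambda>x. 1) u0 + 2 * (norm (trunc (\<lambda>x. rt x * wq x) n u0))\<^sup>2"
      by (subst qf_add[OF _ lb3]) (simp_all add: qf_cmult[OF lb2] qf_sq[OF lbu])
    finally show ?thesis using qf_one[of n u0] power_mono[OF K(1)[of n], of 2] by simp
  qed
  define A where "A = (norm u1)\<^sup>2 + K1\<^sup>2"
  define B where "B = (norm u0)\<^sup>2 + 2 * K0\<^sup>2"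
  have "0 \<le> A" "0 \<le> B" by (simp_all add: A_def B_def)
  then show ?thesis using 1 2 unfolding A_def[symmetric] B_def[symmetric]
    by (intro exI[of _ "A + B + 1"]) (smt (verit))
qed

text \<open>A single radius works for all truncations because the data are bounded uniformly in the
  window. Thus the range of the coefficients and the Lipschitz constant of \<open>m\<close> on it do
  not depend on n.\<close>

lemma rho_exists: "\<exists>\<rho>>0. \<forall>n. (norm (cut n u1))\<^sup>2 + M ((norm (trunc rt n u0))\<^sup>2) < m0 * \<rho>\<^sup>2"
proof -
  obtain C where C: "0 < C" "\<And>n. qf n (\<lambda>x. wt x * lam x) u0 \<le> C" using data_bounds by blast
  have s: "(norm (trunc rt n u0))\<^sup>2 \<le> C" for n
  proof -
    have "(norm (trunc rt n u0))\<^sup>2 = qf n lam u0" using qf_sq[OF lb_rt, of n u0] by (simp add: rt_rt)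
    also have "\<dots> \<le> qf n (\<lambda>x. wt x * lam x) u0"
    proof (rule qf_mono)
      show "lam x \<le> wt x * lam x" for x using mult_right_mono[OF wt_ge lam_nonneg, of x x] by simp
    qed simp_all
    finally show ?thesis using C(2) order_trans by blast
  qed
  define H where "H = (norm u1)\<^sup>2 + M C + 1"
  have MC: "0 \<le> M C" using M_lower[of C] C(1) m0 by (smt (verit) mult_pos_pos)
  have Hpos: "0 < H" using MC by (simp add: H_def add_nonneg_pos)
  have "(norm (cut n u1))\<^sup>2 + M ((norm (trunc rt n u0))\<^sup>2) < m0 * (sqrt (H / m0))\<^sup>2" for n
  proof -
    have "(norm (cut n u1))\<^sup>2 \<le> (norm u1)\<^sup>2" by (intro power_mono norm_cut_le) simp
    moreover have "M ((norm (trunc rt n u0))\<^sup>2) \<le> M C" by (rule M_mono[OF _ s]) simp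
    moreover have "m0 * (sqrt (H / m0))\<^sup>2 = H" using m0 Hpos by simp
    ultimately show ?thesis unfolding H_def by linarith
  qed
  moreover have "0 < sqrt (H / m0)" using m0 Hpos by simp
  ultimately show ?thesis by blast
qed

definition \<rho> :: real where
  "\<rho> = (SOME \<rho>. 0 < \<rho> \<and> (\<forall>n. (norm (cut n u1))\<^sup>2 + M ((norm (trunc rt n u0))\<^sup>2) < m0 * \<rho>\<^sup>2))"

lemma \<rho>: "0 < \<rho>" "(norm (cut n u1))\<^sup>2 + M ((norm (trunc rt n u0))\<^sup>2) < m0 * \<rho>\<^sup>2"
  using someI_ex[OF rho_exists] unfolding \<rho>_def[symmetric] by auto

definition galerkin_pair :: "nat \<Rightarrow> (real \<Rightarrow> 'a) \<Rightarrow> (real \<Rightarrow> 'a) \<Rightarrow> bool" where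
  "galerkin_pair n u v \<longleftrightarrow> u 0 = cut n u0 \<and> v 0 = cut n u1 \<and>
    (\<forall>t\<ge>0. (u has_vector_derivative v t) (at t within {0..})) \<and>
    (\<forall>t\<ge>0. (v has_vector_derivative - m ((norm (trunc rt n (u t)))\<^sup>2) *\<^sub>R trunc lam n (u t)) (at t within {0..})) \<and>
    (\<forall>t\<ge>0. (norm (trunc rt n (u t)))\<^sup>2 \<le> \<rho>\<^sup>2) \<and> (\<forall>t\<ge>0. (norm (v t))\<^sup>2 \<le> m0 * \<rho>\<^sup>2) \<and>
    (\<forall>t\<ge>0. cut n (u t) = u t) \<and> (\<forall>t\<ge>0. cut n (v t) = v t)"

lemma galerkin_pair_exists: "\<exists>uv. galerkin_pair n (fst uv) (snd uv)"
proof (rule galerkin[OF \<rho>, of n])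
  fix u v assume "u 0 = cut n u0" "v 0 = cut n u1"
    "\<And>t. 0 \<le> t \<Longrightarrow> (u has_vector_derivative v t) (at t within {0..})"
    "\<And>t. 0 \<le> t \<Longrightarrow> (v has_vector_derivative - m ((norm (trunc rt n (u t)))\<^sup>2) *\<^sub>R trunc lam n (u t)) (at t within {0..})"
    "\<And>t. 0 \<le> t \<Longrightarrow> (norm (trunc rt n (u t)))\<^sup>2 \<le> \<rho>\<^sup>2" "\<And>t. 0 \<le> t \<Longrightarrow> (norm (v t))\<^sup>2 \<le> m0 * \<rho>\<^sup>2"
    "\<And>t. 0 \<le> t \<Longrightarrow> cut n (u t) = u t" "\<And>t. 0 \<le> t \<Longrightarrow> cut n (v t) = v t"
  then have "galerkin_pair n (fst (u, v)) (snd (u, v))" by (simp add: galerkin_pair_def)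
  then show ?thesis by blast
qed

definition U :: "nat \<Rightarrow> real \<Rightarrow> 'a" where "U n = fst (SOME uv. galerkin_pair n (fst uv) (snd uv))"
definition V :: "nat \<Rightarrow> real \<Rightarrow> 'a" where "V n = snd (SOME uv. galerkin_pair n (fst uv) (snd uv))"
definition coef :: "nat \<Rightarrow> real \<Rightarrow> real" where "coef n t = m ((norm (trunc rt n (U n t)))\<^sup>2)"

lemma galerkin_pair_UV: "galerkin_pair n (U n) (V n)"
  unfolding U_def V_def by (rule someI_ex[OF galerkin_pair_exists])

lemma UV:
  shows U_0: "U n 0 = cut n u0" and V_0: "V n 0 = cut n u1"
    and dU: "0 \<le> t \<Longrightarrow> (U n has_vector_derivative V n t) (at t within {0..})"
    and dV: "0 \<le> t \<Longrightarrow> (V n has_vector_derivative - coef n t *\<^sub>R trunc lam n (U n t)) (at t within {0..})"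
    and U_le: "0 \<le> t \<Longrightarrow> (norm (trunc rt n (U n t)))\<^sup>2 \<le> \<rho>\<^sup>2" and V_le: "0 \<le> t \<Longrightarrow> (norm (V n t))\<^sup>2 \<le> m0 * \<rho>\<^sup>2"
    and cut_U: "0 \<le> t \<Longrightarrow> cut n (U n t) = U n t" and cut_V: "0 \<le> t \<Longrightarrow> cut n (V n t) = V n t"
  using galerkin_pair_UV[of n] unfolding galerkin_pair_def coef_def by blast+

definition Lm :: real where
  "Lm = (SOME L. 0 < L \<and> (\<forall>x\<in>{0..\<rho>\<^sup>2}. \<forall>y\<in>{0..\<rho>\<^sup>2}. \<bar>m x - m y\<bar> \<le> L * \<bar>x - y\<bar>))"

lemma Lm: "0 < Lm" "x \<in> {0..\<rho>\<^sup>2} \<Longrightarrow> y \<in> {0..\<rho>\<^sup>2} \<Longrightarrow> \<bar>m x - m y\<bar> \<le> Lm * \<bar>x - y\<bar>"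
  using someI_ex[OF m_lip[of "\<rho>\<^sup>2"]] unfolding Lm_def[symmetric] by auto

definition M1 :: real where "M1 = m 0 + Lm * \<rho>\<^sup>2"

lemma coef_range: assumes "0 \<le> t" shows "m0 \<le> coef n t" "coef n t \<le> M1"
proof -
  let ?s = "(norm (trunc rt n (U n t)))\<^sup>2"
  have s: "?s \<in> {0..\<rho>\<^sup>2}" using U_le[OF assms] by auto
  show "m0 \<le> coef n t" unfolding coef_def by (rule m_ge) simp
  have "m ?s - m 0 \<le> Lm * \<bar>?s - 0\<bar>" using Lm(2)[OF s, of 0] by auto
  also have "\<dots> \<le> Lm * \<rho>\<^sup>2" using Lm(1) s by (intro mult_left_mono) auto
  finally show "coef n t \<le> M1" by (simp add: coef_def M1_def)
qed

lemma M1_pos: "0 < M1" using coef_range[of 0 0] m0 by simp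

text \<open>|A^(1/4) v|^2 + |A^(3/4) u|^2, a quadratic majorant of the derivative 2 <A u, u'> of
  |A^(1/2) u|^2. Being a sum of quadratic forms it can be split by frequency.\<close>

definition flux :: "nat \<Rightarrow> real \<Rightarrow> real" where
  "flux n t = qf n rt (V n t) + qf n (\<lambda>x. rt x * lam x) (U n t)"

lemma flux_nonneg: "0 \<le> flux n t" unfolding flux_def by (intro add_nonneg_nonneg qf_nonneg) simp_all

lemma inner_lam_flux: "\<bar>2 * inner (trunc lam n (U n t)) (V n t)\<bar> \<le> flux n t"
proof -
  let ?a = "trunc (\<lambda>x. rt x * qrt x) n (U n t)" and ?b = "trunc qrt n (V n t)"
  have lbr: "locally_bounded_borel (\<lambda>x. rt x * qrt x)" by (simp add: locally_bounded_mult)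
  have f1: "rt x * qrt x * qrt x = lam x" for x by (simp add: mult.assoc qrt_qrt rt_rt)
  have f2: "(rt x * qrt x) * (rt x * qrt x) = rt x * lam x" for x
    by (metis f1 mult.assoc mult.commute)
  have "inner (trunc lam n (U n t)) (V n t) = inner ?a ?b"
    unfolding trunc_inner[OF lbr lb_qrt] by (simp add: f1)
  then have "\<bar>2 * inner (trunc lam n (U n t)) (V n t)\<bar> \<le> 2 * (norm ?a * norm ?b)"
    using Cauchy_Schwarz_ineq2[of ?a ?b] by simp
  also have "\<dots> \<le> (norm ?a)\<^sup>2 + (norm ?b)\<^sup>2"
    using zero_le_power2[of "norm ?a - norm ?b"] by (simp add: power2_diff)
  also have "(norm ?a)\<^sup>2 = qf n (\<lambda>x. rt x * lam x) (U n t)" by (simp only: qf_sq[OF lbr, symmetric] f2)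
  also have "(norm ?b)\<^sup>2 = qf n rt (V n t)" by (simp only: qf_sq[OF lb_qrt, symmetric] qrt_qrt)
  finally show ?thesis by (simp add: flux_def)
qed

lemma qf_derivative:
  assumes "locally_bounded_borel g" "(w has_vector_derivative w') (at t within S)"
  shows "((\<lambda>s. qf n g (w s)) has_real_derivative 2 * inner (trunc g n (w t)) w') (at t within S)"
  unfolding qf_def by (rule trunc_quad_derivative[OF assms])

lemma qf_continuous:
  assumes g: "locally_bounded_borel g" and w: "continuous_on S w"
  shows "continuous_on S (\<lambda>s. qf n g (w s))"
  unfolding qf_def by (intro continuous_on_inner bounded_linear.continuous_on[OF trunc_bl[OF g]] w)

lemma cont_U: "continuous_on {0..} (U n)" and cont_V: "continuous_on {0..} (V n)"
  by (rule continuous_on_of_vector_derivative[OF dU], simp) (rule continuous_on_of_vector_derivative[OF dV], simp)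

lemma coef_sigma: "(norm (trunc rt n u))\<^sup>2 = qf n lam u"
  using qf_sq[OF lb_rt, of n u] by (simp add: rt_rt)

lemma coef_dini: assumes t: "0 \<le> t" shows "dini_le (coef n) t (Lm * flux n t)"
proof (rule dini_leI[OF t])
  fix e :: real assume e: "0 < e"
  define \<sigma> where "\<sigma> s = qf n lam (U n s)" for s
  have d: "(\<sigma> has_real_derivative 2 * inner (trunc lam n (U n t)) (V n t)) (at t within {0..})"
    unfolding \<sigma>_def by (rule qf_derivative[OF lb_lam dU[OF t]])
  have rng: "\<sigma> s \<in> {0..\<rho>\<^sup>2}" if "0 \<le> s" for s
    using U_le[OF that, of n] by (simp add: \<sigma>_def coef_sigma[symmetric])
  define e' where "e' = e / Lm"
  have e': "0 < e'" using e Lm by (simp add: e'_def)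
  have est: "\<forall>\<^sub>F s in at_right t. \<bar>\<sigma> s - \<sigma> t - 2 * inner (trunc lam n (U n t)) (V n t) * (s - t)\<bar> \<le> e' * (s - t)"
    by (rule derivative_at_right_estimate[OF d t e'])
  have gt: "\<forall>\<^sub>F s in at_right t. t < s" by (simp add: eventually_at_filter)
  show "\<exists>\<psi> d. (\<psi> has_real_derivative d) (at t within {0..}) \<and> d \<le> Lm * flux n t + e \<and> \<psi> t = coef n t \<and>
      (\<forall>\<^sub>F s in at_right t. coef n s \<le> \<psi> s)"
  proof (intro exI conjI)
    let ?\<psi> = "\<lambda>s. coef n t + (Lm * flux n t + e) * (s - t)"
    show "(?\<psi> has_real_derivative (Lm * flux n t + e)) (at t within {0..})"
      by (auto intro!: derivative_eq_intros)
    show "\<forall>\<^sub>F s in at_right t. coef n s \<le> ?\<psi> s"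
      using est gt
    proof eventually_elim
      case (elim s)
      have "\<bar>2 * inner (trunc lam n (U n t)) (V n t) * (s - t)\<bar> \<le> flux n t * (s - t)"
        unfolding abs_mult[of _ "s - t"] using elim inner_lam_flux[of n t] by (simp add: mult_right_mono)
      then have "\<bar>\<sigma> s - \<sigma> t\<bar> \<le> flux n t * (s - t) + e' * (s - t)" using elim by linarith
      then have "Lm * \<bar>\<sigma> s - \<sigma> t\<bar> \<le> Lm * (flux n t * (s - t) + e' * (s - t))" using Lm by (intro mult_left_mono) auto
      also have "\<dots> = (Lm * flux n t + Lm * e') * (s - t)" by (simp only: algebra_simps)
      also have "Lm * e' = e" using Lm(1) by (simp add: e'_def)
      finally have "\<bar>m (\<sigma> s) - m (\<sigma> t)\<bar> \<le> (Lm * flux n t + e) * (s - t)"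
        using Lm(2)[OF rng rng, of s t] elim t by linarith
      then show ?case by (simp add: coef_def coef_sigma \<sigma>_def)
    qed
  qed auto
qed

lemma cont_coef: "continuous_on {0..} (coef n)"
  unfolding coef_def coef_sigma
  by (rule continuous_on_compose2[OF m_cont qf_continuous[OF lb_lam cont_U]]) (auto intro: qf_nonneg)

section \<open>Weighted energies of the truncations and their growth\<close>

definition energy :: "(real \<Rightarrow> real) \<Rightarrow> nat \<Rightarrow> real \<Rightarrow> real" where
  "energy g n t = qf n g (V n t) + coef n t * qf n (\<lambda>x. g x * lam x) (U n t)"

text \<open>The growth rate is the same for every weight: dividing by \<open>m0\<close> bounds the
  potential form by the energy itself, and only the increment of the coefficient
  contributes.\<close>

lemma energy_growth:
  assumes g: "locally_bounded_borel g" "\<And>x. 0 \<le> g x" and T: "0 \<le> T"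
    and K: "\<And>t. t \<in> {0..T} \<Longrightarrow> (K has_real_derivative Lm / m0 * flux n t) (at t within {0..})"
  shows "energy g n T \<le> energy g n 0 * exp (K T - K 0)"
proof (rule dini_gronwall[OF T _ K])
  show "continuous_on {0..T} (energy g n)" unfolding energy_def
    by (intro continuous_intros qf_continuous continuous_on_subset[OF cont_U] continuous_on_subset[OF cont_V]
        continuous_on_subset[OF cont_coef] lb_lam_mult g) auto
  fix t assume "t \<in> {0..<T}"
  then have t: "0 \<le> t" by simp
  have "dini_le (energy g n) t (2 * inner (trunc g n (V n t)) 0 + Lm * flux n t * inner (trunc (\<lambda>x. g x * lam x) n (U n t)) (U n t))"
    unfolding energy_def qf_def
    by (rule energy_dini[where z="\<lambda>_. 0" and w="U n" and ?w1.0="V n" and c="coef n", OF g t dU[OF t] _ coef_dini[OF t]])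
       (use dV[OF t] in simp)
  then show "dini_le (energy g n) t (Lm / m0 * flux n t * energy g n t)"
  proof (rule dini_le_mono)
    have q0: "0 \<le> qf n (\<lambda>x. g x * lam x) (U n t)" "0 \<le> qf n g (V n t)" by (intro qf_nonneg; simp add: g)+
    have "m0 * qf n (\<lambda>x. g x * lam x) (U n t) \<le> energy g n t"
      unfolding energy_def using q0 coef_range(1)[OF t, of n] by (simp add: add_increasing mult_right_mono)
    then have "Lm / m0 * flux n t * (m0 * qf n (\<lambda>x. g x * lam x) (U n t)) \<le> Lm / m0 * flux n t * energy g n t"
      using Lm m0 flux_nonneg by (intro mult_left_mono) auto
    then show "2 * inner (trunc g n (V n t)) 0 + Lm * flux n t * inner (trunc (\<lambda>x. g x * lam x) n (U n t)) (U n t)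
        \<le> Lm / m0 * flux n t * energy g n t"
      using m0 by (simp add: qf_def)
  qed
qed

lemma energy_0:
  assumes g: "locally_bounded_borel g" "\<And>x. 0 \<le> g x"
  shows "energy g n 0 \<le> (1 + M1) * (qf n g u1 + qf n (\<lambda>x. g x * lam x) u0)"
proof -
  have q: "0 \<le> qf n g u1" "0 \<le> qf n (\<lambda>x. g x * lam x) u0" by (intro qf_nonneg; simp add: g)+
  have "energy g n 0 = qf n g u1 + coef n 0 * qf n (\<lambda>x. g x * lam x) u0"
    by (simp add: energy_def U_0 V_0 qf_cut g)
  also have "\<dots> \<le> qf n g u1 + M1 * qf n (\<lambda>x. g x * lam x) u0"
    using q coef_range(2)[of 0 n] by (simp add: mult_right_mono)
  also have "\<dots> \<le> (1 + M1) * (qf n g u1 + qf n (\<lambda>x. g x * lam x) u0)"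
    using q M1_pos by (simp add: algebra_simps)
  finally show ?thesis .
qed

lemma energy_lower:
  assumes g: "locally_bounded_borel g" "\<And>x. 0 \<le> g x" and t: "0 \<le> t"
  shows "qf n g (V n t) + qf n (\<lambda>x. g x * lam x) (U n t) \<le> (1 + 1 / m0) * energy g n t"
proof -
  have q: "0 \<le> qf n g (V n t)" "0 \<le> qf n (\<lambda>x. g x * lam x) (U n t)" by (intro qf_nonneg; simp add: g)+
  have "m0 * qf n (\<lambda>x. g x * lam x) (U n t) \<le> coef n t * qf n (\<lambda>x. g x * lam x) (U n t)"
    using coef_range(1)[OF t, of n] q by (intro mult_right_mono) auto
  then have e: "qf n g (V n t) + m0 * qf n (\<lambda>x. g x * lam x) (U n t) \<le> energy g n t" by (simp add: energy_def)
  have "qf n (\<lambda>x. g x * lam x) (U n t) \<le> energy g n t / m0"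
    using e q m0 by (simp add: field_simps)
  moreover have "0 \<le> m0 * qf n (\<lambda>x. g x * lam x) (U n t)" using q m0 by simp
  ultimately show ?thesis using e q by (simp add: algebra_simps)
qed

text \<open>Below frequency \<open>l\<close> the factor \<open>rt\<close> is at most
  \<open>l\<close>, above it \<open>rt x\<close> is at most exp(-r \<phi>(l)) times
  \<open>wq x * wq x\<close>. The low part then costs only the bounds m0 \<rho>^2 and \<rho>^2 of
  the Hamiltonian estimate, the high part the Gevrey energy.\<close>

lemma flux_split:
  assumes t: "0 \<le> t" and l: "0 \<le> l"
  shows "flux n t \<le> l * ((m0 + 1) * \<rho>\<^sup>2) + exp (- (r * \<phi> l)) * ((1 + 1 / m0) * energy (\<lambda>x. wq x * wq x) n t)"
proof -
  let ?e = "exp (- (r * \<phi> l))"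
  have pt: "rt x \<le> l * 1 + ?e * (wq x * wq x)" for x
  proof (cases "rt x \<le> l")
    case False
    then have "\<phi> l \<le> \<phi> (rt x)" using l strict_mono_onD[OF phi(3), of l "rt x"] by simp
    then have "1 \<le> exp (- (r * \<phi> l)) * exp (r * \<phi> (rt x))" using r by (simp add: exp_add[symmetric])
    then have "rt x * 1 \<le> rt x * (?e * exp (r * \<phi> (rt x)))" by (intro mult_left_mono) auto
    then show ?thesis using l by (simp add: wq_sq mult_ac)
  qed (simp add: add_increasing2)
  have pt2: "rt x * lam x \<le> l * lam x + ?e * (wq x * wq x * lam x)" for x
    using mult_right_mono[OF pt lam_nonneg, of x x] by (simp add: algebra_simps)
  have lb1: "locally_bounded_borel (\<lambda>x. l * 1 + ?e * (wq x * wq x))"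
    by (intro locally_bounded_add locally_bounded_mult lb_wq) simp_all
  have lb2: "locally_bounded_borel (\<lambda>x. l * lam x + ?e * (wq x * wq x * lam x))"
    by (intro locally_bounded_add locally_bounded_mult lb_wq lb_lam) simp_all
  have lbc: "locally_bounded_borel (\<lambda>x. c * f x)" if "locally_bounded_borel f" for c f
    by (rule locally_bounded_mult[OF _ that]) simp
  have lb3: "locally_bounded_borel (\<lambda>x. wq x * wq x * lam x)" by simp
  have "qf n rt (V n t) \<le> l * qf n (\<lambda>x. 1) (V n t) + ?e * qf n (\<lambda>x. wq x * wq x) (V n t)"
  proof -
    have "qf n rt (V n t) \<le> qf n (\<lambda>x. l * 1 + ?e * (wq x * wq x)) (V n t)" by (rule qf_mono[OF lb_rt lb1 pt])
    also have "\<dots> = qf n (\<lambda>x. l * 1) (V n t) + qf n (\<lambda>x. ?e * (wq x * wq x)) (V n t)"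
      by (rule qf_add) (simp_all add: lbc del: mult_1_right)
    also have "qf n (\<lambda>x. l * 1) (V n t) = l * qf n (\<lambda>x. 1) (V n t)" by (rule qf_cmult) simp
    also have "qf n (\<lambda>x. ?e * (wq x * wq x)) (V n t) = ?e * qf n (\<lambda>x. wq x * wq x) (V n t)" by (rule qf_cmult) simp
    finally show ?thesis .
  qed
  moreover have "qf n (\<lambda>x. rt x * lam x) (U n t) \<le> l * qf n lam (U n t) + ?e * qf n (\<lambda>x. wq x * wq x * lam x) (U n t)"
  proof -
    have "qf n (\<lambda>x. rt x * lam x) (U n t) \<le> qf n (\<lambda>x. l * lam x + ?e * (wq x * wq x * lam x)) (U n t)"
      by (rule qf_mono[OF _ lb2 pt2]) simp
    also have "\<dots> = qf n (\<lambda>x. l * lam x) (U n t) + qf n (\<lambda>x. ?e * (wq x * wq x * lam x)) (U n t)"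
      by (rule qf_add[OF lbc[OF lb_lam] lbc[OF lb3]])
    also have "qf n (\<lambda>x. l * lam x) (U n t) = l * qf n lam (U n t)" by (rule qf_cmult) simp
    also have "qf n (\<lambda>x. ?e * (wq x * wq x * lam x)) (U n t) = ?e * qf n (\<lambda>x. wq x * wq x * lam x) (U n t)"
      by (rule qf_cmult[OF lb3])
    finally show ?thesis .
  qed
  moreover have "l * qf n (\<lambda>x. 1) (V n t) + l * qf n lam (U n t) \<le> l * ((m0 + 1) * \<rho>\<^sup>2)"
    unfolding distrib_left[symmetric]
    using l qf_one[of n "V n t"] V_le[OF t, of n] U_le[OF t, of n]
    by (intro mult_left_mono) (auto simp: coef_sigma algebra_simps)
  moreover have "?e * qf n (\<lambda>x. wq x * wq x) (V n t) + ?e * qf n (\<lambda>x. wq x * wq x * lam x) (U n t)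
      \<le> ?e * ((1 + 1 / m0) * energy (\<lambda>x. wq x * wq x) n t)"
    unfolding distrib_left[symmetric] by (intro mult_left_mono energy_lower t) simp_all
  ultimately show ?thesis by (simp add: flux_def)
qed

text \<open>Y = ln G0 + K n is the logarithm of a majorant of the Gevrey energy. At a level with Y
  \<le> r \<phi>(l) the exponential in \<open>flux_split\<close> cancels this majorant, leaving flux
  \<le> C1 (1 + l), the premise of \<open>no_blow_up\<close>. The second conclusion quantifies over
  all weights so that it can be applied to high-frequency tails.\<close>

lemma flux_bound:
  "\<exists>C\<ge>0. \<forall>n. \<forall>t\<in>{0..T}. flux n t \<le> C \<and>
     (\<forall>g. locally_bounded_borel g \<longrightarrow> (\<forall>x. 0 \<le> g x) \<longrightarrow>
       qf n g (V n t) + qf n (\<lambda>x. g x * lam x) (U n t) \<le> C * (qf n g u1 + qf n (\<lambda>x. g x * lam x) u0))"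
proof -
  obtain C0 where C0: "0 < C0" "\<And>n. qf n wt u1 \<le> C0" "\<And>n. qf n (\<lambda>x. wt x * lam x) u0 \<le> C0"
    using data_bounds by blast
  \<comment> \<open>The summand 1 makes ln G0 defined and nonnegative, so the bound on Y also bounds
    \<open>K n\<close>.\<close>
  define G0 where "G0 = (1 + M1) * (C0 + C0) + 1"
  have G0: "1 \<le> G0" using M1_pos C0 by (simp add: G0_def)
  have e0: "energy (\<lambda>x. wq x * wq x) n 0 \<le> G0" for n
  proof -
    have le: "wq x * wq x \<le> wt x" for x by (simp add: wt_def)
    have "energy (\<lambda>x. wq x * wq x) n 0 \<le> (1 + M1) * (qf n (\<lambda>x. wq x * wq x) u1 + qf n (\<lambda>x. wq x * wq x * lam x) u0)"
      by (rule energy_0) simp_all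
    also have "\<dots> \<le> (1 + M1) * (C0 + C0)"
    proof (intro mult_left_mono add_mono)
      show "qf n (\<lambda>x. wq x * wq x) u1 \<le> C0" by (rule order_trans[OF qf_mono[OF _ _ le] C0(2)]) simp_all
      show "qf n (\<lambda>x. wq x * wq x * lam x) u0 \<le> C0"
        by (rule order_trans[OF qf_mono[OF _ _ mult_right_mono[OF le lam_nonneg]] C0(3)]) simp_all
    qed (use M1_pos in simp)
    finally show ?thesis by (simp add: G0_def)
  qed
  define C1 where "C1 = (m0 + 1) * \<rho>\<^sup>2 + (1 + 1 / m0)"
  have C1: "0 < C1" using m0 \<rho>(1) by (simp add: C1_def add_pos_pos)
  define C where "C = Lm / m0 * C1"
  have C: "0 < C" using Lm m0 C1 by (simp add: C_def)
  obtain B where B: "1 \<le> B" "\<And>Y F. Y 0 \<le> ln G0 \<Longrightarrow> (\<forall>t\<in>{0..T}. (Y has_real_derivative F t) (at t within {0..})) \<Longrightarrow>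
    (\<forall>t\<in>{0..T}. 0 \<le> F t) \<Longrightarrow> (\<forall>t\<in>{0..T}. \<forall>l\<ge>1. Y t \<le> r * \<phi> l \<longrightarrow> F t \<le> C * (1 + l)) \<Longrightarrow>
    (\<forall>t\<in>{0..T}. Y t \<le> r * \<phi> B)"
    using no_blow_up[OF phi r C, of "ln G0" T] by blast
  have flux_cont: "continuous_on {0..} (\<lambda>t. Lm / m0 * flux n t)" for n
    unfolding flux_def by (intro continuous_intros qf_continuous cont_U cont_V lb_rt lb_lam_mult)
  have "\<exists>K. K 0 = 0 \<and> (\<forall>t\<ge>0. (K has_real_derivative Lm / m0 * flux n t) (at t within {0..}))" for n
    using primitive_exists[OF flux_cont[of n]] unfolding has_real_derivative_iff_has_vector_derivative .
  then obtain K where K0: "\<And>n. K n 0 = 0"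
    and K: "\<And>n t. 0 \<le> t \<Longrightarrow> (K n has_real_derivative Lm / m0 * flux n t) (at t within {0..})" by metis
  have growth: "energy g n t \<le> energy g n 0 * exp (K n t)" if "locally_bounded_borel g" "\<And>x. 0 \<le> g x" "0 \<le> t" for g n t
    using energy_growth[of g t "K n" n] that K K0 by simp
  have flux_le: "flux n t \<le> C1 * (1 + l)" if t: "0 \<le> t" and l: "1 \<le> l" and Y: "ln G0 + K n t \<le> r * \<phi> l" for n t l
  proof -
    have "energy (\<lambda>x. wq x * wq x) n t \<le> G0 * exp (K n t)"
      by (rule order_trans[OF growth mult_right_mono[OF e0]]) (simp_all add: t)
    also have "\<dots> = exp (ln G0 + K n t)" using G0 by (simp add: exp_add)
    also have "\<dots> \<le> exp (r * \<phi> l)" using Y by simp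
    finally have en: "energy (\<lambda>x. wq x * wq x) n t \<le> exp (r * \<phi> l)" .
    have "exp (- (r * \<phi> l)) * ((1 + 1 / m0) * energy (\<lambda>x. wq x * wq x) n t) \<le> exp (- (r * \<phi> l)) * ((1 + 1 / m0) * exp (r * \<phi> l))"
      using m0 by (intro mult_left_mono en) auto
    also have "\<dots> = 1 + 1 / m0" by (simp add: exp_minus)
    finally have "flux n t \<le> l * ((m0 + 1) * \<rho>\<^sup>2) + (1 + 1 / m0)" using flux_split[OF t, of l n] l by simp
    also have "\<dots> \<le> C1 * (1 + l)"
    proof -
      have "l * a + b \<le> (a + b) * (1 + l)" if "0 \<le> a" "0 \<le> b" for a b :: real
        using that l mult_nonneg_nonneg[of l b] by (simp add: algebra_simps)
      then show ?thesis unfolding C1_def using m0 by (simp add: add_nonneg_nonneg)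
    qed
    finally show ?thesis .
  qed
  have Yb: "ln G0 + K n t \<le> r * \<phi> B" if "t \<in> {0..T}" for n t
  proof -
    have "\<forall>t\<in>{0..T}. ln G0 + K n t \<le> r * \<phi> B"
    proof (rule B(2)[where F="\<lambda>t. Lm / m0 * flux n t"])
      show "ln G0 + K n 0 \<le> ln G0" by (simp add: K0)
      show "\<forall>t\<in>{0..T}. ((\<lambda>t. ln G0 + K n t) has_real_derivative Lm / m0 * flux n t) (at t within {0..})"
        using K by (auto intro!: derivative_eq_intros)
      show "\<forall>t\<in>{0..T}. 0 \<le> Lm / m0 * flux n t" using Lm m0 flux_nonneg by simp
      show "\<forall>t\<in>{0..T}. \<forall>l\<ge>1. ln G0 + K n t \<le> r * \<phi> l \<longrightarrow> Lm / m0 * flux n t \<le> C * (1 + l)"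
      proof (intro ballI allI impI)
        fix t l assume "t \<in> {0..T}" "1 \<le> l" "ln G0 + K n t \<le> r * \<phi> l"
        then have "Lm / m0 * flux n t \<le> Lm / m0 * (C1 * (1 + l))" using Lm m0 by (intro mult_left_mono flux_le) auto
        then show "Lm / m0 * flux n t \<le> C * (1 + l)" by (simp add: C_def)
      qed
    qed
    then show ?thesis using that by blast
  qed
  define CC where "CC = C1 * (1 + B) + (1 + 1 / m0) * ((1 + M1) * exp (r * \<phi> B))"
  have CCa: "0 \<le> C1 * (1 + B)" using C1 B by simp
  have CCb: "0 \<le> (1 + 1 / m0) * ((1 + M1) * exp (r * \<phi> B))" using m0 M1_pos by (intro mult_nonneg_nonneg) auto
  show ?thesis
  proof (intro exI[of _ CC] conjI allI ballI impI)
    show "0 \<le> CC" using CCa CCb by (simp add: CC_def)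
    fix n t assume t: "t \<in> {0..T}"
    have "flux n t \<le> C1 * (1 + B)" using flux_le[OF _ B(1) Yb[OF t, of n]] t by auto
    then show "flux n t \<le> CC" unfolding CC_def using CCb by linarith
    fix g :: "real \<Rightarrow> real" assume g: "locally_bounded_borel g" "\<forall>x. 0 \<le> g x"
    let ?q = "qf n g u1 + qf n (\<lambda>x. g x * lam x) u0"
    have q0: "0 \<le> ?q" by (intro add_nonneg_nonneg qf_nonneg) (use g in auto)
    have "qf n g (V n t) + qf n (\<lambda>x. g x * lam x) (U n t) \<le> (1 + 1 / m0) * energy g n t"
      by (rule energy_lower) (use g t in auto)
    also have "\<dots> \<le> (1 + 1 / m0) * (((1 + M1) * ?q) * exp (r * \<phi> B))"
    proof (rule mult_left_mono)
      have "0 \<le> ln G0" using G0 by simp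
      then have "K n t \<le> r * \<phi> B" using Yb[OF t, of n] by linarith
      then have "exp (K n t) \<le> exp (r * \<phi> B)" by simp
      then have "((1 + M1) * ?q) * exp (K n t) \<le> ((1 + M1) * ?q) * exp (r * \<phi> B)"
        using M1_pos q0 by (intro mult_left_mono mult_nonneg_nonneg) auto
      moreover have "energy g n t \<le> energy g n 0 * exp (K n t)" using growth g t by auto
      moreover have "energy g n 0 * exp (K n t) \<le> ((1 + M1) * ?q) * exp (K n t)"
        using energy_0[of g n] g by (intro mult_right_mono) auto
      ultimately show "energy g n t \<le> ((1 + M1) * ?q) * exp (r * \<phi> B)" by linarith
    qed (use m0 in simp)
    also have "\<dots> = ((1 + 1 / m0) * ((1 + M1) * exp (r * \<phi> B))) * ?q" by (simp only: mult_ac)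
    also have "\<dots> \<le> CC * ?q" using q0 CCa by (intro mult_right_mono) (auto simp: CC_def)
    finally show "qf n g (V n t) + qf n (\<lambda>x. g x * lam x) (U n t) \<le> CC * ?q" .
  qed
qed

end

section \<open>Convergence of the truncations\<close>

text \<open>The symbols of (1+A)^(-1/2), of its square root (1+A)^(-1/4), and of A^(1/2)
  (1+A)^(1/4). The last is the factor that completes A^(1/2) (1+A)^(-1/4) to A.\<close>

definition damp :: "real \<Rightarrow> real" where "damp x = 1 / sqrt (1 + lam x)"
definition hdamp :: "real \<Rightarrow> real" where "hdamp x = sqrt (damp x)"
definition cdamp :: "real \<Rightarrow> real" where "cdamp x = rt x / hdamp x"

lemma damp_pos [simp]: "0 < damp x" and damp_le_1: "damp x \<le> 1"
  using lam_nonneg[of x] by (auto simp: damp_def add_pos_nonneg)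

lemma hdamp_pos [simp]: "0 < hdamp x" by (simp add: hdamp_def)

lemma lb_damp [simp]: "locally_bounded_borel damp" and lb_hdamp [simp]: "locally_bounded_borel hdamp"
  and lb_cdamp [simp]: "locally_bounded_borel cdamp"
proof -
  have d: "continuous_on UNIV damp" unfolding damp_def[abs_def]
    using lam_nonneg by (intro continuous_intros continuous_lam) (simp add: add_pos_nonneg less_imp_neq[symmetric] del: lam_nonneg)
  have h: "continuous_on UNIV hdamp" unfolding hdamp_def[abs_def] by (intro continuous_intros d)
  have "continuous_on UNIV cdamp" unfolding cdamp_def[abs_def]
    by (intro continuous_intros h continuous_rt) (metis hdamp_pos less_irrefl)
  then show "locally_bounded_borel damp" "locally_bounded_borel hdamp" "locally_bounded_borel cdamp"
    using d h by (simp_all add: locally_bounded_continuous)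
qed

lemma hdamp_sq: "hdamp x * hdamp x = damp x"
  by (simp add: hdamp_def abs_of_pos)

lemma hdamp_nonzero [simp]: "hdamp x \<noteq> 0"
  by (metis hdamp_pos less_irrefl)

lemma cdamp_eq: "(rt x * hdamp x) * cdamp x = lam x"
  by (simp add: cdamp_def rt_rt)

lemma rt_hdamp_sq: "(rt x * hdamp x) * (rt x * hdamp x) = damp x * lam x"
  by (simp add: hdamp_sq[symmetric] rt_rt[symmetric] mult_ac)

lemma sqrt_1_lam: "sqrt (1 + lam x) \<le> 1 + rt x"
  by (rule real_le_lsqrt) (auto simp: power2_eq_square algebra_simps rt_rt)

lemma cdamp_sq: "cdamp x * cdamp x \<le> lam x + rt x * lam x"
proof -
  have "cdamp x * cdamp x = lam x / damp x" by (simp add: cdamp_def rt_rt hdamp_sq)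
  also have "\<dots> = lam x * sqrt (1 + lam x)" by (simp add: damp_def)
  also have "\<dots> \<le> lam x * (1 + rt x)" by (intro mult_left_mono sqrt_1_lam) simp
  finally show ?thesis by (simp add: algebra_simps)
qed

lemma hdamp_lam_sq: "(hdamp x * lam x) * (hdamp x * lam x) \<le> rt x * lam x"
proof -
  have "lam x \<le> rt x * sqrt (1 + lam x)"
  proof -
    have "rt x \<le> sqrt (1 + lam x)" by (simp add: rt_def)
    then have "rt x * rt x \<le> rt x * sqrt (1 + lam x)" by (intro mult_left_mono) auto
    then show ?thesis by (simp add: rt_rt)
  qed
  then have "damp x * lam x \<le> rt x" using lam_nonneg[of x] by (simp add: damp_def divide_le_eq add_pos_nonneg del: lam_nonneg)
  then have "damp x * lam x * lam x \<le> rt x * lam x" by (rule mult_right_mono) simp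
  then show ?thesis by (simp add: hdamp_sq[symmetric] mult_ac)
qed

section \<open>The damped energy of the difference of two truncations\<close>

context quasi_analytic begin

lemma qf_diff_lam:
  "\<bar>qf n lam p - qf n lam q\<bar> \<le> sqrt (qf n (\<lambda>x. damp x * lam x) (p - q)) * (norm (trunc cdamp n p) + norm (trunc cdamp n q))"
proof -
  have lb: "locally_bounded_borel (\<lambda>x. rt x * hdamp x)" by (simp add: locally_bounded_mult)
  have "qf n lam p - qf n lam q = inner (trunc lam n (p - q)) (p + q)"
    unfolding qf_def trunc_linear[OF lb_lam]
    using trunc_sym[OF lb_lam, of n q p] by (simp add: inner_diff_left inner_add_right inner_commute[of q])
  also have "\<dots> = inner (trunc (\<lambda>x. rt x * hdamp x) n (p - q)) (trunc cdamp n (p + q))"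
    unfolding trunc_inner[OF lb lb_cdamp] cdamp_eq by simp
  finally have "\<bar>qf n lam p - qf n lam q\<bar> \<le> norm (trunc (\<lambda>x. rt x * hdamp x) n (p - q)) * norm (trunc cdamp n (p + q))"
    by (simp only: Cauchy_Schwarz_ineq2)
  also have "norm (trunc (\<lambda>x. rt x * hdamp x) n (p - q)) = sqrt (qf n (\<lambda>x. damp x * lam x) (p - q))"
    using qf_sq[OF lb, of n "p - q"] by (simp add: rt_hdamp_sq real_sqrt_unique)
  also have "norm (trunc cdamp n (p + q)) \<le> norm (trunc cdamp n p) + norm (trunc cdamp n q)"
    unfolding trunc_linear[OF lb_cdamp] by (rule norm_triangle_ineq)
  finally show ?thesis by (simp add: mult_left_mono qf_nonneg less_imp_le)
qed

lemma norm_cdamp: "(norm (trunc cdamp n p))\<^sup>2 \<le> qf n lam p + qf n (\<lambda>x. rt x * lam x) p"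
proof -
  have "(norm (trunc cdamp n p))\<^sup>2 \<le> qf n (\<lambda>x. lam x + rt x * lam x) p"
    unfolding qf_sq[OF lb_cdamp, symmetric]
    by (intro qf_mono locally_bounded_add locally_bounded_mult cdamp_sq) simp_all
  then show ?thesis by (simp add: qf_add)
qed

text \<open>The damping is shared evenly: (1+A)^(-1/4) goes to \<open>w\<close>, and (1+A)^(-1/4) A
  on \<open>p\<close> is dominated by A^(3/4).\<close>

lemma inner_damp_lam:
  "\<bar>inner (trunc damp n w) (trunc lam n p)\<bar> \<le> sqrt (qf n damp w) * sqrt (qf n (\<lambda>x. rt x * lam x) p)"
proof -
  have lb: "locally_bounded_borel (\<lambda>x. hdamp x * lam x)" by simp
  have "inner (trunc damp n w) (trunc lam n p) = inner (trunc hdamp n w) (trunc (\<lambda>x. hdamp x * lam x) n p)"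
    unfolding trunc_inner[OF lb_damp lb_lam] trunc_inner[OF lb_hdamp lb] by (simp add: hdamp_sq mult.assoc[symmetric])
  then have "\<bar>inner (trunc damp n w) (trunc lam n p)\<bar> \<le> norm (trunc hdamp n w) * norm (trunc (\<lambda>x. hdamp x * lam x) n p)"
    by (simp only: Cauchy_Schwarz_ineq2)
  also have "norm (trunc hdamp n w) = sqrt (qf n damp w)"
    using qf_sq[OF lb_hdamp, of n w] by (simp add: hdamp_sq real_sqrt_unique)
  also have "norm (trunc (\<lambda>x. hdamp x * lam x) n p) \<le> sqrt (qf n (\<lambda>x. rt x * lam x) p)"
  proof (rule real_le_rsqrt)
    show "(norm (trunc (\<lambda>x. hdamp x * lam x) n p))\<^sup>2 \<le> qf n (\<lambda>x. rt x * lam x) p"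
      unfolding qf_sq[OF lb, symmetric] by (intro qf_mono locally_bounded_mult hdamp_lam_sq) simp_all
  qed
  finally show ?thesis by (simp add: mult_left_mono qf_nonneg less_imp_le)
qed

lemma trunc_up:
  assumes f: "locally_bounded_borel f" and "n \<le> n'" and u: "cut n u = u"
  shows "trunc f n' u = trunc f n u"
  using cut_trunc(3)[OF f assms(2), of u] u by simp

text \<open>The solution of the smaller window n can be read in the larger window n'. The difference
  then solves the equation with coefficient \<open>coef n'\<close> and forcing (coef n - coef n') A
  U n. Both the coefficient difference and the work of the forcing are controlled by the damped
  energy of the difference, so Gronwall leaves only the distance of the cut data.\<close>

lemma cauchy_estimate:
  assumes T: "0 \<le> T"
  shows "\<exists>C\<ge>0. \<forall>n n'. n \<le> n' \<longrightarrow> (\<forall>t\<in>{0..T}.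
    qf n' damp (V n' t - V n t) + qf n' (\<lambda>x. damp x * lam x) (U n' t - U n t) \<le>
      C * ((norm (cut n' u1 - cut n u1))\<^sup>2 + (norm (trunc rt n' u0 - trunc rt n u0))\<^sup>2) \<and>
    \<bar>coef n' t - coef n t\<bar>\<^sup>2 \<le> C * ((norm (cut n' u1 - cut n u1))\<^sup>2 + (norm (trunc rt n' u0 - trunc rt n u0))\<^sup>2))"
proof -
  obtain C0 where C0: "0 \<le> C0" "\<And>n t. t \<in> {0..T} \<Longrightarrow> flux n t \<le> C0" using flux_bound[of T] by blast
  define k0 where "k0 = sqrt (\<rho>\<^sup>2 + C0)"
  have k0: "0 \<le> k0" using C0 by (simp add: k0_def)
  \<comment> \<open>The first term comes from the forcing (\<open>k0\<close> bounds the factor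
    \<open>cdamp\<close>, the root of \<open>C0\<close> the norm of A^(3/4) U n), the second from
    the variation of \<open>coef n'\<close>; the last factor passes from p + q to the
    energy.\<close>
  define K where "K = (2 * Lm * k0 * sqrt C0 + Lm * C0) * (1 + 1 / m0)"
  have K0: "0 \<le> 2 * Lm * k0 * sqrt C0 + Lm * C0" using Lm(1) k0 C0 by (intro add_nonneg_nonneg mult_nonneg_nonneg) auto
  define C1 where "C1 = (1 + 1 / m0) * ((1 + M1) * exp (K * T))"
  have C1: "0 \<le> C1" using m0 M1_pos by (simp add: C1_def)
  define C where "C = C1 + (Lm * (2 * k0))\<^sup>2 * C1"
  have C: "C1 \<le> C" "(Lm * (2 * k0))\<^sup>2 * C1 \<le> C" using C1 by (simp_all add: C_def)
  have qlam: "qf n lam (U n t) \<le> \<rho>\<^sup>2" if "t \<in> {0..T}" for n t using U_le[of t n] that by (simp add: coef_sigma)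
  have qrl: "qf n (\<lambda>x. rt x * lam x) (U n t) \<le> C0" if "t \<in> {0..T}" for n t
  proof -
    have "0 \<le> qf n rt (V n t)" by (rule qf_nonneg) simp_all
    then show ?thesis using C0(2)[OF that, of n] by (simp add: flux_def)
  qed
  have kk: "norm (trunc cdamp n (U n t)) \<le> k0" if "t \<in> {0..T}" for n t
    unfolding k0_def using order_trans[OF norm_cdamp add_mono[OF qlam[OF that] qrl[OF that]], of n]
    by (rule real_le_rsqrt)
  have main: "qf n' damp (V n' t - V n t) + qf n' (\<lambda>x. damp x * lam x) (U n' t - U n t) \<le>
      C1 * ((norm (cut n' u1 - cut n u1))\<^sup>2 + (norm (trunc rt n' u0 - trunc rt n u0))\<^sup>2) \<and>
      \<bar>coef n' t - coef n t\<bar>\<^sup>2 \<le> (Lm * (2 * k0))\<^sup>2 * qf n' (\<lambda>x. damp x * lam x) (U n' t - U n t)"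
    if nn: "n \<le> n'" and t: "t \<in> {0..T}" for n n' t
  proof -
    define p where "p t = qf n' damp (V n' t - V n t)" for t
    define q where "q t = qf n' (\<lambda>x. damp x * lam x) (U n' t - U n t)" for t
    define e where "e t = p t + coef n' t * q t" for t
    have p0: "0 \<le> p t" and q0: "0 \<le> q t" for t
      unfolding p_def q_def by (intro qf_nonneg; simp add: less_imp_le)+
    have up: "trunc f n' (U n t) = trunc f n (U n t)" if "locally_bounded_borel f" "0 \<le> t" for f t
      by (rule trunc_up[OF that(1) nn cut_U[OF that(2)]])
    have dc: "\<bar>coef n' t - coef n t\<bar> \<le> Lm * (sqrt (q t) * (2 * k0))" if t: "t \<in> {0..T}" for t
    proof -
      have t0: "0 \<le> t" using t by simp
      have qn: "qf n lam (U n t) = qf n' lam (U n t)" using up[OF lb_lam t0] by (simp add: qf_def)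
      have "\<bar>coef n' t - coef n t\<bar> \<le> Lm * \<bar>qf n' lam (U n' t) - qf n lam (U n t)\<bar>"
        unfolding coef_def coef_sigma using U_le[OF t0] by (intro Lm) (auto simp: coef_sigma qf_nonneg)
      also have "\<bar>qf n' lam (U n' t) - qf n lam (U n t)\<bar> \<le> sqrt (q t) * (norm (trunc cdamp n' (U n' t)) + norm (trunc cdamp n' (U n t)))"
        unfolding qn q_def by (rule qf_diff_lam)
      also have "\<dots> \<le> sqrt (q t) * (2 * k0)"
        using kk[OF t, of n] kk[OF t, of n'] q0[of t] up[OF lb_cdamp t0] by (intro mult_left_mono) auto
      finally show ?thesis using Lm(1) by (simp add: mult_left_mono)
    qed
    have pq_e: "p t + q t \<le> (1 + 1 / m0) * e t" if "0 \<le> t" for t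
    proof -
      have "m0 * q t \<le> coef n' t * q t" using coef_range(1)[OF that, of n'] q0 by (rule mult_right_mono)
      then have e1: "p t + m0 * q t \<le> e t" by (simp add: e_def)
      then have "q t \<le> e t / m0" using p0[of t] m0 by (simp add: field_simps)
      moreover have "p t \<le> e t" using e1 mult_nonneg_nonneg[of m0 "q t"] m0 q0[of t] by linarith
      ultimately show ?thesis by (simp add: algebra_simps)
    qed
    have grow: "e t \<le> e 0 * exp (K * t - K * 0)"
    proof (rule dini_gronwall[where k="\<lambda>_. K" and K="\<lambda>t. K * t"])
      show "0 \<le> t" using t by simp
      show "continuous_on {0..t} e" unfolding e_def p_def q_def
        by (intro continuous_intros qf_continuous continuous_on_subset[OF cont_U] continuous_on_subset[OF cont_V]
            continuous_on_subset[OF cont_coef] lb_lam_mult lb_damp) auto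
      show "((\<lambda>t. K * t) has_real_derivative K) (at s within {0..})" for s by (auto intro!: derivative_eq_intros)
      fix s assume s: "s \<in> {0..<t}"
      then have s0: "0 \<le> s" and sT: "s \<in> {0..T}" using t by auto
      define z where "z s = (coef n s - coef n' s) *\<^sub>R trunc lam n' (U n s)" for s
      have "dini_le e s (2 * inner (trunc damp n' (V n' s - V n s)) (z s) + Lm * flux n' s * q s)"
        unfolding e_def p_def q_def qf_def
      proof (rule energy_dini[where w="\<lambda>s. U n' s - U n s" and ?w1.0="\<lambda>s. V n' s - V n s" and z=z and c="coef n'"])
        show "((\<lambda>s. U n' s - U n s) has_vector_derivative V n' s - V n s) (at s within {0..})"
          by (intro has_vector_derivative_diff dU s0)
        have "((\<lambda>s. V n' s - V n s) has_vector_derivative (- coef n' s *\<^sub>R trunc lam n' (U n' s) - - coef n s *\<^sub>R trunc lam n (U n s))) (at s within {0..})"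
          by (intro has_vector_derivative_diff dV s0)
        moreover have "- coef n' s *\<^sub>R trunc lam n' (U n' s) - - coef n s *\<^sub>R trunc lam n (U n s)
            = z s - coef n' s *\<^sub>R trunc lam n' (U n' s - U n s)"
          by (simp add: z_def up[OF lb_lam s0] trunc_linear algebra_simps)
        ultimately show "((\<lambda>s. V n' s - V n s) has_vector_derivative z s - coef n' s *\<^sub>R trunc lam n' (U n' s - U n s)) (at s within {0..})"
          by simp
      qed (use s0 coef_dini in \<open>auto simp: less_imp_le\<close>)
      then show "dini_le e s (K * e s)"
      proof (rule dini_le_mono)
        have "\<bar>inner (trunc damp n' (V n' s - V n s)) (z s)\<bar> = \<bar>coef n' s - coef n s\<bar> * \<bar>inner (trunc damp n' (V n' s - V n s)) (trunc lam n' (U n s))\<bar>"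
          by (simp add: z_def abs_mult abs_minus_commute)
        also have "\<dots> \<le> (Lm * (sqrt (q s) * (2 * k0))) * (sqrt (p s) * sqrt C0)"
        proof (rule mult_mono[OF dc[OF sT]])
          have "qf n' (\<lambda>x. rt x * lam x) (U n s) = qf n (\<lambda>x. rt x * lam x) (U n s)"
            using up[OF lb_lam_mult[OF lb_rt] s0] by (simp add: qf_def)
          then have "sqrt (qf n' (\<lambda>x. rt x * lam x) (U n s)) \<le> sqrt C0" using qrl[OF sT, of n] by simp
          then have "sqrt (p s) * sqrt (qf n' (\<lambda>x. rt x * lam x) (U n s)) \<le> sqrt (p s) * sqrt C0"
            using p0[of s] by (intro mult_left_mono) auto
          then show "\<bar>inner (trunc damp n' (V n' s - V n s)) (trunc lam n' (U n s))\<bar> \<le> sqrt (p s) * sqrt C0"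
            using inner_damp_lam[of n' "V n' s - V n s" "U n s"] unfolding p_def by linarith
        qed (use Lm(1) k0 q0 in auto)
        also have "\<dots> = (Lm * k0 * sqrt C0) * (2 * (sqrt (q s) * sqrt (p s)))" by (simp add: mult_ac)
        also have "\<dots> \<le> (Lm * k0 * sqrt C0) * (p s + q s)"
        proof (rule mult_left_mono)
          have "0 \<le> (sqrt (q s) - sqrt (p s))\<^sup>2" by simp
          then show "2 * (sqrt (q s) * sqrt (p s)) \<le> p s + q s" using p0[of s] q0[of s] by (simp add: power2_diff)
        qed (use Lm(1) k0 C0 in simp)
        finally have "2 * inner (trunc damp n' (V n' s - V n s)) (z s) \<le> (2 * Lm * k0 * sqrt C0) * (p s + q s)"
          by (simp add: abs_le_iff)
        moreover have "Lm * flux n' s * q s \<le> (Lm * C0) * (p s + q s)"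
          using C0(2)[OF sT, of n'] Lm(1) p0[of s] q0[of s] C0(1) flux_nonneg[of n' s] by (intro mult_mono) auto
        ultimately have "2 * inner (trunc damp n' (V n' s - V n s)) (z s) + Lm * flux n' s * q s
            \<le> (2 * Lm * k0 * sqrt C0 + Lm * C0) * (p s + q s)" by (simp add: distrib_right)
        also have "\<dots> \<le> (2 * Lm * k0 * sqrt C0 + Lm * C0) * ((1 + 1 / m0) * e s)" by (rule mult_left_mono[OF pq_e[OF s0] K0])
        also have "\<dots> = K * e s" by (simp add: K_def)
        finally show "2 * inner (trunc damp n' (V n' s - V n s)) (z s) + Lm * flux n' s * q s \<le> K * e s" .
      qed
    qed
    let ?d = "(norm (cut n' u1 - cut n u1))\<^sup>2 + (norm (trunc rt n' u0 - trunc rt n u0))\<^sup>2"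
    have e0: "e 0 \<le> (1 + M1) * ?d"
    proof -
      have "p 0 \<le> qf n' (\<lambda>x. 1) (cut n' u1 - cut n u1)" unfolding p_def V_0 by (intro qf_mono damp_le_1) simp_all
      also have "\<dots> \<le> (norm (cut n' u1 - cut n u1))\<^sup>2" by (rule qf_one)
      finally have pp: "p 0 \<le> (norm (cut n' u1 - cut n u1))\<^sup>2" .
      have "q 0 \<le> qf n' lam (cut n' u0 - cut n u0)" unfolding q_def U_0
        by (intro qf_mono) (simp_all add: mult_left_le_one_le damp_le_1 less_imp_le)
      also have "\<dots> = (norm (trunc rt n' u0 - trunc rt n u0))\<^sup>2"
        unfolding coef_sigma[symmetric] trunc_linear[OF lb_rt] using cut_trunc(3)[OF lb_rt nn] cut_trunc(3)[OF lb_rt order_refl] by simp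
      finally have qq: "q 0 \<le> (norm (trunc rt n' u0 - trunc rt n u0))\<^sup>2" .
      have "coef n' 0 * q 0 \<le> M1 * (norm (trunc rt n' u0 - trunc rt n u0))\<^sup>2"
        using coef_range[of 0 n'] m0 M1_pos q0[of 0] qq by (intro mult_mono) auto
      then have "e 0 \<le> (norm (cut n' u1 - cut n u1))\<^sup>2 + M1 * (norm (trunc rt n' u0 - trunc rt n u0))\<^sup>2"
        using pp by (simp add: e_def)
      also have "\<dots> \<le> (1 + M1) * ?d" using M1_pos by (simp add: algebra_simps)
      finally show ?thesis .
    qed
    have "p t + q t \<le> (1 + 1 / m0) * e t" using pq_e t by simp
    also have "\<dots> \<le> (1 + 1 / m0) * (((1 + M1) * ?d) * exp (K * T))"
    proof (rule mult_left_mono)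
      have KT: "K * t \<le> K * T" using t K0 m0 by (intro mult_left_mono) (auto simp: K_def)
      have "e t \<le> e 0 * exp (K * t)" using grow by simp
      also have "\<dots> \<le> ((1 + M1) * ?d) * exp (K * T)"
        using e0 KT M1_pos by (intro mult_mono) auto
      finally show "e t \<le> ((1 + M1) * ?d) * exp (K * T)" .
    qed (use m0 in simp)
    also have "\<dots> = C1 * ?d" by (simp add: C1_def mult_ac)
    finally have 1: "p t + q t \<le> C1 * ?d" .
    have "\<bar>coef n' t - coef n t\<bar>\<^sup>2 \<le> (Lm * (sqrt (q t) * (2 * k0)))\<^sup>2" by (rule power_mono[OF dc[OF t]]) simp
    also have "\<dots> = (Lm * (2 * k0))\<^sup>2 * q t" using q0[of t] by (simp add: power_mult_distrib mult_ac)
    finally show ?thesis using 1 by (simp add: p_def q_def)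
  qed
  show ?thesis
  proof (intro exI[of _ C] conjI allI impI ballI)
    show "0 \<le> C" using C1 C by linarith
    fix n n' :: nat and t :: real assume nn: "n \<le> n'" and t: "t \<in> {0..T}"
    let ?d = "(norm (cut n' u1 - cut n u1))\<^sup>2 + (norm (trunc rt n' u0 - trunc rt n u0))\<^sup>2"
    let ?p = "qf n' damp (V n' t - V n t)" and ?q = "qf n' (\<lambda>x. damp x * lam x) (U n' t - U n t)"
    have d0: "0 \<le> ?d" by simp
    note m = main[OF nn t]
    have "C1 * ?d \<le> C * ?d" by (rule mult_right_mono[OF C(1) d0])
    then show "?p + ?q \<le> C * ?d" using m by linarith
    have "0 \<le> ?p" by (intro qf_nonneg) (simp_all add: less_imp_le)
    then have "?q \<le> C1 * ?d" using m by linarith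
    then have "(Lm * (2 * k0))\<^sup>2 * ?q \<le> (Lm * (2 * k0))\<^sup>2 * (C1 * ?d)" by (intro mult_left_mono) auto
    also have "\<dots> \<le> C * ?d" using mult_right_mono[OF C(2) d0] by (simp add: mult_ac)
    finally show "\<bar>coef n' t - coef n t\<bar>\<^sup>2 \<le> C * ?d" using m by linarith
  qed
qed

end

section \<open>Limits that are uniform on bounded time intervals\<close>

definition locally_uniform_cauchy :: "(nat \<Rightarrow> real \<Rightarrow> 'a::real_normed_vector) \<Rightarrow> bool" where
  "locally_uniform_cauchy F \<longleftrightarrow>
     (\<forall>T\<ge>0. \<forall>\<epsilon>>0. \<exists>N. \<forall>n\<ge>N. \<forall>n'\<ge>n. \<forall>t\<in>{0..T}. norm (F n' t - F n t) \<le> \<epsilon>)"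

lemma locally_uniform_limit:
  fixes F :: "nat \<Rightarrow> real \<Rightarrow> 'a::{real_inner,complete_space}"
  assumes F: "locally_uniform_cauchy F"
  obtains G where "\<And>T. 0 \<le> T \<Longrightarrow> uniform_limit {0..T} F G sequentially"
proof -
  have "convergent (\<lambda>n. F n t)" if t: "0 \<le> t" for t
  proof (rule Cauchy_convergent, rule CauchyI)
    fix e :: real assume e: "0 < e"
    then have "0 < e / 2" by simp
    then obtain N where N: "\<And>n n'. n \<ge> N \<Longrightarrow> n' \<ge> n \<Longrightarrow> norm (F n' t - F n t) \<le> e / 2"
      using F t unfolding locally_uniform_cauchy_def by (meson atLeastAtMost_iff order_refl)
    have "norm (F m t - F n t) < e" if "m \<ge> N" "n \<ge> N" for m n
      using N[of n m] N[of m n] that e by (cases "m \<le> n") (auto simp: norm_minus_commute)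
    then show "\<exists>M. \<forall>m\<ge>M. \<forall>n\<ge>M. norm (F m t - F n t) < e" by blast
  qed
  then have lim: "(\<lambda>n. F n t) \<longlonglongrightarrow> lim (\<lambda>n. F n t)" if "0 \<le> t" for t using that convergent_LIMSEQ_iff by blast
  show ?thesis
  proof (rule that[of "\<lambda>t. lim (\<lambda>n. F n t)"])
    fix T :: real assume T: "0 \<le> T"
    show "uniform_limit {0..T} F (\<lambda>t. lim (\<lambda>n. F n t)) sequentially"
    proof (rule uniform_limitI)
      fix e :: real assume e: "0 < e"
      then have "0 < e / 2" by simp
      then obtain N where N: "\<And>n n' t. n \<ge> N \<Longrightarrow> n' \<ge> n \<Longrightarrow> t \<in> {0..T} \<Longrightarrow> norm (F n' t - F n t) \<le> e / 2"
        using F T unfolding locally_uniform_cauchy_def by meson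
      have "dist (F n t) (lim (\<lambda>n. F n t)) < e" if n: "n \<ge> N" and t: "t \<in> {0..T}" for n t
      proof -
        have "norm (lim (\<lambda>n. F n t) - F n t) \<le> e / 2"
        proof (rule LIMSEQ_le_const2)
          show "(\<lambda>n'. norm (F n' t - F n t)) \<longlonglongrightarrow> norm (lim (\<lambda>n. F n t) - F n t)"
            using t by (intro tendsto_intros lim) simp
        qed (use N[OF n _ t] in blast)
        then show ?thesis using e by (simp add: dist_norm norm_minus_commute)
      qed
      then show "\<forall>\<^sub>F n in sequentially. \<forall>t\<in>{0..T}. dist (F n t) (lim (\<lambda>n. F n t)) < e"
        unfolding eventually_sequentially by blast
    qed
  qed
qed

lemma locally_uniform_pointwise:
  fixes F :: "nat \<Rightarrow> real \<Rightarrow> 'a::metric_space"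
  assumes "\<And>T. 0 \<le> T \<Longrightarrow> uniform_limit {0..T} F G sequentially" "0 \<le> t"
  shows "(\<lambda>n. F n t) \<longlonglongrightarrow> G t"
  by (rule tendsto_uniform_limitI[OF assms(1)[OF assms(2)]]) (use assms(2) in simp)

lemma locally_uniform_continuous:
  fixes F :: "nat \<Rightarrow> real \<Rightarrow> 'a::metric_space"
  assumes lim: "\<And>T. 0 \<le> T \<Longrightarrow> uniform_limit {0..T} F G sequentially"
    and cont: "\<And>n. continuous_on {0..} (F n)"
  shows "continuous_on {0..} G"
  unfolding continuous_on_eq_continuous_within
proof
  fix t :: real assume t: "t \<in> {0..}"
  have "continuous_on {0..t + 1} G"
    by (rule uniform_limit_theorem[OF _ lim]) (use t in \<open>auto intro!: always_eventually continuous_on_subset[OF cont]\<close>)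
  then have "continuous (at t within {0..t+1}) G" using t by (auto simp: continuous_on_eq_continuous_within)
  moreover have "at t within {0..t+1} = at t within {0..}"
    using t by (intro at_within_nhd[of t "{..<t+1}"]) auto
  ultimately show "continuous (at t within {0..}) G" by (simp add: continuous_within)
qed

text \<open>The mean value inequality shows that \<open>F n\<close> minus its initial value
  converges to the primitive of the limit derivative, so \<open>G\<close> is that primitive up to a
  constant.\<close>

lemma locally_uniform_derivative:
  fixes F :: "nat \<Rightarrow> real \<Rightarrow> 'a::{real_inner,complete_space}"
  assumes lim: "\<And>T. 0 \<le> T \<Longrightarrow> uniform_limit {0..T} F' G' sequentially"
    and cont: "\<And>n. continuous_on {0..} (F' n)"
    and d: "\<And>n t. 0 \<le> t \<Longrightarrow> (F n has_vector_derivative F' n t) (at t within {0..})"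
    and ptw: "\<And>t. 0 \<le> t \<Longrightarrow> (\<lambda>n. F n t) \<longlonglongrightarrow> G t" and t: "0 \<le> t"
  shows "(G has_vector_derivative G' t) (at t within {0..})"
proof -
  have "continuous_on {0..} G'" by (rule locally_uniform_continuous[OF lim cont])
  then obtain P where P0: "P 0 = 0" and P: "\<And>t. 0 \<le> t \<Longrightarrow> (P has_vector_derivative G' t) (at t within {0..})"
    using primitive_exists by blast
  have GP: "G s = G 0 + P s" if s: "0 \<le> s" for s
  proof -
    have "(\<lambda>n. F n s - F n 0 - P s) \<longlonglongrightarrow> 0"
    proof (rule tendstoI)
      fix e :: real assume e: "0 < e"
      define e' where "e' = e / (s + 1)"
      have e': "0 < e'" using e s by (simp add: e'_def)
      have ev: "\<forall>\<^sub>F n in sequentially. \<forall>\<tau>\<in>{0..s}. dist (F' n \<tau>) (G' \<tau>) < e'"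
        by (rule uniform_limitD[OF lim[OF s] e'])
      show "\<forall>\<^sub>F n in sequentially. dist (F n s - F n 0 - P s) 0 < e" using ev
      proof eventually_elim
        case (elim n)
        have "norm ((F n s - P s) - (F n 0 - P 0)) \<le> e' * s - e' * 0"
          by (rule norm_increment_le[OF order_refl s, where g="\<lambda>\<tau>. F' n \<tau> - G' \<tau>" and h'="\<lambda>_. e'"])
             (use elim in \<open>auto simp: dist_norm less_imp_le intro!: has_vector_derivative_diff d P derivative_eq_intros\<close>)
        also have "\<dots> < e" using e s by (simp add: e'_def divide_less_eq)
        finally show ?case by (simp add: P0 algebra_simps)
      qed
    qed
    moreover have "(\<lambda>n. F n s - F n 0 - P s) \<longlonglongrightarrow> G s - G 0 - P s" using s by (intro tendsto_intros ptw) auto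
    ultimately have "G s - G 0 - P s = 0" using LIMSEQ_unique by blast
    then show ?thesis by (simp add: algebra_simps)
  qed
  show ?thesis
  proof (rule has_vector_derivative_transform[where f="\<lambda>s. G 0 + P s"])
    have "((\<lambda>s. G 0 + P s) has_vector_derivative 0 + G' t) (at t within {0..})"
      by (intro has_vector_derivative_add has_vector_derivative_const P t)
    then show "((\<lambda>s. G 0 + P s) has_vector_derivative G' t) (at t within {0..})" by simp
    show "G s = G 0 + P s" if "s \<in> {0..}" for s using that by (intro GP) simp
  qed (use t in simp)
qed

text \<open>A closed graph property along moving windows: on a fixed window j all operators are
  bounded, and for n \<ge> j cutting \<open>trunc f n\<close> to window j gives
  \<open>trunc f j\<close>.\<close>

lemma (in resolution) spec_op_limit:
  assumes f: "locally_bounded_borel f" and X: "X \<longlonglongrightarrow> x" and Y: "(\<lambda>n. trunc f n (X n)) \<longlonglongrightarrow> y"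
  shows "x \<in> spec_dom E f" "spec_op E f x = y"
proof -
  have "cut j y = trunc f j x" for j
  proof (rule LIMSEQ_unique)
    show "(\<lambda>n. cut j (trunc f n (X n))) \<longlonglongrightarrow> cut j y" by (rule bounded_linear.tendsto[OF cut_bl Y])
    have "(\<lambda>n. trunc f j (X n)) \<longlonglongrightarrow> trunc f j x" by (rule bounded_linear.tendsto[OF trunc_bl[OF f] X])
    moreover have "\<forall>\<^sub>F n in sequentially. trunc f j (X n) = cut j (trunc f n (X n))"
      unfolding eventually_sequentially by (intro exI[of _ j] allI impI cut_trunc(2)[OF f, symmetric])
    ultimately show "(\<lambda>n. cut j (trunc f n (X n))) \<longlonglongrightarrow> trunc f j x" by (rule Lim_transform_eventually)
  qed
  then show "x \<in> spec_dom E f" "spec_op E f x = y" by (rule spec_opI[OF f])+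
qed

section \<open>Tails, and convergence of functions of A along the truncations\<close>

context quasi_analytic begin

lemma qf_level_mono:
  assumes g: "locally_bounded_borel g" "\<And>x. 0 \<le> g x" and jn: "j \<le> n"
  shows "qf j g u \<le> qf n g u"
  unfolding qf_def trunc_quad[OF g(1)]
proof (rule integral_mono)
  show "integrable (\<mu> u) (\<lambda>x. g x * indicator {- real j..real j} x)"
    "integrable (\<mu> u) (\<lambda>x. g x * indicator {- real n..real n} x)"
    by (intro integrable_mu locally_bounded_borelD(2) g)+
  show "g x * indicator {- real j..real j} x \<le> g x * indicator {- real n..real n} x" for x
    using g(2)[of x] jn by (auto simp: indicator_def)
qed

definition tail :: "nat \<Rightarrow> (real \<Rightarrow> real) \<Rightarrow> real \<Rightarrow> real" where
  "tail j g x = g x * (1 - indicator {- real j..real j} x)"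

lemma lb_tail [simp]: "locally_bounded_borel g \<Longrightarrow> locally_bounded_borel (tail j g)"
  unfolding tail_def[abs_def] by (rule locally_bounded_mult) (simp_all add: bounded_imp_locally_bounded)

lemma tail_nonneg: "0 \<le> g x \<Longrightarrow> 0 \<le> tail j g x"
  by (simp add: tail_def indicator_def)

lemma trunc_tail:
  assumes f: "locally_bounded_borel f" and jn: "j \<le> n"
  shows "trunc f n u = trunc f j u + trunc (tail j f) n u"
proof -
  have "(\<lambda>x. f x * indicator {- real n..real n} x) =
     (\<lambda>x. f x * indicator {- real j..real j} x + tail j f x * indicator {- real n..real n} x)"
    using jn by (auto simp: tail_def indicator_def)
  then show ?thesis unfolding trunc_def
    by (simp only: fcalc_add[OF locally_bounded_borelD(2)[OF f] locally_bounded_borelD(2)[OF lb_tail[OF f]]])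
qed

lemma qf_tail: "locally_bounded_borel g \<Longrightarrow> j \<le> n \<Longrightarrow> qf n (tail j g) u = qf n g u - qf j g u"
  using trunc_tail[of g j n u] by (simp add: qf_def inner_add_left)

lemma qf_low:
  assumes f: "locally_bounded_borel f" "locally_bounded_borel g" "\<And>x. 0 \<le> g x"
    and le: "\<And>x. x \<in> {- real j..real j} \<Longrightarrow> f x * f x \<le> c * g x"
  shows "(norm (trunc f j u))\<^sup>2 \<le> c * qf j g u"
proof -
  have lbf: "locally_bounded_borel (\<lambda>x. f x * f x)" by (rule locally_bounded_mult[OF f(1) f(1)])
  have lbg: "locally_bounded_borel (\<lambda>x. c * g x)" by (rule locally_bounded_mult[OF _ f(2)]) simp
  have "(norm (trunc f j u))\<^sup>2 = (\<integral>x. (f x * f x) * indicator {- real j..real j} x \<partial>\<mu> u)"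
    unfolding norm_trunc_sq[OF f(1)] by (rule trunc_quad[OF lbf])
  also have "\<dots> \<le> (\<integral>x. c * g x * indicator {- real j..real j} x \<partial>\<mu> u)"
    by (intro integral_mono integrable_mu locally_bounded_borelD(2) lbf lbg) (auto simp: indicator_def le)
  also have "\<dots> = qf j (\<lambda>x. c * g x) u" unfolding qf_def by (rule trunc_quad[OF lbg, symmetric])
  also have "\<dots> = c * qf j g u" by (rule qf_cmult[OF f(2)])
  finally show ?thesis .
qed

text \<open>On a bounded window the full weight and the damped one are comparable, so the weak
  Cauchy estimate already controls low frequencies in the strong norm.\<close>

lemma wt_local_bound: "\<exists>c\<ge>0. \<forall>x\<in>{- real j..real j}. wt x \<le> c * damp x"
proof -
  obtain K where K: "0 \<le> K" "\<And>x. \<bar>wt x * indicator {- real j..real j} x\<bar> \<le> K"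
    by (rule bounded_borelE[OF locally_bounded_borelD(2)[OF lb_wt, of j]]) (rule that)
  have "wt x \<le> K * sqrt (1 + real j) * damp x" if x: "x \<in> {- real j..real j}" for x
  proof -
    have "wt x \<le> K" using K(2)[of x] x by (simp add: indicator_def)
    moreover have "1 \<le> sqrt (1 + real j) * damp x"
    proof -
      have "sqrt (1 + lam x) \<le> sqrt (1 + real j)" using x by (simp add: lam_def)
      moreover have "0 < sqrt (1 + lam x)" using lam_nonneg[of x] by (simp add: add_pos_nonneg del: lam_nonneg)
      ultimately show ?thesis by (simp add: damp_def)
    qed
    then have "K * 1 \<le> K * (sqrt (1 + real j) * damp x)" using K(1) by (rule mult_left_mono)
    ultimately show ?thesis by (simp add: mult_ac)
  qed
  then show ?thesis using K(1) by (intro exI[of _ "K * sqrt (1 + real j)"]) auto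
qed

definition gap :: "nat \<Rightarrow> nat \<Rightarrow> real" where
  "gap n n' = (norm (cut n' u1 - cut n u1))\<^sup>2 + (norm (trunc rt n' u0 - trunc rt n u0))\<^sup>2"

lemma data_rt: "u0 \<in> spec_dom E rt"
proof -
  have "norm (trunc rt n u0) \<le> \<rho>" for n
    using U_le[of 0 n] cut_trunc(3)[OF lb_rt order_refl, of n u0] \<rho>(1)
    by - (rule power2_le_imp_le, simp_all add: U_0)
  then show ?thesis using spec_dom_iff[OF lb_rt] by blast
qed

lemma gap_small: assumes "0 < \<epsilon>" shows "\<exists>N. \<forall>n\<ge>N. \<forall>n'\<ge>n. gap n n' \<le> \<epsilon>"
proof -
  define e where "e = sqrt (\<epsilon> / 2)"
  have e: "0 < e" "e\<^sup>2 = \<epsilon> / 2" using assms by (simp_all add: e_def)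
  have "Cauchy (\<lambda>n. cut n u1)" "Cauchy (\<lambda>n. trunc rt n u0)"
    using cut_tendsto spec_op_tendsto[OF lb_rt data_rt] by (auto intro: LIMSEQ_imp_Cauchy)
  then obtain N1 N2 where N: "\<And>m n. m \<ge> N1 \<Longrightarrow> n \<ge> N1 \<Longrightarrow> norm (cut m u1 - cut n u1) < e"
    "\<And>m n. m \<ge> N2 \<Longrightarrow> n \<ge> N2 \<Longrightarrow> norm (trunc rt m u0 - trunc rt n u0) < e"
    using e(1) by (metis CauchyD)
  have "gap n n' \<le> \<epsilon>" if "n \<ge> max N1 N2" "n' \<ge> n" for n n'
  proof -
    have "(norm (cut n' u1 - cut n u1))\<^sup>2 \<le> e\<^sup>2" "(norm (trunc rt n' u0 - trunc rt n u0))\<^sup>2 \<le> e\<^sup>2"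
      using N(1)[of n' n] N(2)[of n' n] that by (auto intro!: power_mono)
    then show ?thesis using e(2) by (simp add: gap_def)
  qed
  then show ?thesis by blast
qed

lemma coef_cauchy: "locally_uniform_cauchy coef"
  unfolding locally_uniform_cauchy_def
proof (intro allI impI)
  fix T \<epsilon> :: real assume T: "0 \<le> T" and \<epsilon>: "0 < \<epsilon>"
  obtain C where C: "0 \<le> C" "\<And>n n' t. n \<le> n' \<Longrightarrow> t \<in> {0..T} \<Longrightarrow> \<bar>coef n' t - coef n t\<bar>\<^sup>2 \<le> C * gap n n'"
    using cauchy_estimate[OF T] unfolding gap_def by blast
  have "0 < \<epsilon>\<^sup>2 / (C + 1)" using \<epsilon> C by simp
  then obtain N where N: "\<And>n n'. n \<ge> N \<Longrightarrow> n' \<ge> n \<Longrightarrow> gap n n' \<le> \<epsilon>\<^sup>2 / (C + 1)" using gap_small by blast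
  have "norm (coef n' t - coef n t) \<le> \<epsilon>" if n: "n \<ge> N" "n' \<ge> n" and t: "t \<in> {0..T}" for n n' t
  proof (rule power2_le_imp_le)
    have "(norm (coef n' t - coef n t))\<^sup>2 \<le> C * gap n n'" using C(2)[OF n(2) t] by simp
    also have "\<dots> \<le> C * (\<epsilon>\<^sup>2 / (C + 1))" using C(1) N[OF n] by (rule mult_left_mono[rotated])
    also have "\<dots> \<le> \<epsilon>\<^sup>2" using C(1) by (simp add: divide_simps algebra_simps)
    finally show "(norm (coef n' t - coef n t))\<^sup>2 \<le> \<epsilon>\<^sup>2" .
  qed (use \<epsilon> in simp)
  then show "\<exists>N. \<forall>n\<ge>N. \<forall>n'\<ge>n. \<forall>t\<in>{0..T}. norm (coef n' t - coef n t) \<le> \<epsilon>" by blast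
qed

text \<open>The truncated energies of the data increase with n and are bounded; a tail is an
  increment of this convergent sequence.\<close>

lemma data_tail_small:
  assumes "0 < \<epsilon>"
  shows "\<exists>j. \<forall>n\<ge>j. qf n (tail j wt) u1 + qf n (\<lambda>x. tail j wt x * lam x) u0 \<le> \<epsilon>"
proof -
  let ?wl = "\<lambda>x. wt x * lam x"
  obtain C where C: "\<And>n. qf n wt u1 \<le> C" "\<And>n. qf n ?wl u0 \<le> C" using data_bounds by blast
  define a where "a n = qf n wt u1 + qf n ?wl u0" for n
  have w0: "0 \<le> wt x" "0 \<le> wt x * lam x" for x using wt_ge[of x] by (auto intro: mult_nonneg_nonneg order_trans[OF zero_le_one])
  have lbw: "locally_bounded_borel ?wl" by simp
  have mono: "incseq a"
    unfolding incseq_def a_def by (intro allI impI add_mono qf_level_mono w0) simp_all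
  have "Bseq a"
  proof (rule BseqI'[where K="C + C"])
    show "norm (a n) \<le> C + C" for n
      using C[of n] qf_nonneg[OF lb_wt w0(1), of n u1] qf_nonneg[OF lbw w0(2), of n u0] by (simp add: a_def)
  qed
  then have "convergent a" using mono by (simp add: Bseq_mono_convergent incseq_def)
  then have "Cauchy a" by (rule convergent_Cauchy)
  then obtain j where j: "\<And>m n. m \<ge> j \<Longrightarrow> n \<ge> j \<Longrightarrow> norm (a m - a n) < \<epsilon>" using CauchyD[OF _ assms] by blast
  have "qf n (tail j wt) u1 + qf n (\<lambda>x. tail j wt x * lam x) u0 \<le> \<epsilon>" if n: "n \<ge> j" for n
  proof -
    have "(\<lambda>x. tail j wt x * lam x) = tail j ?wl" by (simp add: tail_def fun_eq_iff)
    then have "qf n (tail j wt) u1 + qf n (\<lambda>x. tail j wt x * lam x) u0 = a n - a j"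
      using qf_tail[OF lb_wt n] qf_tail[OF lbw n] by (simp add: a_def)
    then show ?thesis using j[OF n order_refl] by simp
  qed
  then show ?thesis by blast
qed

lemma tail_sq_le:
  assumes "f x * f x \<le> K * g x"
  shows "tail j f x * tail j f x \<le> K * tail j g x"
  using assms by (simp add: tail_def indicator_def)

text \<open>Split at a window j. Outside it, \<open>flux_bound\<close> with tail weights carries the
  smallness of the data tails to all times and all truncations. Inside it, the damped estimate
  applies at the price of a constant \<open>c\<close> depending on j. Hence j is fixed first and the
  threshold N afterwards; two tails and one low part give \<epsilon>/3 each.\<close>

lemma observables_cauchy:
  assumes f: "locally_bounded_borel f" and T: "0 \<le> T" and \<epsilon>: "0 < \<epsilon>" and K: "0 \<le> K"
  shows "(\<And>x. f x * f x \<le> K * wt x) \<Longrightarrow>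
      \<exists>N. \<forall>n\<ge>N. \<forall>n'\<ge>n. \<forall>t\<in>{0..T}. norm (trunc f n' (V n' t) - trunc f n (V n t)) \<le> \<epsilon>"
    and "(\<And>x. f x * f x \<le> K * (wt x * lam x)) \<Longrightarrow>
      \<exists>N. \<forall>n\<ge>N. \<forall>n'\<ge>n. \<forall>t\<in>{0..T}. norm (trunc f n' (U n' t) - trunc f n (U n t)) \<le> \<epsilon>"
proof -
  let ?wl = "\<lambda>x. wt x * lam x"
  obtain C where C: "0 \<le> C" "\<And>n t g. t \<in> {0..T} \<Longrightarrow> locally_bounded_borel g \<Longrightarrow> (\<And>x. 0 \<le> g x) \<Longrightarrow>
       qf n g (V n t) + qf n (\<lambda>x. g x * lam x) (U n t) \<le> C * (qf n g u1 + qf n (\<lambda>x. g x * lam x) u0)"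
    using flux_bound[of T] by blast
  obtain C' where C': "0 \<le> C'" "\<And>n n' t. n \<le> n' \<Longrightarrow> t \<in> {0..T} \<Longrightarrow>
      qf n' damp (V n' t - V n t) + qf n' (\<lambda>x. damp x * lam x) (U n' t - U n t) \<le> C' * gap n n'"
    using cauchy_estimate[OF T] unfolding gap_def by blast
  define \<epsilon>1 where "\<epsilon>1 = (\<epsilon> / 3)\<^sup>2"
  have \<epsilon>1: "0 < \<epsilon>1" using \<epsilon> by (simp add: \<epsilon>1_def)
  have "0 < \<epsilon>1 / (K * C + 1)" using \<epsilon>1 K C by (simp add: add_nonneg_pos)
  then obtain j where j: "\<And>n. n \<ge> j \<Longrightarrow> qf n (tail j wt) u1 + qf n (\<lambda>x. tail j wt x * lam x) u0 \<le> \<epsilon>1 / (K * C + 1)"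
    using data_tail_small by blast
  have w0: "0 \<le> wt x" for x using wt_ge[of x] by linarith
  obtain c where c: "0 \<le> c" "\<And>x. x \<in> {- real j..real j} \<Longrightarrow> wt x \<le> c * damp x" using wt_local_bound[of j] by blast
  have "0 < \<epsilon>1 / (K * c * C' + 1)" using \<epsilon>1 K c C' by (simp add: add_nonneg_pos)
  then obtain N where N: "\<And>n n'. n \<ge> N \<Longrightarrow> n' \<ge> n \<Longrightarrow> gap n n' \<le> \<epsilon>1 / (K * c * C' + 1)" using gap_small by blast
  have frac: "a * (\<epsilon>1 / (a + 1)) \<le> \<epsilon>1" if "0 \<le> a" for a
    using that \<epsilon>1 by (simp add: divide_simps algebra_simps)
  have sqrt_le: "norm x \<le> \<epsilon> / 3" if "(norm x)\<^sup>2 \<le> \<epsilon>1" for x :: 'a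
    using that \<epsilon> unfolding \<epsilon>1_def by - (rule power2_le_imp_le, auto)
  have tails: "K * qf n (tail j wt) (V n t) \<le> \<epsilon>1" "K * qf n (\<lambda>x. tail j wt x * lam x) (U n t) \<le> \<epsilon>1"
    if n: "n \<ge> j" and t: "t \<in> {0..T}" for n t
  proof -
    have q: "0 \<le> qf n (tail j wt) (V n t)" "0 \<le> qf n (\<lambda>x. tail j wt x * lam x) (U n t)"
      by (intro qf_nonneg; simp add: tail_nonneg w0)+
    have "qf n (tail j wt) (V n t) + qf n (\<lambda>x. tail j wt x * lam x) (U n t) \<le> C * (\<epsilon>1 / (K * C + 1))"
      using C(2)[OF t, of "tail j wt" n] mult_left_mono[OF j[OF n] C(1)] by (simp add: tail_nonneg w0)
    then have "K * (qf n (tail j wt) (V n t) + qf n (\<lambda>x. tail j wt x * lam x) (U n t)) \<le> K * (C * (\<epsilon>1 / (K * C + 1)))"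
      using K by (rule mult_left_mono)
    also have "\<dots> \<le> \<epsilon>1" using frac[of "K * C"] K C by (simp add: mult.assoc)
    finally have "K * (qf n (tail j wt) (V n t) + qf n (\<lambda>x. tail j wt x * lam x) (U n t)) \<le> \<epsilon>1" .
    moreover have "0 \<le> K * qf n (tail j wt) (V n t)" "0 \<le> K * qf n (\<lambda>x. tail j wt x * lam x) (U n t)"
      using K q by simp_all
    ultimately show "K * qf n (tail j wt) (V n t) \<le> \<epsilon>1" "K * qf n (\<lambda>x. tail j wt x * lam x) (U n t) \<le> \<epsilon>1"
      by (simp_all add: distrib_left)
  qed
  have low: "K * c * qf j damp (V n' t - V n t) \<le> \<epsilon>1" "K * c * qf j (\<lambda>x. damp x * lam x) (U n' t - U n t) \<le> \<epsilon>1"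
    if n: "n \<ge> N" "n \<ge> j" "n' \<ge> n" and t: "t \<in> {0..T}" for n n' t
  proof -
    have q: "0 \<le> qf n' damp (V n' t - V n t)" "0 \<le> qf n' (\<lambda>x. damp x * lam x) (U n' t - U n t)"
      by (intro qf_nonneg; simp add: less_imp_le)+
    have "qf n' damp (V n' t - V n t) + qf n' (\<lambda>x. damp x * lam x) (U n' t - U n t) \<le> C' * (\<epsilon>1 / (K * c * C' + 1))"
      using C'(2)[OF n(3) t] mult_left_mono[OF N[OF n(1,3)] C'(1)] by linarith
    then have sum: "K * c * (qf n' damp (V n' t - V n t) + qf n' (\<lambda>x. damp x * lam x) (U n' t - U n t)) \<le> K * c * (C' * (\<epsilon>1 / (K * c * C' + 1)))"
      using K c by (intro mult_left_mono) auto
    also have "\<dots> \<le> \<epsilon>1" using frac[of "K * c * C'"] K c C' by (simp add: mult.assoc)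
    finally have sum: "K * c * (qf n' damp (V n' t - V n t) + qf n' (\<lambda>x. damp x * lam x) (U n' t - U n t)) \<le> \<epsilon>1" .
    have jn: "j \<le> n'" using n by simp
    have "K * c * qf j damp (V n' t - V n t) \<le> K * c * qf n' damp (V n' t - V n t)"
      using K c by (intro mult_left_mono qf_level_mono jn) (simp_all add: less_imp_le)
    moreover have "K * c * qf j (\<lambda>x. damp x * lam x) (U n' t - U n t) \<le> K * c * qf n' (\<lambda>x. damp x * lam x) (U n' t - U n t)"
      using K c by (intro mult_left_mono qf_level_mono jn) (simp_all add: less_imp_le)
    moreover have "0 \<le> K * c * qf n' damp (V n' t - V n t)" "0 \<le> K * c * qf n' (\<lambda>x. damp x * lam x) (U n' t - U n t)"
      using K c q by simp_all
    ultimately show "K * c * qf j damp (V n' t - V n t) \<le> \<epsilon>1" "K * c * qf j (\<lambda>x. damp x * lam x) (U n' t - U n t) \<le> \<epsilon>1"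
      using sum unfolding distrib_left by linarith+
  qed
  have split: "norm (trunc f n' y - trunc f n x) \<le> \<epsilon>"
    if n: "n \<ge> j" "n' \<ge> n" and "(norm (trunc f j (y - x)))\<^sup>2 \<le> \<epsilon>1"
      "(norm (trunc (tail j f) n' y))\<^sup>2 \<le> \<epsilon>1" "(norm (trunc (tail j f) n x))\<^sup>2 \<le> \<epsilon>1" for n n' x y
  proof -
    have "trunc f n' y - trunc f n x = trunc f j (y - x) + (trunc (tail j f) n' y - trunc (tail j f) n x)"
      using n by (simp add: trunc_tail[OF f, of j n'] trunc_tail[OF f, of j n] trunc_linear[OF f])
    then have "norm (trunc f n' y - trunc f n x) \<le> norm (trunc f j (y - x)) + (norm (trunc (tail j f) n' y) + norm (trunc (tail j f) n x))"
      by (metis norm_triangle_le add_left_mono norm_triangle_ineq4)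
    then show ?thesis using sqrt_le[OF that(3)] sqrt_le[OF that(4)] sqrt_le[OF that(5)] by linarith
  qed
  show "\<exists>N. \<forall>n\<ge>N. \<forall>n'\<ge>n. \<forall>t\<in>{0..T}. norm (trunc f n' (V n' t) - trunc f n (V n t)) \<le> \<epsilon>"
    if fK: "\<And>x. f x * f x \<le> K * wt x"
  proof (intro exI[of _ "max N j"] allI impI ballI)
    fix n n' t assume n: "n \<ge> max N j" "n' \<ge> n" and t: "t \<in> {0..T}"
    have tl: "(norm (trunc (tail j f) k (V k t)))\<^sup>2 \<le> \<epsilon>1" if k: "k \<ge> j" for k
    proof -
      have "(norm (trunc (tail j f) k (V k t)))\<^sup>2 \<le> qf k (\<lambda>x. K * tail j wt x) (V k t)"
        unfolding qf_sq[OF lb_tail[OF f], symmetric]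
        by (intro qf_mono locally_bounded_mult tail_sq_le fK) (simp_all add: f)
      also have "\<dots> \<le> \<epsilon>1" using tails(1)[OF k t] by (simp add: qf_cmult)
      finally show ?thesis .
    qed
    have lw: "(norm (trunc f j (V n' t - V n t)))\<^sup>2 \<le> \<epsilon>1"
    proof (rule order_trans[OF qf_low[OF f lb_damp]])
      show "f x * f x \<le> (K * c) * damp x" if "x \<in> {- real j..real j}" for x
        using order_trans[OF fK mult_left_mono[OF c(2)[OF that] K]] by (simp add: mult.assoc)
      show "K * c * qf j damp (V n' t - V n t) \<le> \<epsilon>1" using low(1)[OF _ _ n(2) t] n(1) by simp
    qed (simp add: less_imp_le)
    show "norm (trunc f n' (V n' t) - trunc f n (V n t)) \<le> \<epsilon>"
      using n by (intro split lw tl) auto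
  qed
  show "\<exists>N. \<forall>n\<ge>N. \<forall>n'\<ge>n. \<forall>t\<in>{0..T}. norm (trunc f n' (U n' t) - trunc f n (U n t)) \<le> \<epsilon>"
    if fK: "\<And>x. f x * f x \<le> K * (wt x * lam x)"
  proof (intro exI[of _ "max N j"] allI impI ballI)
    fix n n' t assume n: "n \<ge> max N j" "n' \<ge> n" and t: "t \<in> {0..T}"
    have te: "tail j ?wl = (\<lambda>x. tail j wt x * lam x)" by (simp add: tail_def fun_eq_iff)
    have tl: "(norm (trunc (tail j f) k (U k t)))\<^sup>2 \<le> \<epsilon>1" if k: "k \<ge> j" for k
    proof -
      have "(norm (trunc (tail j f) k (U k t)))\<^sup>2 \<le> qf k (\<lambda>x. K * tail j ?wl x) (U k t)"
        unfolding qf_sq[OF lb_tail[OF f], symmetric]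
        by (intro qf_mono locally_bounded_mult tail_sq_le fK) (simp_all add: f)
      also have "\<dots> \<le> \<epsilon>1" using tails(2)[OF k t] by (simp add: qf_cmult te)
      finally show ?thesis .
    qed
    have lw: "(norm (trunc f j (U n' t - U n t)))\<^sup>2 \<le> \<epsilon>1"
    proof (rule order_trans[OF qf_low[OF f, where g="\<lambda>x. damp x * lam x"]])
      show "f x * f x \<le> (K * c) * (damp x * lam x)" if "x \<in> {- real j..real j}" for x
      proof -
        have "K * (wt x * lam x) \<le> K * ((c * damp x) * lam x)"
          using K by (intro mult_left_mono mult_right_mono c(2)[OF that]) auto
        then show ?thesis using fK[of x] by (simp add: mult.assoc)
      qed
      show "K * c * qf j (\<lambda>x. damp x * lam x) (U n' t - U n t) \<le> \<epsilon>1" using low(2)[OF _ _ n(2) t] n(1) by simp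
    qed (simp_all add: less_imp_le)
    show "norm (trunc f n' (U n' t) - trunc f n (U n t)) \<le> \<epsilon>"
      using n by (intro split lw tl) auto
  qed
qed

text \<open>The symbols f for which f(A) applied to the velocity is controlled by the energy with
  weight \<open>wt\<close>. The index 1 refers to u1; \<open>admissible0\<close> is the analogue for
  the position, whose energy carries the extra factor \<open>lam\<close>.\<close>

definition admissible1 :: "(real \<Rightarrow> real) \<Rightarrow> bool" where
  "admissible1 f \<longleftrightarrow> locally_bounded_borel f \<and> (\<exists>K\<ge>0. \<forall>x. f x * f x \<le> K * wt x)"

definition admissible0 :: "(real \<Rightarrow> real) \<Rightarrow> bool" where
  "admissible0 f \<longleftrightarrow> locally_bounded_borel f \<and> (\<exists>K\<ge>0. \<forall>x. f x * f x \<le> K * (wt x * lam x))"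

lemma V_observable: "admissible1 f \<Longrightarrow> locally_uniform_cauchy (\<lambda>n t. trunc f n (V n t))"
  unfolding locally_uniform_cauchy_def admissible1_def using observables_cauchy(1) by blast

lemma U_observable: "admissible0 f \<Longrightarrow> locally_uniform_cauchy (\<lambda>n t. trunc f n (U n t))"
  unfolding locally_uniform_cauchy_def admissible0_def using observables_cauchy(2) by blast

lemma admissible1_one: "admissible1 (\<lambda>_. 1)"
  unfolding admissible1_def using wt_ge by (auto intro!: exI[of _ 1])

lemma rt_le_wq: "rt x \<le> wq x * wq x"
proof -
  have "1 \<le> exp (r * \<phi> (rt x))" using r phi(1) by simp
  then show ?thesis using mult_left_mono[of 1 "exp (r * \<phi> (rt x))" "rt x"] by (simp add: wq_sq)
qed

lemma admissible_examples: "admissible1 wq" "admissible1 qrt" "admissible0 (\<lambda>x. rt x * wq x)"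
  "admissible0 (\<lambda>x. rt x * qrt x)" "admissible0 rt"
proof -
  show "admissible1 wq" unfolding admissible1_def by (auto simp: wt_def intro!: exI[of _ 1])
  have "rt x \<le> wt x" for x using rt_le_wq[of x] by (simp add: wt_def)
  then show "admissible1 qrt" unfolding admissible1_def by (auto simp: qrt_qrt intro!: exI[of _ 1])
  have e: "(rt x * f) * (rt x * f) = (f * f) * lam x" for x f by (simp add: rt_rt[symmetric] mult_ac)
  show "admissible0 (\<lambda>x. rt x * wq x)" unfolding admissible0_def e
    by (auto simp: locally_bounded_mult wt_def intro!: exI[of _ 1] mult_right_mono)
  show "admissible0 (\<lambda>x. rt x * qrt x)" unfolding admissible0_def e qrt_qrt
    using \<open>\<And>x. rt x \<le> wt x\<close> by (auto simp: locally_bounded_mult intro!: exI[of _ 1] mult_right_mono)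
  have "lam x \<le> wt x * lam x" for x using mult_right_mono[OF wt_ge[of x] lam_nonneg[of x]] by simp
  then show "admissible0 rt" unfolding admissible0_def rt_rt by (auto intro!: exI[of _ 1])
qed

text \<open>Velocity symbols must also apply to the initial position, since u is to be C1 with
  values in their domain. Where \<open>lam\<close> exceeds 1 the weight is at most
  \<open>wt x * lam x\<close>, and elsewhere it is bounded, so the norm of \<open>u0\<close> covers
  the rest.\<close>

lemma data_dom:
  assumes f: "admissible1 f" shows "u0 \<in> spec_dom E f"
proof -
  obtain K where lb: "locally_bounded_borel f" and K: "0 \<le> K" "\<And>x. f x * f x \<le> K * wt x"
    using f by (auto simp: admissible1_def)
  obtain C where C: "\<And>n. qf n (\<lambda>x. wt x * lam x) u0 \<le> C" using data_bounds by blast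
  define c where "c = 1 + exp (r * \<phi> 1)"
  have c0: "0 \<le> c" by (simp add: c_def)
  have wle: "wt x \<le> c + wt x * lam x" for x
  proof (cases "lam x \<le> 1")
    case True
    then have "rt x \<le> 1" by (simp add: rt_def)
    moreover from this have "\<phi> (rt x) \<le> \<phi> 1"
      using strict_mono_onD[OF phi(3), of "rt x" 1] by (cases "rt x = 1") auto
    ultimately have "rt x * exp (r * \<phi> (rt x)) \<le> 1 * exp (r * \<phi> 1)" using r by (intro mult_mono) auto
    then have "wt x \<le> c" by (simp add: wt_def wq_sq c_def)
    moreover have "0 \<le> wt x * lam x" using wt_ge[of x] by simp
    ultimately show ?thesis by linarith
  next
    case False
    then have "wt x * 1 \<le> wt x * lam x" using wt_ge[of x] by (intro mult_left_mono) auto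
    then show ?thesis using c0 by linarith
  qed
  have lbw: "locally_bounded_borel (\<lambda>x. wt x * lam x)" by simp
  have lbs: "locally_bounded_borel (\<lambda>x. c + wt x * lam x)" by (intro locally_bounded_add lbw) simp
  have "norm (trunc f n u0) \<le> sqrt (K * (c * (norm u0)\<^sup>2 + C))" for n
  proof (rule real_le_rsqrt)
    have "(norm (trunc f n u0))\<^sup>2 \<le> qf n (\<lambda>x. K * (c + wt x * lam x)) u0"
      unfolding qf_sq[OF lb, symmetric]
      using order_trans[OF K(2) mult_left_mono[OF wle K(1)]]
      by (intro qf_mono locally_bounded_mult lb lbs) simp_all
    also have "\<dots> = K * (qf n (\<lambda>x. c * 1) u0 + qf n (\<lambda>x. wt x * lam x) u0)"
      by (simp add: qf_cmult[OF lbs] qf_add[OF _ lbw])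
    also have "qf n (\<lambda>x. c * 1) u0 = c * qf n (\<lambda>x. 1) u0" by (rule qf_cmult) simp
    also have "K * (c * qf n (\<lambda>x. 1) u0 + qf n (\<lambda>x. wt x * lam x) u0) \<le> K * (c * (norm u0)\<^sup>2 + C)"
      using K(1) c0 by (intro mult_left_mono add_mono C qf_one) auto
    finally show "(norm (trunc f n u0))\<^sup>2 \<le> K * (c * (norm u0)\<^sup>2 + C)" .
  qed
  then show ?thesis using spec_dom_iff[OF lb] by blast
qed

text \<open>One limit pair serves all admissible symbols: it is obtained with the symbol 1, and for
  the other symbols \<open>spec_op_limit\<close> identifies the limit of the truncations with f(A)
  applied to it.\<close>

theorem kirchhoff_exists:
  "\<exists>u v. u 0 = u0 \<and> v 0 = u1 \<and>
    (\<forall>f. admissible1 f \<longrightarrow> (\<forall>t\<ge>0. u t \<in> spec_dom E f \<and> v t \<in> spec_dom E f \<and>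
       ((\<lambda>s. spec_op E f (u s)) has_vector_derivative spec_op E f (v t)) (at t within {0..})) \<and>
       continuous_on {0..} (\<lambda>s. spec_op E f (v s))) \<and>
    (\<forall>t\<ge>0. (u has_vector_derivative v t) (at t within {0..})) \<and> continuous_on {0..} v \<and>
    (\<forall>f. admissible0 f \<longrightarrow> (\<forall>t\<ge>0. u t \<in> spec_dom E f) \<and> continuous_on {0..} (\<lambda>s. spec_op E f (u s))) \<and>
    (\<forall>y\<in>spec_dom E lam. \<forall>t\<ge>0. ((\<lambda>s. inner (v s) y) has_real_derivative
        - (m ((norm (spec_op E rt (u t)))\<^sup>2) * inner (u t) (spec_op E lam y))) (at t within {0..})) \<and>
    continuous_on {0..} (\<lambda>t. m ((norm (spec_op E rt (u t)))\<^sup>2))"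
proof -
  have tr1: "trunc (\<lambda>_. 1) n x = cut n x" for n x by (simp add: cut_eq_trunc)
  have cVt: "continuous_on {0..} (\<lambda>t. trunc f n (V n t))" if "locally_bounded_borel f" for f n
    by (intro bounded_linear.continuous_on[OF trunc_bl[OF that]] cont_V)
  have cUt: "continuous_on {0..} (\<lambda>t. trunc f n (U n t))" if "locally_bounded_borel f" for f n
    by (intro bounded_linear.continuous_on[OF trunc_bl[OF that]] cont_U)
  \<comment> \<open>At low frequencies a velocity symbol is not controlled by the potential energy
    of the position. The position is therefore obtained by integrating the velocity in time,
    starting from \<open>data_dom\<close>.\<close>
  have obsU: "\<exists>P Q. (\<forall>T\<ge>0. uniform_limit {0..T} (\<lambda>n t. trunc f n (V n t)) Q sequentially) \<and>
     (\<forall>t\<ge>0. (\<lambda>n. trunc f n (U n t)) \<longlonglongrightarrow> P t) \<and> continuous_on {0..} Q \<and>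
     (\<forall>t\<ge>0. (P has_vector_derivative Q t) (at t within {0..}))" if f: "admissible1 f" for f
  proof -
    have lb: "locally_bounded_borel f" using f by (simp add: admissible1_def)
    obtain Q where Q: "\<And>T. 0 \<le> T \<Longrightarrow> uniform_limit {0..T} (\<lambda>n t. trunc f n (V n t)) Q sequentially"
      using locally_uniform_limit[OF V_observable[OF f]] by blast
    have Qc: "continuous_on {0..} Q" by (rule locally_uniform_continuous[OF Q cVt[OF lb]])
    obtain P0 where P0: "P0 0 = 0" "\<And>t. 0 \<le> t \<Longrightarrow> (P0 has_vector_derivative Q t) (at t within {0..})"
      using primitive_exists[OF Qc] by blast
    have d: "((\<lambda>t. trunc f n (U n t) - trunc f n u0) has_vector_derivative trunc f n (V n t) - 0) (at t within {0..})" if "0 \<le> t" for n t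
      using that by (intro has_vector_derivative_diff has_vector_derivative_bounded_linear[OF trunc_bl[OF lb]] dU has_vector_derivative_const)
    have lim0: "(\<lambda>n. trunc f n (U n t) - trunc f n u0) \<longlonglongrightarrow> P0 t" if t: "0 \<le> t" for t
    proof (rule tendstoI)
      fix e :: real assume e: "0 < e"
      define e' where "e' = e / (t + 1)"
      have e': "0 < e'" using e t by (simp add: e'_def)
      show "\<forall>\<^sub>F n in sequentially. dist (trunc f n (U n t) - trunc f n u0) (P0 t) < e"
        using uniform_limitD[OF Q[OF t] e']
      proof eventually_elim
        case (elim n)
        have "norm (((trunc f n (U n t) - trunc f n u0) - P0 t) - ((trunc f n (U n 0) - trunc f n u0) - P0 0)) \<le> e' * t - e' * 0"
        proof (rule norm_increment_le[OF order_refl t, where g="\<lambda>s. trunc f n (V n s) - 0 - Q s" and h'="\<lambda>_. e'"])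
          fix s assume s: "s \<in> {0..t}"
          show "((\<lambda>t. trunc f n (U n t) - trunc f n u0 - P0 t) has_vector_derivative trunc f n (V n s) - 0 - Q s) (at s within {0..})"
            using s by (intro has_vector_derivative_diff[OF d P0(2)]) auto
          show "((*) e' has_real_derivative e') (at s within {0..})" by (auto intro!: derivative_eq_intros)
          show "norm (trunc f n (V n s) - 0 - Q s) \<le> e'" using elim s by (auto simp: dist_norm less_imp_le)
        qed
        also have "trunc f n (U n 0) = trunc f n u0" using cut_trunc(3)[OF lb order_refl] by (simp add: U_0)
        also have "e' * t - e' * 0 < e" using e t by (simp add: e'_def divide_less_eq)
        finally show ?case by (simp add: P0 dist_norm)
      qed
    qed
    have conv0: "(\<lambda>n. trunc f n u0) \<longlonglongrightarrow> spec_op E f u0" by (rule spec_op_tendsto[OF lb data_dom[OF f]])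
    have "(\<lambda>n. trunc f n (U n t)) \<longlonglongrightarrow> P0 t + spec_op E f u0" if "0 \<le> t" for t
      using tendsto_add[OF lim0[OF that] conv0] by simp
    moreover have "((\<lambda>t. P0 t + spec_op E f u0) has_vector_derivative Q t) (at t within {0..})" if "0 \<le> t" for t
      using has_vector_derivative_add[OF P0(2)[OF that] has_vector_derivative_const] by simp
    ultimately show ?thesis using Q Qc by (intro exI[of _ "\<lambda>t. P0 t + spec_op E f u0"] exI[of _ Q]) auto
  qed
  obtain u v where v: "\<And>T. 0 \<le> T \<Longrightarrow> uniform_limit {0..T} (\<lambda>n t. trunc (\<lambda>_. 1) n (V n t)) v sequentially"
    and u: "\<And>t. 0 \<le> t \<Longrightarrow> (\<lambda>n. trunc (\<lambda>_. 1) n (U n t)) \<longlonglongrightarrow> u t" and vc: "continuous_on {0..} v"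
    and du: "\<And>t. 0 \<le> t \<Longrightarrow> (u has_vector_derivative v t) (at t within {0..})"
    using obsU[OF admissible1_one] by blast
  have ulim: "(\<lambda>n. U n t) \<longlonglongrightarrow> u t" if "0 \<le> t" for t using u[OF that] that by (simp add: tr1 cut_U)
  have vlim: "(\<lambda>n. V n t) \<longlonglongrightarrow> v t" if "0 \<le> t" for t
    using locally_uniform_pointwise[OF v that] that by (simp add: tr1 cut_V)
  have u0: "u 0 = u0" using LIMSEQ_unique[OF ulim[of 0]] cut_tendsto[of u0] by (simp add: U_0)
  have v0: "v 0 = u1" using LIMSEQ_unique[OF vlim[of 0]] cut_tendsto[of u1] by (simp add: V_0)
  have A1: "(\<forall>t\<ge>0. u t \<in> spec_dom E f \<and> v t \<in> spec_dom E f \<and>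
       ((\<lambda>s. spec_op E f (u s)) has_vector_derivative spec_op E f (v t)) (at t within {0..})) \<and>
       continuous_on {0..} (\<lambda>s. spec_op E f (v s))" if f: "admissible1 f" for f
  proof -
    have lb: "locally_bounded_borel f" using f by (simp add: admissible1_def)
    obtain P Q where Q: "\<And>T. 0 \<le> T \<Longrightarrow> uniform_limit {0..T} (\<lambda>n t. trunc f n (V n t)) Q sequentially"
      and P: "\<And>t. 0 \<le> t \<Longrightarrow> (\<lambda>n. trunc f n (U n t)) \<longlonglongrightarrow> P t" and Qc: "continuous_on {0..} Q"
      and dP: "\<And>t. 0 \<le> t \<Longrightarrow> (P has_vector_derivative Q t) (at t within {0..})"
      using obsU[OF f] by blast
    have uu: "u t \<in> spec_dom E f" "spec_op E f (u t) = P t" if "0 \<le> t" for t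
      using spec_op_limit[OF lb ulim[OF that] P[OF that]] by auto
    have vv: "v t \<in> spec_dom E f" "spec_op E f (v t) = Q t" if "0 \<le> t" for t
      using spec_op_limit[OF lb vlim[OF that] locally_uniform_pointwise[OF Q that]] by auto
    have "((\<lambda>s. spec_op E f (u s)) has_vector_derivative spec_op E f (v t)) (at t within {0..})" if t: "0 \<le> t" for t
      unfolding vv(2)[OF t] by (rule has_vector_derivative_transform[OF _ _ dP[OF t]]) (use t uu in auto)
    moreover have "continuous_on {0..} (\<lambda>s. spec_op E f (v s))"
      by (rule continuous_on_eq[OF Qc]) (simp add: vv)
    ultimately show ?thesis using uu vv by blast
  qed
  have A0: "\<exists>P. (\<forall>T\<ge>0. uniform_limit {0..T} (\<lambda>n t. trunc f n (U n t)) P sequentially) \<and>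
      (\<forall>t\<ge>0. u t \<in> spec_dom E f \<and> spec_op E f (u t) = P t) \<and> continuous_on {0..} P" if f: "admissible0 f" for f
  proof -
    have lb: "locally_bounded_borel f" using f by (simp add: admissible0_def)
    obtain P where P: "\<And>T. 0 \<le> T \<Longrightarrow> uniform_limit {0..T} (\<lambda>n t. trunc f n (U n t)) P sequentially"
      using locally_uniform_limit[OF U_observable[OF f]] by blast
    have uu: "u t \<in> spec_dom E f" "spec_op E f (u t) = P t" if "0 \<le> t" for t
      using spec_op_limit[OF lb ulim[OF that] locally_uniform_pointwise[OF P that]] by auto
    show ?thesis using P uu locally_uniform_continuous[OF P cUt[OF lb]] by blast
  qed
  obtain S where S: "\<And>T. 0 \<le> T \<Longrightarrow> uniform_limit {0..T} (\<lambda>n t. trunc rt n (U n t)) S sequentially"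
    and uS: "\<And>t. 0 \<le> t \<Longrightarrow> spec_op E rt (u t) = S t" and Sc: "continuous_on {0..} S"
    using A0[OF admissible_examples(5)] by blast
  define c where "c t = m ((norm (spec_op E rt (u t)))\<^sup>2)" for t
  have cc: "continuous_on {0..} c"
  proof -
    have "continuous_on {0..} (\<lambda>t. m ((norm (S t))\<^sup>2))"
      by (rule continuous_on_compose2[OF m_cont]) (auto intro!: continuous_intros Sc)
    then show ?thesis by (rule continuous_on_eq) (simp add: c_def uS)
  qed
  \<comment> \<open>\<open>coef_cauchy\<close> gives uniform convergence of the coefficients; the
    limit is identified pointwise by continuity of \<open>m\<close>.\<close>
  obtain c' where c': "\<And>T. 0 \<le> T \<Longrightarrow> uniform_limit {0..T} coef c' sequentially"
    using locally_uniform_limit[OF coef_cauchy] by blast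
  have clim: "(\<lambda>n. coef n t) \<longlonglongrightarrow> c t" if t: "0 \<le> t" for t
  proof -
    have "(\<lambda>n. (norm (trunc rt n (U n t)))\<^sup>2) \<longlonglongrightarrow> (norm (S t))\<^sup>2"
      by (intro tendsto_intros locally_uniform_pointwise[OF S t])
    then show ?thesis unfolding coef_def c_def uS[OF t]
      by (intro continuous_on_tendsto_compose[OF m_cont]) auto
  qed
  have c'c: "c' t = c t" if "0 \<le> t" for t
    using LIMSEQ_unique[OF locally_uniform_pointwise[OF c' that] clim[OF that]] .
  have c: "uniform_limit {0..T} coef c sequentially" if "0 \<le> T" for T
    by (rule uniform_limit_cong'[THEN iffD1, OF _ _ c'[OF that]]) (auto simp: c'c)
  have weak: "((\<lambda>s. inner (v s) y) has_real_derivative - (c t * inner (u t) (spec_op E lam y))) (at t within {0..})"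
    if y: "y \<in> spec_dom E lam" and t: "0 \<le> t" for y t
  proof -
    define a where "a n t = inner (U n t) (trunc lam n y)" for n t
    have ylim: "(\<lambda>n. trunc lam n y) \<longlonglongrightarrow> spec_op E lam y" by (rule spec_op_tendsto[OF lb_lam y])
    have "locally_uniform_cauchy a"
      unfolding locally_uniform_cauchy_def
    proof (intro allI impI)
      fix T \<epsilon> :: real assume T: "0 \<le> T" and \<epsilon>: "0 < \<epsilon>"
      have rty: "inner (trunc f n x) (trunc f n z) = inner x (trunc (\<lambda>x. f x * f x) n z)" if "locally_bounded_borel f" for f n x z
        unfolding trunc_inner[OF that that] by (rule trunc_sym) (simp add: locally_bounded_mult that)
      \<comment> \<open>Half of A is moved to the test vector: A^(1/2) U n converges uniformly on
        bounded time intervals, while A U n is not among the controlled quantities.\<close>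
      have a_rt: "a n t = inner (trunc rt n (U n t)) (trunc rt n y)" for n t
        unfolding rty[OF lb_rt] rt_rt by (simp add: a_def)
      have ydom: "\<exists>K. \<forall>n. norm (trunc rt n y) \<le> K"
      proof -
        obtain K where K: "\<And>n. norm (trunc lam n y) \<le> K" using y spec_dom_iff[OF lb_lam] by blast
        have "norm (trunc rt n y) \<le> sqrt (norm y * K)" for n
        proof (rule real_le_rsqrt)
          have "(norm (trunc rt n y))\<^sup>2 = inner (trunc lam n y) y" unfolding norm_trunc_sq[OF lb_rt] rt_rt ..
          also have "\<dots> \<le> norm (trunc lam n y) * norm y" by (rule norm_cauchy_schwarz)
          also have "\<dots> \<le> norm y * K" using K[of n] mult_right_mono[OF K[of n], of "norm y"] by (simp add: mult.commute)
          finally show "(norm (trunc rt n y))\<^sup>2 \<le> norm y * K" .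
        qed
        then show ?thesis by blast
      qed
      have ydom': "y \<in> spec_dom E rt" using ydom spec_dom_iff[OF lb_rt] by blast
      obtain K where K: "\<And>n. norm (trunc rt n y) \<le> K" using ydom by blast
      have K0: "0 \<le> K" using order_trans[OF norm_ge_zero K] .
      have "Cauchy (\<lambda>n. trunc rt n y)" using spec_op_tendsto[OF lb_rt ydom'] by (rule LIMSEQ_imp_Cauchy)
      moreover have "0 < \<epsilon> / (2 * \<rho>)" using \<epsilon> \<rho>(1) by simp
      ultimately obtain N1 where N1: "\<And>m n. m \<ge> N1 \<Longrightarrow> n \<ge> N1 \<Longrightarrow> norm (trunc rt m y - trunc rt n y) < \<epsilon> / (2 * \<rho>)"
        using CauchyD by blast
      have "0 < \<epsilon> / (2 * (K + 1))" using \<epsilon> K0 by simp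
      then obtain N2 where N2: "\<And>n n' t. n \<ge> N2 \<Longrightarrow> n' \<ge> n \<Longrightarrow> t \<in> {0..T} \<Longrightarrow>
          norm (trunc rt n' (U n' t) - trunc rt n (U n t)) \<le> \<epsilon> / (2 * (K + 1))"
        using U_observable[OF admissible_examples(5)] T unfolding locally_uniform_cauchy_def by meson
      have "norm (a n' t - a n t) \<le> \<epsilon>" if n: "n \<ge> max N1 N2" "n' \<ge> n" and t: "t \<in> {0..T}" for n n' t
      proof -
        let ?x = "trunc rt n' (U n' t)" and ?z = "trunc rt n (U n t)"
        have eq: "a n' t - a n t = inner ?x (trunc rt n' y - trunc rt n y) + inner (?x - ?z) (trunc rt n y)"
          by (simp add: a_rt inner_diff_left inner_diff_right)
        have xr: "norm ?x \<le> \<rho>" using U_le[of t n'] t \<rho>(1) by - (rule power2_le_imp_le, auto)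
        have "\<bar>inner ?x (trunc rt n' y - trunc rt n y)\<bar> \<le> norm ?x * norm (trunc rt n' y - trunc rt n y)"
          by (rule Cauchy_Schwarz_ineq2)
        also have "\<dots> \<le> \<rho> * (\<epsilon> / (2 * \<rho>))" using xr N1[of n' n] n \<rho>(1) by (intro mult_mono) auto
        finally have 1: "\<bar>inner ?x (trunc rt n' y - trunc rt n y)\<bar> \<le> \<epsilon> / 2" using \<rho>(1) by simp
        have "\<bar>inner (?x - ?z) (trunc rt n y)\<bar> \<le> norm (?x - ?z) * norm (trunc rt n y)" by (rule Cauchy_Schwarz_ineq2)
        also have "\<dots> \<le> \<epsilon> / (2 * (K + 1)) * K" using N2[of n n' t] n t K[of n] \<epsilon> K0 by (intro mult_mono) auto
        also have "\<dots> \<le> \<epsilon> / 2" using \<epsilon> K0 by (simp add: divide_simps)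
        finally have 2: "\<bar>inner (?x - ?z) (trunc rt n y)\<bar> \<le> \<epsilon> / 2" .
        show ?thesis using 1 2 unfolding eq real_norm_def by linarith
      qed
      then show "\<exists>N. \<forall>n\<ge>N. \<forall>n'\<ge>n. \<forall>t\<in>{0..T}. norm (a n' t - a n t) \<le> \<epsilon>" by blast
    qed
    then obtain a' where a': "\<And>T. 0 \<le> T \<Longrightarrow> uniform_limit {0..T} a a' sequentially"
      using locally_uniform_limit by blast
    have a'eq: "a' t = inner (u t) (spec_op E lam y)" if t: "0 \<le> t" for t
    proof -
      have "(\<lambda>n. a n t) \<longlonglongrightarrow> inner (u t) (spec_op E lam y)" unfolding a_def by (intro tendsto_inner ulim ylim t)
      then show ?thesis using LIMSEQ_unique[OF locally_uniform_pointwise[OF a' t]] by blast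
    qed
    have ac: "continuous_on {0..} (a n)" for n unfolding a_def by (intro continuous_intros cont_U)
    have a'c: "continuous_on {0..} a'" by (rule locally_uniform_continuous[OF a' ac])
    have prod: "uniform_limit {0..T} (\<lambda>n t. - (coef n t * a n t)) (\<lambda>t. - (c t * a' t)) sequentially" if T: "0 \<le> T" for T
    proof (rule uniform_limit_uminus[OF uniform_lim_mult[OF c[OF T] a'[OF T]]])
      show "bounded (c ` {0..T})" by (intro compact_imp_bounded compact_continuous_image continuous_on_subset[OF cc]) auto
      show "bounded (a' ` {0..T})" by (intro compact_imp_bounded compact_continuous_image continuous_on_subset[OF a'c]) auto
    qed
    have "((\<lambda>s. inner (v s) y) has_vector_derivative - (c t * a' t)) (at t within {0..})"
    proof (rule locally_uniform_derivative[where F="\<lambda>n s. inner (V n s) y" and F'="\<lambda>n t. - (coef n t * a n t)" and G'="\<lambda>t. - (c t * a' t)", OF prod _ _ _ t])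
      show "continuous_on {0..} (\<lambda>t. - (coef n t * a n t))" for n by (intro continuous_intros cont_coef ac)
      show "((\<lambda>s. inner (V n s) y) has_vector_derivative - (coef n t * a n t)) (at t within {0..})" if "0 \<le> t" for n t
        using has_vector_derivative_inner[OF dV[OF that, of n] has_vector_derivative_const[of y]]
        by (simp add: a_def trunc_sym has_real_derivative_iff_has_vector_derivative)
      show "(\<lambda>n. inner (V n t) y) \<longlonglongrightarrow> inner (v t) y" if "0 \<le> t" for t by (intro tendsto_intros vlim that)
    qed
    then show ?thesis by (simp add: has_real_derivative_iff_has_vector_derivative a'eq[OF t])
  qed
  have A0': "(\<forall>t\<ge>0. u t \<in> spec_dom E f) \<and> continuous_on {0..} (\<lambda>s. spec_op E f (u s))" if f: "admissible0 f" for f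
  proof -
    obtain P where P: "\<And>t. 0 \<le> t \<Longrightarrow> u t \<in> spec_dom E f \<and> spec_op E f (u t) = P t" "continuous_on {0..} P" using A0[OF f] by blast
    have "continuous_on {0..} (\<lambda>s. spec_op E f (u s))" by (rule continuous_on_eq[OF P(2)]) (simp add: P(1))
    then show ?thesis using P(1) by blast
  qed
  show ?thesis
    by (rule exI[of _ u], rule exI[of _ v]) (use u0 v0 A1 du vc A0' weak cc in \<open>auto simp: c_def[abs_def]\<close>)
qed

end

section \<open>Uniqueness\<close>

context resolution begin

lemma spec_op_norm_trunc:
  assumes f: "locally_bounded_borel f" and x: "x \<in> spec_dom E f"
  shows "norm (trunc f n x) \<le> norm (spec_op E f x)"
  using norm_cut_le[of n "spec_op E f x"] by (simp add: cut_spec_op[OF f x])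

lemma trunc_abs_le:
  assumes f: "locally_bounded_borel f" "locally_bounded_borel g" and le: "\<And>x. \<bar>f x\<bar> \<le> \<bar>g x\<bar>"
  shows "norm (trunc f n u) \<le> norm (trunc g n u)"
proof (rule power2_le_imp_le)
  have "f x * f x \<le> g x * g x" for x using le[of x] by (metis abs_le_square_iff power2_eq_square)
  then show "(norm (trunc f n u))\<^sup>2 \<le> (norm (trunc g n u))\<^sup>2"
    unfolding norm_trunc_sq[OF f(1)] norm_trunc_sq[OF f(2)]
    by (intro trunc_quad_mono locally_bounded_mult f)
qed simp

lemma spec_op_abs_le:
  assumes f: "locally_bounded_borel f" "locally_bounded_borel g" and le: "\<And>x. \<bar>f x\<bar> \<le> \<bar>g x\<bar>"
    and x: "x \<in> spec_dom E g"
  shows "x \<in> spec_dom E f" "norm (spec_op E f x) \<le> norm (spec_op E g x)"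
proof -
  have b: "norm (trunc f n x) \<le> norm (spec_op E g x)" for n
    by (rule order_trans[OF trunc_abs_le[OF f le] spec_op_norm_trunc[OF f(2) x]])
  then show xf: "x \<in> spec_dom E f" using spec_dom_iff[OF f(1)] by blast
  show "norm (spec_op E f x) \<le> norm (spec_op E g x)"
    by (rule LIMSEQ_le_const2[OF tendsto_norm[OF spec_op_tendsto[OF f(1) xf]]]) (use b in blast)
qed

text \<open>Pointwise domination of symbols passes to norms of differences, so continuity is
  inherited from the larger symbol.\<close>

lemma spec_op_continuous_smaller:
  fixes X :: "real \<Rightarrow> 'a"
  assumes f: "locally_bounded_borel f" "locally_bounded_borel g" and le: "\<And>x. \<bar>f x\<bar> \<le> \<bar>g x\<bar>"
    and X: "\<And>t. 0 \<le> t \<Longrightarrow> X t \<in> spec_dom E g" and cont: "continuous_on {0..} (\<lambda>t. spec_op E g (X t))"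
  shows "continuous_on {0..} (\<lambda>t. spec_op E f (X t))"
  unfolding continuous_on_iff
proof (intro ballI allI impI)
  fix t e :: real assume t: "t \<in> {0..}" and e: "0 < e"
  then obtain d where d: "0 < d" "\<And>s. 0 \<le> s \<Longrightarrow> dist s t < d \<Longrightarrow> dist (spec_op E g (X s)) (spec_op E g (X t)) < e"
    using cont unfolding continuous_on_iff by (metis atLeast_iff)
  have "dist (spec_op E f (X s)) (spec_op E f (X t)) \<le> dist (spec_op E g (X s)) (spec_op E g (X t))" if s: "0 \<le> s" for s
  proof -
    have st: "X s \<in> spec_dom E g" "X t \<in> spec_dom E g" using X s t by auto
    note sub = subspace_diff[OF spec_dom_subspace[OF f(2)] st]
    have "norm (spec_op E f (X s - X t)) \<le> norm (spec_op E g (X s - X t))" by (rule spec_op_abs_le(2)[OF f le sub])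
    moreover have "X s \<in> spec_dom E f" "X t \<in> spec_dom E f" using spec_op_abs_le(1)[OF f le] st by auto
    ultimately show ?thesis by (simp add: dist_norm spec_op_linear[OF f(1)] spec_op_linear[OF f(2)] st)
  qed
  then show "\<exists>d>0. \<forall>s\<in>{0..}. dist s t < d \<longrightarrow> dist (spec_op E f (X s)) (spec_op E f (X t)) < e"
    using d by (intro exI[of _ d]) (auto intro: le_less_trans)
qed

lemma trunc_quad_tendsto:
  assumes f: "locally_bounded_borel f" and x: "x \<in> spec_dom E f"
  shows "(\<lambda>n. inner (trunc (\<lambda>x. f x * f x) n x) x) \<longlonglongrightarrow> (norm (spec_op E f x))\<^sup>2"
  unfolding norm_trunc_sq[OF f, symmetric] by (intro tendsto_intros spec_op_tendsto[OF f x])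

lemma trunc_quad_le:
  assumes f: "locally_bounded_borel f" and x: "x \<in> spec_dom E f"
  shows "inner (trunc (\<lambda>x. f x * f x) n x) x \<le> (norm (spec_op E f x))\<^sup>2"
  unfolding norm_trunc_sq[OF f, symmetric] by (intro power_mono spec_op_norm_trunc[OF f x]) simp

lemma spec_op_cut:
  assumes f: "locally_bounded_borel f" shows "spec_op E f (cut n x) = trunc f n x"
proof (rule spec_opI(2)[OF f])
  fix j
  show "cut j (trunc f n x) = trunc f j (cut n x)"
    using cut_trunc[OF f, of j n x] cut_trunc[OF f, of n j x] by (cases "j \<le> n") auto
qed

end

section \<open>Weak solutions, their coefficients and the uniqueness estimate\<close>

context quasi_analytic begin

text \<open>The notion of solution with an explicit velocity, regularity at the level of A^(1/4) for
  \<open>u\<close> and \<open>v\<close> and A^(3/4) for \<open>u\<close>, and the equation as a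
  first-order statement on <v, y>.\<close>

definition weak_solution :: "(real \<Rightarrow> 'a) \<Rightarrow> (real \<Rightarrow> 'a) \<Rightarrow> bool" where
  "weak_solution u v \<longleftrightarrow>
    (\<forall>t\<ge>0. (u has_vector_derivative v t) (at t within {0..})) \<and> continuous_on {0..} v \<and>
    (\<forall>t\<ge>0. u t \<in> spec_dom E qrt \<and> v t \<in> spec_dom E qrt \<and>
       ((\<lambda>s. spec_op E qrt (u s)) has_vector_derivative spec_op E qrt (v t)) (at t within {0..})) \<and>
    continuous_on {0..} (\<lambda>s. spec_op E qrt (v s)) \<and>
    (\<forall>t\<ge>0. u t \<in> spec_dom E (\<lambda>x. rt x * qrt x)) \<and>
    continuous_on {0..} (\<lambda>s. spec_op E (\<lambda>x. rt x * qrt x) (u s)) \<and>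
    (\<forall>y\<in>spec_dom E lam. \<forall>t\<ge>0. ((\<lambda>s. inner (v s) y) has_real_derivative
        - (m ((norm (spec_op E rt (u t)))\<^sup>2) * inner (u t) (spec_op E lam y))) (at t within {0..}))"

text \<open>Interpolation of A^(1/2) between A^(1/4) and A^(3/4): the inequality y \<le> 1 + y^2 for
  y = \<open>qrt x\<close>, multiplied by y.\<close>

lemma rt_le: "rt x \<le> qrt x + rt x * qrt x"
proof -
  have "qrt x \<le> 1 + qrt x * qrt x"
  proof (cases "qrt x \<le> 1")
    case False
    then have "qrt x * 1 \<le> qrt x * qrt x" by (intro mult_left_mono) auto
    then show ?thesis by linarith
  qed (simp add: add_increasing2)
  then have "qrt x * qrt x \<le> (1 + qrt x * qrt x) * qrt x" by (rule mult_right_mono) simp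
  then show ?thesis by (simp add: qrt_qrt algebra_simps)
qed

lemma lb_rq [simp]: "locally_bounded_borel (\<lambda>x. rt x * qrt x)" by (simp add: locally_bounded_mult)
lemma lb_rh [simp]: "locally_bounded_borel (\<lambda>x. rt x * hdamp x)" by (simp add: locally_bounded_mult)

lemma rt_bound:
  assumes x: "x \<in> spec_dom E qrt" "x \<in> spec_dom E (\<lambda>x. rt x * qrt x)"
  shows "x \<in> spec_dom E rt" "norm (spec_op E rt x) \<le> norm (spec_op E qrt x) + norm (spec_op E (\<lambda>x. rt x * qrt x) x)"
proof -
  have lbs: "locally_bounded_borel (\<lambda>x. qrt x + rt x * qrt x)" by (intro locally_bounded_add) simp_all
  have b: "norm (trunc rt n x) \<le> norm (spec_op E qrt x) + norm (spec_op E (\<lambda>x. rt x * qrt x) x)" for n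
  proof -
    have "norm (trunc rt n x) \<le> norm (trunc (\<lambda>x. qrt x + rt x * qrt x) n x)"
      using rt_le by (intro trunc_abs_le lbs) (simp_all add: add_nonneg_nonneg)
    also have "\<dots> \<le> norm (trunc qrt n x) + norm (trunc (\<lambda>x. rt x * qrt x) n x)"
      by (simp add: trunc_add norm_triangle_ineq)
    also have "\<dots> \<le> norm (spec_op E qrt x) + norm (spec_op E (\<lambda>x. rt x * qrt x) x)"
      by (intro add_mono spec_op_norm_trunc x) simp_all
    finally show ?thesis .
  qed
  then show d: "x \<in> spec_dom E rt" using spec_dom_iff[OF lb_rt] by blast
  show "norm (spec_op E rt x) \<le> norm (spec_op E qrt x) + norm (spec_op E (\<lambda>x. rt x * qrt x) x)"
    by (rule LIMSEQ_le_const2[OF tendsto_norm[OF spec_op_tendsto[OF lb_rt d]]]) (use b in blast)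
qed

lemma rh_le_qrt: "\<bar>rt x * hdamp x\<bar> \<le> \<bar>qrt x\<bar>"
proof -
  have "(rt x * hdamp x)\<^sup>2 \<le> (qrt x)\<^sup>2"
  proof -
    have "(hdamp x * lam x) * (hdamp x * lam x) \<le> rt x * lam x" by (rule hdamp_lam_sq)
    then have "(damp x * lam x) * lam x \<le> rt x * lam x" by (simp add: hdamp_sq[symmetric] mult_ac)
    then have "damp x * lam x \<le> rt x"
      using lam_nonneg[of x] by (cases "lam x = 0") (auto dest: mult_right_le_imp_le simp: less_le)
    then show ?thesis by (simp add: power2_eq_square rt_hdamp_sq qrt_qrt)
  qed
  then show ?thesis by (simp only: abs_le_square_iff)
qed

lemma hdamp_le_1: "hdamp x \<le> 1"
  using damp_le_1[of x] by (simp add: hdamp_def)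

lemma spec_dom_hdamp: "x \<in> spec_dom E hdamp"
proof -
  have "norm (trunc hdamp n x) \<le> norm (trunc (\<lambda>_. 1) n x)" for n
    using hdamp_le_1 by (intro trunc_abs_le) (simp_all add: abs_of_pos)
  then have "norm (trunc hdamp n x) \<le> norm x" for n
    by (rule order_trans) (use norm_cut_le[of n x] in \<open>simp add: cut_eq_trunc\<close>)
  then show ?thesis using spec_dom_iff[OF lb_hdamp] by blast
qed

lemma bounded_on_interval:
  fixes f :: "real \<Rightarrow> 'a" assumes "continuous_on {0..} f"
  shows "\<exists>K\<ge>0. \<forall>t\<in>{0..T}. norm (f t) \<le> K"
proof -
  have "compact (f ` {0..T})" by (intro compact_continuous_image continuous_on_subset[OF assms]) auto
  then obtain K where K: "\<And>t. t \<in> {0..T} \<Longrightarrow> norm (f t) \<le> K" using compact_imp_bounded bounded_iff by (metis image_eqI)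
  then have "norm (f t) \<le> \<bar>K\<bar>" if "t \<in> {0..T}" for t using that order_trans[OF _ abs_ge_self] by blast
  then show ?thesis by (intro exI[of _ "\<bar>K\<bar>"]) auto
qed

text \<open><A(x - y), x + y> is paired as A^(1/4) against A^(3/4). For one solution at two times
  this gives Lipschitz dependence of the coefficient on time, because A^(1/4) u is C1.\<close>

lemma sigma_increment:
  assumes x: "x \<in> spec_dom E qrt" "x \<in> spec_dom E (\<lambda>x. rt x * qrt x)"
    and y: "y \<in> spec_dom E qrt" "y \<in> spec_dom E (\<lambda>x. rt x * qrt x)"
  shows "\<bar>(norm (spec_op E rt x))\<^sup>2 - (norm (spec_op E rt y))\<^sup>2\<bar> \<le>
    norm (spec_op E qrt x - spec_op E qrt y) * (norm (spec_op E (\<lambda>x. rt x * qrt x) x) + norm (spec_op E (\<lambda>x. rt x * qrt x) y))"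
proof (rule LIMSEQ_le_const2)
  let ?rq = "\<lambda>x. rt x * qrt x"
  show "(\<lambda>n. \<bar>(norm (trunc rt n x))\<^sup>2 - (norm (trunc rt n y))\<^sup>2\<bar>) \<longlonglongrightarrow> \<bar>(norm (spec_op E rt x))\<^sup>2 - (norm (spec_op E rt y))\<^sup>2\<bar>"
    by (intro tendsto_intros spec_op_tendsto[OF lb_rt] rt_bound x y)
  have "\<bar>(norm (trunc rt n x))\<^sup>2 - (norm (trunc rt n y))\<^sup>2\<bar> \<le>
      norm (spec_op E qrt x - spec_op E qrt y) * (norm (spec_op E ?rq x) + norm (spec_op E ?rq y))" for n
  proof -
    have lr: "qrt z * (rt z * qrt z) = lam z" for z by (metis mult.assoc mult.commute qrt_qrt rt_rt)
    have "(norm (trunc rt n x))\<^sup>2 - (norm (trunc rt n y))\<^sup>2 = inner (trunc lam n (x - y)) (x + y)"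
      unfolding coef_sigma qf_def trunc_linear[OF lb_lam]
      using trunc_sym[OF lb_lam, of n y x] by (simp add: inner_diff_left inner_add_right inner_commute[of y])
    also have "\<dots> = inner (trunc qrt n (x - y)) (trunc ?rq n (x + y))"
      unfolding trunc_inner[OF lb_qrt lb_rq] lr ..
    finally have "\<bar>(norm (trunc rt n x))\<^sup>2 - (norm (trunc rt n y))\<^sup>2\<bar> \<le> norm (trunc qrt n (x - y)) * norm (trunc ?rq n (x + y))"
      by (simp only: Cauchy_Schwarz_ineq2)
    also have "\<dots> \<le> norm (spec_op E qrt (x - y)) * (norm (spec_op E ?rq x) + norm (spec_op E ?rq y))"
    proof (rule mult_mono)
      show "norm (trunc qrt n (x - y)) \<le> norm (spec_op E qrt (x - y))"
        by (intro spec_op_norm_trunc subspace_diff[OF spec_dom_subspace] x y) simp_all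
      have "norm (trunc ?rq n (x + y)) \<le> norm (trunc ?rq n x) + norm (trunc ?rq n y)"
        unfolding trunc_linear[OF lb_rq] by (rule norm_triangle_ineq)
      then show "norm (trunc ?rq n (x + y)) \<le> norm (spec_op E ?rq x) + norm (spec_op E ?rq y)"
        using spec_op_norm_trunc[OF lb_rq x(2), of n] spec_op_norm_trunc[OF lb_rq y(2), of n] by linarith
    qed simp_all
    finally show ?thesis by (simp add: spec_op_linear[OF lb_qrt x(1) y(1)])
  qed
  then show "\<exists>N. \<forall>n\<ge>N. \<bar>(norm (trunc rt n x))\<^sup>2 - (norm (trunc rt n y))\<^sup>2\<bar> \<le>
      norm (spec_op E qrt x - spec_op E qrt y) * (norm (spec_op E ?rq x) + norm (spec_op E ?rq y))" by blast
qed

text \<open>The variant of \<open>sigma_increment\<close> for two solutions at the same time: the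
  difference is measured in the damped norm, so that it can be absorbed by the energy of the
  difference.\<close>

lemma sigma_difference:
  assumes x: "x \<in> spec_dom E qrt" "x \<in> spec_dom E (\<lambda>x. rt x * qrt x)"
    and y: "y \<in> spec_dom E qrt" "y \<in> spec_dom E (\<lambda>x. rt x * qrt x)"
    and B: "(norm (spec_op E rt x))\<^sup>2 + (norm (spec_op E (\<lambda>x. rt x * qrt x) x))\<^sup>2 \<le> B\<^sup>2"
      "(norm (spec_op E rt y))\<^sup>2 + (norm (spec_op E (\<lambda>x. rt x * qrt x) y))\<^sup>2 \<le> B\<^sup>2" "0 \<le> B"
  shows "\<bar>(norm (spec_op E rt x))\<^sup>2 - (norm (spec_op E rt y))\<^sup>2\<bar> \<le> norm (spec_op E (\<lambda>x. rt x * hdamp x) (x - y)) * (2 * B)"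
proof (rule LIMSEQ_le_const2)
  let ?rq = "\<lambda>x. rt x * qrt x"
  show "(\<lambda>n. \<bar>(norm (trunc rt n x))\<^sup>2 - (norm (trunc rt n y))\<^sup>2\<bar>) \<longlonglongrightarrow> \<bar>(norm (spec_op E rt x))\<^sup>2 - (norm (spec_op E rt y))\<^sup>2\<bar>"
    by (intro tendsto_intros spec_op_tendsto[OF lb_rt] rt_bound x y)
  have xy: "x - y \<in> spec_dom E (\<lambda>x. rt x * hdamp x)"
    by (rule spec_op_abs_le(1)[OF lb_rh lb_qrt rh_le_qrt]) (intro subspace_diff[OF spec_dom_subspace] x y, simp)
  \<comment> \<open>The square of \<open>cdamp\<close> is at most \<open>lam + rt * lam\<close>,
    whose form is the sum of the two squared norms that \<open>B\<close> bounds.\<close>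
  have cd: "norm (trunc cdamp n z) \<le> B" if "z \<in> spec_dom E qrt" "z \<in> spec_dom E ?rq"
    "(norm (spec_op E rt z))\<^sup>2 + (norm (spec_op E ?rq z))\<^sup>2 \<le> B\<^sup>2" for z n
  proof (rule power2_le_imp_le)
    have e: "rt x * lam x = (rt x * qrt x) * (rt x * qrt x)" for x
      by (metis mult.assoc mult.commute qrt_qrt rt_rt)
    have "(norm (trunc cdamp n z))\<^sup>2 \<le> qf n lam z + qf n (\<lambda>x. rt x * lam x) z" by (rule norm_cdamp)
    also have "\<dots> \<le> (norm (spec_op E rt z))\<^sup>2 + (norm (spec_op E ?rq z))\<^sup>2"
      unfolding qf_def e using trunc_quad_le[OF lb_rt rt_bound(1)[OF that(1,2)], of n] trunc_quad_le[OF lb_rq that(2), of n]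
      by (simp add: rt_rt)
    finally show "(norm (trunc cdamp n z))\<^sup>2 \<le> B\<^sup>2" using that(3) by linarith
  qed (rule B)
  have "\<bar>(norm (trunc rt n x))\<^sup>2 - (norm (trunc rt n y))\<^sup>2\<bar> \<le> norm (spec_op E (\<lambda>x. rt x * hdamp x) (x - y)) * (2 * B)" for n
  proof -
    have "\<bar>(norm (trunc rt n x))\<^sup>2 - (norm (trunc rt n y))\<^sup>2\<bar> \<le>
        sqrt (qf n (\<lambda>x. damp x * lam x) (x - y)) * (norm (trunc cdamp n x) + norm (trunc cdamp n y))"
      unfolding coef_sigma by (rule qf_diff_lam)
    also have "sqrt (qf n (\<lambda>x. damp x * lam x) (x - y)) = norm (trunc (\<lambda>x. rt x * hdamp x) n (x - y))"
      using qf_sq[OF lb_rh, of n "x - y"] by (simp add: rt_hdamp_sq)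
    also have "\<dots> * (norm (trunc cdamp n x) + norm (trunc cdamp n y)) \<le> norm (spec_op E (\<lambda>x. rt x * hdamp x) (x - y)) * (2 * B)"
      using cd[OF x B(1), of n] cd[OF y B(2), of n] spec_op_norm_trunc[OF lb_rh xy, of n] by (intro mult_mono) auto
    finally show ?thesis .
  qed
  then show "\<exists>N. \<forall>n\<ge>N. \<bar>(norm (trunc rt n x))\<^sup>2 - (norm (trunc rt n y))\<^sup>2\<bar> \<le> norm (spec_op E (\<lambda>x. rt x * hdamp x) (x - y)) * (2 * B)"
    by blast
qed

text \<open>On a window A is bounded and every cut vector is an allowed test vector, so the weak
  equation becomes a differential equation in norm.\<close>

lemma weak_solution_cut:
  assumes s: "weak_solution u v" and t: "0 \<le> t"
    and c: "continuous_on {0..} (\<lambda>t. m ((norm (spec_op E rt (u t)))\<^sup>2))"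
  shows "((\<lambda>s. cut n (v s)) has_vector_derivative - m ((norm (spec_op E rt (u t)))\<^sup>2) *\<^sub>R trunc lam n (u t)) (at t within {0..})"
proof (rule weak_derivative_imp_derivative[OF _ _ t])
  have du: "\<And>t. 0 \<le> t \<Longrightarrow> (u has_vector_derivative v t) (at t within {0..})" using s by (simp add: weak_solution_def)
  have uc: "continuous_on {0..} u" by (rule continuous_on_of_vector_derivative[OF du])
  show "continuous_on {0..} (\<lambda>t. - m ((norm (spec_op E rt (u t)))\<^sup>2) *\<^sub>R trunc lam n (u t))"
    by (intro continuous_intros c bounded_linear.continuous_on[OF trunc_bl[OF lb_lam]] uc)
  fix x and t :: real assume t: "0 \<le> t"
  have "((\<lambda>s. inner (v s) (cut n x)) has_real_derivative
        - (m ((norm (spec_op E rt (u t)))\<^sup>2) * inner (u t) (spec_op E lam (cut n x)))) (at t within {0..})"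
    using s t cut_in_spec_dom[OF lb_lam, of n x] by (simp add: weak_solution_def)
  then show "((\<lambda>s. inner (cut n (v s)) x) has_real_derivative
      inner (- m ((norm (spec_op E rt (u t)))\<^sup>2) *\<^sub>R trunc lam n (u t)) x) (at t within {0..})"
    unfolding spec_op_cut[OF lb_lam] by (simp add: cut_def fcalc_sym trunc_sym)
qed

lemma weak_solution_coef_continuous:
  assumes s: "weak_solution u v"
  shows "continuous_on {0..} (\<lambda>t. (norm (spec_op E rt (u t)))\<^sup>2)"
  unfolding continuous_on_def
proof
  let ?rq = "\<lambda>x. rt x * qrt x"
  fix t :: real assume t: "t \<in> {0..}"
  have dq: "\<And>t. 0 \<le> t \<Longrightarrow> ((\<lambda>s. spec_op E qrt (u s)) has_vector_derivative spec_op E qrt (v t)) (at t within {0..})"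
    and rqc: "continuous_on {0..} (\<lambda>s. spec_op E ?rq (u s))"
    and dom: "\<And>t. 0 \<le> t \<Longrightarrow> u t \<in> spec_dom E qrt" "\<And>t. 0 \<le> t \<Longrightarrow> u t \<in> spec_dom E ?rq"
    using s by (auto simp: weak_solution_def)
  have qc: "continuous_on {0..} (\<lambda>s. spec_op E qrt (u s))" by (rule continuous_on_of_vector_derivative[OF dq])
  have "((\<lambda>s. norm (spec_op E qrt (u s) - spec_op E qrt (u t)) * (norm (spec_op E ?rq (u s)) + norm (spec_op E ?rq (u t)))) \<longlongrightarrow>
      norm (spec_op E qrt (u t) - spec_op E qrt (u t)) * (norm (spec_op E ?rq (u t)) + norm (spec_op E ?rq (u t)))) (at t within {0..})"
    using qc rqc t by (intro tendsto_intros) (auto simp: continuous_on_def)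
  then have lim: "((\<lambda>s. norm (spec_op E qrt (u s) - spec_op E qrt (u t)) * (norm (spec_op E ?rq (u s)) + norm (spec_op E ?rq (u t)))) \<longlongrightarrow> 0) (at t within {0..})"
    by simp
  have "((\<lambda>s. (norm (spec_op E rt (u s)))\<^sup>2 - (norm (spec_op E rt (u t)))\<^sup>2) \<longlongrightarrow> 0) (at t within {0..})"
  proof (rule Lim_null_comparison[OF _ lim])
    show "\<forall>\<^sub>F s in at t within {0..}. norm ((norm (spec_op E rt (u s)))\<^sup>2 - (norm (spec_op E rt (u t)))\<^sup>2) \<le>
        norm (spec_op E qrt (u s) - spec_op E qrt (u t)) * (norm (spec_op E ?rq (u s)) + norm (spec_op E ?rq (u t)))"
      unfolding eventually_at_filter using t by (auto intro!: always_eventually sigma_increment dom)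
  qed
  then show "((\<lambda>s. (norm (spec_op E rt (u s)))\<^sup>2) \<longlongrightarrow> (norm (spec_op E rt (u t)))\<^sup>2) (at t within {0..})"
    by (rule LIM_zero_cancel)
qed

text \<open>The difference solves the equation with the coefficient of \<open>u\<close> and forcing
  (d - c) A p. Its energy can be differentiated only on a window, but c - d is bounded by the energy
  of the uncut difference. So the estimate is integrated on each window against the primitive Y of K
  e, the window is sent to infinity, and Gronwall is applied to Y.\<close>

theorem kirchhoff_unique:
  assumes s: "weak_solution u v" and s': "weak_solution p q" and init: "u 0 = p 0" "v 0 = q 0" and T: "0 \<le> T"
  shows "u T = p T"
proof -
  let ?rq = "\<lambda>x. rt x * qrt x" and ?rh = "\<lambda>x. rt x * hdamp x"
  define c where "c t = m ((norm (spec_op E rt (u t)))\<^sup>2)" for t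
  define d where "d t = m ((norm (spec_op E rt (p t)))\<^sup>2)" for t
  have du: "\<And>t. 0 \<le> t \<Longrightarrow> (u has_vector_derivative v t) (at t within {0..})"
    and dp: "\<And>t. 0 \<le> t \<Longrightarrow> (p has_vector_derivative q t) (at t within {0..})"
    and vc: "continuous_on {0..} v" "continuous_on {0..} q"
    and udom: "\<And>t. 0 \<le> t \<Longrightarrow> u t \<in> spec_dom E qrt" "\<And>t. 0 \<le> t \<Longrightarrow> u t \<in> spec_dom E ?rq"
    and pdom: "\<And>t. 0 \<le> t \<Longrightarrow> p t \<in> spec_dom E qrt" "\<And>t. 0 \<le> t \<Longrightarrow> p t \<in> spec_dom E ?rq"
    and duq: "\<And>t. 0 \<le> t \<Longrightarrow> ((\<lambda>s. spec_op E qrt (u s)) has_vector_derivative spec_op E qrt (v t)) (at t within {0..})"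
    and dpq: "\<And>t. 0 \<le> t \<Longrightarrow> ((\<lambda>s. spec_op E qrt (p s)) has_vector_derivative spec_op E qrt (q t)) (at t within {0..})"
    and vqc: "continuous_on {0..} (\<lambda>s. spec_op E qrt (v s))"
    and urq: "continuous_on {0..} (\<lambda>s. spec_op E ?rq (u s))" and prq: "continuous_on {0..} (\<lambda>s. spec_op E ?rq (p s))"
    using s s' by (auto simp: weak_solution_def)
  have uqc: "continuous_on {0..} (\<lambda>s. spec_op E qrt (u s))" by (rule continuous_on_of_vector_derivative[OF duq])
  have pqc: "continuous_on {0..} (\<lambda>s. spec_op E qrt (p s))" by (rule continuous_on_of_vector_derivative[OF dpq])
  have cc: "continuous_on {0..} c" unfolding c_def
    by (rule continuous_on_compose2[OF m_cont weak_solution_coef_continuous[OF s]]) auto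
  have dc: "continuous_on {0..} d" unfolding d_def
    by (rule continuous_on_compose2[OF m_cont weak_solution_coef_continuous[OF s']]) auto
  obtain K1 where K1: "0 \<le> K1" "\<And>t. t \<in> {0..T} \<Longrightarrow> norm (spec_op E qrt (v t)) \<le> K1" using bounded_on_interval[OF vqc, of T] by blast
  obtain K2 where K2: "0 \<le> K2" "\<And>t. t \<in> {0..T} \<Longrightarrow> norm (spec_op E ?rq (u t)) \<le> K2" using bounded_on_interval[OF urq, of T] by blast
  obtain K3 where K3: "0 \<le> K3" "\<And>t. t \<in> {0..T} \<Longrightarrow> norm (spec_op E ?rq (p t)) \<le> K3" using bounded_on_interval[OF prq, of T] by blast
  obtain K4 where K4: "0 \<le> K4" "\<And>t. t \<in> {0..T} \<Longrightarrow> norm (spec_op E qrt (u t)) \<le> K4" using bounded_on_interval[OF uqc, of T] by blast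
  obtain K5 where K5: "0 \<le> K5" "\<And>t. t \<in> {0..T} \<Longrightarrow> norm (spec_op E qrt (p t)) \<le> K5" using bounded_on_interval[OF pqc, of T] by blast
  define B0 where "B0 = K2 + K3 + K4 + K5"
  \<comment> \<open>\<open>B0\<close> bounds the norms of both A^(1/2) and A^(3/4) on both
    solutions; doubling it covers the sum of two squares.\<close>
  define B where "B = 2 * B0"
  have B0: "0 \<le> B0" "K2 \<le> B0" "K3 \<le> B0" "K2 + K4 \<le> B0" "K3 + K5 \<le> B0"
    using K2 K3 K4 K5 by (auto simp: B0_def)
  have B: "0 \<le> B" using B0 by (simp add: B_def)
  have rtu: "norm (spec_op E rt (u t)) \<le> B0" if "t \<in> {0..T}" for t
    using rt_bound(2)[OF udom(1)[of t] udom(2)[of t]] K2(2)[OF that] K4(2)[OF that] B0 that by auto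
  have rtp: "norm (spec_op E rt (p t)) \<le> B0" if "t \<in> {0..T}" for t
    using rt_bound(2)[OF pdom(1)[of t] pdom(2)[of t]] K3(2)[OF that] K5(2)[OF that] B0 that by auto
  have sq: "a\<^sup>2 + b\<^sup>2 \<le> B\<^sup>2" if "0 \<le> a" "a \<le> B0" "0 \<le> b" "b \<le> B0" for a b :: real
  proof -
    have "a\<^sup>2 \<le> B0\<^sup>2" "b\<^sup>2 \<le> B0\<^sup>2" using that by (auto intro: power_mono)
    moreover have "B\<^sup>2 = 4 * B0\<^sup>2" by (simp add: B_def power_mult_distrib)
    ultimately show ?thesis using zero_le_power2[of B0] by linarith
  qed
  have Bu: "(norm (spec_op E rt (u t)))\<^sup>2 + (norm (spec_op E ?rq (u t)))\<^sup>2 \<le> B\<^sup>2" if "t \<in> {0..T}" for t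
    using rtu[OF that] K2(2)[OF that] B0 by (intro sq) auto
  have Bp: "(norm (spec_op E rt (p t)))\<^sup>2 + (norm (spec_op E ?rq (p t)))\<^sup>2 \<le> B\<^sup>2" if "t \<in> {0..T}" for t
    using rtp[OF that] K3(2)[OF that] B0 by (intro sq) auto
  obtain L where L: "0 < L" "\<And>x y. x \<in> {0..B0\<^sup>2} \<Longrightarrow> y \<in> {0..B0\<^sup>2} \<Longrightarrow> \<bar>m x - m y\<bar> \<le> L * \<bar>x - y\<bar>"
    using m_lip[of "B0\<^sup>2"] by blast
  have ru: "(norm (spec_op E rt (u t)))\<^sup>2 \<in> {0..B0\<^sup>2}" if "t \<in> {0..T}" for t using rtu[OF that] by (auto intro: power_mono)
  have rp: "(norm (spec_op E rt (p t)))\<^sup>2 \<in> {0..B0\<^sup>2}" if "t \<in> {0..T}" for t using rtp[OF that] by (auto intro: power_mono)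
  \<comment> \<open>The Lipschitz rate of \<open>c\<close> in time: \<open>L\<close> for
    \<open>m\<close>, \<open>K1\<close> for the speed of A^(1/4) u, and \<open>K2\<close> twice for
    A^(3/4) u at the two times.\<close>
  define \<kappa> where "\<kappa> = L * (K1 * (K2 + K2))"
  have \<kappa>0: "0 \<le> \<kappa>" using L K1 K2 by (simp add: \<kappa>_def)
  have c_dini: "dini_le c t \<kappa>" if t: "t \<in> {0..<T}" for t
    unfolding dini_le_def
  proof (intro allI impI)
    fix e :: real assume e: "0 < e"
    have "\<forall>\<^sub>F s in at_right t. s \<in> {t<..<T}" by (rule eventually_at_rightI[of t T]) (use t in auto)
    then show "\<forall>\<^sub>F s in at_right t. c s \<le> c t + (\<kappa> + e) * (s - t)"
    proof eventually_elim
      case (elim s)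
      have st: "s \<in> {0..T}" "t \<in> {0..T}" "0 \<le> t" "0 \<le> s" "t \<le> s" using elim t by auto
      have "norm (spec_op E qrt (u s) - spec_op E qrt (u t)) \<le> K1 * s - K1 * t"
        by (rule norm_increment_le[where g="\<lambda>t. spec_op E qrt (v t)" and h'="\<lambda>_. K1", OF st(3,5)])
           (use st duq K1 in \<open>auto intro!: derivative_eq_intros\<close>)
      then have n1: "norm (spec_op E qrt (u s) - spec_op E qrt (u t)) \<le> K1 * (s - t)" by (simp add: algebra_simps)
      have "c s - c t \<le> L * \<bar>(norm (spec_op E rt (u s)))\<^sup>2 - (norm (spec_op E rt (u t)))\<^sup>2\<bar>"
        unfolding c_def using L(2)[OF ru[OF st(1)] ru[OF st(2)]] by linarith
      also have "\<dots> \<le> L * (norm (spec_op E qrt (u s) - spec_op E qrt (u t)) * (norm (spec_op E ?rq (u s)) + norm (spec_op E ?rq (u t))))"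
        using L(1) st by (intro mult_left_mono sigma_increment udom) auto
      also have "\<dots> \<le> L * ((K1 * (s - t)) * (K2 + K2))"
        using L(1) K1(1) st n1 K2(2)[OF st(1)] K2(2)[OF st(2)] by (intro mult_left_mono mult_mono add_mono) auto
      also have "\<dots> = \<kappa> * (s - t)" by (simp add: \<kappa>_def mult_ac)
      also have "\<dots> \<le> (\<kappa> + e) * (s - t)" using e st by (intro mult_right_mono) auto
      finally show ?case by simp
    qed
  qed
  define w where "w t = u t - p t" for t
  define z where "z t = v t - q t" for t
  have wdom: "w t \<in> spec_dom E qrt" if "0 \<le> t" for t unfolding w_def
    by (intro subspace_diff[OF spec_dom_subspace] udom pdom that) simp
  have wrh: "w t \<in> spec_dom E ?rh" if "0 \<le> t" for t
    by (rule spec_op_abs_le(1)[OF lb_rh lb_qrt rh_le_qrt wdom[OF that]])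
  define P where "P t = norm (spec_op E hdamp (z t))" for t
  define Q where "Q t = norm (spec_op E ?rh (w t))" for t
  have Pc: "continuous_on {0..} P"
  proof -
    have 1: "x \<in> spec_dom E (\<lambda>_. 1) \<and> spec_op E (\<lambda>_. 1) x = x" for x
      using spec_opI[OF locally_bounded_one[of 1], of x x] by (simp add: cut_eq_trunc)
    have "continuous_on {0..} (\<lambda>t. spec_op E hdamp (z t))"
    proof (rule spec_op_continuous_smaller[OF lb_hdamp locally_bounded_one[of 1]])
      show "continuous_on {0..} (\<lambda>t. spec_op E (\<lambda>_. 1) (z t))" using 1 vc by (auto simp: z_def intro!: continuous_intros)
    qed (use 1 hdamp_le_1 in \<open>auto simp: abs_of_pos\<close>)
    then show ?thesis unfolding P_def by (intro continuous_intros)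
  qed
  have Qc: "continuous_on {0..} Q"
  proof -
    have "continuous_on {0..} (\<lambda>t. spec_op E qrt (w t))"
      by (rule continuous_on_eq[OF continuous_on_diff[OF uqc pqc]])
         (simp add: w_def spec_op_linear[OF lb_qrt udom(1) pdom(1)])
    then have "continuous_on {0..} (\<lambda>t. spec_op E ?rh (w t))"
      by - (rule spec_op_continuous_smaller[OF lb_rh lb_qrt rh_le_qrt wdom])
    then show ?thesis unfolding Q_def by (intro continuous_intros)
  qed
  define e where "e t = (P t)\<^sup>2 + (Q t)\<^sup>2" for t
  have ec: "continuous_on {0..} e" unfolding e_def by (intro continuous_intros Pc Qc)
  \<comment> \<open>The first term bounds the work of the forcing, the second the variation of the
    coefficient.\<close>
  define K where "K = 2 * L * (2 * B) * K3 + \<kappa>"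
  have K0: "0 \<le> K" using L B K3 \<kappa>0 by (simp add: K_def)
  have "continuous_on {0..} (\<lambda>t. K * e t)" by (intro continuous_intros ec)
  then obtain Y where Y0: "Y 0 = 0" and dY: "\<And>t. 0 \<le> t \<Longrightarrow> (Y has_real_derivative K * e t) (at t within {0..})"
    using primitive_exists unfolding has_real_derivative_iff_has_vector_derivative by blast
  have qP: "qf n damp (z t) \<le> (P t)\<^sup>2" for n t
    using trunc_quad_le[OF lb_hdamp spec_dom_hdamp, of n "z t"] by (simp add: qf_def P_def hdamp_sq)
  have qQ: "qf n (\<lambda>x. damp x * lam x) (w t) \<le> (Q t)\<^sup>2" if "0 \<le> t" for n t
    using trunc_quad_le[OF lb_rh wrh[OF that], of n] by (simp add: qf_def Q_def rt_hdamp_sq)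
  have trunc_est: "qf n damp (z t) + m0 * qf n (\<lambda>x. damp x * lam x) (w t) \<le> Y t" if t: "t \<in> {0..T}" for n t
  proof -
    have t0: "0 \<le> t" using t by simp
    define en where "en t = qf n damp (cut n (z t)) + c t * qf n (\<lambda>x. damp x * lam x) (cut n (w t))" for t
    have "en t - en 0 \<le> Y t - Y 0"
    proof (rule dini_integral[OF t0 _ dY])
      have "continuous_on {0..} z" "continuous_on {0..} w"
        unfolding z_def w_def using vc continuous_on_of_vector_derivative[OF du] continuous_on_of_vector_derivative[OF dp]
        by (intro continuous_intros; simp)+
      then have "continuous_on {0..} en" unfolding en_def
        by (intro continuous_intros qf_continuous cc bounded_linear.continuous_on[OF cut_bl]) simp_all
      then show "continuous_on {0..t} en" by (rule continuous_on_subset) auto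
      fix s assume "s \<in> {0..<t}"
      then have s0: "0 \<le> s" and sT: "s \<in> {0..T}" "s \<in> {0..<T}" using t by auto
      define f where "f s = (d s - c s) *\<^sub>R trunc lam n (p s)" for s
      have cl: "cut n (x - y) = cut n x - cut n y" for x y by (simp add: cut_def fcalc_linear)
      have "dini_le en s (2 * inner (trunc damp n (cut n (z s))) (f s) + \<kappa> * inner (trunc (\<lambda>x. damp x * lam x) n (cut n (w s))) (cut n (w s)))"
        unfolding en_def qf_def
      proof (rule energy_dini[where w="\<lambda>s. cut n (w s)" and ?w1.0="\<lambda>s. cut n (z s)" and z=f and c=c])
        show "((\<lambda>s. cut n (w s)) has_vector_derivative cut n (z s)) (at s within {0..})"
          unfolding w_def z_def by (intro has_vector_derivative_bounded_linear[OF cut_bl] has_vector_derivative_diff du dp s0)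
        have "((\<lambda>s. cut n (v s) - cut n (q s)) has_vector_derivative (- c s *\<^sub>R trunc lam n (u s) - - d s *\<^sub>R trunc lam n (p s))) (at s within {0..})"
          unfolding c_def d_def
          by (intro has_vector_derivative_diff weak_solution_cut[OF s s0 cc[unfolded c_def]] weak_solution_cut[OF s' s0 dc[unfolded d_def]])
        moreover have "- c s *\<^sub>R trunc lam n (u s) - - d s *\<^sub>R trunc lam n (p s) = f s - c s *\<^sub>R trunc lam n (cut n (w s))"
        proof -
          have "trunc lam n (cut n (w s)) = trunc lam n (u s) - trunc lam n (p s)"
            using cut_trunc(3)[OF lb_lam order_refl, of n "w s"] by (simp add: w_def trunc_linear)
          then show ?thesis by (simp only: f_def scaleR_diff_left scaleR_diff_right scaleR_minus_left) simp
        qed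
        ultimately show "((\<lambda>s. cut n (z s)) has_vector_derivative f s - c s *\<^sub>R trunc lam n (cut n (w s))) (at s within {0..})"
          by (simp add: z_def cl)
      qed (use s0 c_dini[OF sT(2)] in \<open>auto simp: less_imp_le\<close>)
      then show "dini_le en s (K * e s)"
      proof (rule dini_le_mono)
        have tz: "trunc damp n (cut n (z s)) = trunc damp n (z s)" by (rule cut_trunc(3)[OF lb_damp order_refl])
        have "\<bar>inner (trunc damp n (cut n (z s))) (f s)\<bar> = \<bar>d s - c s\<bar> * \<bar>inner (trunc damp n (z s)) (trunc lam n (p s))\<bar>"
          unfolding tz by (simp add: f_def abs_mult)
        also have "\<dots> \<le> (L * (Q s * (2 * B))) * (P s * K3)"
        proof (rule mult_mono)
          have "\<bar>d s - c s\<bar> \<le> L * \<bar>(norm (spec_op E rt (u s)))\<^sup>2 - (norm (spec_op E rt (p s)))\<^sup>2\<bar>"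
            unfolding c_def d_def using L(2)[OF ru[OF sT(1)] rp[OF sT(1)]] by linarith
          also have "\<dots> \<le> L * (norm (spec_op E ?rh (u s - p s)) * (2 * B))"
            using L(1) by (intro mult_left_mono sigma_difference udom pdom s0 Bu Bp sT B) auto
          finally show "\<bar>d s - c s\<bar> \<le> L * (Q s * (2 * B))" by (simp add: Q_def w_def)
          have "\<bar>inner (trunc damp n (z s)) (trunc lam n (p s))\<bar> \<le> sqrt (qf n damp (z s)) * sqrt (qf n (\<lambda>x. rt x * lam x) (p s))"
            by (rule inner_damp_lam)
          also have "\<dots> \<le> P s * K3"
          proof (rule mult_mono)
            show "sqrt (qf n damp (z s)) \<le> P s" using qP[of n s] by (intro real_le_lsqrt) (auto simp: P_def qf_nonneg less_imp_le)
            have e: "rt x * lam x = (rt x * qrt x) * (rt x * qrt x)" for x by (metis mult.assoc mult.commute qrt_qrt rt_rt)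
            have "qf n (\<lambda>x. rt x * lam x) (p s) \<le> (norm (spec_op E ?rq (p s)))\<^sup>2"
              unfolding qf_def e by (rule trunc_quad_le[OF lb_rq pdom(2)[OF s0]])
            also have "\<dots> \<le> K3\<^sup>2" by (intro power_mono K3 sT) simp
            finally show "sqrt (qf n (\<lambda>x. rt x * lam x) (p s)) \<le> K3" using K3(1) by (intro real_le_lsqrt) (auto simp: qf_nonneg)
          qed (auto simp: P_def qf_nonneg)
          finally show "\<bar>inner (trunc damp n (z s)) (trunc lam n (p s))\<bar> \<le> P s * K3" .
        qed (use L B in \<open>auto simp: Q_def\<close>)
        also have "\<dots> = (L * (2 * B) * K3) * (Q s * P s)" by (simp add: mult_ac)
        also have "\<dots> \<le> (L * (2 * B) * K3) * e s"
        proof (rule mult_left_mono)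
          have "0 \<le> (Q s - P s)\<^sup>2 + (Q s)\<^sup>2 + (P s)\<^sup>2" by simp
          then show "Q s * P s \<le> e s" by (simp add: e_def power2_diff)
        qed (use L B K3 in simp)
        finally have 1: "2 * inner (trunc damp n (cut n (z s))) (f s) \<le> (2 * L * (2 * B) * K3) * e s" unfolding mult.assoc abs_le_iff by linarith
        have "\<kappa> * qf n (\<lambda>x. damp x * lam x) (cut n (w s)) \<le> \<kappa> * e s"
          using \<kappa>0 qQ[OF s0, of n] by (intro mult_left_mono) (auto simp: e_def qf_cut intro: order_trans)
        then show "2 * inner (trunc damp n (cut n (z s))) (f s) + \<kappa> * inner (trunc (\<lambda>x. damp x * lam x) n (cut n (w s))) (cut n (w s)) \<le> K * e s"
          using 1 unfolding K_def qf_def distrib_right by linarith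
      qed
    qed simp
    moreover have "en 0 = 0" by (simp add: en_def z_def w_def init cut_def fcalc_linear qf_def)
    moreover have "en t = qf n damp (z t) + c t * qf n (\<lambda>x. damp x * lam x) (w t)" by (simp add: en_def qf_cut)
    moreover have "m0 * qf n (\<lambda>x. damp x * lam x) (w t) \<le> c t * qf n (\<lambda>x. damp x * lam x) (w t)"
      unfolding c_def by (intro mult_right_mono m_ge qf_nonneg) (simp_all add: less_imp_le)
    ultimately show ?thesis using Y0 by linarith
  qed
  have full: "(P t)\<^sup>2 + m0 * (Q t)\<^sup>2 \<le> Y t" if t: "t \<in> {0..T}" for t
  proof (rule LIMSEQ_le_const2)
    show "(\<lambda>n. qf n damp (z t) + m0 * qf n (\<lambda>x. damp x * lam x) (w t)) \<longlonglongrightarrow> (P t)\<^sup>2 + m0 * (Q t)\<^sup>2"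
      using trunc_quad_tendsto[OF lb_hdamp spec_dom_hdamp, of "z t"] trunc_quad_tendsto[OF lb_rh wrh, of t] t
      by (intro tendsto_intros) (simp_all add: qf_def P_def Q_def hdamp_sq rt_hdamp_sq)
  qed (use trunc_est[OF t] in blast)
  have eY: "e t \<le> (1 + 1 / m0) * Y t" if t: "t \<in> {0..T}" for t
  proof -
    have "0 \<le> m0 * (Q t)\<^sup>2" using m0 by simp
    then have "(P t)\<^sup>2 \<le> Y t" using full[OF t] by linarith
    moreover have "m0 * (Q t)\<^sup>2 \<le> Y t" using full[OF t] zero_le_power2[of "P t"] by linarith
    then have "(Q t)\<^sup>2 \<le> Y t / m0" using m0 by (simp add: pos_le_divide_eq mult.commute)
    ultimately show ?thesis by (simp add: e_def algebra_simps)
  qed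
  have Yle: "Y t \<le> 0" if t: "t \<in> {0..T}" for t
  proof -
    have "Y t \<le> Y 0 * exp (K * (1 + 1 / m0) * t - K * (1 + 1 / m0) * 0)"
    proof (rule dini_gronwall[where K="\<lambda>t. K * (1 + 1 / m0) * t" and k="\<lambda>_. K * (1 + 1 / m0)"])
      show "continuous_on {0..t} Y" by (rule continuous_on_of_real_derivative[OF order_refl dY]) simp
      show "((\<lambda>t. K * (1 + 1 / m0) * t) has_real_derivative K * (1 + 1 / m0)) (at x within {0..})" for x
        by (auto intro!: derivative_eq_intros)
      fix x assume x: "x \<in> {0..<t}"
      then have xT: "x \<in> {0..T}" "0 \<le> x" using t by auto
      show "dini_le Y x (K * (1 + 1 / m0) * Y x)"
      proof (rule dini_leI[OF xT(2)])
        fix \<epsilon> :: real assume \<epsilon>: "0 < \<epsilon>"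
        have "K * e x \<le> K * ((1 + 1 / m0) * Y x)" by (rule mult_left_mono[OF eY[OF xT(1)] K0])
        then have "K * e x \<le> K * (1 + 1 / m0) * Y x + \<epsilon>" using \<epsilon> by (simp add: mult.assoc)
        then show "\<exists>\<psi> d. (\<psi> has_real_derivative d) (at x within {0..}) \<and> d \<le> K * (1 + 1 / m0) * Y x + \<epsilon> \<and>
            \<psi> x = Y x \<and> (\<forall>\<^sub>F s in at_right x. Y s \<le> \<psi> s)"
          using dY[OF xT(2)] by (intro exI[of _ Y] exI[of _ "K * e x"]) simp
      qed
    qed (use t in simp)
    then show ?thesis by (simp add: Y0)
  qed
  \<comment> \<open>\<open>hdamp\<close> is strictly positive, so its locally bounded reciprocal
    recovers the velocity difference. The potential part could not do this for the positions, as it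
    does not see the kernel of A; they are compared by integrating the velocities.\<close>
  have z0: "z t = 0" if t: "t \<in> {0..T}" for t
  proof (rule cut_inject)
    fix n
    have "0 \<le> m0 * (Q t)\<^sup>2" using m0 by simp
    then have "(P t)\<^sup>2 \<le> 0" using full[OF t] Yle[OF t] by linarith
    then have "qf n damp (z t) \<le> 0" using qP[of n t] by linarith
    then have "(norm (trunc hdamp n (z t)))\<^sup>2 \<le> 0" using qf_sq[OF lb_hdamp, of n "z t"] by (simp add: hdamp_sq)
    then have h0: "trunc hdamp n (z t) = 0" by simp
    have lbi: "locally_bounded_borel (\<lambda>x. 1 / hdamp x)"
    proof -
      have "continuous_on UNIV hdamp" unfolding hdamp_def damp_def lam_def
        by (intro continuous_intros) (auto simp: add_pos_nonneg less_imp_neq[symmetric] max_def)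
      then show ?thesis by (intro locally_bounded_continuous continuous_intros) auto
    qed
    have "cut n (z t) = trunc (\<lambda>x. 1 / hdamp x) n (trunc hdamp n (z t))"
      unfolding trunc_trunc(1)[OF lbi lb_hdamp order_refl] by (simp add: cut_eq_trunc)
    also have "\<dots> = 0" unfolding h0 by (rule trunc_linear(4)[OF lbi])
    finally show "cut n (z t) = cut n 0" by (simp add: cut_def fcalc_linear)
  qed
  have "norm ((u T - p T) - (u 0 - p 0)) \<le> 0 * T - 0 * 0"
    by (rule norm_increment_le[OF order_refl T, where g=z and h'="\<lambda>_. 0" and h="\<lambda>t. 0 * t"])
       (use z0 in \<open>auto simp: z_def intro!: has_vector_derivative_diff du dp derivative_eq_intros\<close>)
  then show ?thesis using init by simp
qed

end

section \<open>The Cauchy problem\<close>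

text \<open>The Frechet quotient divides by |s - t|, the one in \<open>C1_in\<close> by s - t;
  inside the norm this is only a sign.\<close>

lemma has_vector_derivative_quotient:
  "(f has_vector_derivative D) (at t within S) \<longleftrightarrow>
    ((\<lambda>s. (1 / (s - t)) *\<^sub>R (f s - f t) - D) \<longlongrightarrow> 0) (at t within S)"
proof -
  have eq: "norm ((1 / norm (s - t)) *\<^sub>R (f s - (f t + (s - t) *\<^sub>R D))) = norm ((1 / (s - t)) *\<^sub>R (f s - f t) - D)"
    if "s \<noteq> t" for s
  proof -
    have "(1 / (s - t)) *\<^sub>R (f s - f t) - D = (1 / (s - t)) *\<^sub>R (f s - (f t + (s - t) *\<^sub>R D))"
      using that by (simp add: scaleR_diff_right scaleR_add_right)
    then show ?thesis by simp
  qed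
  have "(f has_vector_derivative D) (at t within S) \<longleftrightarrow>
      ((\<lambda>s. norm ((1 / norm (s - t)) *\<^sub>R (f s - (f t + (s - t) *\<^sub>R D)))) \<longlongrightarrow> 0) (at t within S)"
    unfolding has_vector_derivative_def has_derivative_within tendsto_norm_zero_iff
    by (simp add: bounded_linear_scaleR_left)
  also have "\<dots> \<longleftrightarrow> ((\<lambda>s. norm ((1 / (s - t)) *\<^sub>R (f s - f t) - D)) \<longlongrightarrow> 0) (at t within S)"
    by (rule tendsto_cong) (use eq in \<open>auto simp: eventually_at_filter\<close>)
  finally show ?thesis by (simp add: tendsto_norm_zero_iff)
qed

lemma graph_norm_tendsto_0:
  "((\<lambda>s. graph_norm T (a s)) \<longlongrightarrow> 0) F \<longleftrightarrow> (a \<longlongrightarrow> 0) F \<and> ((\<lambda>s. T (a s)) \<longlongrightarrow> 0) F"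
proof
  assume lim: "((\<lambda>s. graph_norm T (a s)) \<longlongrightarrow> 0) F"
  have "norm (a s) \<le> graph_norm T (a s)" "norm (T (a s)) \<le> graph_norm T (a s)" for s
    by (auto simp: graph_norm_def intro: real_le_rsqrt)
  then show "(a \<longlongrightarrow> 0) F \<and> ((\<lambda>s. T (a s)) \<longlongrightarrow> 0) F"
    by (auto intro!: Lim_null_comparison[OF _ lim] always_eventually)
next
  assume "(a \<longlongrightarrow> 0) F \<and> ((\<lambda>s. T (a s)) \<longlongrightarrow> 0) F"
  then have a: "(a \<longlongrightarrow> 0) F" and Ta: "((\<lambda>s. T (a s)) \<longlongrightarrow> 0) F" by auto
  have "((\<lambda>s. sqrt ((norm (a s))\<^sup>2 + (norm (T (a s)))\<^sup>2)) \<longlongrightarrow> sqrt ((norm (0::'b))\<^sup>2 + (norm (0::'b))\<^sup>2)) F"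
    by (intro tendsto_intros a Ta)
  then show "((\<lambda>s. graph_norm T (a s)) \<longlongrightarrow> 0) F" by (simp add: graph_norm_def)
qed

section \<open>The spaces of functions of time in terms of spectral operators\<close>

context resolution begin

lemma C0_in_spec_iff:
  assumes f: "locally_bounded_borel f"
  shows "C0_in (spec_dom E f) (spec_op E f) u \<longleftrightarrow>
    (\<forall>t\<ge>0. u t \<in> spec_dom E f) \<and> continuous_on {0..} u \<and> continuous_on {0..} (\<lambda>s. spec_op E f (u s))"
proof -
  have "((\<lambda>s. spec_op E f (u s - u t)) \<longlongrightarrow> 0) (at t within {0..}) \<longleftrightarrow>
      ((\<lambda>s. spec_op E f (u s) - spec_op E f (u t)) \<longlongrightarrow> 0) (at t within {0..})"
    if dom: "\<forall>t\<ge>0. u t \<in> spec_dom E f" and t: "0 \<le> t" for t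
    by (rule tendsto_cong) (use dom t in \<open>auto simp: eventually_at_filter spec_op_linear[OF f]\<close>)
  then show ?thesis
    unfolding C0_in_def graph_norm_tendsto_0 continuous_on_def LIM_zero_iff[of u, symmetric]
      LIM_zero_iff[of "\<lambda>s. spec_op E f (u s)", symmetric] by auto
qed

lemma C1_in_spec_iff:
  assumes f: "locally_bounded_borel f"
  shows "C1_in (spec_dom E f) (spec_op E f) u \<longleftrightarrow>
    (\<forall>t\<ge>0. u t \<in> spec_dom E f) \<and> (\<exists>v. C0_in (spec_dom E f) (spec_op E f) v \<and>
      (\<forall>t\<ge>0. (u has_vector_derivative v t) (at t within {0..}) \<and>
        ((\<lambda>s. spec_op E f (u s)) has_vector_derivative spec_op E f (v t)) (at t within {0..})))"
proof -
  have "((\<lambda>s. spec_op E f ((1 / (s - t)) *\<^sub>R (u s - u t) - v t)) \<longlongrightarrow> 0) (at t within {0..}) \<longleftrightarrow>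
      ((\<lambda>s. (1 / (s - t)) *\<^sub>R (spec_op E f (u s) - spec_op E f (u t)) - spec_op E f (v t)) \<longlongrightarrow> 0) (at t within {0..})"
    if dom: "\<forall>t\<ge>0. u t \<in> spec_dom E f" and v: "C0_in (spec_dom E f) (spec_op E f) v" and t: "0 \<le> t" for t v
  proof (rule tendsto_cong)
    note sub = spec_dom_subspace[OF f]
    have "spec_op E f ((1 / (s - t)) *\<^sub>R (u s - u t) - v t) =
        (1 / (s - t)) *\<^sub>R (spec_op E f (u s) - spec_op E f (u t)) - spec_op E f (v t)" if "0 \<le> s" for s
    proof -
      have us: "u s \<in> spec_dom E f" "u t \<in> spec_dom E f" "v t \<in> spec_dom E f"
        using dom v that t by (auto simp: C0_in_def)
      note d = subspace_diff[OF sub us(1,2)]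
      show ?thesis
        unfolding spec_op_linear(2)[OF f subspace_scale[OF sub d] us(3)] spec_op_linear(3)[OF f d d]
          spec_op_linear(2)[OF f us(1,2)] ..
    qed
    then show "\<forall>\<^sub>F s in at t within {0..}. spec_op E f ((1 / (s - t)) *\<^sub>R (u s - u t) - v t) =
        (1 / (s - t)) *\<^sub>R (spec_op E f (u s) - spec_op E f (u t)) - spec_op E f (v t)"
      by (auto simp: eventually_at_filter)
  qed
  then show ?thesis
    unfolding C1_in_def graph_norm_tendsto_0 has_vector_derivative_quotient by auto
qed

end

lemma sqrt_fun_pow:
  "sqrt_fun (pow_fun (1/4)) = qrt" "sqrt_fun (pow_fun (1/2)) = rt" "sqrt_fun (pow_fun (3/4)) = (\<lambda>x. rt x * qrt x)"
proof -
  have half: "y powr (1/2) = sqrt y" if "0 \<le> y" for y using that by (simp add: powr_half_sqrt)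
  have "y powr (3/2) = y * sqrt y" if "0 \<le> y" for y :: real
    using that powr_add[of y 1 "1/2"] by (simp add: half)
  then show "sqrt_fun (pow_fun (1/4)) = qrt" "sqrt_fun (pow_fun (1/2)) = rt" "sqrt_fun (pow_fun (3/4)) = (\<lambda>x. rt x * qrt x)"
    by (auto simp: fun_eq_iff sqrt_fun_def pow_fun_def rpow_def qrt_def rt_def lam_def half max_def)
qed

text \<open>For negative x the left-hand sides are 0 by definition, the right-hand sides because of
  the factor \<open>qrt\<close>.\<close>

lemma sqrt_fun_gevrey:
  "sqrt_fun (gevrey_fun \<phi> r (1/4)) = (\<lambda>x. qrt x * exp (r / 2 * \<phi> (rt x)))"
  "sqrt_fun (gevrey_fun \<phi> r (3/4)) = (\<lambda>x. rt x * (qrt x * exp (r / 2 * \<phi> (rt x))))"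
proof -
  have g: "sqrt_fun (gevrey_fun \<phi> r a) x = sqrt_fun (pow_fun a) x * exp (r / 2 * \<phi> (rt x))" for a x
    by (simp add: sqrt_fun_def gevrey_fun_def pow_fun_def rt_def lam_def)
  show "sqrt_fun (gevrey_fun \<phi> r (1/4)) = (\<lambda>x. qrt x * exp (r / 2 * \<phi> (rt x)))"
    "sqrt_fun (gevrey_fun \<phi> r (3/4)) = (\<lambda>x. rt x * (qrt x * exp (r / 2 * \<phi> (rt x))))"
    unfolding fun_eq_iff g sqrt_fun_pow by simp_all
qed

lemma locally_lipschitz_imp_lipschitz:
  assumes "locally_lipschitz_on {0..} m"
  shows "\<exists>L>0. \<forall>x\<in>{0..R}. \<forall>y\<in>{0..R}. \<bar>m x - m y\<bar> \<le> L * \<bar>x - y\<bar>"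
proof -
  \<comment> \<open>The compactness argument is the one for time-dependent functions, here with the
    single time 0.\<close>
  have "local_lipschitz {0::real} {0..R} (\<lambda>_. m)"
    unfolding local_lipschitz_def
  proof (intro ballI)
    fix x t :: real assume x: "x \<in> {0..R}"
    then obtain d L where d: "0 < d" "L-lipschitz_on (cball x d \<inter> {0..}) m"
      using assms unfolding locally_lipschitz_on_def by (metis atLeastAtMost_iff atLeast_iff)
    then have "L-lipschitz_on (cball x d \<inter> {0..R}) m" by (auto intro: lipschitz_on_subset)
    then show "\<exists>u>0. \<exists>L. \<forall>t\<in>cball t u \<inter> {0}. L-lipschitz_on (cball x u \<inter> {0..R}) m" using d(1) by blast
  qed
  then obtain L where "L-lipschitz_on {0..R} m"
    using local_lipschitz_compact_implies_lipschitz[where T="{0::real}" and X="{0..R}" and f="\<lambda>_. m"] by auto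
  then have L: "0 \<le> L" "\<And>x y. x \<in> {0..R} \<Longrightarrow> y \<in> {0..R} \<Longrightarrow> \<bar>m x - m y\<bar> \<le> L * \<bar>x - y\<bar>"
    by (auto simp: lipschitz_on_def dist_real_def)
  show ?thesis
  proof (intro exI[of _ "L + 1"] conjI ballI)
    fix x y assume "x \<in> {0..R}" "y \<in> {0..R}"
    then have "\<bar>m x - m y\<bar> \<le> L * \<bar>x - y\<bar>" by (rule L)
    also have "\<dots> \<le> (L + 1) * \<bar>x - y\<bar>" by (simp add: mult_right_mono)
    finally show "\<bar>m x - m y\<bar> \<le> (L + 1) * \<bar>x - y\<bar>" .
  qed (use L in simp)
qed

text \<open>This gives uniqueness of derivatives along the closed half-line, including the one-sided
  derivative at 0.\<close>

lemma at_within_atLeast_nontrivial: "0 \<le> t \<Longrightarrow> at t within {0::real..} \<noteq> bot"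
proof -
  assume "0 \<le> t"
  then have "at_right t \<le> at t within {0..}" by (intro at_le) auto
  then show ?thesis using trivial_limit_at_right_real[of t] by (auto simp: bot_unique)
qed

theorem theorem2p1:
  fixes D :: "'a::{real_inner, complete_space} set"
    and A :: "'a \<Rightarrow> 'a"
    and m \<phi> :: "real \<Rightarrow> real"
    and r0 :: real
    and u0 u1 :: 'a
  assumes "separable_space (euclidean :: 'a topology)"
    and "self_adjoint_op D A" and "nonneg_op D A"
    and "\<forall>\<sigma>\<ge>0. 0 < m \<sigma>"
    and "locally_lipschitz_on {0..} m"
    and "0 < (INF \<sigma>\<in>{0..}. m \<sigma>)"
    and "\<forall>\<sigma>\<ge>0. 0 \<le> \<phi> \<sigma>"
    and "continuous_on {0..} \<phi>" and "strict_mono_on {0..} \<phi>"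
    and "(\<integral>\<^sup>+\<sigma>\<in>{1..}. ennreal (\<phi> \<sigma> / \<sigma>\<^sup>2) \<partial>lborel) = \<infinity>"
    and "0 < r0"
    and "u0 \<in> gevrey_space D A \<phi> r0 (3/4)"
    and "u1 \<in> gevrey_space D A \<phi> r0 (1/4)"
  shows "\<exists>u. kirchhoff_solution D A m u0 u1 u \<and> gevrey_regular D A \<phi> r0 u \<and>
           (\<forall>v. kirchhoff_solution D A m u0 u1 v \<and> gevrey_regular D A \<phi> r0 v \<longrightarrow>
                (\<forall>t\<ge>0. v t = u t))"
proof -
  define E where "E = spectral_resolution D A"
  have spec: "is_spectral_resolution D A E"
    unfolding E_def spectral_resolution_def by (rule someI_ex[OF spectral_resolution_exists[OF assms(2,3)]])
  have neg: "E x u = 0" if "x < 0" for x u by (rule spectral_resolution_negative[OF spec assms(3) that])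
  define m0 where "m0 = (INF \<sigma>\<in>{0..}. m \<sigma>)"
  define wq where "wq x = qrt x * exp (r0 / 2 * \<phi> (rt x))" for x
  have dom: "fsqrt_dom D A f = spec_dom E (sqrt_fun f)" and op: "fsqrt_op D A f = spec_op E (sqrt_fun f)" for f
    by (simp_all add: fsqrt_dom_def fsqrt_op_def E_def)
  have gev: "sqrt_fun (gevrey_fun \<phi> r0 (1/4)) = wq" "sqrt_fun (gevrey_fun \<phi> r0 (3/4)) = (\<lambda>x. rt x * wq x)"
    unfolding sqrt_fun_gevrey wq_def by simp_all
  interpret quasi_analytic E m m0 \<phi> r0 wq u0 u1
  proof
    show "resolution_of_identity E" using spec by (simp add: is_spectral_resolution_def)
    show "0 < m0" using assms(6) by (simp add: m0_def)
    show "m0 \<le> m \<sigma>" if "0 \<le> \<sigma>" for \<sigma> unfolding m0_def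
      using that assms(4) by (intro cINF_lower bdd_belowI2[where m=0]) (auto simp: less_imp_le)
    show "\<exists>L>0. \<forall>x\<in>{0..R}. \<forall>y\<in>{0..R}. \<bar>m x - m y\<bar> \<le> L * \<bar>x - y\<bar>" for R
      by (rule locally_lipschitz_imp_lipschitz[OF assms(5)])
    show "u0 \<in> spec_dom E (\<lambda>x. rt x * wq x)" "u1 \<in> spec_dom E wq"
      using assms(12,13) by (simp_all add: gevrey_space_def dom gev)
  qed (use assms in \<open>simp_all add: wq_def\<close>)
  \<comment> \<open>The symbols x and \<open>lam\<close> agree on the nonnegative half-line, which
    carries all spectral mass because A is nonnegative.\<close>
  have trunc_id: "trunc (\<lambda>x. x) n y = trunc lam n y" for n y
    unfolding trunc_def
    by (rule fcalc_negative_part[OF neg]) (auto simp: lam_def locally_bounded_borelD[OF locally_bounded_id] locally_bounded_borelD[OF lb_lam[unfolded lam_def[abs_def]]])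
  have dom_lam: "spec_dom E lam = D"
  proof -
    have "spec_dom E lam = spec_dom E (\<lambda>x. x)"
      using spec_dom_iff[OF lb_lam] spec_dom_iff[OF locally_bounded_id] by (auto simp: trunc_id)
    then show ?thesis using spec by (simp add: is_spectral_resolution_def)
  qed
  have op_lam: "spec_op E lam y = A y" if y: "y \<in> D" for y
  proof (rule spec_opI(2)[OF lb_lam])
    have yd: "y \<in> spec_dom E (\<lambda>x. x)" "A y = spec_op E (\<lambda>x. x) y" using spec y by (auto simp: is_spectral_resolution_def)
    show "cut n (A y) = trunc lam n y" for n
      using cut_spec_op[OF locally_bounded_id yd(1), of n] by (simp add: yd(2) trunc_id)
  qed
  have sol_iff: "kirchhoff_solution D A m u0 u1 u \<longleftrightarrow> C1_in (spec_dom E qrt) (spec_op E qrt) u \<and>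
      C0_in (spec_dom E (\<lambda>x. rt x * qrt x)) (spec_op E (\<lambda>x. rt x * qrt x)) u \<and>
      kirchhoff_weak D A m u \<and> u 0 = u0 \<and> (u has_vector_derivative u1) (at 0 within {0..})" for u
    unfolding kirchhoff_solution_def C1_fsqrt_def C0_fsqrt_def dom op sqrt_fun_pow ..
  have reg_iff: "gevrey_regular D A \<phi> r0 u \<longleftrightarrow> C1_in (spec_dom E wq) (spec_op E wq) u \<and>
      C0_in (spec_dom E (\<lambda>x. rt x * wq x)) (spec_op E (\<lambda>x. rt x * wq x)) u" for u
    unfolding gevrey_regular_def C1_fsqrt_def C0_fsqrt_def dom op gev ..
  obtain u v where u0: "u 0 = u0" and v0: "v 0 = u1"
    and adm1: "\<And>f. admissible1 f \<Longrightarrow> (\<forall>t\<ge>0. u t \<in> spec_dom E f \<and> v t \<in> spec_dom E f \<and>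
       ((\<lambda>s. spec_op E f (u s)) has_vector_derivative spec_op E f (v t)) (at t within {0..})) \<and>
       continuous_on {0..} (\<lambda>s. spec_op E f (v s))"
    and du: "\<And>t. 0 \<le> t \<Longrightarrow> (u has_vector_derivative v t) (at t within {0..})" and vc: "continuous_on {0..} v"
    and adm0: "\<And>f. admissible0 f \<Longrightarrow> (\<forall>t\<ge>0. u t \<in> spec_dom E f) \<and> continuous_on {0..} (\<lambda>s. spec_op E f (u s))"
    and weak: "\<And>y t. y \<in> spec_dom E lam \<Longrightarrow> 0 \<le> t \<Longrightarrow> ((\<lambda>s. inner (v s) y) has_real_derivative
        - (m ((norm (spec_op E rt (u t)))\<^sup>2) * inner (u t) (spec_op E lam y))) (at t within {0..})"
    and cc: "continuous_on {0..} (\<lambda>t. m ((norm (spec_op E rt (u t)))\<^sup>2))"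
    using kirchhoff_exists by blast
  have uc: "continuous_on {0..} u" by (rule continuous_on_of_vector_derivative[OF du])
  have C1: "C1_in (spec_dom E f) (spec_op E f) u" if f: "admissible1 f" for f
  proof -
    have lb: "locally_bounded_borel f" using f by (simp add: admissible1_def)
    show ?thesis unfolding C1_in_spec_iff[OF lb] C0_in_spec_iff[OF lb]
      using adm1[OF f] du vc by blast
  qed
  have C0: "C0_in (spec_dom E f) (spec_op E f) u" if f: "admissible0 f" for f
  proof -
    have lb: "locally_bounded_borel f" using f by (simp add: admissible0_def)
    show ?thesis unfolding C0_in_spec_iff[OF lb] using adm0[OF f] uc by blast
  qed
  have "kirchhoff_weak D A m u"
    unfolding kirchhoff_weak_def op sqrt_fun_pow
  proof
    fix y assume y: "y \<in> D"
    let ?g'' = "\<lambda>t. - (m ((norm (spec_op E rt (u t)))\<^sup>2) * inner (u t) (A y))"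
    have 1: "((\<lambda>s. inner (u s) y) has_real_derivative inner (v t) y) (at t within {0..})" if "0 \<le> t" for t
      using has_vector_derivative_inner[OF du[OF that] has_vector_derivative_const[of y]] by simp
    have 2: "((\<lambda>s. inner (v s) y) has_real_derivative ?g'' t) (at t within {0..})" if "0 \<le> t" for t
      using weak[of y t] y that by (simp add: dom_lam op_lam)
    have 3: "continuous_on {0..} ?g''" by (intro continuous_intros cc uc)
    show "\<exists>g' g''. (\<forall>t\<ge>0. ((\<lambda>s. inner (u s) y) has_real_derivative g' t) (at t within {0..})) \<and>
        (\<forall>t\<ge>0. (g' has_real_derivative g'' t) (at t within {0..})) \<and> continuous_on {0..} g'' \<and>
        (\<forall>t\<ge>0. g'' t + m ((norm (spec_op E rt (u t)))\<^sup>2) * inner (u t) (A y) = 0)"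
      by (rule exI[of _ "\<lambda>t. inner (v t) y"], rule exI[of _ ?g'']) (use 1 2 3 in auto)
  qed
  then have sol: "kirchhoff_solution D A m u0 u1 u"
    unfolding sol_iff using C1 C0 admissible_examples u0 du[of 0] v0 by auto
  have reg: "gevrey_regular D A \<phi> r0 u"
    unfolding reg_iff using C1 C0 admissible_examples by auto
  \<comment> \<open>The weak equation supplies scalar derivatives separately for each test vector;
    uniqueness of derivatives identifies them with the pairing of one velocity \<open>q\<close>,
    which comes from the C1 regularity.\<close>
  have to_weak: "\<exists>q. weak_solution p q \<and> p 0 = u0 \<and> q 0 = u1" if p: "kirchhoff_solution D A m u0 u1 p" for p
  proof -
    have p1: "C1_in (spec_dom E qrt) (spec_op E qrt) p"
      and p2: "C0_in (spec_dom E (\<lambda>x. rt x * qrt x)) (spec_op E (\<lambda>x. rt x * qrt x)) p"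
      and p3: "kirchhoff_weak D A m p" and p4: "p 0 = u0" "(p has_vector_derivative u1) (at 0 within {0..})"
      using p unfolding sol_iff by auto
    obtain q where pdom: "\<And>t. 0 \<le> t \<Longrightarrow> p t \<in> spec_dom E qrt"
      and q: "C0_in (spec_dom E qrt) (spec_op E qrt) q"
      and dp: "\<And>t. 0 \<le> t \<Longrightarrow> (p has_vector_derivative q t) (at t within {0..})"
      and dqp: "\<And>t. 0 \<le> t \<Longrightarrow> ((\<lambda>s. spec_op E qrt (p s)) has_vector_derivative spec_op E qrt (q t)) (at t within {0..})"
      using p1 unfolding C1_in_spec_iff[OF lb_qrt] by blast
    have "((\<lambda>s. inner (q s) y) has_real_derivative
        - (m ((norm (spec_op E rt (p t)))\<^sup>2) * inner (p t) (spec_op E lam y))) (at t within {0..})"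
      if y: "y \<in> spec_dom E lam" and t: "0 \<le> t" for y t
    proof -
      have yD: "y \<in> D" using y by (simp add: dom_lam)
      obtain g' g'' where g': "\<And>t. 0 \<le> t \<Longrightarrow> ((\<lambda>s. inner (p s) y) has_real_derivative g' t) (at t within {0..})"
        and g'': "\<And>t. 0 \<le> t \<Longrightarrow> (g' has_real_derivative g'' t) (at t within {0..})"
        and eq: "\<And>t. 0 \<le> t \<Longrightarrow> g'' t + m ((norm (spec_op E rt (p t)))\<^sup>2) * inner (p t) (A y) = 0"
        using p3 yD unfolding kirchhoff_weak_def op sqrt_fun_pow by blast
      have gq: "g' s = inner (q s) y" if s: "0 \<le> s" for s
      proof (rule vector_derivative_unique_within[OF at_within_atLeast_nontrivial[OF s]])
        show "((\<lambda>s. inner (p s) y) has_vector_derivative g' s) (at s within {0..})"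
          using g'[OF s] by (simp add: has_real_derivative_iff_has_vector_derivative)
        show "((\<lambda>s. inner (p s) y) has_vector_derivative inner (q s) y) (at s within {0..})"
          using has_vector_derivative_inner[OF dp[OF s] has_vector_derivative_const[of y]]
          by (simp add: has_real_derivative_iff_has_vector_derivative)
      qed
      have "((\<lambda>s. inner (q s) y) has_real_derivative g'' t) (at t within {0..})"
        using g''[OF t] unfolding has_real_derivative_iff_has_vector_derivative
        by (rule has_vector_derivative_transform[rotated 2]) (use t gq in auto)
      moreover have "g'' t = - (m ((norm (spec_op E rt (p t)))\<^sup>2) * inner (p t) (spec_op E lam y))"
        using eq[OF t] op_lam[OF yD] by simp
      ultimately show ?thesis by simp
    qed
    then have "weak_solution p q"
      unfolding weak_solution_def using pdom q dp dqp p2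
      unfolding C0_in_spec_iff[OF lb_qrt] C0_in_spec_iff[OF lb_rq] by blast
    moreover have "q 0 = u1"
      by (rule vector_derivative_unique_within[OF at_within_atLeast_nontrivial dp p4(2)]) simp_all
    ultimately show ?thesis using p4(1) by blast
  qed
  show ?thesis
  proof (intro exI[of _ u] conjI allI impI sol reg)
    fix p t assume p: "kirchhoff_solution D A m u0 u1 p \<and> gevrey_regular D A \<phi> r0 p" and t: "0 \<le> (t::real)"
    obtain q where q: "weak_solution p q" "p 0 = u0" "q 0 = u1" using to_weak p by blast
    obtain v' where v': "weak_solution u v'" "u 0 = u0" "v' 0 = u1" using to_weak sol by blast
    show "p t = u t" by (rule kirchhoff_unique[OF q(1) v'(1) _ _ t]) (simp_all add: q v')
  qed
qed

end
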